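(* Let $\theta$ be an inner function, $g\in H^1$, and let $X$ be a $K$-space. The following are equivalent: (i) $T_{\overline g}$ acts boundedly from $K^{\mathrm{BMO}}_\theta$ to $X$, i.e. $T_{\overline g}f\in X$ and $\|T_{\overline g}f\|_X\le C\|f\|_*$ for all $f\in K^{\mathrm{BMO}}_\theta$; (ii) $T_{\overline g}$ acts boundedly from $K^\infty_\theta$ to $X$, i.e. $\|T_{\overline g}f\|_X\le C\|f\|_\infty$ for all $f\in K^\infty_\theta$; (iii) the function $k(z)=(\theta(z)-\theta(0))/z$ satisfies $T_{\overline g}k\in X$. Moreover, the operator norms $\|T_{\overline g}\|_{K^{\mathrm{BMO}}_\theta\to X}$ and $\|T_{\overline g}\|_{K^\infty_\theta\to X}$ are comparable to each other and to $\|T_{\overline g}k\|_X$ (with constants depending only on $X$).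
   Context: $H^p$ are the Hardy spaces on the unit disk $\mathbb D$ (boundary functions on $\mathbb T$). Inner function: $\theta\in H^\infty$ with $|\theta|=1$ a.e. on $\mathbb T$. $K_\theta=H^2\ominus\theta H^2$, $K^\infty_\theta=H^\infty\cap\theta\overline{H^\infty_0}$ where $H^\infty_0=\{h\in H^\infty:h(0)=0\}$. $\mathrm{BMOA}=\mathrm{BMO}(\mathbb T)\cap H^1$ with norm $\|\cdot\|_*$ being the dual norm induced by $H^1$ (pairing $\int_{\mathbb T}f\overline h\,dm$); $K^{\mathrm{BMO}}_\theta=K_\theta\cap\mathrm{BMOA}$. $P_+F=\sum_{n\ge0}\widehat F(n)z^n$, $T_{\overline h}f=P_+(\overline hf)$. For $f\in K^{\mathrm{BMO}}_\theta$ and $g\in H^1$, $T_{\overline g}f$ is defined as the unique $\Phi\in\bigcap_{0<p<1}H^p$ with $\|T_{\overline{g_n}}f-\Phi\|_p\to0$ for all $p\in(0,1)$ whenever $g_n\in H^2$, $\|g_n-g\|_1\to0$ (such $\Phi$ exists). A $K$-space is a Banach space $X$ of analytic functions on $\mathbb D$ with $X\subset H^1$ such that for each $\psi\in H^\infty$ the Toeplitz operator $T_{\overline\psi}$ maps $X$ into $X$ with $\|T_{\overline\psi}\|_{X\to X}\le C_X\|\psi\|_\infty$, $C_X$ independent of $\psi$. *)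

theory Defs
  imports "HOL-Analysis.Analysis"
begin

text \<open>Representation: an analytic function on the unit disk is represented by its
  sequence of Taylor coefficients a :: nat => complex (f(z) = sum a_n z^n), with the
  power series converging on the open unit disk.  Boundary functions on the circle are
  functions of t in [0, 2 pi] (the point cis t); m is normalised Lebesgue measure dt/(2 pi).\<close>

type_synonym afun = "nat \<Rightarrow> complex"

definition analytic_disk :: "afun \<Rightarrow> bool" where
  "analytic_disk a \<longleftrightarrow> (\<forall>r::real. 0 \<le> r \<and> r < 1 \<longrightarrow> summable (\<lambda>n. norm (a n) * r ^ n))"

definition ev :: "afun \<Rightarrow> complex \<Rightarrow> complex" where
  "ev a z = (\<Sum>n. a n * z ^ n)"

definition bv :: "afun \<Rightarrow> real \<Rightarrow> complex" where
  "bv a t = Lim (at_left 1) (\<lambda>r::real. ev a (of_real r * cis t))"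

definition pmean :: "real \<Rightarrow> afun \<Rightarrow> real \<Rightarrow> real" where
  "pmean p a r = (1 / (2*pi)) * (LINT t:{0..2*pi}|lborel. cmod (ev a (of_real r * cis t)) powr p)"

definition Hp :: "real \<Rightarrow> afun set" where
  "Hp p = {a. analytic_disk a \<and> bdd_above (pmean p a ` {0..<1})}"

definition hnorm :: "real \<Rightarrow> afun \<Rightarrow> real" where
  "hnorm p a = (SUP r\<in>{0..<1}. pmean p a r) powr (1 / p)"

definition Hinf :: "afun set" where
  "Hinf = {a. analytic_disk a \<and> bounded (ev a ` ball 0 1)}"

definition hinf_norm :: "afun \<Rightarrow> real" where
  "hinf_norm a = (SUP z\<in>ball 0 1. cmod (ev a z))"

definition amult :: "afun \<Rightarrow> afun \<Rightarrow> afun" where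
  "amult a b = (\<lambda>n. \<Sum>k\<le>n. a k * b (n - k))"

definition inner_fn :: "afun \<Rightarrow> bool" where
  "inner_fn \<theta> \<longleftrightarrow> \<theta> \<in> Hinf \<and>
     (AE t in lborel. t \<in> {0..2*pi} \<longrightarrow>
        (\<exists>L. ((\<lambda>r::real. ev \<theta> (of_real r * cis t)) \<longlongrightarrow> L) (at_left 1) \<and> cmod L = 1))"

definition pairing :: "afun \<Rightarrow> afun \<Rightarrow> complex" where
  "pairing f h = (1 / (2*pi)) * (LINT t:{0..2*pi}|lborel. bv f t * cnj (bv h t))"

definition Ktheta :: "afun \<Rightarrow> afun set" where
  "Ktheta \<theta> = {f. f \<in> Hp 2 \<and> (\<forall>h\<in>Hp 2. pairing f (amult \<theta> h) = 0)}"

definition Kinf :: "afun \<Rightarrow> afun set" where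
  "Kinf \<theta> = {f. f \<in> Hinf \<and> (\<exists>h\<in>Hinf. h 0 = 0 \<and>
      (AE t in lborel. t \<in> {0..2*pi} \<longrightarrow> bv f t = bv \<theta> t * cnj (bv h t)))}"

definition BMO_T :: "(real \<Rightarrow> complex) \<Rightarrow> bool" where
  "BMO_T F \<longleftrightarrow> set_integrable lborel {0..2*pi} F \<and>
     bdd_above {(1 / l) * (LINT t:{a..a+l}|lborel.
                   cmod (F t - (1 / l) * (LINT s:{a..a+l}|lborel. F s))) | a l. 0 < l \<and> l \<le> 2*pi}"

definition BMOA :: "afun set" where
  "BMOA = {f. f \<in> Hp 1 \<and> BMO_T (bv f)}"

text \<open>The norm on BMOA dual to H^1 (pairing over the dense class H^2 of H^1).\<close>
definition bmo_norm :: "afun \<Rightarrow> real" where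
  "bmo_norm f = Sup {cmod (pairing f h) | h. h \<in> Hp 2 \<and> hnorm 1 h \<le> 1}"

definition KBMO :: "afun \<Rightarrow> afun set" where
  "KBMO \<theta> = Ktheta \<theta> \<inter> BMOA"

text \<open>Toeplitz operator T_{conj h} f = P_+(conj(h) f): Taylor coefficients are the
  nonnegative Fourier coefficients of conj(h) f on the circle.\<close>
definition toep :: "afun \<Rightarrow> afun \<Rightarrow> afun" where
  "toep h f = (\<lambda>n. (1 / (2*pi)) *
      (LINT t:{0..2*pi}|lborel. cnj (bv h t) * bv f t * cis (- (real n * t))))"

definition toep_lim :: "afun \<Rightarrow> afun \<Rightarrow> afun" where
  "toep_lim g f = (THE \<Phi>. (\<forall>p. 0 < p \<and> p < 1 \<longrightarrow> \<Phi> \<in> Hp p) \<and>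
      (\<forall>G. (\<forall>n. G n \<in> Hp 2) \<and> (\<lambda>n. hnorm 1 (\<lambda>k. G n k - g k)) \<longlonglongrightarrow> 0 \<longrightarrow>
         (\<forall>p. 0 < p \<and> p < 1 \<longrightarrow> (\<lambda>n. hnorm p (\<lambda>k. toep (G n) f k - \<Phi> k)) \<longlonglongrightarrow> 0)))"

definition K_space :: "afun set \<Rightarrow> (afun \<Rightarrow> real) \<Rightarrow> bool" where
  "K_space X N \<longleftrightarrow>
     (\<lambda>n. 0) \<in> X \<and> (\<forall>f\<in>X. \<forall>h\<in>X. (\<lambda>n. f n + h n) \<in> X) \<and> (\<forall>c. \<forall>f\<in>X. (\<lambda>n. c * f n) \<in> X) \<and>
     (\<forall>f\<in>X. 0 \<le> N f \<and> (N f = 0 \<longleftrightarrow> f = (\<lambda>n. 0))) \<and>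
     (\<forall>c. \<forall>f\<in>X. N (\<lambda>n. c * f n) = cmod c * N f) \<and>
     (\<forall>f\<in>X. \<forall>h\<in>X. N (\<lambda>n. f n + h n) \<le> N f + N h) \<and>
     (\<forall>F. (\<forall>n. F n \<in> X) \<and> (\<forall>e>0. \<exists>M. \<forall>m\<ge>M. \<forall>n\<ge>M. N (\<lambda>k. F m k - F n k) < e) \<longrightarrow>
          (\<exists>f\<in>X. (\<lambda>n. N (\<lambda>k. F n k - f k)) \<longlonglongrightarrow> 0)) \<and>
     X \<subseteq> Hp 1 \<and>
     (\<exists>C. \<forall>\<psi>\<in>Hinf. \<forall>f\<in>X. toep \<psi> f \<in> X \<and> N (toep \<psi> f) \<le> C * hinf_norm \<psi> * N f)"

text \<open>The function k(z) = (theta(z) - theta(0)) / z: its Taylor coefficients are those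
  of theta shifted by one.\<close>
definition kfun :: "afun \<Rightarrow> afun" where
  "kfun \<theta> = (\<lambda>n. \<theta> (Suc n))"

definition bdd_BMO :: "afun set \<Rightarrow> (afun \<Rightarrow> real) \<Rightarrow> afun \<Rightarrow> afun \<Rightarrow> bool" where
  "bdd_BMO X N \<theta> g \<longleftrightarrow> (\<exists>C. \<forall>f\<in>KBMO \<theta>. toep_lim g f \<in> X \<and> N (toep_lim g f) \<le> C * bmo_norm f)"

definition bdd_Inf :: "afun set \<Rightarrow> (afun \<Rightarrow> real) \<Rightarrow> afun \<Rightarrow> afun \<Rightarrow> bool" where
  "bdd_Inf X N \<theta> g \<longleftrightarrow> (\<exists>C. \<forall>f\<in>Kinf \<theta>. toep_lim g f \<in> X \<and> N (toep_lim g f) \<le> C * hinf_norm f)"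

definition opnorm_BMO :: "(afun \<Rightarrow> real) \<Rightarrow> afun \<Rightarrow> afun \<Rightarrow> real" where
  "opnorm_BMO N \<theta> g = Sup {N (toep_lim g f) | f. f \<in> KBMO \<theta> \<and> bmo_norm f \<le> 1}"

definition opnorm_Inf :: "(afun \<Rightarrow> real) \<Rightarrow> afun \<Rightarrow> afun \<Rightarrow> real" where
  "opnorm_Inf N \<theta> g = Sup {N (toep_lim g f) | f. f \<in> Kinf \<theta> \<and> hinf_norm f \<le> 1}"

end

theory Submission
  imports Defs "HOL-Complex_Analysis.Complex_Analysis"
begin

text \<open>
  Let \<open>f\<close> belong to \<open>K\<^sub>\<theta>\<close> and to BMOA. By duality \<open>f = P\<^sub>+ \<phi>\<close> with \<open>|\<phi>|\<close> bounded by the dual norm of \<open>f\<close>. Put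
  \<open>\<psi> = \<theta> z\<^sup>* \<phi>\<^sup>*\<close> on the circle (star for conjugation). As \<open>f\<close> is orthogonal to \<open>\<theta> H\<^sup>2\<close>, the negative Fourier
  coefficients of \<open>\<psi>\<close> vanish, so \<open>\<psi>\<close> is bounded and analytic, and \<open>f\<close> is the image of \<open>k\<close> under the Toeplitz
  operator with symbol \<open>\<psi>\<^sup>*\<close>. Co-analytic Toeplitz operators commute, so \<open>T\<^sub>g f\<close> is the image of \<open>T\<^sub>g k\<close> under a
  Toeplitz operator whose norm on a K-space is controlled by the norm of \<open>f\<close>.

  The dual norm is finite by Fefferman's inequality, which is derived from the maximum principle alone: it
  upgrades the \<open>L\<^sup>1\<close> Garsia bound to an \<open>L\<^sup>2\<close> one, and then bounds \<open>Re (f\<^sup>* h)\<close> by an explicit subharmonic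
  function of size \<open>|h|\<close>. Hahn--Banach is replaced by a convexity argument in \<open>L\<^sup>2\<close>, and the Blaschke
  factorisation of \<open>H\<^sup>1\<close> functions by division by an \<open>H\<^sup>2\<close> function with positive real part.
\<close>

text \<open>The obstacle is that the product of conj g and f need not be integrable when g is only
  in H^1 and f only in BMOA. A bounded function \<open>\<phi>\<close> with the same nonnegative
  Fourier coefficients as f differs from it by negative frequencies only. Multiplication by
  conjugates of analytic functions keeps frequencies negative, so f may be exchanged for
  \<open>\<phi>\<close>, the product with conj g becomes integrable, and Kolmogorov's weak
  substitute for the boundedness of \<open>P\<^sub>+\<close> on L^1 identifies the limit that
  defines \<open>toep_lim\<close>. The function k enters because conj z times theta differs from it
  only at frequency -1: k has a unimodular representative, and |theta| = 1 lets theta cancel exactly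
  when it is multiplied by conj \<open>\<psi>\<close>. The dual norm is a real supremum, which says
  something only when the set is bounded; this is what Fefferman's inequality supplies. Its constant
  does not enter the comparison of operator norms, since \<open>\<phi>\<close> is bounded by the
  dual norm itself.\<close>

section \<open>Normalised arc length, periodicity and rotation invariance\<close>

text \<open>The measure m, carried by the whole line, so that measurability is plain Borel
  measurability and periodic functions are integrated without restricting them. The endpoint 2*pi, a
  second copy of 0, has mass zero.\<close>

definition circ :: "real measure" where
  "circ = density lborel (\<lambda>t. ennreal (indicator {0..2*pi} t / (2*pi)))"

lemma sets_circ [simp, measurable_cong]: "sets circ = sets borel"
  by (simp add: circ_def)

lemma space_circ [simp]: "space circ = UNIV"
  by (simp add: circ_def)

lemma measurable_circ [simp]: "measurable circ M = measurable borel M"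
  by (rule measurable_cong_sets) auto

lemma AE_circ: "(AE t in circ. P t) \<longleftrightarrow> (AE t in lborel. t \<in> {0..2*pi} \<longrightarrow> P t)"
proof -
  have "(AE t in circ. P t) \<longleftrightarrow> (AE t in lborel. 0 < ennreal (indicator {0..2*pi} t / (2*pi)) \<longrightarrow> P t)"
    unfolding circ_def by (rule AE_density) auto
  also have "(\<lambda>t. 0 < ennreal (indicator {0..2*pi} t / (2*pi)) \<longrightarrow> P t) = (\<lambda>t. t \<in> {0..2*pi} \<longrightarrow> P t)"
    by (auto simp: fun_eq_iff indicator_def)
  finally show ?thesis .
qed

lemma integral_circ:
  fixes F :: "real \<Rightarrow> 'a::{banach, second_countable_topology}"
  assumes [measurable]: "F \<in> borel_measurable borel"
  shows "integral\<^sup>L circ F = (1/(2*pi)) *\<^sub>R (LINT t:{0..2*pi}|lborel. F t)"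
proof -
  have "integral\<^sup>L circ F = (LINT t|lborel. (indicator {0..2*pi} t / (2*pi)) *\<^sub>R F t)"
    unfolding circ_def by (rule integral_density) auto
  also have "\<dots> = (LINT t|lborel. (1/(2*pi)) *\<^sub>R (indicator {0..2*pi} t *\<^sub>R F t))"
    by (intro Bochner_Integration.integral_cong) auto
  finally show ?thesis unfolding set_lebesgue_integral_def by (simp only: integral_scaleR_right)
qed

lemma integrable_circ:
  fixes F :: "real \<Rightarrow> 'a::{banach, second_countable_topology}"
  assumes [measurable]: "F \<in> borel_measurable borel"
  shows "integrable circ F \<longleftrightarrow> set_integrable lborel {0..2*pi} F"
proof -
  have "integrable circ F \<longleftrightarrow> integrable lborel (\<lambda>t. (indicator {0..2*pi} t / (2*pi)) *\<^sub>R F t)"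
    unfolding circ_def by (rule integrable_density) auto
  also have "(\<lambda>t. (indicator {0..2*pi} t / (2*pi)) *\<^sub>R F t) = (\<lambda>t. (1/(2*pi)) *\<^sub>R (indicator {0..2*pi} t *\<^sub>R F t))"
    by (auto simp: fun_eq_iff)
  finally have 1: "integrable circ F \<longleftrightarrow> integrable lborel (\<lambda>t. (1/(2*pi)) *\<^sub>R (indicator {0..2*pi} t *\<^sub>R F t))" .
  have "integrable lborel (\<lambda>t. indicator {0..2*pi} t *\<^sub>R F t)"
    if "integrable lborel (\<lambda>t. (1/(2*pi)) *\<^sub>R (indicator {0..2*pi} t *\<^sub>R F t))"
    using integrable_scaleR_right[of "2*pi", OF that] by simp
  moreover have "integrable lborel (\<lambda>t. (1/(2*pi)) *\<^sub>R (indicator {0..2*pi} t *\<^sub>R F t))"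
    if "integrable lborel (\<lambda>t. indicator {0..2*pi} t *\<^sub>R F t)"
    by (rule integrable_scaleR_right) (rule that)
  ultimately show ?thesis unfolding set_integrable_def 1 by (rule iffI)
qed

lemma emeasure_circ_space: "emeasure circ UNIV = 1"
proof -
  have "emeasure circ UNIV = (\<integral>\<^sup>+ t. ennreal (indicator {0..2*pi} t / (2*pi)) * indicator UNIV t \<partial>lborel)"
    unfolding circ_def by (subst emeasure_density) auto
  also have "\<dots> = (\<integral>\<^sup>+ t. ennreal (1/(2*pi)) * indicator {0..2*pi} t \<partial>lborel)"
    by (intro nn_integral_cong) (auto simp: indicator_def)
  also have "\<dots> = ennreal (1/(2*pi)) * ennreal (2*pi)"
    by (subst nn_integral_cmult) auto
  also have "\<dots> = 1" by (simp flip: ennreal_mult ennreal_1)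
  finally show ?thesis .
qed

interpretation circ: finite_measure circ
  by standard (simp add: emeasure_circ_space)

lemma measure_circ_UNIV [simp]: "measure circ UNIV = 1"
  by (simp add: measure_def emeasure_circ_space)

lemma integral_circ_const [simp]:
  "(LINT t|circ. c :: 'a::{banach, second_countable_topology}) = c"
  by simp

lemma integrable_circ_bounded:
  fixes F :: "real \<Rightarrow> 'a::{banach, second_countable_topology}"
  assumes "F \<in> borel_measurable borel" "AE t in circ. norm (F t) \<le> B"
  shows "integrable circ F"
  by (rule circ.integrable_const_bound[OF assms(2)]) (use assms in simp)

lemma integrable_circ_continuous:
  fixes F :: "real \<Rightarrow> 'a::{banach, second_countable_topology}"
  assumes "continuous_on UNIV F"
  shows "integrable circ F"
proof -
  have "compact (F ` {0..2*pi})"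
    by (intro compact_continuous_image continuous_on_subset[OF assms]) auto
  then obtain B where "\<And>x. x \<in> {0..2*pi} \<Longrightarrow> norm (F x) \<le> B"
    by (metis bounded_iff compact_imp_bounded image_eqI)
  then show ?thesis
    by (intro integrable_circ_bounded[of _ B])
       (auto simp: AE_circ intro!: borel_measurable_continuous_onI assms)
qed

lemma integrable_circ_mult_bounded:
  fixes F G :: "real \<Rightarrow> complex"
  assumes "integrable circ F" "G \<in> borel_measurable borel" "AE t in circ. norm (G t) \<le> B"
  shows "integrable circ (\<lambda>t. G t * F t)"
proof (rule Bochner_Integration.integrable_bound[of _ "\<lambda>t. B * norm (F t)"])
  show "AE x in circ. norm (G x * F x) \<le> norm (B * norm (F x))"
    using assms(3)
  proof eventually_elim
    case (elim x)
    then have "norm (G x) * norm (F x) \<le> B * norm (F x)" by (intro mult_right_mono) auto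
    also have "\<dots> \<le> norm (B * norm (F x))" by simp
    finally show ?case by (simp add: norm_mult)
  qed
qed (use assms borel_measurable_integrable[OF assms(1)] in auto)

lemma integral_cis_of_int: "(LINT t|circ. cis (of_int n * t)) = (if n = 0 then 1 else 0)"
proof (cases "n = 0")
  case False
  have *: "((\<lambda>t. cis (of_int n * t)) has_integral
      (cis (of_int n * (2*pi)) / (\<i> * of_int n) - cis (of_int n * 0) / (\<i> * of_int n))) {0..2*pi}"
  proof (rule fundamental_theorem_of_calculus)
    fix x :: real
    have "((\<lambda>z. exp (\<i> * of_int n * z) / (\<i> * of_int n)) has_field_derivative exp (\<i> * of_int n * of_real x)) (at (of_real x))"
      using False by (auto intro!: derivative_eq_intros)
    then have "((\<lambda>x. exp (\<i> * of_int n * of_real x) / (\<i> * of_int n)) has_vector_derivative exp (\<i> * of_int n * of_real x)) (at x within {0..2*pi})"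
      by (intro has_vector_derivative_real_field)
    then show "((\<lambda>x. cis (of_int n * x) / (\<i> * of_int n)) has_vector_derivative cis (of_int n * x)) (at x within {0..2*pi})"
      by (simp add: cis_conv_exp mult_ac)
  qed auto
  have "((\<lambda>t. cis (of_int n * t)) has_integral 0) {0..2*pi}"
  proof -
    have 1: "cis (of_int n * (2*pi)) = 1" by (metis Ints_of_int cis_multiple_2pi mult.commute)
    then show ?thesis using * by (simp only: 1) simp
  qed
  moreover have "set_integrable lborel {0..2*pi} (\<lambda>t. cis (of_int n * t))"
    by (rule borel_integrable_atLeastAtMost') (intro continuous_intros)
  ultimately have "(LINT t:{0..2*pi}|lborel. cis (of_int n * t)) = 0"
    using set_borel_integral_eq_integral(2) by (metis integral_unique)
  moreover have "(\<lambda>t. cis (of_int n * t)) \<in> borel_measurable borel"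
    by (intro borel_measurable_continuous_onI continuous_intros)
  ultimately show ?thesis using False by (simp add: integral_circ)
qed auto

text \<open>The representative of t modulo 2*pi in [0, 2*pi). A periodic function factors through
  it, so rotation invariance becomes a property of one image measure.\<close>

definition wrap :: "real \<Rightarrow> real" where "wrap t = t - 2*pi * of_int \<lfloor>t / (2*pi)\<rfloor>"

lemma wrap_measurable [measurable]: "wrap \<in> borel_measurable borel"
  unfolding wrap_def by measurable

lemma periodic_int:
  fixes F :: "real \<Rightarrow> 'a"
  assumes "\<And>t. F (t + 2*pi) = F t"
  shows "F (t + 2*pi * of_int m) = F t"
proof (induction m rule: int_induct[of _ 0])
  case (step1 i)
  have "F (t + 2*pi * of_int (i+1)) = F ((t + 2*pi * of_int i) + 2*pi)" by (simp add: algebra_simps)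
  then show ?case using step1 assms by metis
next
  case (step2 i)
  have "F ((t + 2*pi * of_int (i-1)) + 2*pi) = F (t + 2*pi * of_int i)" by (simp add: algebra_simps)
  then show ?case using step2 assms by metis
qed auto

lemma periodic_wrap:
  fixes F :: "real \<Rightarrow> 'a"
  assumes "\<And>t. F (t + 2*pi) = F t"
  shows "F (wrap t) = F t"
  using periodic_int[of F t "- \<lfloor>t / (2*pi)\<rfloor>"] assms by (simp add: wrap_def)

lemma wrap_periodic: "wrap (t + 2*pi) = wrap t"
proof -
  have "(t + 2*pi) / (2*pi) = t / (2*pi) + 1" by (simp add: field_simps)
  then show ?thesis by (simp add: wrap_def algebra_simps)
qed

lemma wrap_bounds: "0 \<le> wrap t" "wrap t < 2*pi"
proof -
  have "of_int \<lfloor>t / (2*pi)\<rfloor> * (2*pi) \<le> t" "t < (of_int \<lfloor>t / (2*pi)\<rfloor> + 1) * (2*pi)"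
    by (simp_all add: floor_divide_lower floor_divide_upper)
  then show "0 \<le> wrap t" "wrap t < 2*pi" unfolding wrap_def by (auto simp: algebra_simps)
qed

lemma nn_integral_shift:
  assumes [measurable]: "F \<in> borel_measurable (borel::real measure)"
  shows "(\<integral>\<^sup>+t. F t \<partial>lborel) = (\<integral>\<^sup>+t. F (t + a) \<partial>lborel)"
  using nn_integral_real_affine[of F 1 a] by (simp add: add.commute)

text \<open>A translation by whole periods reduces to a base point in [0, 2*pi); the part of the
  interval beyond 2*pi then moves back by one period.\<close>

lemma nn_integral_period:
  fixes F :: "real \<Rightarrow> ennreal"
  assumes per: "\<And>t. F (t + 2*pi) = F t" and [measurable]: "F \<in> borel_measurable borel"
  shows "(\<integral>\<^sup>+t. F t * indicator {a..<a+2*pi} t \<partial>lborel) = (\<integral>\<^sup>+t. F t * indicator {0..<2*pi} t \<partial>lborel)"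
proof -
  define b m where "b = wrap a" and "m = \<lfloor>a / (2*pi)\<rfloor>"
  have ab: "a = b + 2*pi * of_int m" by (simp add: b_def m_def wrap_def)
  have b: "0 \<le> b" "b < 2*pi" using wrap_bounds b_def by auto
  have "(\<integral>\<^sup>+t. F t * indicator {a..<a+2*pi} t \<partial>lborel) = (\<integral>\<^sup>+t. F (t + 2*pi * of_int m) * indicator {a..<a+2*pi} (t + 2*pi * of_int m) \<partial>lborel)"
    by (rule nn_integral_shift) measurable
  also have "\<dots> = (\<integral>\<^sup>+t. F t * indicator {b..<b+2*pi} t \<partial>lborel)"
    by (intro nn_integral_cong) (auto simp: periodic_int[of F, OF per] ab indicator_def)
  also have "\<dots> = (\<integral>\<^sup>+t. F t * indicator {b..<2*pi} t + F t * indicator {2*pi..<b+2*pi} t \<partial>lborel)"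
    using b by (intro nn_integral_cong) (auto simp: indicator_def)
  also have "\<dots> = (\<integral>\<^sup>+t. F t * indicator {b..<2*pi} t \<partial>lborel) + (\<integral>\<^sup>+t. F t * indicator {2*pi..<b+2*pi} t \<partial>lborel)"
    by (rule nn_integral_add) auto
  also have "(\<integral>\<^sup>+t. F t * indicator {2*pi..<b+2*pi} t \<partial>lborel) = (\<integral>\<^sup>+t. F (t + 2*pi) * indicator {2*pi..<b+2*pi} (t+2*pi) \<partial>lborel)"
    by (rule nn_integral_shift) measurable
  also have "\<dots> = (\<integral>\<^sup>+t. F t * indicator {0..<b} t \<partial>lborel)"
    by (intro nn_integral_cong) (auto simp: per indicator_def)
  also have "(\<integral>\<^sup>+t. F t * indicator {b..<2*pi} t \<partial>lborel) + (\<integral>\<^sup>+t. F t * indicator {0..<b} t \<partial>lborel) =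
     (\<integral>\<^sup>+t. F t * indicator {b..<2*pi} t + F t * indicator {0..<b} t \<partial>lborel)"
    by (rule nn_integral_add [symmetric]) auto
  also have "\<dots> = (\<integral>\<^sup>+t. F t * indicator {0..<2*pi} t \<partial>lborel)"
    using b by (intro nn_integral_cong) (auto simp: indicator_def)
  finally show ?thesis .
qed

lemma nn_integral_circ:
  assumes [measurable]: "F \<in> borel_measurable borel"
  shows "(\<integral>\<^sup>+t. F t \<partial>circ) = ennreal (1/(2*pi)) * (\<integral>\<^sup>+t. F t * indicator {0..<2*pi} t \<partial>lborel)"
proof -
  have "(\<integral>\<^sup>+t. F t \<partial>circ) = (\<integral>\<^sup>+t. ennreal (indicator {0..2*pi} t / (2*pi)) * F t \<partial>lborel)"
    unfolding circ_def by (rule nn_integral_density) auto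
  also have "\<dots> = (\<integral>\<^sup>+t. ennreal (1/(2*pi)) * (F t * indicator {0..<2*pi} t) \<partial>lborel)"
  proof (rule nn_integral_cong_AE)
    have "AE t in lborel. t \<noteq> 2*pi" by (rule AE_lborel_singleton)
    then show "AE t in lborel. ennreal (indicator {0..2*pi} t / (2*pi)) * F t = ennreal (1/(2*pi)) * (F t * indicator {0..<2*pi} t)"
      by eventually_elim (auto simp: indicator_def)
  qed
  also have "\<dots> = ennreal (1/(2*pi)) * (\<integral>\<^sup>+t. F t * indicator {0..<2*pi} t \<partial>lborel)"
    by (rule nn_integral_cmult) measurable
  finally show ?thesis .
qed

lemma nn_integral_circ_shift:
  fixes F :: "real \<Rightarrow> ennreal"
  assumes per: "\<And>t. F (t + 2*pi) = F t" and [measurable]: "F \<in> borel_measurable borel"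
  shows "(\<integral>\<^sup>+t. F (t + a) \<partial>circ) = (\<integral>\<^sup>+t. F t \<partial>circ)"
proof -
  have "(\<integral>\<^sup>+t. F t * indicator {a..<a+2*pi} t \<partial>lborel) = (\<integral>\<^sup>+t. F (t + a) * indicator {a..<a+2*pi} (t+a) \<partial>lborel)"
    by (rule nn_integral_shift) measurable
  also have "\<dots> = (\<integral>\<^sup>+t. F (t + a) * indicator {0..<2*pi} t \<partial>lborel)"
    by (intro nn_integral_cong) (auto simp: indicator_def)
  finally show ?thesis by (simp add: nn_integral_circ nn_integral_period[of F, OF per])
qed

text \<open>Equality of image measures transfers rotation invariance from nonnegative functions to
  integrals and integrability of vector-valued ones in one stroke.\<close>

lemma distr_circ_wrap: "distr circ borel (\<lambda>t. wrap (t + a)) = distr circ borel wrap"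
proof (rule measure_eqI)
  fix A assume "A \<in> sets (distr circ borel (\<lambda>t. wrap (t + a)))"
  then have [measurable]: "A \<in> sets borel" by simp
  have [measurable]: "(\<lambda>t. wrap (t + a)) \<in> borel_measurable borel" by measurable
  have "emeasure (distr circ borel (\<lambda>t. wrap (t + a))) A = (\<integral>\<^sup>+t. indicator A t \<partial>(distr circ borel (\<lambda>t. wrap (t + a))))"
    by simp
  also have "\<dots> = (\<integral>\<^sup>+t. indicator A (wrap (t + a)) \<partial>circ)"
    by (rule nn_integral_distr) auto
  also have "\<dots> = (\<integral>\<^sup>+t. indicator A (wrap t) \<partial>circ)"
    by (rule nn_integral_circ_shift) (auto simp: wrap_periodic)
  also have "\<dots> = (\<integral>\<^sup>+t. indicator A t \<partial>(distr circ borel wrap))"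
    by (rule nn_integral_distr [symmetric]) auto
  finally show "emeasure (distr circ borel (\<lambda>t. wrap (t + a))) A = emeasure (distr circ borel wrap) A"
    by simp
qed simp

lemma
  fixes F :: "real \<Rightarrow> 'a::{banach, second_countable_topology}"
  assumes per: "\<And>t. F (t + 2*pi) = F t" and [measurable]: "F \<in> borel_measurable borel"
  shows integral_circ_shift: "(LINT t|circ. F (t + a)) = integral\<^sup>L circ F"
    and integrable_circ_shift: "integrable circ (\<lambda>t. F (t + a)) = integrable circ F"
proof -
  have 1: "F (t + a) = F (wrap (t + a))" "F t = F (wrap t)" for t
    using periodic_wrap[of F, OF per] by auto
  have m: "(\<lambda>t. wrap (t + a)) \<in> borel_measurable borel" by measurable
  show "(LINT t|circ. F (t + a)) = integral\<^sup>L circ F"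
    using integral_distr[of "\<lambda>t. wrap (t + a)" circ borel F] integral_distr[of wrap circ borel F]
    unfolding distr_circ_wrap by (simp add: 1[symmetric] m)
  show "integrable circ (\<lambda>t. F (t + a)) = integrable circ F"
    using integrable_distr_eq[of "\<lambda>t. wrap (t + a)" circ borel F] integrable_distr_eq[of wrap circ borel F]
    unfolding distr_circ_wrap by (simp add: 1[symmetric] m)
qed

text \<open>Countably many translates by multiples of 2*pi of a null set in one period form a null
  set. This matters for mean oscillation, whose intervals leave [0, 2*pi].\<close>

lemma AE_circ_shift:
  assumes "\<And>t. P (t + 2*pi) \<longleftrightarrow> P t" "AE t in circ. P t"
  shows "AE t in lborel. P t"
proof -
  have "AE t in lborel. t \<in> {0..2*pi} \<longrightarrow> P t" using assms(2) AE_circ by auto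
  then obtain N where N: "N \<in> null_sets lborel" "\<And>t. t \<notin> N \<Longrightarrow> t \<in> {0..2*pi} \<Longrightarrow> P t"
    by (auto simp: eventually_ae_filter)
  define M where "M = (\<Union>m::int. (\<lambda>t. t + 2*pi * of_int m) ` N)"
  have "(\<lambda>t. t + 2*pi * of_int m) ` N \<in> null_sets lborel" for m :: int
  proof -
    have [measurable]: "N \<in> sets borel" using N by auto
    have eq: "(\<lambda>t. t + 2*pi * of_int m) ` N = (\<lambda>t. t - 2*pi * of_int m) -` N \<inter> space borel"
      by (auto simp: image_iff algebra_simps intro!: bexI[of _ "_ - 2*pi * of_int m"])
    have [measurable]: "(\<lambda>t. t + 2*pi * of_int m) ` N \<in> sets borel"
      unfolding eq by (rule measurable_sets[of _ borel borel]) auto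
    have "emeasure lborel ((\<lambda>t. t + 2*pi * of_int m) ` N) = (\<integral>\<^sup>+t. indicator ((\<lambda>t. t + 2*pi * of_int m) ` N) t \<partial>lborel)"
      by simp
    also have "\<dots> = (\<integral>\<^sup>+t. indicator ((\<lambda>t. t + 2*pi * of_int m) ` N) (t + 2*pi * of_int m) \<partial>lborel)"
      by (rule nn_integral_shift) measurable
    also have "\<dots> = (\<integral>\<^sup>+t. indicator N t \<partial>lborel)"
      by (intro nn_integral_cong) (auto simp: indicator_def)
    finally show ?thesis using N by (auto simp: null_sets_def)
  qed
  then have "M \<in> null_sets lborel" unfolding M_def by (intro null_sets_UN) auto
  moreover have "P t" if "t \<notin> M" for t
  proof -
    have "wrap t \<notin> N"
    proof
      assume "wrap t \<in> N"
      then have "t \<in> M" unfolding M_def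
        by (intro UN_I[of "\<lfloor>t / (2*pi)\<rfloor>"] image_eqI[of _ _ "wrap t"]) (auto simp: wrap_def)
      with that show False by simp
    qed
    then have "P (wrap t)" using N(2) wrap_bounds[of t] by (auto simp: less_imp_le)
    then show ?thesis using periodic_wrap[of P] assms by auto
  qed
  ultimately show ?thesis by (intro AE_I'[of M]) auto
qed

section \<open>Fourier coefficients and power series\<close>

abbreviation evc :: "afun \<Rightarrow> real \<Rightarrow> real \<Rightarrow> complex" where
  "evc a r t \<equiv> ev a (of_real r * cis t)"

definition fc :: "(real \<Rightarrow> complex) \<Rightarrow> int \<Rightarrow> complex" where
  "fc F n = (LINT t|circ. F t * cis (- (of_int n * t)))"

lemma cis_measurable [measurable]: "(\<lambda>t. cis (c * t)) \<in> borel_measurable borel"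
  by (intro borel_measurable_continuous_onI continuous_intros)

lemma cis_measurable' [measurable]: "cis \<in> borel_measurable borel"
  by (intro borel_measurable_continuous_onI continuous_intros)

lemma cnj_measurable [measurable]: "cnj \<in> borel_measurable borel"
  by (intro borel_measurable_continuous_onI continuous_intros)

lemma integrable_fc:
  assumes "integrable circ F"
  shows "integrable circ (\<lambda>t. F t * cis (c * t))"
  using integrable_circ_mult_bounded[OF assms, of "\<lambda>t. cis (c * t)" 1]
  by (simp add: mult.commute cis_measurable)

lemma integrable_fc':
  assumes "integrable circ F"
  shows "integrable circ (\<lambda>t. F t * cis (- (c * t)))"
  using integrable_fc[OF assms, of "-c"] by simp

lemma fc_add: "integrable circ F \<Longrightarrow> integrable circ G \<Longrightarrow> fc (\<lambda>t. F t + G t) n = fc F n + fc G n"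
  unfolding fc_def distrib_right by (intro Bochner_Integration.integral_add integrable_fc')

lemma fc_diff: "integrable circ F \<Longrightarrow> integrable circ G \<Longrightarrow> fc (\<lambda>t. F t - G t) n = fc F n - fc G n"
  unfolding fc_def left_diff_distrib by (intro Bochner_Integration.integral_diff integrable_fc')

lemma fc_cmult: "fc (\<lambda>t. c * F t) n = c * fc F n"
  by (simp add: fc_def mult.assoc)

lemma norm_fc_le: "cmod (fc F n) \<le> (LINT t|circ. cmod (F t))"
  unfolding fc_def by (rule order.trans[OF integral_norm_bound]) (simp add: norm_mult)

lemma fc_cnj: "fc (\<lambda>t. cnj (F t)) n = cnj (fc F (-n))"
  unfolding fc_def Bochner_Integration.integral_cnj[symmetric] by (simp add: cis_cnj)

lemma fc_cis_shift: "fc (\<lambda>t. F t * cis (of_int m * t)) n = fc F (n - m)"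
  unfolding fc_def by (intro Bochner_Integration.integral_cong) (auto simp: mult.assoc cis_mult algebra_simps)

lemma fc_cong_AE:
  assumes "F \<in> borel_measurable borel" "G \<in> borel_measurable borel" "AE t in circ. F t = G t"
  shows "fc F n = fc G n"
  unfolding fc_def by (rule integral_cong_AE) (use assms in auto)

lemma analytic_disk_summable:
  assumes "analytic_disk a" "cmod z < 1"
  shows "summable (\<lambda>n. norm (a n * z ^ n))"
  using assms unfolding analytic_disk_def by (auto simp: norm_mult norm_power)

lemma ev_sums: "analytic_disk a \<Longrightarrow> cmod z < 1 \<Longrightarrow> (\<lambda>n. a n * z ^ n) sums ev a z"
  unfolding ev_def by (intro summable_sums summable_norm_cancel[OF analytic_disk_summable])

lemma ev_holomorphic: "analytic_disk a \<Longrightarrow> ev a holomorphic_on ball 0 1"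
  by (rule power_series_holomorphic[of _ _ a]) (auto intro: ev_sums)

lemma ev_0 [simp]: "ev a 0 = a 0"
  unfolding ev_def by (rule powser_zero)

lemma analytic_diskI:
  assumes "\<And>z. cmod z < 1 \<Longrightarrow> summable (\<lambda>n. a n * z ^ n)"
  shows "analytic_disk a"
  unfolding analytic_disk_def
proof (intro allI impI)
  fix r :: real assume r: "0 \<le> r \<and> r < 1"
  have "summable (\<lambda>n. a n * (of_real ((1+r)/2)) ^ n)"
  proof (rule assms)
    have "cmod (complex_of_real ((1+r)/2)) = (1+r)/2" using r by (simp only: norm_of_real) simp
    then show "cmod (complex_of_real ((1+r)/2)) < 1" using r by simp
  qed
  then have "summable (\<lambda>n. norm (a n * (of_real r) ^ n))"
    by (rule powser_insidea) (use r in \<open>simp only: norm_of_real, simp\<close>)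
  then show "summable (\<lambda>n. norm (a n) * r ^ n)" using r by (simp add: norm_mult norm_power)
qed

lemma holomorphic_afun:
  assumes "f holomorphic_on ball 0 1"
  obtains a where "analytic_disk a" "\<And>z. cmod z < 1 \<Longrightarrow> ev a z = f z"
proof -
  define a where "a n = (deriv ^^ n) f 0 / fact n" for n
  have s: "(\<lambda>n. a n * z ^ n) sums f z" if "cmod z < 1" for z
    using holomorphic_power_series[OF assms, of z] that by (simp add: a_def)
  show ?thesis
  proof
    show "analytic_disk a" by (rule analytic_diskI) (use s in \<open>auto simp: sums_iff\<close>)
    show "ev a z = f z" if "cmod z < 1" for z using s[OF that] by (simp add: sums_iff ev_def)
  qed
qed

lemma analytic_disk_diff: "analytic_disk a \<Longrightarrow> analytic_disk b \<Longrightarrow> analytic_disk (\<lambda>n. a n - b n)"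
  by (rule analytic_diskI) (auto simp: left_diff_distrib intro!: summable_diff intro: sums_summable ev_sums)
lemma analytic_disk_cmult: "analytic_disk a \<Longrightarrow> analytic_disk (\<lambda>n. c * a n)"
  by (rule analytic_diskI) (auto simp: mult.assoc intro!: summable_mult intro: sums_summable ev_sums)

lemma ev_diff: "analytic_disk a \<Longrightarrow> analytic_disk b \<Longrightarrow> cmod z < 1 \<Longrightarrow> ev (\<lambda>n. a n - b n) z = ev a z - ev b z"
  unfolding ev_def left_diff_distrib by (rule suminf_diff [symmetric]) (auto intro: sums_summable ev_sums)
lemma ev_cmult: "analytic_disk a \<Longrightarrow> cmod z < 1 \<Longrightarrow> ev (\<lambda>n. c * a n) z = c * ev a z"
  unfolding ev_def mult.assoc by (rule suminf_mult) (auto intro: sums_summable ev_sums)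

lemma amult_ev:
  assumes "analytic_disk a" "analytic_disk b" "cmod z < 1"
  shows "(\<lambda>n. amult a b n * z ^ n) sums (ev a z * ev b z)"
proof -
  have "(\<lambda>k. \<Sum>i\<le>k. (a i * z ^ i) * (b (k - i) * z ^ (k - i))) sums ((\<Sum>k. a k * z ^ k) * (\<Sum>k. b k * z ^ k))"
    by (intro Cauchy_product_sums analytic_disk_summable assms)
  moreover have "(\<Sum>i\<le>k. (a i * z ^ i) * (b (k - i) * z ^ (k - i))) = amult a b k * z ^ k" for k
    unfolding amult_def sum_distrib_right
  proof (intro sum.cong refl)
    fix i assume "i \<in> {..k}"
    then have "z ^ i * z ^ (k - i) = z ^ k" by (simp add: power_add[symmetric])
    moreover have "(a i * z ^ i) * (b (k - i) * z ^ (k - i)) = (a i * b (k - i)) * (z ^ i * z ^ (k - i))"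
      by (simp add: mult_ac)
    ultimately show "(a i * z ^ i) * (b (k - i) * z ^ (k - i)) = a i * b (k - i) * z ^ k" by simp
  qed
  ultimately show ?thesis by (simp add: ev_def)
qed

lemma analytic_disk_amult: "analytic_disk a \<Longrightarrow> analytic_disk b \<Longrightarrow> analytic_disk (amult a b)"
  by (rule analytic_diskI) (blast intro: sums_summable amult_ev)

lemma ev_amult: "analytic_disk a \<Longrightarrow> analytic_disk b \<Longrightarrow> cmod z < 1 \<Longrightarrow> ev (amult a b) z = ev a z * ev b z"
  using amult_ev unfolding ev_def by (metis sums_unique)

lemma continuous_ev_circle:
  assumes "analytic_disk a" "0 \<le> r" "r < 1"
  shows "continuous_on UNIV (\<lambda>t. evc a r t)"
  by (rule continuous_on_compose2[OF holomorphic_on_imp_continuous_on[OF ev_holomorphic[OF assms(1)]]])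
     (use assms in \<open>auto intro!: continuous_intros simp: norm_mult\<close>)

lemma ev_circle_measurable:
  assumes "analytic_disk a" "0 \<le> r" "r < 1"
  shows "(\<lambda>t. evc a r t) \<in> borel_measurable borel"
  by (intro borel_measurable_continuous_onI continuous_ev_circle assms)

text \<open>Absolute convergence on the circle of radius r < 1 permits termwise integration.
  Coefficient formulas, Parseval's identity and the Poisson formula are all obtained by choosing F
  or the series suitably.\<close>

lemma integral_ev:
  assumes F: "integrable circ F" and a: "analytic_disk a" and r: "0 \<le> r" "r < 1"
  shows "(\<lambda>k. fc F (- int k) * a k * of_real r ^ k) sums (LINT t|circ. F t * evc a r t)"
    and "integrable circ (\<lambda>t. F t * evc a r t)"
proof -
  define u where "u k t = F t * (a k * of_real r ^ k * cis (of_int (int k) * t))" for k t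
  have su: "(\<lambda>k. u k t) sums (F t * evc a r t)" for t
    unfolding u_def using ev_sums[OF a, of "of_real r * cis t"] r
    by (intro sums_mult) (simp add: norm_mult power_mult_distrib Complex.DeMoivre mult_ac)
  have int: "integrable circ (u k)" for k
    using integrable_mult_right[of "a k * of_real r ^ k" circ "\<lambda>t. F t * cis (of_int (int k) * t)"] integrable_fc[OF F, of "of_int (int k)"]
    by (auto simp: u_def[abs_def] mult_ac)
  have nu: "norm (u k t) = cmod (F t) * (norm (a k) * r ^ k)" for k t
    using r by (simp add: u_def norm_mult norm_power)
  have s: "summable (\<lambda>k. norm (a k) * r ^ k)" using a r by (auto simp: analytic_disk_def)
  have 1: "AE x in circ. summable (\<lambda>i. norm (u i x))"
    by (simp add: nu s summable_mult)
  have 2: "summable (\<lambda>i. LINT x|circ. norm (u i x))"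
    by (simp add: nu s summable_mult)
  have "(\<lambda>k. integral\<^sup>L circ (u k)) sums integral\<^sup>L circ (\<lambda>x. \<Sum>i. u i x)"
    by (rule sums_integral) (use int 1 2 in auto)
  moreover have "integral\<^sup>L circ (u k) = fc F (- int k) * a k * of_real r ^ k" for k
  proof -
    have "integral\<^sup>L circ (u k) = (LINT t|circ. (a k * of_real r ^ k) * (F t * cis (- (of_int (- int k) * t))))"
      by (rule Bochner_Integration.integral_cong) (auto simp: u_def)
    then show ?thesis by (simp add: fc_def)
  qed
  moreover have "(\<Sum>i. u i x) = F x * evc a r x" for x using su sums_unique by metis
  ultimately show "(\<lambda>k. fc F (- int k) * a k * of_real r ^ k) sums (LINT t|circ. F t * evc a r t)"
    by simp
  have "integrable circ (\<lambda>x. \<Sum>i. u i x)"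
    by (rule integrable_suminf) (use int 1 2 in auto)
  then show "integrable circ (\<lambda>t. F t * evc a r t)"
    using su sums_unique by (simp add: sums_iff)
qed

lemma integral_cnj_ev:
  assumes F: "integrable circ F" and a: "analytic_disk a" and r: "0 \<le> r" "r < 1"
  shows "(\<lambda>k. fc F (int k) * cnj (a k) * of_real r ^ k) sums (LINT t|circ. F t * cnj (evc a r t))"
proof -
  have "integrable circ (\<lambda>t. cnj (F t))" using F by simp
  from integral_ev(1)[OF this a r] have
    "(\<lambda>k. cnj (fc (\<lambda>t. cnj (F t)) (- int k) * a k * of_real r ^ k)) sums
      cnj ((LINT t|circ. cnj (F t) * evc a r t))"
    by (simp only: sums_cnj)
  then show ?thesis unfolding fc_cnj Bochner_Integration.integral_cnj[symmetric] by simp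
qed

lemma fc_dilation:
  assumes a: "analytic_disk a" and r: "0 \<le> r" "r < 1"
  shows "fc (\<lambda>t. evc a r t) n = (if n \<ge> 0 then a (nat n) * of_real r ^ nat n else 0)"
proof -
  have i: "integrable circ (\<lambda>t. cis (- (of_int n * t)))"
    by (intro integrable_circ_continuous continuous_intros)
  have "fc (\<lambda>t. cis (- (of_int n * t))) (- int k) = (if nat n = k \<and> n \<ge> 0 then 1 else 0)" for k
  proof -
    have "fc (\<lambda>t. cis (- (of_int n * t))) (- int k) = (LINT t|circ. cis (of_int (int k - n) * t))"
      unfolding fc_def by (rule Bochner_Integration.integral_cong) (auto simp: cis_mult algebra_simps)
    then show ?thesis unfolding integral_cis_of_int by auto
  qed
  with integral_ev(1)[OF i a r]
  have "(\<lambda>k. (if nat n = k \<and> n \<ge> 0 then 1 else 0) * a k * of_real r ^ k) sums fc (\<lambda>t. evc a r t) n"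
    by (simp add: fc_def mult.commute)
  moreover have "(\<lambda>k. (if nat n = k \<and> n \<ge> 0 then 1 else 0) * a k * of_real r ^ k) = (\<lambda>k. if k = nat n then (if n \<ge> 0 then a (nat n) * of_real r ^ nat n else 0) else 0)"
    by auto
  ultimately have "(\<lambda>k. if k = nat n then (if n \<ge> 0 then a (nat n) * of_real r ^ nat n else 0) else 0) sums fc (\<lambda>t. evc a r t) n"
    by (simp only:)
  then show ?thesis
    by (rule sums_unique2) (rule sums_single[of "nat n" "\<lambda>_. (if n \<ge> 0 then a (nat n) * of_real r ^ nat n else 0)"])
qed

lemma parseval_dilation:
  assumes a: "analytic_disk a" and r: "0 \<le> r" "r < 1"
  shows "(\<lambda>k. (cmod (a k))\<^sup>2 * r ^ (2*k)) sums (LINT t|circ. (cmod (evc a r t))\<^sup>2)"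
proof -
  have i: "integrable circ (\<lambda>t. evc a r t)"
    by (intro integrable_circ_continuous continuous_ev_circle assms)
  have 1: "a k * (cnj (a k) * (complex_of_real r ^ k * complex_of_real r ^ k)) = of_real ((cmod (a k))\<^sup>2 * r ^ (2*k))" for k
  proof -
    have "complex_of_real ((cmod (a k))\<^sup>2 * r ^ (2*k)) = of_real ((cmod (a k))\<^sup>2) * (of_real r ^ k * of_real r ^ k)"
      by (simp add: mult_2 power_add)
    then show ?thesis unfolding complex_norm_square by (simp add: mult_ac)
  qed
  have "(\<lambda>k. of_real ((cmod (a k))\<^sup>2 * r ^ (2*k))) sums (LINT t|circ. complex_of_real ((cmod (evc a r t))\<^sup>2))"
    using integral_cnj_ev[OF i a r] unfolding fc_dilation[OF a r]
    unfolding complex_norm_square[symmetric] by (simp add: mult_ac 1 del: of_real_power of_real_mult)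
  then show ?thesis
    by (simp only: sums_of_real_iff integral_complex_of_real)
qed

section \<open>Integral means, and H^2 as square-summable coefficients\<close>

lemma pmean_eq:
  assumes "analytic_disk a" "0 \<le> r" "r < 1"
  shows "pmean p a r = (LINT t|circ. cmod (evc a r t) powr p)"
proof -
  have [measurable]: "(\<lambda>t. evc a r t) \<in> borel_measurable borel"
    by (rule ev_circle_measurable[OF assms])
  show ?thesis unfolding pmean_def by (subst integral_circ) auto
qed

lemma pmean1: "analytic_disk a \<Longrightarrow> 0 \<le> r \<Longrightarrow> r < 1 \<Longrightarrow> pmean 1 a r = (LINT t|circ. cmod (evc a r t))"
  by (simp add: pmean_eq)

lemma pmean2: "analytic_disk a \<Longrightarrow> 0 \<le> r \<Longrightarrow> r < 1 \<Longrightarrow> pmean 2 a r = (LINT t|circ. (cmod (evc a r t))\<^sup>2)"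
  by (simp add: pmean_eq)

lemma Hp2_I:
  assumes "summable (\<lambda>k. (cmod (a k))\<^sup>2)"
  shows "a \<in> Hp 2"
proof -
  have "(\<lambda>k. (cmod (a k))\<^sup>2) \<longlonglongrightarrow> 0" using assms by (rule summable_LIMSEQ_zero)
  then have "bounded (range (\<lambda>k. (cmod (a k))\<^sup>2))" by (intro convergent_imp_bounded)
  then obtain B where B: "\<And>k. (cmod (a k))\<^sup>2 \<le> B" by (auto simp: bounded_iff)
  have B': "cmod (a k) \<le> B + 1" for k
  proof -
    have "cmod (a k) \<le> (cmod (a k))\<^sup>2 + 1"
      using zero_le_power2[of "cmod (a k) - 1/2"] by (simp add: power2_eq_square algebra_simps)
    then show ?thesis using B[of k] by simp
  qed
  have ad: "analytic_disk a" unfolding analytic_disk_def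
  proof (intro allI impI)
    fix r :: real assume r: "0 \<le> r \<and> r < 1"
    then have "summable (\<lambda>n. (B+1) * r ^ n)" by (intro summable_mult summable_geometric) auto
    then show "summable (\<lambda>n. cmod (a n) * r ^ n)"
      by (rule summable_comparison_test_ev[rotated]) (use r B' in \<open>auto intro!: mult_right_mono always_eventually\<close>)
  qed
  have "pmean 2 a r \<le> (\<Sum>k. (cmod (a k))\<^sup>2)" if "r \<in> {0..<1}" for r
  proof -
    have r: "0 \<le> r" "r < 1" using that by auto
    have "(cmod (a k))\<^sup>2 * r ^ (2 * k) \<le> (cmod (a k))\<^sup>2" for k
      using r by (intro mult_left_le power_le_one) auto
    then have "(\<Sum>k. (cmod (a k))\<^sup>2 * r ^ (2 * k)) \<le> (\<Sum>k. (cmod (a k))\<^sup>2)"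
      using parseval_dilation[OF ad r] assms by (intro suminf_le) (auto simp: sums_iff)
    then show ?thesis using parseval_dilation[OF ad r] by (simp add: pmean2[OF ad r] sums_iff)
  qed
  then show ?thesis using ad by (auto simp: Hp_def intro!: bdd_aboveI[of _ "\<Sum>k. (cmod (a k))\<^sup>2"])
qed

lemma Hp2_D:
  assumes "analytic_disk a" "\<And>r. 0 \<le> r \<Longrightarrow> r < 1 \<Longrightarrow> pmean 2 a r \<le> B"
  shows "summable (\<lambda>k. (cmod (a k))\<^sup>2)" "(\<Sum>k. (cmod (a k))\<^sup>2) \<le> B"
proof -
  have *: "(\<Sum>k<n. (cmod (a k))\<^sup>2) \<le> B" for n
  proof (rule tendsto_upperbound)
    show "((\<lambda>r. \<Sum>k<n. (cmod (a k))\<^sup>2 * r ^ (2*k)) \<longlongrightarrow> (\<Sum>k<n. (cmod (a k))\<^sup>2)) (at_left (1::real))"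
      by (auto intro!: tendsto_eq_intros)
    have "eventually (\<lambda>r::real. r \<in> {0<..<1}) (at_left 1)" by (rule eventually_at_leftI[of 0]) auto
    then show "\<forall>\<^sub>F r in at_left 1. (\<Sum>k<n. (cmod (a k))\<^sup>2 * r ^ (2 * k)) \<le> B"
    proof eventually_elim
      case (elim r)
      then have r: "0 \<le> r" "r < 1" by auto
      have "(\<Sum>k<n. (cmod (a k))\<^sup>2 * r ^ (2 * k)) \<le> (\<Sum>k. (cmod (a k))\<^sup>2 * r ^ (2 * k))"
        using parseval_dilation[OF assms(1) r] r by (intro sum_le_suminf) (auto simp: sums_iff)
      also have "\<dots> \<le> B" using assms(2)[OF r] parseval_dilation[OF assms(1) r] by (simp add: pmean2[OF assms(1) r] sums_iff)
      finally show ?case .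
    qed
  qed auto
  show s: "summable (\<lambda>k. (cmod (a k))\<^sup>2)" by (rule summableI_nonneg_bounded[of _ B]) (use * in auto)
  show "(\<Sum>k. (cmod (a k))\<^sup>2) \<le> B" by (rule suminf_le_const[OF s]) (use * in auto)
qed

lemma Hp2_iff: "a \<in> Hp 2 \<longleftrightarrow> summable (\<lambda>k. (cmod (a k))\<^sup>2)"
proof
  assume "a \<in> Hp 2"
  then have "analytic_disk a" "bdd_above (pmean 2 a ` {0..<1})" by (auto simp: Hp_def)
  then obtain B where B: "analytic_disk a" "\<forall>r\<in>{0..<1}. pmean 2 a r \<le> B"
    unfolding bdd_above_def by blast
  show "summable (\<lambda>k. (cmod (a k))\<^sup>2)"
    by (rule Hp2_D(1)[OF B(1), of B]) (use B(2) in auto)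
qed (rule Hp2_I)

section \<open>Radial limits and measurability of the boundary function\<close>

definition radlim :: "afun \<Rightarrow> real \<Rightarrow> complex \<Rightarrow> bool" where
  "radlim a t L \<longleftrightarrow> ((\<lambda>r::real. evc a r t) \<longlongrightarrow> L) (at_left 1)"

lemma radlim_bv: "radlim a t L \<Longrightarrow> bv a t = L"
  unfolding radlim_def bv_def by (intro tendsto_Lim) auto

lemma radlim_seq: "radlim a t L \<Longrightarrow> (\<lambda>n. evc a (1 - 1 / Suc n) t) \<longlonglongrightarrow> L"
  unfolding radlim_def
proof (rule filterlim_compose, assumption)
  show "filterlim (\<lambda>n. 1 - 1 / real (Suc n)) (at_left 1) sequentially"
    by (rule tendsto_imp_filterlim_at_left) (use LIMSEQ_inverse_real_of_nat_add_minus[of 1] in \<open>auto simp: field_simps inverse_eq_divide\<close>)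
qed

lemma bv_periodic: "bv a (t + 2*pi) = bv a t"
  by (simp add: bv_def flip: cis_mult)

text \<open>Where no radial limit exists, \<open>bv\<close> takes a fixed junk value. The set of these points is Borel
  because the Cauchy criterion is an intersection of closed conditions.\<close>
lemma bv_measurable:
  assumes a: "analytic_disk a"
  shows "bv a \<in> borel_measurable borel"
proof -
  define f where "f r t = evc a r t" for r t
  define S where "S m n = {t. \<forall>p\<in>{1 - 1 / Suc n<..<1}. \<forall>q\<in>{1 - 1 / Suc n<..<1}. dist (f p t) (f q t) \<le> 1 / Suc m}" for m n :: nat
  define C where "C = (\<Inter>m. \<Union>n. S m n)"
  have pos: "0 < p" if "p \<in> {1 - 1 / Suc n<..<1}" for p :: real and n
  proof -
    have "1 / real (Suc n) \<le> 1" by simp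
    then show ?thesis using that unfolding greaterThanLessThan_iff by linarith
  qed
  have "closed (S m n)" for m n
  proof -
    have "S m n = (\<Inter>p\<in>{1 - 1 / Suc n<..<1}. \<Inter>q\<in>{1 - 1 / Suc n<..<1}. {t. dist (f p t) (f q t) \<le> 1 / Suc m})"
      by (auto simp: S_def)
    moreover have "closed {t. dist (f p t) (f q t) \<le> 1 / Suc m}"
      if "p \<in> {1 - 1 / Suc n<..<1}" "q \<in> {1 - 1 / Suc n<..<1}" for p q
      unfolding f_def using that pos[of p n] pos[of q n]
      by (intro closed_Collect_le continuous_intros continuous_ev_circle a) auto
    ultimately show ?thesis by (auto intro!: closed_INT)
  qed
  then have [measurable]: "S m n \<in> sets borel" for m n by (rule borel_closed)
  have Cm [measurable]: "C \<in> sets borel" unfolding C_def by measurable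
  have CI: "t \<in> C" if "radlim a t L" for t L
    unfolding C_def
  proof
    fix m
    have "\<forall>\<^sub>F r in at_left 1. dist (f r t) L < 1 / Suc m / 2"
      using that unfolding radlim_def f_def by (intro tendstoD) auto
    then obtain b where b: "b < 1" "\<And>r. b < r \<Longrightarrow> r < 1 \<Longrightarrow> dist (f r t) L < 1 / Suc m / 2"
      unfolding eventually_at_left[of 0 1, OF zero_less_one] by auto
    obtain n where n: "1 / Suc n < 1 - b" using b(1) nat_approx_posE[of "1-b"] by auto
    have "t \<in> S m n" unfolding S_def
    proof (intro CollectI ballI)
      fix p q :: real assume "p \<in> {1 - 1 / Suc n<..<1}" "q \<in> {1 - 1 / Suc n<..<1}"
      then have "dist (f p t) L < 1 / Suc m / 2" "dist (f q t) L < 1 / Suc m / 2"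
        using n b(2)[of p] b(2)[of q] unfolding greaterThanLessThan_iff by linarith+
      then have "dist (f p t) (f q t) < 1 / Suc m" by (rule dist_triangle_half_l)
      then show "dist (f p t) (f q t) \<le> 1 / Suc m" by simp
    qed
    then show "t \<in> (\<Union>n. S m n)" by blast
  qed
  have CD: "\<exists>L. radlim a t L" if "t \<in> C" for t
  proof -
    define g where "g n = f (1 - 1 / Suc (Suc n)) t" for n
    have dn: "\<exists>n0. \<forall>p\<in>{1 - 1 / Suc n0<..<1}. \<forall>q\<in>{1 - 1 / Suc n0<..<1}. dist (f p t) (f q t) \<le> e/2" if "e > 0" for e
    proof -
      obtain m where m: "1 / Suc m < e/2" using nat_approx_posE[of "e/2"] \<open>e > 0\<close> half_gt_zero by blast
      obtain n where "t \<in> S m n" using \<open>t \<in> C\<close> unfolding C_def by blast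
      then have "\<forall>p\<in>{1 - 1 / Suc n<..<1}. \<forall>q\<in>{1 - 1 / Suc n<..<1}. dist (f p t) (f q t) \<le> 1 / Suc m"
        unfolding S_def by blast
      then have "\<forall>p\<in>{1 - 1 / Suc n<..<1}. \<forall>q\<in>{1 - 1 / Suc n<..<1}. dist (f p t) (f q t) \<le> e/2"
        using less_imp_le[OF m] order.trans by blast
      then show ?thesis by blast
    qed
    have gn: "1 - 1 / Suc (Suc n) \<in> {1 - 1 / Suc n0<..<1}" if "n \<ge> n0" for n n0 :: nat
      using that by (auto simp: field_simps)
    have "Cauchy g"
    proof (rule metric_CauchyI)
      fix e :: real assume e: "e > 0"
      obtain n0 where n0: "\<forall>p\<in>{1 - 1 / Suc n0<..<1}. \<forall>q\<in>{1 - 1 / Suc n0<..<1}. dist (f p t) (f q t) \<le> e/2"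
        using dn[OF e] by blast
      have "dist (g m) (g n) \<le> e/2" if "m \<ge> n0" "n \<ge> n0" for m n
        unfolding g_def using n0 gn[OF that(1)] gn[OF that(2)] by blast
      moreover have "e/2 < e" using e by simp
      ultimately show "\<exists>M. \<forall>m\<ge>M. \<forall>n\<ge>M. dist (g m) (g n) < e"
        using le_less_trans by blast
    qed
    then obtain L where L: "g \<longlonglongrightarrow> L" by (auto simp: Cauchy_convergent_iff convergent_def)
    have "radlim a t L" unfolding radlim_def f_def[symmetric]
    proof (rule tendstoI)
      fix e :: real assume e: "e > 0"
      obtain n0 where n0: "\<forall>p\<in>{1 - 1 / Suc n0<..<1}. \<forall>q\<in>{1 - 1 / Suc n0<..<1}. dist (f p t) (f q t) \<le> e/2"
        using dn[OF e] by blast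
      have *: "dist (f r t) L \<le> e/2" if "r \<in> {1 - 1 / Suc n0<..<1}" for r
      proof (rule tendsto_upperbound)
        show "(\<lambda>n. dist (f r t) (g n)) \<longlonglongrightarrow> dist (f r t) L" by (intro tendsto_intros L)
        show "\<forall>\<^sub>F n in sequentially. dist (f r t) (g n) \<le> e/2"
          using eventually_ge_at_top[of n0] by eventually_elim (use n0 that gn g_def in auto)
      qed auto
      have "\<forall>\<^sub>F r in at_left 1. r \<in> {1 - 1 / Suc n0<..<1}"
        by (rule eventually_at_leftI[of "1 - 1 / Suc n0"]) auto
      then show "\<forall>\<^sub>F r in at_left 1. dist (f r t) L < e"
      proof eventually_elim
        case (elim r)
        then have "dist (f r t) L \<le> e/2" by (rule *)
        then show ?case using e by linarith
      qed
    qed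
    then show ?thesis ..
  qed
  \<comment> \<open>\<open>(THE x. False)\<close> is the value \<open>Lim\<close> takes where no
    limit exists, so \<open>l\<close> agrees with \<open>bv a\<close> everywhere and not just almost
    everywhere.\<close>
  define l where "l t = (if t \<in> C then lim (\<lambda>n. f (1 - 1 / Suc n) t) else (THE x. False))" for t
  have [measurable]: "f (1 - 1 / Suc n) \<in> borel_measurable borel" for n
    unfolding f_def by (rule ev_circle_measurable[OF a]) auto
  have "l \<in> borel_measurable borel" unfolding l_def by measurable
  moreover have "bv a t = l t" for t
  proof (cases "t \<in> C")
    case True
    then obtain L where L: "radlim a t L" using CD by blast
    then show ?thesis using limI[OF radlim_seq[OF L]] True radlim_bv[OF L] by (simp add: l_def f_def)
  next
    case False
    then have "((\<lambda>r::real. evc a r t) \<longlongrightarrow> L) (at_left 1) = False" for L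
      using CI unfolding radlim_def by blast
    then show ?thesis using False by (simp add: bv_def Topological_Spaces.Lim_def l_def)
  qed
  ultimately show ?thesis by (simp cong: measurable_cong)
qed

section \<open>The Poisson kernel and radial limits\<close>

definition pk :: "real \<Rightarrow> real \<Rightarrow> real" where
  "pk r y = (1 - r\<^sup>2) / (1 - 2 * r * cos y + r\<^sup>2)"

lemma pk_denom: "1 - 2 * r * cos y + r\<^sup>2 = (cmod (1 - of_real r * cis y))\<^sup>2"
proof -
  have "(cmod (1 - of_real r * cis y))\<^sup>2 = (1 - r * cos y)\<^sup>2 + (r * sin y)\<^sup>2"
    by (simp add: cmod_power2)
  also have "\<dots> = 1 - 2 * r * cos y + r\<^sup>2 * ((cos y)\<^sup>2 + (sin y)\<^sup>2)"
    by (simp only: power2_eq_square algebra_simps)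
  finally show ?thesis by simp
qed

lemma pk_denom_ge:
  fixes r :: real
  assumes "0 \<le> r" "r < 1"
  shows "(1 - r)\<^sup>2 \<le> 1 - 2 * r * cos y + r\<^sup>2"
proof -
  have "1 - r \<le> cmod (1 - of_real r * cis y)"
    using norm_triangle_ineq2[of 1 "of_real r * cis y"] assms by (simp add: norm_mult)
  then show ?thesis unfolding pk_denom using assms by (intro power_mono) auto
qed

lemma pk_nonneg: "0 \<le> r \<Longrightarrow> r < 1 \<Longrightarrow> 0 \<le> pk r y"
  using pk_denom_ge[of r y] unfolding pk_def
  by (intro divide_nonneg_nonneg) (auto simp: power_le_one intro: order.trans[OF zero_le_power2])

lemma pk_le:
  assumes "0 \<le> r" "r < 1"
  shows "pk r y \<le> 2 / (1 - r)"
proof -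
  have "pk r y \<le> (1 - r\<^sup>2) / (1 - r)\<^sup>2"
    unfolding pk_def using pk_denom_ge[OF assms, of y] assms
    by (intro divide_left_mono) (auto simp: power_le_one intro!: mult_pos_pos intro: less_le_trans[of 0 "(1-r)\<^sup>2"])
  also have "\<dots> = (1 + r) / (1 - r)"
    using assms by (simp add: divide_simps power2_eq_square) (simp add: algebra_simps)
  also have "\<dots> \<le> 2 / (1 - r)" using assms by (intro divide_right_mono) auto
  finally show ?thesis .
qed

lemma pk_periodic: "pk r (y + 2*pi) = pk r y" "pk r (- y) = pk r y"
  by (simp_all add: pk_def)

lemma pk_measurable [measurable]: "pk r \<in> borel_measurable borel"
  unfolding pk_def by measurable

text \<open>Writing the Poisson kernel through the Cauchy kernel and its conjugate separates the
  Poisson integral into an analytic and an antianalytic power series.\<close>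

lemma pk_cauchy:
  assumes "0 \<le> r" "r < 1"
  shows "complex_of_real (pk r y) = 1 / (1 - of_real r * cis y) + cnj (1 / (1 - of_real r * cis y)) - 1"
proof -
  define w where "w = 1 - complex_of_real r * cis y"
  have d: "w \<noteq> 0"
  proof
    assume "w = 0"
    then have "cmod (of_real r * cis y) = 1" unfolding w_def by simp
    then show False using assms by (simp add: norm_mult)
  qed
  have "1 / w + cnj (1 / w) - 1 = (w + cnj w - w * cnj w) / (w * cnj w)"
    using d by (simp add: field_simps)
  also have "w * cnj w = of_real ((cmod w)\<^sup>2)" by (rule complex_norm_square[symmetric])
  also have "w + cnj w = of_real (2 * Re w)" by (simp add: complex_add_cnj)
  also have "(of_real (2 * Re w) - of_real ((cmod w)\<^sup>2)) / complex_of_real ((cmod w)\<^sup>2) = of_real ((2 * Re w - (cmod w)\<^sup>2) / (cmod w)\<^sup>2)"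
    by simp
  also have "(2 * Re w - (cmod w)\<^sup>2) / (cmod w)\<^sup>2 = pk r y"
    unfolding w_def pk_denom[symmetric] pk_def by simp
  finally show ?thesis unfolding w_def by simp
qed

lemma analytic_disk_bounded:
  assumes "\<And>n. cmod (a n) \<le> B"
  shows "analytic_disk a"
  unfolding analytic_disk_def
proof (intro allI impI)
  fix r :: real assume r: "0 \<le> r \<and> r < 1"
  then have "summable (\<lambda>n. B * r ^ n)" by (intro summable_mult summable_geometric) auto
  then show "summable (\<lambda>n. cmod (a n) * r ^ n)"
    by (rule summable_comparison_test_ev[rotated]) (use r assms in \<open>auto intro!: mult_right_mono always_eventually\<close>)
qed

lemma analytic_disk_fc: "analytic_disk (\<lambda>n. fc F (int n))" "analytic_disk (\<lambda>n. cnj (fc F (- int n)))"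
  by (rule analytic_disk_bounded[of _ "(LINT t|circ. cmod (F t))"]; simp add: norm_fc_le)+

definition pint :: "(real \<Rightarrow> complex) \<Rightarrow> real \<Rightarrow> real \<Rightarrow> complex" where
  "pint F r t = (LINT s|circ. of_real (pk r (t - s)) * F s)"

lemma integrable_pk:
  fixes F :: "real \<Rightarrow> 'a::{banach, second_countable_topology}"
  assumes "integrable circ F" "0 \<le> r" "r < 1"
  shows "integrable circ (\<lambda>s. pk r (t - s) *\<^sub>R F s)"
proof (rule Bochner_Integration.integrable_bound[of _ "\<lambda>s. (2 / (1 - r)) * norm (F s)"])
  show "AE x in circ. norm (pk r (t - x) *\<^sub>R F x) \<le> norm ((2 / (1 - r)) * norm (F x))"
  proof (rule AE_I2)
    fix x
    have "pk r (t - x) * norm (F x) \<le> (2 / (1 - r)) * norm (F x)"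
      using pk_le[OF assms(2,3)] by (intro mult_right_mono) auto
    then show "norm (pk r (t - x) *\<^sub>R F x) \<le> norm ((2 / (1 - r)) * norm (F x))"
      using pk_nonneg[OF assms(2,3), of "t - x"] assms(2,3) by (simp add: abs_mult)
  qed
  show "(\<lambda>s. pk r (t - s) *\<^sub>R F s) \<in> borel_measurable circ"
    using borel_measurable_integrable[OF assms(1)] by simp
qed (use assms in auto)

lemma pint_eq:
  assumes F: "integrable circ F" and r: "0 \<le> r" "r < 1"
  shows "pint F r t = ev (\<lambda>n. fc F (int n)) (of_real r * cis t) + cnj (ev (\<lambda>n. cnj (fc F (- int n))) (of_real r * cis t)) - fc F 0"
proof -
  \<comment> \<open>The Taylor coefficients of the Cauchy kernel with pole at the boundary point
    \<open>cis t\<close>, so that \<open>integral_ev\<close> sums both halves of the kernel.\<close>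
  define b where "b k = cis (- (real k * t))" for k :: nat
  have b: "analytic_disk b" by (rule analytic_disk_bounded[of _ 1]) (simp add: b_def)
  have evb: "evc b r s = 1 / (1 - of_real r * cis (s - t))" for s
  proof -
    have "b k * (of_real r * cis s) ^ k = (of_real r * cis (s - t)) ^ k" for k
      by (simp add: b_def power_mult_distrib Complex.DeMoivre cis_mult algebra_simps)
    then have "(\<lambda>k. b k * (of_real r * cis s) ^ k) sums (1 / (1 - of_real r * cis (s - t)))"
      using geometric_sums[of "of_real r * cis (s - t)"] r by (simp add: norm_mult)
    then show ?thesis by (simp add: ev_def sums_iff)
  qed
  define I where "I = (LINT s|circ. F s * evc b r s)"
  define J where "J = (LINT s|circ. F s * cnj (evc b r s))"
  have pw: "(of_real r * cis t) ^ k = of_real r ^ k * cis (real k * t)" for k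
    by (simp add: power_mult_distrib Complex.DeMoivre)
  have n1: "cmod (of_real r * cis t) < 1" using r by (simp add: norm_mult)
  have "(\<lambda>k. fc F (int k) * (of_real r * cis t) ^ k) sums J"
    using integral_cnj_ev[OF F b r] unfolding J_def b_def pw by (simp add: cis_cnj mult_ac)
  then have J: "J = ev (\<lambda>n. fc F (int n)) (of_real r * cis t)"
    using ev_sums[OF analytic_disk_fc(1) n1] sums_unique2 by blast
  have pw': "cnj (of_real r * cis t) ^ k = of_real r ^ k * cis (- (real k * t))" for k
    by (simp add: power_mult_distrib Complex.DeMoivre cis_cnj)
  have "(\<lambda>k. fc F (- int k) * cnj (of_real r * cis t) ^ k) sums I"
    using integral_ev(1)[OF F b r] unfolding I_def b_def pw' by (simp add: mult_ac)
  moreover have "(\<lambda>k. cnj (cnj (fc F (- int k)) * (of_real r * cis t) ^ k)) sums cnj (ev (\<lambda>n. cnj (fc F (- int n))) (of_real r * cis t))"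
    unfolding sums_cnj by (rule ev_sums[OF analytic_disk_fc(2) n1])
  ultimately have I: "I = cnj (ev (\<lambda>n. cnj (fc F (- int n))) (of_real r * cis t))"
    by (simp add: sums_iff)
  have "integrable circ (\<lambda>t. cnj (F t))" using F by simp
  from integral_ev(2)[OF this b r] have "integrable circ (\<lambda>s. cnj (cnj (F s) * evc b r s))"
    by (simp only: integrable_cnj)
  then have int: "integrable circ (\<lambda>s. F s * cnj (evc b r s))" by simp
  have pkb: "of_real (pk r (t - s)) * F s = F s * evc b r s + F s * cnj (evc b r s) - F s" for s
    using arg_cong[OF pk_cauchy[OF r, of "s - t"], of "\<lambda>x. F s * x"] pk_periodic(2)[of r "s - t"] unfolding evb by (simp add: distrib_left right_diff_distrib mult.commute)
  have "pint F r t = I + J - integral\<^sup>L circ F"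
    unfolding pint_def pkb I_def J_def by (simp add: int F integral_ev(2)[OF F b r])
  then show ?thesis by (simp add: I J fc_def)
qed

lemma pint_const:
  assumes r: "0 \<le> r" "r < 1"
  shows "(LINT s|circ. pk r (t - s)) = 1"
proof -
  have 1: "fc (\<lambda>_. 1) n = (if n = 0 then 1 else 0)" for n
    using integral_cis_of_int[of "-n"] by (simp add: fc_def)
  have s: "ev (\<lambda>n. if n = 0 then 1 else 0) z = 1" for z
  proof -
    have eq: "(\<lambda>n. (if n = 0 then 1 else 0) * z ^ n) = (\<lambda>n. if n = 0 then 1 else 0)" by auto
    show ?thesis unfolding ev_def eq using sums_single[of 0 "\<lambda>_. 1::complex"] by (simp add: sums_iff)
  qed
  have "pint (\<lambda>_. 1) r t = 1"
    by (subst pint_eq[OF _ r]) (auto simp: 1 s if_distrib[of cnj] cong: if_cong)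
  then have "(LINT s|circ. complex_of_real (pk r (t - s))) = 1"
    by (simp add: pint_def)
  then show ?thesis by (metis integral_complex_of_real of_real_1 of_real_eq_iff)
qed

lemma pint_analytic:
  assumes F: "integrable circ F" and r: "0 \<le> r" "r < 1"
    and "\<And>n. fc F (int n) = a n" "\<And>n. n < 0 \<Longrightarrow> fc F n = 0"
  shows "pint F r t = evc a r t"
proof -
  have eq: "(\<lambda>n. cnj (fc F (- int n)) * z ^ n) = (\<lambda>n. if n = 0 then cnj (a 0) else 0)" for z
    using assms(4)[of 0] assms(5) by (auto simp: fun_eq_iff)
  have "ev (\<lambda>n. cnj (fc F (- int n))) z = cnj (a 0)" for z
    unfolding ev_def eq using sums_single[of 0 "\<lambda>_. cnj (a 0)"] by (simp add: sums_iff)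
  then show ?thesis using assms(4)[of 0] by (simp add: pint_eq[OF F r] assms(4))
qed

section \<open>Dyadic control of the Poisson kernel\<close>

text \<open>A crude form of Jordan's inequality. The slope 2/5 lies below 1/2, the least value of
  cos on [0, pi/3], and for x up to pi/2 < 2 the line stays below 4/5, hence below sqrt 3 / 2 = sin
  (pi/3).\<close>

lemma sin_ge_linear:
  fixes x :: real assumes "0 \<le> x" "x \<le> pi/2"
  shows "2/5 * x \<le> sin x"
proof (cases "x \<le> pi/3")
  case True
  have "sin 0 - 2/5 * 0 \<le> sin x - 2/5 * x"
  proof (rule DERIV_nonneg_imp_nondecreasing[where f = "\<lambda>x. sin x - 2/5 * x"])
    fix y assume y: "0 \<le> y" "y \<le> x"
    have "cos (pi/3) \<le> cos y" using y True by (intro cos_monotone_0_pi_le) auto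
    then have "0 \<le> cos y - 2/5" by (simp add: cos_60)
    then show "\<exists>d. ((\<lambda>x. sin x - 2/5 * x) has_real_derivative d) (at y) \<and> 0 \<le> d"
      by (intro exI[of _ "cos y - 2/5"]) (auto intro!: derivative_eq_intros)
  qed (use assms in auto)
  then show ?thesis by simp
next
  case False
  have "2/5 * x \<le> 4/5" using assms pi_half_less_two by simp
  also have "4/5 \<le> sqrt 3 / 2" using real_le_rsqrt[of "8/5" 3] by (simp add: power2_eq_square)
  also have "\<dots> = sin (pi/3)" by (simp add: sin_60)
  also have "\<dots> \<le> sin x" using False assms by (intro sin_monotone_2pi_le) auto
  finally show ?thesis .
qed

lemma sin_half_lower:
  fixes y :: real assumes "\<bar>y\<bar> \<le> pi"
  shows "y\<^sup>2 / 25 \<le> (sin (y/2))\<^sup>2"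
proof -
  have "(\<bar>y\<bar>/5)\<^sup>2 \<le> (sin (\<bar>y\<bar>/2))\<^sup>2"
    using sin_ge_linear[of "\<bar>y\<bar>/2"] assms by (intro power_mono) auto
  then show ?thesis by (cases "y \<ge> 0") (auto simp: power_divide)
qed

text \<open>With 1 - r of size 2^-n the kernel has height about 2^n near 0 and decays like (1 -
  r)/y^2, that is 4^k 2^-n where |y| is about 2^-k. The constant 12 is 2 * 6: one factor bounds 1 +
  r, the other comes from the lower bound 4^-k / 6 for the denominator.\<close>

lemma pk_dyadic_bound:
  assumes r: "1/2 \<le> r" "r < 1" and n: "1 - r \<le> (1/2)^n" "(1/2)^Suc n \<le> 1 - r" and y: "\<bar>y\<bar> \<le> pi"
  shows "pk r y \<le> (\<Sum>k\<le>n. 12 * 4^k * (1/2)^n * indicator {-pi*(1/2)^k..pi*(1/2)^k} y)"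
proof -
  have ex: "\<exists>k\<le>n. \<bar>y\<bar> \<le> pi*(1/2)^k \<and> pk r y \<le> 12 * 4^k * (1/2)^n"
  proof (cases "\<bar>y\<bar> \<le> pi*(1/2)^n")
    case True
    have "pk r y \<le> 2 / (1 - r)" using r by (intro pk_le) auto
    also have "\<dots> \<le> 2 / (1/2)^Suc n" using n(2) r by (intro divide_left_mono) auto
    also have "\<dots> = 4 * 2^n" by (simp add: field_simps)
    also have "\<dots> \<le> 12 * 4^n * (1/2)^n" by (simp add: mult.assoc flip: power_mult_distrib)
    finally show ?thesis using True by blast
  next
    case False
    define m where "m = (LEAST m. \<not> \<bar>y\<bar> \<le> pi*(1/2)^m)"
    have m: "\<not> \<bar>y\<bar> \<le> pi*(1/2)^m" "m \<le> n" unfolding m_def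
      using LeastI[of "\<lambda>m. \<not> \<bar>y\<bar> \<le> pi*(1/2)^m", OF False] Least_le[of "\<lambda>m. \<not> \<bar>y\<bar> \<le> pi*(1/2)^m", OF False] by auto
    then have "m \<noteq> 0" using y by (intro notI) auto
    then obtain k where k: "m = Suc k" by (cases m) auto
    have yk: "\<bar>y\<bar> \<le> pi*(1/2)^k" using not_less_Least[of k "\<lambda>m. \<not> \<bar>y\<bar> \<le> pi*(1/2)^m"] k unfolding m_def[symmetric] by auto
    have "3 * (1/2)^Suc k \<le> pi * (1/2)^Suc k" using pi_gt3 by (intro mult_right_mono) auto
    also have "\<dots> \<le> \<bar>y\<bar>" using m k by auto
    finally have "(3 * (1/2)^Suc k)\<^sup>2 \<le> \<bar>y\<bar>\<^sup>2" by (intro power_mono) auto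
    then have y2: "9 / 4 * (1/4)^k \<le> y\<^sup>2" by (simp add: power_mult_distrib power_divide power2_eq_square flip: power_mult_distrib)
    have "1 - 2 * r * cos y + r\<^sup>2 = (1 - r)\<^sup>2 + 4 * r * (sin (y/2))\<^sup>2"
    proof -
      have c: "cos y = 1 - 2 * (sin (y/2))\<^sup>2" using cos_double_sin[of "y/2"] by simp
      show ?thesis unfolding c by (simp add: power2_eq_square algebra_simps)
    qed
    also have "\<dots> \<ge> 4 * (1/2) * (sin (y/2))\<^sup>2" using r by (intro add_increasing mult_mono mult_right_mono) auto
    finally have "(1/4)^k / 6 \<le> 1 - 2 * r * cos y + r\<^sup>2"
      using sin_half_lower[OF y] y2 zero_le_power[of "1/4::real" k] by linarith
    then have "pk r y \<le> (1 - r\<^sup>2) / ((1/4)^k / 6)"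
      unfolding pk_def using r by (intro divide_left_mono) (auto simp: power_le_one intro!: mult_pos_pos intro: less_le_trans[of 0 "(1/4)^k/6"])
    also have "\<dots> = (1 - r) * (1 + r) * (6 * 4^k)" by (simp add: field_simps power2_eq_square)
    also have "\<dots> \<le> (1/2)^n * 2 * (6 * 4^k)" using r n by (intro mult_mono) auto
    finally show ?thesis using yk m k by (intro exI[of _ k]) (auto simp: mult_ac)
  qed
  then obtain k where k: "k \<le> n" "\<bar>y\<bar> \<le> pi*(1/2)^k" "pk r y \<le> 12 * 4^k * (1/2)^n" by blast
  have "pk r y \<le> 12 * 4^k * (1/2)^n * indicator {-pi*(1/2)^k..pi*(1/2)^k} y" using k by (auto simp: indicator_def abs_le_iff)
  also have "\<dots> \<le> (\<Sum>k\<le>n. 12 * 4^k * (1/2)^n * indicator {-pi*(1/2)^k..pi*(1/2)^k} y)"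
    using k(1) by (intro member_le_sum) auto
  finally show ?thesis .
qed

definition davg :: "(real \<Rightarrow> real) \<Rightarrow> real \<Rightarrow> nat \<Rightarrow> real" where
  "davg W t k = (1 / (2 * pi * (1/2)^k)) * (LINT s:{t - pi*(1/2)^k..t + pi*(1/2)^k}|lborel. W s)"

text \<open>An interval of length proportional to 2^-k turns the height 4^k 2^-n into the weight
  2^(k-n) of its average. Weights thus decay geometrically away from the finest scale, and their sum
  is bounded.\<close>

lemma pint_dyadic_bound:
  fixes W :: "real \<Rightarrow> real"
  assumes per: "\<And>s. W (s + 2*pi) = W s" and W: "integrable circ W" and pos: "\<And>s. W s \<ge> 0"
    and r: "1/2 \<le> r" "r < 1" and n: "1 - r \<le> (1/2)^n" "(1/2)^Suc n \<le> 1 - r"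
  shows "(LINT s|circ. pk r (t - s) * W s) \<le> 12 * (\<Sum>k\<le>n. (1/2)^(n-k) * davg W t k)"
proof -
  have Wm [measurable]: "W \<in> borel_measurable borel" using borel_measurable_integrable[OF W] by simp
  \<comment> \<open>The rotation puts t at the midpoint pi of [0, 2*pi], so all dyadic intervals
    around it lie in the range of integration without wrapping.\<close>
  define V where "V s = W (s + (t - pi))" for s
  have V: "integrable circ V" unfolding V_def using integrable_circ_shift[OF per Wm] W by simp
  have Vm [measurable]: "V \<in> borel_measurable borel" unfolding V_def by measurable
  define I where "I k = {-pi*(1/2)^k..pi*(1/2)^k}" for k :: nat
  have "(LINT s|circ. pk r (t - s) * W s) = (LINT s|circ. pk r (t - (s + (t - pi))) * W (s + (t - pi)))"
    using pk_periodic(1)[of r]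
    by (intro integral_circ_shift[symmetric]) (auto simp: per pk_def cos_diff)
  also have "\<dots> = (LINT s|circ. pk r (pi - s) * V s)" by (simp add: V_def)
  also have "\<dots> \<le> integral\<^sup>L circ (\<lambda>s. \<Sum>k\<le>n. 12 * 4^k * (1/2)^n * (indicator (I k) (pi - s) * V s))"
  proof (rule integral_mono_AE)
    show "integrable circ (\<lambda>s. pk r (pi - s) * V s)" using integrable_pk[OF V, of r pi] r by simp
    have "integrable circ (\<lambda>s. indicator (I k) (pi - s) * V s)" for k
      by (rule Bochner_Integration.integrable_bound[OF V]) (auto simp: indicator_def I_def)
    then show "integrable circ (\<lambda>s. \<Sum>k\<le>n. 12 * 4^k * (1/2)^n * (indicator (I k) (pi - s) * V s))"
      by (intro Bochner_Integration.integrable_sum integrable_mult_right)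
    show "AE s in circ. pk r (pi - s) * V s \<le> (\<Sum>k\<le>n. 12 * 4^k * (1/2)^n * (indicator (I k) (pi - s) * V s))"
      unfolding AE_circ
    proof (intro AE_I2 impI)
      fix s :: real assume s: "s \<in> {0..2*pi}"
      have "pk r (pi - s) * V s \<le> (\<Sum>k\<le>n. 12 * 4^k * (1/2)^n * indicator (I k) (pi - s)) * V s"
        unfolding I_def by (intro mult_right_mono pk_dyadic_bound r n) (use s pos V_def in auto)
      then show "pk r (pi - s) * V s \<le> (\<Sum>k\<le>n. 12 * 4^k * (1/2)^n * (indicator (I k) (pi - s) * V s))"
        by (simp add: sum_distrib_right mult.assoc)
    qed
  qed
  also have "\<dots> = (\<Sum>k\<le>n. 12 * 4^k * (1/2)^n * (LINT s|circ. indicator (I k) (pi - s) * V s))"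
  proof -
    have "integrable circ (\<lambda>s. indicator (I k) (pi - s) * V s)" for k
      by (rule Bochner_Integration.integrable_bound[OF V]) (auto simp: indicator_def I_def)
    then show ?thesis by (subst Bochner_Integration.integral_sum) (auto intro!: integrable_mult_right)
  qed
  also have "\<dots> = (\<Sum>k\<le>n. 12 * 4^k * (1/2)^n * ((1/2)^k * davg W t k))"
  proof (intro sum.cong refl arg_cong[where f = "\<lambda>x. _ * x"])
    fix k
    have "(1/2::real)^k \<le> 1" by (intro power_le_one) auto
    then have le: "pi * (1/2)^k \<le> pi" by simp
    have "(LINT s|circ. indicator (I k) (pi - s) * V s) = (1/(2*pi)) * (LINT s|lborel. indicator {0..2*pi} s * (indicator (I k) (pi - s) * V s))"
      by (subst integral_circ) (auto simp: set_lebesgue_integral_def I_def)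
    also have "(LINT s|lborel. indicator {0..2*pi} s * (indicator (I k) (pi - s) * V s)) =
      (LINT s|lborel. indicator {t - pi*(1/2)^k..t + pi*(1/2)^k} ((t - pi) + 1 * s) * W ((t - pi) + 1 * s))"

    proof (intro Bochner_Integration.integral_cong refl)
      fix s
      have "s \<in> {0..2*pi} \<and> pi - s \<in> I k \<longleftrightarrow> (t - pi) + 1 * s \<in> {t - pi*(1/2)^k..t + pi*(1/2)^k}"
        unfolding I_def atLeastAtMost_iff using le by (intro iffI conjI) linarith+
      then show "indicator {0..2*pi} s * (indicator (I k) (pi - s) * V s) =
        indicator {t - pi*(1/2)^k..t + pi*(1/2)^k} ((t - pi) + 1 * s) * W ((t - pi) + 1 * s)"
        by (auto simp: indicator_def V_def add.commute)
    qed
    also have "\<dots> = (LINT s|lborel. indicator {t - pi*(1/2)^k..t + pi*(1/2)^k} s * W s)"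
      using lborel_integral_real_affine[of 1 "\<lambda>s. indicator {t - pi*(1/2)^k..t + pi*(1/2)^k} s * W s" "t - pi"] by simp
    finally show "(LINT s|circ. indicator (I k) (pi - s) * V s) = (1/2)^k * davg W t k" by (simp add: davg_def set_lebesgue_integral_def field_simps)
  qed
  also have "\<dots> = 12 * (\<Sum>k\<le>n. (1/2)^(n-k) * davg W t k)"
    unfolding sum_distrib_left
  proof (intro sum.cong refl)
    fix k assume k: "k \<in> {..n}"
    have "(4::real)^k * (1/2)^n * (1/2)^k = (1/2)^(n-k)"
    proof -
      have "(1/2::real)^n = (1/2)^(n-k) * (1/2)^k" using k by (simp flip: power_add)
      moreover have "(4::real)^k * ((1/2)^k * (1/2)^k) = 1" by (simp flip: power_mult_distrib)
      ultimately show ?thesis by (simp add: mult_ac)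
    qed
    then show "12 * 4^k * (1/2)^n * ((1/2)^k * davg W t k) = 12 * ((1/2)^(n-k) * davg W t k)" by (metis mult.assoc)
  qed
  finally show ?thesis .
qed

lemma ex_dyadic:
  fixes d :: real assumes "0 < d" "d \<le> 1"
  obtains n where "d \<le> (1/2)^n" "(1/2)^Suc n \<le> d"
proof -
  obtain m where m: "(1/2)^m < d" using real_arch_pow_inv[of d "1/2"] assms by auto
  define m where "m = (LEAST m. (1/2::real)^m < d)"
  have 1: "(1/2::real)^m < d" unfolding m_def by (rule LeastI) (rule m)
  then have "m \<noteq> 0" using assms by (intro notI) auto
  then obtain k where k: "m = Suc k" by (cases m) auto
  then have "\<not> (1/2::real)^k < d" unfolding m_def by (metis lessI not_less_Least)
  then show ?thesis using that[of k] 1 k by auto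
qed

lemma integrable_on_periodic:
  fixes F :: "real \<Rightarrow> 'a::euclidean_space"
  assumes per: "\<And>s. F (s + 2*pi) = F s" and F: "integrable circ F"
  shows "set_integrable lborel {a..b} F"
proof -
  have Fm [measurable]: "F \<in> borel_measurable borel" using borel_measurable_integrable[OF F] by simp
  have 1: "set_integrable lborel {c..c+2*pi} F" for c
  proof -
    have "integrable circ (\<lambda>s. F (s + c))" using integrable_circ_shift[OF per Fm] F by simp
    then have "set_integrable lborel {0..2*pi} (\<lambda>s. F (s + c))" by (subst (asm) integrable_circ) auto
    then have "integrable lborel (\<lambda>s. indicator {c..c+2*pi} (c + 1 * s) *\<^sub>R F (c + 1 * s))"
      unfolding set_integrable_def by (rule Bochner_Integration.integrable_cong[THEN iffD1, rotated 2]) (auto simp: indicator_def add.commute)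
    then show ?thesis unfolding set_integrable_def
      using lborel_integrable_real_affine_iff[of 1 "\<lambda>s. indicator {c..c+2*pi} s *\<^sub>R F s" c] by simp
  qed
  have 2: "set_integrable lborel {a..a + 2*pi*real n} F" for n
  proof (induction n)
    case 0
    show ?case by (rule set_integrable_subset[OF 1[of a]]) (auto simp: )
  next
    case (Suc n)
    have "set_integrable lborel ({a..a + 2*pi*real n} \<union> {a + 2*pi*real n..a + 2*pi*real n + 2*pi}) F"
      by (intro set_integrable_Un Suc 1) auto
    then show ?case by (rule set_integrable_subset) (auto simp: algebra_simps)
  qed
  obtain n where "(b - a) / (2*pi) < real n" using reals_Archimedean2 by blast
  then have "b \<le> a + 2*pi*real n" by (simp add: field_simps)
  then show ?thesis by (intro set_integrable_subset[OF 2[of n]]) auto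
qed

section \<open>Lebesgue points and Fatou's theorem on radial limits\<close>

text \<open>One-sided differentiation of the indefinite integral, applied to W and to its
  reflection, controls the two halves of the symmetric interval separately.\<close>

lemma davg_tendsto:
  fixes W :: "real \<Rightarrow> real"
  assumes per: "\<And>s. W (s + 2*pi) = W s" and W: "integrable circ W"
  shows "AE t in lborel. (\<lambda>k. davg W t k) \<longlonglongrightarrow> W t"
proof -
  have intW: "W integrable_on cbox a b" "(LINT s:{a..b}|lborel. W s) = integral {a..b} W" for a b
    using set_borel_integral_eq_integral[OF integrable_on_periodic[OF per W, of a b]] by auto
  define V where "V s = W (-s)" for s
  have intV: "V integrable_on cbox a b" for a b
    using integrable_reflect[of W "-a" "-b"] intW(1)[of "-b" "-a"] by (simp add: V_def[abs_def])
  obtain N where N: "negligible N" "\<And>x e. \<lbrakk>x \<notin> N; 0 < e\<rbrakk> \<Longrightarrow> \<exists>d>0. \<forall>h. 0 < h \<and> h < d \<longrightarrow>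
       norm(integral (cbox x (x + h *\<^sub>R One)) W /\<^sub>R h ^ DIM(real) - W x) < e"
    using integrable_ccontinuous_explicit[OF intW(1)] by metis
  obtain M where M: "negligible M" "\<And>x e. \<lbrakk>x \<notin> M; 0 < e\<rbrakk> \<Longrightarrow> \<exists>d>0. \<forall>h. 0 < h \<and> h < d \<longrightarrow>
       norm(integral (cbox x (x + h *\<^sub>R One)) V /\<^sub>R h ^ DIM(real) - V x) < e"
    using integrable_ccontinuous_explicit[OF intV] by metis
  have *: "(\<lambda>k. davg W t k) \<longlonglongrightarrow> W t" if t: "t \<notin> N" "-t \<notin> M" for t
  proof (rule LIMSEQ_I)
    fix e :: real assume e: "e > 0"
    obtain d where d: "d > 0" "\<And>h. 0 < h \<Longrightarrow> h < d \<Longrightarrow> \<bar>integral {t..t+h} W / h - W t\<bar> < e"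
      using N(2)[OF t(1) e] by (auto simp: divide_inverse_commute)
    obtain d' where d': "d' > 0" "\<And>h. 0 < h \<Longrightarrow> h < d' \<Longrightarrow> \<bar>integral {-t..-t+h} V / h - W t\<bar> < e"
      using M(2)[OF t(2) e] by (auto simp: divide_inverse_commute V_def)
    have V': "integral {-t..-t+h} V = integral {t-h..t} W" for h
      using Henstock_Kurzweil_Integration.integral_reflect_real[of t "t - h" W] by (simp add: V_def[abs_def])
    have lim: "(\<lambda>k. pi * (1/2)^k) \<longlonglongrightarrow> pi * 0" by (intro tendsto_intros LIMSEQ_realpow_zero) auto
    have "\<forall>\<^sub>F k in sequentially. pi * (1/2)^k < min d d'"
      using d(1) d'(1) lim by (intro order_tendstoD(2)[of _ "pi * 0"]) auto
    then show "\<exists>no. \<forall>k\<ge>no. norm (davg W t k - W t) < e"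
      unfolding eventually_sequentially[symmetric]
    proof eventually_elim
      case (elim k)
      define h where "h = pi * (1/2)^k"
      have h: "h > 0" "h < d" "h < d'" using elim by (auto simp: h_def)
      have "integral {t-h..t+h} W = integral {t-h..t} W + integral {t..t+h} W"
        using h intW(1)[of "t-h" "t+h"] by (intro Henstock_Kurzweil_Integration.integral_combine[symmetric]) auto
      then have "davg W t k = (integral {t-h..t} W / h + integral {t..t+h} W / h) / 2"
        unfolding davg_def intW(2) h_def[symmetric] using h by (simp add: field_simps h_def)
      moreover have "\<bar>integral {t..t+h} W / h - W t\<bar> < e" using d(2) h by simp
      moreover have "\<bar>integral {t-h..t} W / h - W t\<bar> < e" using d'(2)[of h] h V' by simp
      ultimately show ?case by (simp add: abs_if field_simps split: if_splits)
    qed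
  qed
  have "AE t in lborel. t \<notin> N \<and> -t \<notin> M"
  proof -
    have "negligible (uminus ` M)"
      using M(1) by (intro negligible_differentiable_image_negligible) (auto intro!: derivative_intros simp: differentiable_on_minus)
    then have "N \<union> uminus ` M \<in> null_sets lebesgue" using N(1) by (simp add: negligible_iff_null_sets[symmetric])
    then have "AE t in lebesgue. t \<notin> N \<union> uminus ` M" by (rule AE_not_in)
    then have "AE t in lborel. t \<notin> N \<union> uminus ` M" by (simp add: AE_completion_iff)
    then show ?thesis by eventually_elim (auto simp: image_iff)
  qed
  then show ?thesis by eventually_elim (use * in blast)
qed

lemma davg_mono:
  assumes "set_integrable lborel {t - pi..t+pi} V" "set_integrable lborel {t - pi..t+pi} W" "\<And>s. V s \<le> W s"
  shows "davg V t k \<le> davg W t k"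
proof -
  have "(1/2::real)^k \<le> 1" by (intro power_le_one) auto
  then have sub: "{t - pi*(1/2)^k..t + pi*(1/2)^k} \<subseteq> {t - pi..t+pi}" by auto
  show ?thesis unfolding davg_def
    by (intro mult_left_mono set_integral_mono set_integrable_subset[OF assms(1) _ sub] set_integrable_subset[OF assms(2) _ sub]) (use assms in auto)
qed

lemma davg_add_const:
  assumes "set_integrable lborel {t - pi..t+pi} W"
  shows "davg (\<lambda>s. W s + c) t k = davg W t k + c"
proof -
  have "(1/2::real)^k \<le> 1" by (intro power_le_one) auto
  then have sub: "{t - pi*(1/2)^k..t + pi*(1/2)^k} \<subseteq> {t - pi..t+pi}" by auto
  have "(LINT s:{t - pi*(1/2)^k..t + pi*(1/2)^k}|lborel. W s + c) = (LINT s:{t - pi*(1/2)^k..t + pi*(1/2)^k}|lborel. W s) + 2 * pi*(1/2)^k * c"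
  proof (subst set_integral_add)
    show "set_integrable lborel {t - pi*(1/2)^k..t + pi*(1/2)^k} W" by (rule set_integrable_subset[OF assms _ sub]) auto
    show "set_integrable lborel {t - pi*(1/2)^k..t + pi*(1/2)^k} (\<lambda>_. c)" by (simp add: set_integrable_def)
  qed (simp add: set_lebesgue_integral_def)
  then show ?thesis unfolding davg_def by (simp add: field_simps)
qed

text \<open>Almost every point is a Lebesgue point: apply differentiation to \<open>|F - q|\<close> for \<open>q\<close> in a countable dense set.\<close>
lemma lebesgue_points:
  fixes F :: "real \<Rightarrow> complex"
  assumes per: "\<And>s. F (s + 2*pi) = F s" and F: "integrable circ F"
  shows "AE t in lborel. (\<lambda>k. davg (\<lambda>s. cmod (F s - F t)) t k) \<longlonglongrightarrow> 0"
proof -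
  obtain D :: "complex set" where D: "countable D" "\<And>X. open X \<Longrightarrow> X \<noteq> {} \<Longrightarrow> \<exists>d\<in>D. d \<in> X"
    by (rule countable_dense_setE) auto
  have int: "integrable circ (\<lambda>s. cmod (F s - q))" for q using F by auto
  have "AE t in lborel. \<forall>q\<in>D. (\<lambda>k. davg (\<lambda>s. cmod (F s - q)) t k) \<longlonglongrightarrow> cmod (F t - q)"
    by (subst AE_ball_countable[OF D(1)]) (intro ballI davg_tendsto int; simp add: per)
  then show ?thesis
  proof eventually_elim
    case (elim t)
    show ?case
    proof (rule LIMSEQ_I)
      fix e :: real assume e: "e > 0"
      obtain q where q: "q \<in> D" "cmod (F t - q) < e/3" using D(2)[of "ball (F t) (e/3)"] e by (auto simp: dist_norm)
      have si: "set_integrable lborel {t - pi..t+pi} (\<lambda>s. cmod (F s - q))" for q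
        by (rule integrable_on_periodic) (auto simp: per int)
      have "davg (\<lambda>s. cmod (F s - F t)) t k \<le> davg (\<lambda>s. cmod (F s - q) + cmod (F t - q)) t k" for k
      proof (rule davg_mono)
        show "cmod (F s - F t) \<le> cmod (F s - q) + cmod (F t - q)" for s
          using norm_triangle_ineq4[of "F s - q" "F t - q"] by simp
        show "set_integrable lborel {t - pi..t+pi} (\<lambda>s. cmod (F s - q) + cmod (F t - q))"
          by (rule integrable_on_periodic) (auto simp: per F)
      qed (rule si)
      then have up: "davg (\<lambda>s. cmod (F s - F t)) t k \<le> davg (\<lambda>s. cmod (F s - q)) t k + cmod (F t - q)" for k
        using davg_add_const[OF si] by simp
      have lo: "0 \<le> davg (\<lambda>s. cmod (F s - F t)) t k" for k
        unfolding davg_def set_lebesgue_integral_def by (intro mult_nonneg_nonneg integral_nonneg_AE) auto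
      have "\<forall>\<^sub>F k in sequentially. davg (\<lambda>s. cmod (F s - q)) t k < e/3"
        using elim q by (intro order_tendstoD(2)) auto
      then show "\<exists>no. \<forall>k\<ge>no. norm (davg (\<lambda>s. cmod (F s - F t)) t k - 0) < e"
        unfolding eventually_sequentially[symmetric]
      proof eventually_elim
        case (elim k)
        then show ?case using up[of k] lo[of k] q(2) e by simp
      qed
    qed
  qed
qed

text \<open>At a Lebesgue point the averages \<open>A k\<close> are small from some K on, and the
  weights 2^(k-n) sum to at most 2. The finitely many coarse scales together contribute at most 2^-n
  \<open>B\<close>, which vanishes as r tends to 1.\<close>

lemma fatou_point:
  fixes F :: "real \<Rightarrow> complex"
  assumes per: "\<And>s. F (s + 2*pi) = F s" and F: "integrable circ F"
    and t: "(\<lambda>k. davg (\<lambda>s. cmod (F s - F t)) t k) \<longlonglongrightarrow> 0"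
  shows "((\<lambda>r. pint F r t) \<longlongrightarrow> F t) (at_left 1)"
proof (rule tendstoI)
  fix e :: real assume e: "e > 0"
  define A where "A k = davg (\<lambda>s. cmod (F s - F t)) t k" for k
  have A0: "0 \<le> A k" for k
    unfolding A_def davg_def set_lebesgue_integral_def by (intro mult_nonneg_nonneg integral_nonneg_AE) auto
  \<comment> \<open>48 = 12 * 4: 12 is the kernel constant, and the bracket it multiplies stays
    below 4 e', with 2 e' from the fine scales and the rest from the vanishing coarse block.\<close>
  define e' where "e' = e / 48"
  have e': "e' > 0" using e by (simp add: e'_def)
  obtain K where K: "\<And>k. k \<ge> K \<Longrightarrow> A k < e'"
    using order_tendstoD(2)[OF t e'] by (auto simp: A_def eventually_sequentially)
  define B where "B = (\<Sum>k<K. 2^k * A k)"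
  have geo: "(\<Sum>k\<le>n. (1/2::real)^(n-k)) \<le> 2" for n
  proof -
    have "(\<Sum>k\<le>n. (1/2::real)^(n-k)) = (\<Sum>k\<le>n. (1/2::real)^k)"
      by (rule sum.reindex_bij_witness[of _ "\<lambda>k. n - k" "\<lambda>k. n - k"]) auto
    also have "\<dots> = 2 - (1/2)^n" by (induction n) auto
    finally show ?thesis by simp
  qed
  have bound: "(\<Sum>k\<le>n. (1/2)^(n-k) * A k) \<le> (1/2)^n * B + 2 * e'" for n
  proof -
    have "(\<Sum>k\<le>n. (1/2)^(n-k) * A k) \<le> (\<Sum>k\<le>n. (if k < K then (1/2)^(n-k) * A k else 0) + (1/2)^(n-k) * e')"
      using K e' by (intro sum_mono) (auto intro!: mult_left_mono less_imp_le)
    also have "\<dots> = (\<Sum>k\<le>n. if k < K then (1/2)^(n-k) * A k else 0) + (\<Sum>k\<le>n. (1/2)^(n-k)) * e'"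
      by (simp add: sum.distrib sum_distrib_right)
    also have "(\<Sum>k\<le>n. if k < K then (1/2)^(n-k) * A k else 0) = (\<Sum>k\<in>{..n} \<inter> {..<K}. (1/2)^(n-k) * A k)"
      by (simp add: sum.inter_restrict)
    also have "\<dots> = (\<Sum>k\<in>{..n} \<inter> {..<K}. (1/2)^n * (2^k * A k))"
    proof (intro sum.cong refl)
      fix k assume "k \<in> {..n} \<inter> {..<K}"
      then have "(1/2::real)^n = (1/2)^(n-k) * (1/2)^k" by (simp flip: power_add)
      then show "(1/2)^(n-k) * A k = (1/2)^n * (2^k * A k)" by (simp add: power_one_over)
    qed
    also have "\<dots> \<le> (\<Sum>k<K. (1/2)^n * (2^k * A k))"
      using A0 by (intro sum_mono2) auto
    also have "\<dots> = (1/2)^n * B" by (simp add: B_def sum_distrib_left)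
    also have "(\<Sum>k\<le>n. (1/2)^(n-k)) * e' \<le> 2 * e'" using geo e' by (intro mult_right_mono) auto
    finally show ?thesis by simp
  qed
  have "(\<lambda>r. (2 * (1 - r)) * B + 2 * e') \<midarrow>1\<rightarrow> (2 * (1 - 1)) * B + 2 * e'" by (intro tendsto_intros)
  then have "((\<lambda>r. (2 * (1 - r)) * B + 2 * e') \<longlongrightarrow> 2 * e') (at_left 1)"
    by (auto intro: filterlim_mono[OF _ order_refl at_le])
  then have "\<forall>\<^sub>F r in at_left 1. (2 * (1 - r)) * B + 2 * e' < 4 * e'" using e' by (intro order_tendstoD(2)) auto
  moreover have "\<forall>\<^sub>F r in at_left 1. r \<in> {1/2::real<..<1}" by (rule eventually_at_leftI[of "1/2"]) auto
  ultimately show "\<forall>\<^sub>F r in at_left 1. dist (pint F r t) (F t) < e"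
  proof eventually_elim
    case (elim r)
    then have r: "0 \<le> r" "1/2 \<le> r" "r < 1" by auto
    obtain n where n: "1 - r \<le> (1/2)^n" "(1/2)^Suc n \<le> 1 - r" using ex_dyadic[of "1-r"] r by auto
    have i1: "integrable circ (\<lambda>s. of_real (pk r (t - s)) * F s)"
      using integrable_pk[OF F r(1,3)] by (simp add: scaleR_conv_of_real)
    have i2: "integrable circ (\<lambda>s. of_real (pk r (t - s)) * F t)"
      using integrable_pk[of "\<lambda>_. F t", OF _ r(1,3)] by (simp add: scaleR_conv_of_real)
    have "F t = (LINT s|circ. of_real (pk r (t - s)) * F t)"
      using pint_const[OF r(1,3), of t] by (simp add: integral_complex_of_real)
    then have "pint F r t - F t = (LINT s|circ. of_real (pk r (t - s)) * (F s - F t))"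
      unfolding pint_def using i1 i2 by (simp add: right_diff_distrib)
    then have "cmod (pint F r t - F t) \<le> (LINT s|circ. cmod (of_real (pk r (t - s)) * (F s - F t)))"
      by (metis integral_norm_bound)
    also have "\<dots> = (LINT s|circ. pk r (t - s) * cmod (F s - F t))"
      using pk_nonneg[OF r(1,3)] by (simp add: norm_mult)
    also have "\<dots> \<le> 12 * (\<Sum>k\<le>n. (1/2)^(n-k) * A k)"
      unfolding A_def using F by (intro pint_dyadic_bound r n) (auto simp: per)
    also have "\<dots> \<le> 12 * ((1/2)^n * B + 2 * e')" by (intro mult_left_mono bound) auto
    also have "\<dots> \<le> 12 * ((2 * (1 - r)) * B + 2 * e')"
      using n A0 by (intro mult_left_mono add_mono mult_right_mono) (auto simp: B_def intro!: sum_nonneg)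
    also have "\<dots> < 12 * (4 * e')" using elim(1) by (intro mult_strict_left_mono) auto
    also have "\<dots> = e" by (simp add: e'_def)
    finally show ?case by (simp add: dist_norm)
  qed
qed

lemma fatou_radial:
  fixes F :: "real \<Rightarrow> complex"
  assumes per: "\<And>s. F (s + 2*pi) = F s" and F: "integrable circ F"
  shows "AE t in lborel. ((\<lambda>r. pint F r t) \<longlongrightarrow> F t) (at_left 1)"
  using lebesgue_points[OF assms] by eventually_elim (rule fatou_point[OF assms])

section \<open>Boundary values in the Hardy space \<open>H\<^sup>2\<close>\<close>

lemma L1_analytic_boundary:
  assumes F: "integrable circ F" and neg: "\<And>n. n < 0 \<Longrightarrow> fc F n = 0" and a: "\<And>n. fc F (int n) = a n"
  shows "analytic_disk a" "AE t in circ. radlim a t (F t)"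
    "\<And>r t. 0 \<le> r \<Longrightarrow> r < 1 \<Longrightarrow> evc a r t = pint F r t"
proof -
  have aeq: "a = (\<lambda>n. fc F (int n))" using a by auto
  show "analytic_disk a" unfolding aeq by (rule analytic_disk_fc)
  show ev: "evc a r t = pint F r t" if "0 \<le> r" "r < 1" for r t
    using pint_analytic[OF F that a neg] by simp
  \<comment> \<open>F is only known on one period, while Fatou's theorem looks at neighbourhoods of
    every point; the periodic version agrees with F almost everywhere there.\<close>
  define G where "G t = F (wrap t)" for t
  have Fm [measurable]: "F \<in> borel_measurable borel" using borel_measurable_integrable[OF F] by simp
  have Gm [measurable]: "G \<in> borel_measurable borel" unfolding G_def by measurable
  have per: "G (t + 2*pi) = G t" for t by (simp add: G_def wrap_periodic)
  have GF: "AE t in circ. G t = F t"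
  proof -
    have "AE t in lborel. t \<noteq> 2*pi" by (rule AE_lborel_singleton)
    then show ?thesis unfolding AE_circ
    proof eventually_elim
      case (elim t)
      show ?case
      proof
        assume "t \<in> {0..2*pi}"
        then have "0 \<le> t / (2*pi)" "t / (2*pi) < 1" using elim by auto
        then have "\<lfloor>t / (2*pi)\<rfloor> = 0" by (simp add: floor_eq_iff)
        then show "G t = F t" by (simp add: G_def wrap_def)
      qed
    qed
  qed
  then have G: "integrable circ G" using F by (subst integrable_cong_AE[of _ _ F]) auto
  have "pint G r t = pint F r t" for r t
    unfolding pint_def by (rule integral_cong_AE) (use GF in auto)
  then have "AE t in lborel. ((\<lambda>r. pint F r t) \<longlongrightarrow> G t) (at_left 1)"
    using fatou_radial[OF per G] by simp
  then have "AE t in circ. ((\<lambda>r. pint F r t) \<longlongrightarrow> G t) (at_left 1)"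
    unfolding AE_circ by eventually_elim auto
  with GF show "AE t in circ. radlim a t (F t)"
  proof eventually_elim
    case (elim t)
    have "\<forall>\<^sub>F r in at_left 1. r \<in> {0<..<1::real}" by (rule eventually_at_leftI[of 0]) auto
    then have "\<forall>\<^sub>F r in at_left 1. pint F r t = evc a r t"
      by eventually_elim (use ev in auto)
    with elim(2) show ?case unfolding radlim_def elim(1)[symmetric] by (rule Lim_transform_eventually)
  qed
qed

lemma radlim_bv_AE:
  assumes "AE t in circ. radlim a t (F t)"
  shows "AE t in circ. bv a t = F t" "AE t in circ. radlim a t (bv a t)"
  using assms by (eventually_elim, simp add: radlim_bv)+

section \<open>Completeness and Cauchy--Schwarz on the circle\<close>

text \<open>Geometric L^1 increments make the telescoping series absolutely convergent almost
  everywhere, and the sum of the absolute increments is an integrable majorant for all tails. This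
  one statement gives pointwise and L^1 convergence together.\<close>

lemma L1_fast_cauchy:
  fixes s :: "nat \<Rightarrow> real \<Rightarrow> complex"
  assumes int: "\<And>j. integrable circ (s j)" and le: "\<And>j. (LINT t|circ. cmod (s (Suc j) t - s j t)) \<le> (1/2)^j"
  obtains F where "integrable circ F" "AE t in circ. (\<lambda>j. s j t) \<longlonglongrightarrow> F t"
    "(\<lambda>j. (LINT t|circ. cmod (s j t - F t))) \<longlonglongrightarrow> 0"
proof -
  define u where "u j t = s (Suc j) t - s j t" for j t
  have iu: "integrable circ (u j)" for j unfolding u_def using int by auto
  have sm: "summable (\<lambda>j. (LINT t|circ. cmod (u j t)))"
    by (rule summable_comparison_test'[of "\<lambda>j. (1/2)^j" 0]) (use le in \<open>auto simp: u_def summable_geometric\<close>)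
  have "summable (\<lambda>j. cmod ((LINT t|circ. cmod (u j t))))" using sm by simp
  have ae: "AE t in circ. summable (\<lambda>j. cmod (u j t))"
  proof -
    have "(\<integral>\<^sup>+t. (\<Sum>j. ennreal (cmod (u j t))) \<partial>circ) = (\<Sum>j. \<integral>\<^sup>+t. ennreal (cmod (u j t)) \<partial>circ)"
      using borel_measurable_integrable[OF iu] by (intro nn_integral_suminf) auto
    also have "\<dots> = (\<Sum>j. ennreal ((LINT t|circ. cmod (u j t))))"
      by (subst nn_integral_eq_integral) (auto intro: iu)
    also have "\<dots> < \<infinity>" using sm by (subst suminf_ennreal2) auto
    finally have fin: "(\<integral>\<^sup>+t. (\<Sum>j. ennreal (cmod (u j t))) \<partial>circ) \<noteq> \<infinity>" by simp
    have "AE t in circ. (\<Sum>j. ennreal (cmod (u j t))) \<noteq> \<infinity>"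
      by (rule nn_integral_PInf_AE[OF _ fin]) (use borel_measurable_integrable[OF iu] in auto)
    then show ?thesis by eventually_elim (auto intro: summable_suminf_not_top)
  qed
  define w where "w t = (\<Sum>j. cmod (u j t))" for t
  define F where "F t = s 0 t + (\<Sum>j. u j t)" for t
  have iw: "integrable circ w" unfolding w_def
    by (rule integrable_suminf) (use iu ae sm in auto)
  have iF: "integrable circ F" unfolding F_def
    by (intro Bochner_Integration.integrable_add int integrable_suminf) (use iu ae sm in auto)
  have part: "s j t = s 0 t + (\<Sum>i<j. u i t)" for j t by (induction j) (auto simp: u_def)
  have lim: "AE t in circ. (\<lambda>j. s j t) \<longlonglongrightarrow> F t" using ae
  proof eventually_elim
    case (elim t)
    then have "(\<lambda>j. u j t) sums (\<Sum>j. u j t)" by (rule summable_sums[OF summable_norm_cancel])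
    then have "(\<lambda>j. s 0 t + (\<Sum>i<j. u i t)) \<longlonglongrightarrow> F t" unfolding F_def sums_def by (rule tendsto_add[OF tendsto_const])
    moreover have "(\<lambda>j. s j t) = (\<lambda>j. s 0 t + (\<Sum>i<j. u i t))" by (intro ext part)
    ultimately show ?case by (simp only:)
  qed
  have dom: "AE t in circ. norm (cmod (s j t - F t)) \<le> w t" for j using ae
  proof eventually_elim
    case (elim t)
    then have su: "summable (\<lambda>j. u j t)" by (rule summable_norm_cancel)
    have "F t = s j t + (\<Sum>i. u (i + j) t)"
      unfolding F_def using suminf_split_initial_segment[OF su, of j] part[of j t] by (simp only: add.assoc) (simp add: add.commute)
    then have "F t - s j t = (\<Sum>i. u (i + j) t)" by simp
    then have "cmod (s j t - F t) = cmod (\<Sum>i. u (i + j) t)" by (subst norm_minus_commute) (rule arg_cong)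
    also have "\<dots> \<le> (\<Sum>i. cmod (u (i + j) t))" by (intro summable_norm summable_ignore_initial_segment[OF elim])
    also have "\<dots> \<le> w t" unfolding w_def using suminf_split_initial_segment[OF elim, of j]
      by (simp add: sum_nonneg)
    finally show ?case by simp
  qed
  have "(\<lambda>j. (LINT t|circ. cmod (s j t - F t))) \<longlonglongrightarrow> (LINT t|circ. 0::real)"
  proof (rule integral_dominated_convergence[where w = w])
    show "AE x in circ. (\<lambda>j. cmod (s j x - F x)) \<longlonglongrightarrow> 0" using lim
      by eventually_elim (simp add: LIM_zero tendsto_norm_zero)
  qed (use int iF iw dom borel_measurable_integrable[OF iF] borel_measurable_integrable[OF int] in auto)
  then show ?thesis using that iF lim by simp
qed

lemma circ_Cauchy_Schwarz:
  fixes f g :: "real \<Rightarrow> complex"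
  assumes m: "f \<in> borel_measurable borel" "g \<in> borel_measurable borel"
    and i: "integrable circ (\<lambda>t. (cmod (f t))\<^sup>2)" "integrable circ (\<lambda>t. (cmod (g t))\<^sup>2)"
  shows "integrable circ (\<lambda>t. f t * g t)"
    "(LINT t|circ. cmod (f t * g t)) \<le> sqrt ((LINT t|circ. (cmod (f t))\<^sup>2)) * sqrt ((LINT t|circ. (cmod (g t))\<^sup>2))"
proof -
  have amgm: "2 * (cmod (f t) * cmod (g t)) \<le> (cmod (f t))\<^sup>2 + (cmod (g t))\<^sup>2" for t
    using sum_squares_bound[of "cmod (f t)" "cmod (g t)"] by simp
  show int: "integrable circ (\<lambda>t. f t * g t)"
  proof (rule Bochner_Integration.integrable_bound[of _ "\<lambda>t. (cmod (f t))\<^sup>2 + (cmod (g t))\<^sup>2"])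
    show "AE t in circ. norm (f t * g t) \<le> norm ((cmod (f t))\<^sup>2 + (cmod (g t))\<^sup>2)"
    proof (rule AE_I2)
      fix t
      have "0 \<le> cmod (f t) * cmod (g t)" by simp
      then have "cmod (f t) * cmod (g t) \<le> (cmod (f t))\<^sup>2 + (cmod (g t))\<^sup>2"
        using amgm[of t] by linarith
      then show "norm (f t * g t) \<le> norm ((cmod (f t))\<^sup>2 + (cmod (g t))\<^sup>2)"
        by (simp add: norm_mult)
    qed
  qed (use m i in auto)
  define A B C where "A = (LINT t|circ. (cmod (f t))\<^sup>2)" and "B = (LINT t|circ. (cmod (g t))\<^sup>2)"
    and "C = (LINT t|circ. cmod (f t * g t))"
  have AB: "0 \<le> A" "0 \<le> B" "0 \<le> C" unfolding A_def B_def C_def by simp_all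
  have q: "2 * x * C \<le> x\<^sup>2 * A + B" for x
  proof -
    have "(LINT t|circ. 2 * x * cmod (f t * g t)) \<le> (LINT t|circ. x\<^sup>2 * (cmod (f t))\<^sup>2 + (cmod (g t))\<^sup>2)"
    proof (rule integral_mono)
      fix t show "2 * x * cmod (f t * g t) \<le> x\<^sup>2 * (cmod (f t))\<^sup>2 + (cmod (g t))\<^sup>2"
        using sum_squares_bound[of "x * cmod (f t)" "cmod (g t)"] by (simp add: norm_mult power_mult_distrib mult.assoc)
    qed (use int i in auto)
    then show ?thesis using i int by (simp add: A_def B_def C_def)
  qed
  have "C\<^sup>2 \<le> A * B"
  proof (cases "A = 0")
    case True
    have "C = 0"
    proof (rule ccontr)
      assume "C \<noteq> 0"
      then have "C > 0" using AB by simp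
      moreover have "2 * ((B + 1) / (2 * C)) * C \<le> B" using q[of "(B + 1) / (2 * C)"] True by simp
      ultimately show False by simp
    qed
    then show ?thesis using AB by simp
  next
    case False
    then have "A > 0" using AB by simp
    then show ?thesis using q[of "C / A"] by (simp add: power2_eq_square field_simps)
  qed
  then have "C \<le> sqrt (A * B)" by (intro real_le_rsqrt)
  then show "C \<le> sqrt A * sqrt B" by (simp add: real_sqrt_mult)
qed

lemma circ_L1_le_L2:
  fixes f :: "real \<Rightarrow> complex"
  assumes m: "f \<in> borel_measurable borel" and i: "integrable circ (\<lambda>t. (cmod (f t))\<^sup>2)"
  shows "integrable circ f" "(LINT t|circ. cmod (f t)) \<le> sqrt ((LINT t|circ. (cmod (f t))\<^sup>2))"
  using circ_Cauchy_Schwarz[OF m _ i, of "\<lambda>_. 1"] by simp_all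

text \<open>By Parseval this is the squared L^2 distance between the boundary function and its
  dilation of radius r. Phrased through coefficients, it is available before the boundary function
  has been constructed.\<close>

definition defect :: "afun \<Rightarrow> real \<Rightarrow> real" where
  "defect a r = (\<Sum>k. (cmod (a k))\<^sup>2 * (1 - r ^ k)\<^sup>2)"

lemma defect_summable:
  assumes "summable (\<lambda>k. (cmod (a k))\<^sup>2)" "0 \<le> r" "r \<le> 1"
  shows "summable (\<lambda>k. (cmod (a k))\<^sup>2 * (1 - r ^ k)\<^sup>2)"
  by (rule summable_comparison_test'[OF assms(1), of 0])
     (use assms in \<open>auto intro!: mult_left_le power_le_one\<close>)

lemma defect_tendsto:
  assumes s: "summable (\<lambda>k. (cmod (a k))\<^sup>2)"
  shows "((\<lambda>r. defect a r) \<longlongrightarrow> 0) (at_left 1)"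
proof -
  have "((\<lambda>r. \<Sum>k. (cmod (a k))\<^sup>2 * (1 - r ^ k)\<^sup>2) \<longlongrightarrow> (\<Sum>k. 0)) (at_left 1)"
  proof (rule tannerys_theorem[THEN conjunct2, THEN conjunct2])
    have "\<forall>\<^sub>F r in at_left (1::real). r \<in> {0<..<1}" by (rule eventually_at_leftI[of 0]) auto
    then have *: "\<forall>\<^sub>F r in at_left 1. \<forall>k. norm ((cmod (a k))\<^sup>2 * (1 - r ^ k)\<^sup>2) \<le> (cmod (a k))\<^sup>2"
    proof eventually_elim
      case (elim r)
      have "0 \<le> r ^ k" "r ^ k \<le> 1" for k using elim by (auto intro!: power_le_one)
      then have "(1 - r ^ k)\<^sup>2 \<le> 1" for k by (intro power_le_one) auto
      then show ?case by (auto intro!: mult_left_le)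
    qed
    show "\<forall>\<^sub>F (k, r) in sequentially \<times>\<^sub>F at_left 1. norm ((cmod (a k))\<^sup>2 * (1 - r ^ k)\<^sup>2) \<le> (cmod (a k))\<^sup>2"
      using eventually_prodI[OF always_eventually[of "\<lambda>_. True" sequentially] *] by (auto elim!: eventually_mono)
    show "summable (\<lambda>k. (cmod (a k))\<^sup>2)" by (rule s)
    show "at_left (1::real) \<noteq> bot" by simp
    fix k
    have "((\<lambda>r::real. (cmod (a k))\<^sup>2 * (1 - r ^ k)\<^sup>2) \<longlongrightarrow> (cmod (a k))\<^sup>2 * (1 - 1 ^ k)\<^sup>2) (at_left 1)"
      by (intro tendsto_intros)
    then show "((\<lambda>r::real. (cmod (a k))\<^sup>2 * (1 - r ^ k)\<^sup>2) \<longlongrightarrow> 0) (at_left 1)" by simp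
  qed
  then show ?thesis by (simp add: defect_def[abs_def])
qed

text \<open>The difference of the dilations of radii q <= r is itself the dilation of radius r of
  the series with coefficients a_k (1 - (q/r)^k), so Parseval gives the sum of |a_k|^2 (r^k -
  q^k)^2, and r^k <= 1.\<close>

lemma dilation_dist:
  assumes s: "summable (\<lambda>k. (cmod (a k))\<^sup>2)" and r: "0 \<le> r" "r < 1" "0 \<le> q" "q < 1"
  shows "(LINT t|circ. (cmod (evc a r t - evc a q t))\<^sup>2) \<le> defect a (min r q)"
proof -
  have main: "(LINT t|circ. (cmod (evc a r t - evc a q t))\<^sup>2) \<le> defect a q"
    if r: "0 \<le> q" "q \<le> r" "r < 1" "0 < r" for r q
  proof -
    have a: "analytic_disk a" using Hp2_I[OF s] by (simp add: Hp_def)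
    define b where "b k = a k - a k * of_real (q/r) ^ k" for k
    have "cmod (b k) \<le> 2 * cmod (a k)" for k
    proof -
      have "cmod (b k) \<le> cmod (a k) + cmod (a k) * (q/r)^k"
        unfolding b_def using r by (intro order.trans[OF norm_triangle_ineq4]) (simp add: norm_mult norm_power norm_divide)
      also have "\<dots> \<le> cmod (a k) + cmod (a k) * 1"
        using r by (intro add_left_mono mult_left_mono power_le_one) auto
      finally show ?thesis by simp
    qed
    then have b: "analytic_disk b" unfolding analytic_disk_def
    proof (intro allI impI)
      fix x :: real assume x: "0 \<le> x \<and> x < 1"
      then have "summable (\<lambda>n. 2 * (cmod (a n) * x ^ n))" using a by (intro summable_mult) (auto simp: analytic_disk_def)
      then show "summable (\<lambda>n. cmod (b n) * x ^ n)"
        by (rule summable_comparison_test'[of _ 0]) (use \<open>\<And>k. cmod (b k) \<le> 2 * cmod (a k)\<close> x in \<open>auto simp: mult.assoc[symmetric] intro!: mult_right_mono\<close>)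
    qed
    have evb: "evc b r t = evc a r t - evc a q t" for t
    proof -
      have n: "cmod (of_real r * cis t) < 1" "cmod (of_real q * cis t) < 1" using r by (auto simp: norm_mult)
      have "b k * (of_real r * cis t) ^ k = a k * (of_real r * cis t) ^ k - a k * (of_real q * cis t) ^ k" for k
        using r by (simp add: b_def power_mult_distrib left_diff_distrib power_divide)
      then have "(\<lambda>k. b k * (of_real r * cis t) ^ k) sums (evc a r t - evc a q t)"
        using sums_diff[OF ev_sums[OF a n(1)] ev_sums[OF a n(2)]] by simp
      then show ?thesis by (simp add: ev_def sums_iff)
    qed
    have cb: "(cmod (b k))\<^sup>2 * r ^ (2*k) = (cmod (a k))\<^sup>2 * (r ^ k - q ^ k)\<^sup>2" for k
    proof -
      have "b k * of_real r ^ k = a k * of_real (r ^ k - q ^ k)"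
        using r by (simp add: b_def left_diff_distrib right_diff_distrib power_divide)
      then have "(cmod (b k * of_real r ^ k))\<^sup>2 = (cmod (a k * of_real (r ^ k - q ^ k)))\<^sup>2" by simp
      then have "(cmod (b k))\<^sup>2 * (r ^ k)\<^sup>2 = (cmod (a k))\<^sup>2 * (r ^ k - q ^ k)\<^sup>2"
        unfolding norm_mult power_mult_distrib using r by (simp only: norm_power norm_of_real abs_of_nonneg power2_abs)
      moreover have "r ^ (2*k) = (r ^ k)\<^sup>2" by (metis mult.commute power_mult)
      ultimately show ?thesis by simp
    qed
    have "(\<lambda>k. (cmod (a k))\<^sup>2 * (r ^ k - q ^ k)\<^sup>2) sums (LINT t|circ. (cmod (evc a r t - evc a q t))\<^sup>2)"
      using parseval_dilation[OF b, of r] r unfolding cb evb by simp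
    then have 1: "(LINT t|circ. (cmod (evc a r t - evc a q t))\<^sup>2) = (\<Sum>k. (cmod (a k))\<^sup>2 * (r ^ k - q ^ k)\<^sup>2)"
      "summable (\<lambda>k. (cmod (a k))\<^sup>2 * (r ^ k - q ^ k)\<^sup>2)" by (simp_all add: sums_iff)
    have "(r ^ k - q ^ k)\<^sup>2 \<le> (1 - q ^ k)\<^sup>2" for k
      using r by (intro power_mono) (auto intro!: power_mono power_le_one)
    then show ?thesis unfolding 1(1) defect_def using r s 1(2)
      by (intro suminf_le defect_summable mult_left_mono) auto
  qed
  show ?thesis
  proof (cases "q \<le> r")
    case True
    show ?thesis
    proof (cases "r = 0")
      case True
      then have "q = 0" using \<open>q \<le> r\<close> r(3) by simp
      moreover have "0 \<le> defect a 0" unfolding defect_def by (intro suminf_nonneg defect_summable s) auto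
      ultimately show ?thesis using True by simp
    next
      case False
      then show ?thesis using main[of q r] True r by (simp add: min_absorb2)
    qed
  next
    case False
    then have "(LINT t|circ. (cmod (evc a q t - evc a r t))\<^sup>2) \<le> defect a r"
      using main[of r q] r by simp
    then show ?thesis using False by (simp add: norm_minus_commute min_def)
  qed
qed

text \<open>Dilations along suitable radii converge in L^1 to some F with the coefficients of a. As
  a is then the Poisson integral of F, its radial limits equal F almost everywhere, which identifies
  F with \<open>bv a\<close>.\<close>

lemma Hp2_boundary:
  assumes "a \<in> Hp 2"
  shows "analytic_disk a" "AE t in circ. radlim a t (bv a t)" "bv a \<in> borel_measurable borel"
    "integrable circ (bv a)" "\<And>n. fc (bv a) (int n) = a n" "\<And>n. n < 0 \<Longrightarrow> fc (bv a) n = 0"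
    "integrable circ (\<lambda>t. (cmod (bv a t))\<^sup>2)"
    "\<And>s. 0 \<le> s \<Longrightarrow> s < 1 \<Longrightarrow> (LINT t|circ. (cmod (bv a t - evc a s t))\<^sup>2) \<le> defect a s"
    "\<And>s. 0 \<le> s \<Longrightarrow> s < 1 \<Longrightarrow> integrable circ (\<lambda>t. (cmod (bv a t - evc a s t))\<^sup>2)"
proof -
  show a: "analytic_disk a" using assms by (simp add: Hp_def)
  have s: "summable (\<lambda>k. (cmod (a k))\<^sup>2)" using assms Hp2_iff by simp
  show bm [measurable]: "bv a \<in> borel_measurable borel" by (rule bv_measurable[OF a])
  \<comment> \<open>The tolerance 4^-j is a squared distance: its square root is the rate 2^-j that
    \<open>L1_fast_cauchy\<close> asks for.\<close>
  have "\<exists>r. 0 \<le> r \<and> r < 1 \<and> 1 - r < 1 / Suc j \<and> defect a r \<le> (1/4)^j" for j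
  proof -
    have "\<forall>\<^sub>F r in at_left 1. defect a r < (1/4)^j" by (rule order_tendstoD(2)[OF defect_tendsto[OF s]]) auto
    moreover have "\<forall>\<^sub>F r in at_left 1. r \<in> {1 - 1 / Suc j<..<1::real}" by (rule eventually_at_leftI[of "1 - 1 / Suc j"]) auto
    ultimately have "\<forall>\<^sub>F r in at_left 1. 0 \<le> r \<and> r < 1 \<and> 1 - r < 1 / Suc j \<and> defect a r \<le> (1/4)^j"
    proof eventually_elim
      case (elim r)
      have "1 / real (Suc j) \<le> 1" by simp
      then show ?case using elim unfolding greaterThanLessThan_iff by linarith
    qed
    then show ?thesis by (metis (mono_tags, lifting) eventually_happens trivial_limit_at_left_real)
  qed
  then obtain \<rho> where \<rho>: "\<And>j. 0 \<le> \<rho> j" "\<And>j. \<rho> j < 1" "\<And>j. 1 - \<rho> j < 1 / Suc j" "\<And>j. defect a (\<rho> j) \<le> (1/4)^j"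
    by metis
  define S where "S j t = evc a (\<rho> j) t" for j t
  have Sc: "continuous_on UNIV (S j)" for j unfolding S_def by (intro continuous_ev_circle a \<rho>)
  then have Sm [measurable]: "S j \<in> borel_measurable borel" for j by (rule borel_measurable_continuous_onI)
  have Si: "integrable circ (S j)" for j by (intro integrable_circ_continuous Sc)
  have dist2: "(LINT t|circ. (cmod (S (Suc j) t - S j t))\<^sup>2) \<le> (1/4)^j" for j
  proof -
    have "(LINT t|circ. (cmod (S (Suc j) t - S j t))\<^sup>2) \<le> defect a (min (\<rho> (Suc j)) (\<rho> j))"
      unfolding S_def by (intro dilation_dist s \<rho>)
    also have "\<dots> \<le> (1/4)^j"
    proof (cases "\<rho> (Suc j) \<le> \<rho> j")
      case True
      have "defect a (\<rho> (Suc j)) \<le> (1/4)^Suc j" by (rule \<rho>(4))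
      also have "(1/4::real)^Suc j \<le> (1/4)^j" by (intro power_decreasing) auto
      finally show ?thesis using True by (simp add: min_def)
    qed (use \<rho>(4)[of j] in \<open>auto simp: min_def\<close>)
    finally show ?thesis .
  qed
  have dist1: "(LINT t|circ. cmod (S (Suc j) t - S j t)) \<le> (1/2)^j" for j
  proof -
    have "(LINT t|circ. cmod (S (Suc j) t - S j t)) \<le> sqrt ((LINT t|circ. (cmod (S (Suc j) t - S j t))\<^sup>2))"
      by (intro circ_L1_le_L2 integrable_circ_continuous continuous_intros Sc) measurable
    also have "\<dots> \<le> sqrt ((1/4)^j)" using dist2 by simp
    also have "\<dots> = (1/2)^j" by (simp add: real_sqrt_power real_sqrt_divide)
    finally show ?thesis .
  qed
  obtain F where F: "integrable circ F" "AE t in circ. (\<lambda>j. S j t) \<longlonglongrightarrow> F t"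
    "(\<lambda>j. (LINT t|circ. cmod (S j t - F t))) \<longlonglongrightarrow> 0"
    using L1_fast_cauchy[OF Si dist1] by blast
  have "(\<lambda>j. 1 - \<rho> j) \<longlonglongrightarrow> 0"
  proof (rule tendsto_sandwich[OF _ _ tendsto_const LIMSEQ_inverse_real_of_nat]; intro always_eventually allI)
    fix j
    show "0 \<le> 1 - \<rho> j" using \<rho>(2)[of j] by simp
    show "1 - \<rho> j \<le> inverse (real (Suc j))" using \<rho>(3)[of j] by (simp add: inverse_eq_divide)
  qed
  then have \<rho>1: "\<rho> \<longlonglongrightarrow> 1" using tendsto_diff[OF tendsto_const[of 1], of "\<lambda>j. 1 - \<rho> j" 0 sequentially] by simp
  have fcF: "fc F n = (if n \<ge> 0 then a (nat n) else 0)" for n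
  proof -
    have "(\<lambda>j. fc (S j) n) \<longlonglongrightarrow> fc F n"
    proof (rule LIM_zero_cancel, rule Lim_null_comparison[OF _ F(3)], intro always_eventually allI)
      fix j
      have "fc (S j) n - fc F n = fc (\<lambda>t. S j t - F t) n" by (rule fc_diff[symmetric]) (use Si F in auto)
      then show "norm (fc (S j) n - fc F n) \<le> (LINT t|circ. cmod (S j t - F t))" using norm_fc_le by metis
    qed
    moreover have "(\<lambda>j. fc (S j) n) \<longlonglongrightarrow> (if n \<ge> 0 then a (nat n) else 0)"
    proof -
      have "(\<lambda>j. a (nat n) * of_real (\<rho> j) ^ nat n) \<longlonglongrightarrow> a (nat n) * of_real 1 ^ nat n"
        by (intro tendsto_intros \<rho>1)
      then show ?thesis unfolding S_def by (subst fc_dilation) (auto simp: a \<rho>)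
    qed
    ultimately show ?thesis using LIMSEQ_unique by blast
  qed
  have ae: "AE t in circ. radlim a t (F t)" by (rule L1_analytic_boundary(2)[OF F(1)]) (auto simp: fcF)
  show rl: "AE t in circ. radlim a t (bv a t)" by (rule radlim_bv_AE(2)[OF ae])
  have bF: "AE t in circ. bv a t = F t" by (rule radlim_bv_AE(1)[OF ae])
  have Fm: "F \<in> borel_measurable borel" using borel_measurable_integrable[OF F(1)] by simp
  show "integrable circ (bv a)" using F(1) bF by (subst integrable_cong_AE[of _ _ F]) (auto simp: Fm)
  have "fc (bv a) n = fc F n" for n by (rule fc_cong_AE[OF bm Fm bF])
  then show "\<And>n. fc (bv a) (int n) = a n" "\<And>n. n < 0 \<Longrightarrow> fc (bv a) n = 0" by (auto simp: fcF)
  \<comment> \<open>Fatou's lemma along the radii \<open>\<rho> j\<close> carries the estimate for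
    two dilations over to the boundary function; in the nonnegative integral it also proves square
    integrability.\<close>
  have nn: "(\<integral>\<^sup>+t. ennreal ((cmod (bv a t - evc a s t))\<^sup>2) \<partial>circ) \<le> ennreal (defect a s)" if r: "0 \<le> s" "s < 1" for s
  proof -
    have [measurable]: "(\<lambda>t. evc a s t) \<in> borel_measurable borel" by (rule ev_circle_measurable[OF a r])
    have "(\<integral>\<^sup>+t. ennreal ((cmod (bv a t - evc a s t))\<^sup>2) \<partial>circ)
       = (\<integral>\<^sup>+t. liminf (\<lambda>j. ennreal ((cmod (S j t - evc a s t))\<^sup>2)) \<partial>circ)"
    proof (rule nn_integral_cong_AE)
      show "AE t in circ. ennreal ((cmod (bv a t - evc a s t))\<^sup>2) = liminf (\<lambda>j. ennreal ((cmod (S j t - evc a s t))\<^sup>2))"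
        using F(2) bF
      proof eventually_elim
        case (elim t)
        have "(\<lambda>j. ennreal ((cmod (S j t - evc a s t))\<^sup>2)) \<longlonglongrightarrow> ennreal ((cmod (F t - evc a s t))\<^sup>2)"
          by (intro tendsto_intros elim)
        from lim_imp_Liminf[OF _ this] show ?case using elim by simp
      qed
    qed
    also have "\<dots> \<le> liminf (\<lambda>j. \<integral>\<^sup>+t. ennreal ((cmod (S j t - evc a s t))\<^sup>2) \<partial>circ)"
      by (rule nn_integral_liminf) measurable
    also have "\<dots> \<le> ennreal (defect a s)"
    proof (rule order.trans[OF Liminf_mono Liminf_const[THEN eq_refl]])
      have "\<forall>\<^sub>F j in sequentially. s < \<rho> j" using \<rho>1 r by (intro order_tendstoD(1)) auto
      then show "\<forall>\<^sub>F j in sequentially. (\<integral>\<^sup>+t. ennreal ((cmod (S j t - evc a s t))\<^sup>2) \<partial>circ) \<le> ennreal (defect a s)"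
      proof eventually_elim
        case (elim j)
        have "(\<integral>\<^sup>+t. ennreal ((cmod (S j t - evc a s t))\<^sup>2) \<partial>circ) = ennreal ((LINT t|circ. (cmod (S j t - evc a s t))\<^sup>2))"
          by (intro nn_integral_eq_integral integrable_circ_continuous continuous_intros Sc continuous_ev_circle a r) auto
        also have "\<dots> \<le> ennreal (defect a (min (\<rho> j) s))" unfolding S_def by (intro ennreal_leI dilation_dist \<rho> r) (rule \<open>summable (\<lambda>k. (cmod (a k))\<^sup>2)\<close>)
        finally show ?case using elim by (simp add: min_def)
      qed
    qed simp
    finally show ?thesis .
  qed
  show int: "integrable circ (\<lambda>t. (cmod (bv a t - evc a s t))\<^sup>2)" if r: "0 \<le> s" "s < 1" for s
  proof (rule integrableI_bounded)
    show "(\<integral>\<^sup>+t. ennreal (norm ((cmod (bv a t - evc a s t))\<^sup>2)) \<partial>circ) < \<infinity>"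
      using le_less_trans[OF nn[OF r]] by simp
  qed (use ev_circle_measurable[OF a r] in simp)
  show "(LINT t|circ. (cmod (bv a t - evc a s t))\<^sup>2) \<le> defect a s" if r: "0 \<le> s" "s < 1" for s
  proof -
    have "0 \<le> defect a s" unfolding defect_def using r
      by (intro suminf_nonneg defect_summable \<open>summable (\<lambda>k. (cmod (a k))\<^sup>2)\<close>) auto
    then show ?thesis using nn[OF r] nn_integral_eq_integral[OF int[OF r]] by simp
  qed
  show "integrable circ (\<lambda>t. (cmod (bv a t))\<^sup>2)"
  proof (rule Bochner_Integration.integrable_bound)
    show "integrable circ (\<lambda>t. 2 * (cmod (bv a t - evc a 0 t))\<^sup>2 + 2 * (cmod (a 0))\<^sup>2)"
      using int[of 0] by simp
    show "AE t in circ. norm ((cmod (bv a t))\<^sup>2) \<le> norm (2 * (cmod (bv a t - evc a 0 t))\<^sup>2 + 2 * (cmod (a 0))\<^sup>2)"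
    proof (rule AE_I2)
      fix t
      have "cmod (bv a t) \<le> cmod (bv a t - a 0) + cmod (a 0)" using norm_triangle_ineq[of "bv a t - a 0" "a 0"] by simp
      then have "(cmod (bv a t))\<^sup>2 \<le> (cmod (bv a t - a 0) + cmod (a 0))\<^sup>2" by (intro power_mono) auto
      also have "\<dots> \<le> 2 * (cmod (bv a t - a 0))\<^sup>2 + 2 * (cmod (a 0))\<^sup>2"
        using sum_squares_bound[of "cmod (bv a t - a 0)" "cmod (a 0)"] by (simp add: power2_sum)
      finally show "norm ((cmod (bv a t))\<^sup>2) \<le> norm (2 * (cmod (bv a t - evc a 0 t))\<^sup>2 + 2 * (cmod (a 0))\<^sup>2)" by simp
    qed
  qed simp
qed

section \<open>Subharmonicity\<close>

text \<open>A function supported from below at every point by real parts of holomorphic functions is subharmonic;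
  this form of subharmonicity is easy to check and suffices for the maximum principle.\<close>
definition hsupp :: "(complex \<Rightarrow> real) \<Rightarrow> complex \<Rightarrow> bool" where
  "hsupp U w0 \<longleftrightarrow> (\<exists>F e. e > 0 \<and> F holomorphic_on ball w0 e \<and> Re (F w0) = U w0 \<and> (\<forall>w\<in>ball w0 e. Re (F w) \<le> U w))"

lemma hsuppI:
  assumes "e > 0" "F holomorphic_on ball w0 e" "Re (F w0) = U w0" "\<And>w. w \<in> ball w0 e \<Longrightarrow> Re (F w) \<le> U w"
  shows "hsupp U w0"
  using assms unfolding hsupp_def by blast

lemma hsupp_add_Re:
  assumes "hsupp U w0" "G holomorphic_on ball w0 e" "e > 0"
  shows "hsupp (\<lambda>w. U w + Re (G w)) w0"
proof -
  obtain F d where F: "d > 0" "F holomorphic_on ball w0 d" "Re (F w0) = U w0" "\<forall>w\<in>ball w0 d. Re (F w) \<le> U w"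
    using assms(1) unfolding hsupp_def by blast
  show ?thesis
  proof (rule hsuppI[of "min d e" "\<lambda>w. F w + G w"])
    show "(\<lambda>w. F w + G w) holomorphic_on ball w0 (min d e)"
      by (intro holomorphic_intros holomorphic_on_subset[OF F(2)] holomorphic_on_subset[OF assms(2)]) auto
  qed (use F assms in auto)
qed

text \<open>At the rightmost point of the set where U attains its maximum, the supporting Re F
  attains a maximum too, so |exp F| is constant by the maximum modulus principle. Then U is maximal
  on a whole disc, contradicting the choice of a rightmost point. K and its open part are arbitrary
  because a sublevel set will play that role.\<close>

lemma max_principle:
  assumes K: "compact K" "continuous_on K U" and O: "open \<Omega>" "\<Omega> \<subseteq> K"
    and supp: "\<And>w. w \<in> \<Omega> \<Longrightarrow> hsupp U w" and bd: "\<And>w. w \<in> K - \<Omega> \<Longrightarrow> U w \<le> c" and w: "w \<in> K"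
  shows "U w \<le> c"
proof (rule ccontr)
  assume nle: "\<not> U w \<le> c"
  obtain m where m: "m \<in> K" "\<And>z. z \<in> K \<Longrightarrow> U z \<le> U m" using continuous_attains_sup[of K U] K w by blast
  define M where "M = U m"
  have Mc: "M > c" using m(2)[OF w] nle by (simp add: M_def)
  define Z where "Z = {z \<in> K. U z = M}"
  have "closed Z"
    unfolding Z_def using continuous_closed_preimage_constant[OF K(2) compact_imp_closed[OF K(1)]] by simp
  moreover have "Z = K \<inter> Z" by (auto simp: Z_def)
  ultimately have "compact Z" using compact_Int_closed[OF K(1)] by metis
  moreover have "Z \<noteq> {}" using m by (auto simp: Z_def M_def)
  ultimately obtain w0 where w0: "w0 \<in> Z" "\<And>z. z \<in> Z \<Longrightarrow> Re z \<le> Re w0"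
    using continuous_attains_sup[of Z Re] continuous_on_Re[OF continuous_on_id] by auto
  have w0O: "w0 \<in> \<Omega>"
  proof (rule ccontr)
    assume "w0 \<notin> \<Omega>"
    then have "U w0 \<le> c" using bd w0 by (auto simp: Z_def)
    then show False using w0 Mc by (auto simp: Z_def)
  qed
  obtain F d where F: "d > 0" "F holomorphic_on ball w0 d" "Re (F w0) = U w0" "\<forall>w\<in>ball w0 d. Re (F w) \<le> U w"
    using supp[OF w0O] unfolding hsupp_def by blast
  obtain e where e: "e > 0" "ball w0 e \<subseteq> \<Omega>" "e \<le> d"
  proof -
    obtain e where "e > 0" "ball w0 e \<subseteq> \<Omega>" using O(1) w0O openE by blast
    moreover have "ball w0 (min e d) \<subseteq> ball w0 e" by auto
    ultimately show ?thesis using that[of "min e d"] F(1) by auto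
  qed
  have F': "F holomorphic_on ball w0 e" by (rule holomorphic_on_subset[OF F(2)]) (use e in auto)
  have le: "Re (F z) \<le> M" "U z \<le> M" if "z \<in> ball w0 e" for z
  proof -
    have "z \<in> K" using that e O by auto
    then show "U z \<le> M" using m by (auto simp: M_def)
    moreover have "Re (F z) \<le> U z" using F(4) that e(3) by auto
    ultimately show "Re (F z) \<le> M" by linarith
  qed
  have FM: "Re (F w0) = M" using F(3) w0 by (auto simp: Z_def)
  have "(\<lambda>z. exp (F z)) constant_on ball w0 e"
  proof (rule maximum_modulus_principle[of _ "ball w0 e" "ball w0 e" w0])
    show "(\<lambda>z. exp (F z)) holomorphic_on ball w0 e" by (intro holomorphic_intros F')
    show "\<And>z. z \<in> ball w0 e \<Longrightarrow> cmod (exp (F z)) \<le> cmod (exp (F w0))" using le FM by simp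
  qed (use e in auto)
  then have c: "cmod (exp (F z)) = cmod (exp (F w0))" if "z \<in> ball w0 e" for z
    using that e(1) unfolding constant_on_def by (metis centre_in_ball)
  define z where "z = w0 + of_real (e/2)"
  have z: "z \<in> ball w0 e" using e by (simp add: z_def dist_norm)
  have "Re (F z) = M" using c[OF z] FM by simp
  moreover have "Re (F z) \<le> U z" using F(4) z e(3) by auto
  ultimately have "U z = M" using le(2)[OF z] by simp
  then have "z \<in> Z" using z e O by (auto simp: Z_def)
  from w0(2)[OF this] show False using e by (simp add: z_def)
qed

section \<open>Trigonometric polynomials as real parts of polynomials, and submean values\<close>

text \<open>On the unit circle z times its conjugate is 1, so a common factor z cancels and the
  degree drops; mixed terms become polynomial after conjugation, which leaves real parts
  unchanged.\<close>

lemma Re_poly_mult_cnj: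
  fixes p q :: "complex poly"
  shows "\<exists>s. \<forall>z\<in>sphere 0 1. Re (poly p z * cnj (poly q z)) = Re (poly s z)"
proof (induction p arbitrary: q)
  case 0
  show ?case by (intro exI[of _ 0]) simp
next
  case (pCons a p)
  obtain b q' where q: "q = pCons b q'" by (cases q)
  obtain s where s: "\<forall>z\<in>sphere 0 1. Re (poly p z * cnj (poly q' z)) = Re (poly s z)" using pCons.IH by blast
  define r where "r = [:a * cnj b:] + smult (cnj a) (pCons 0 q') + smult (cnj b) (pCons 0 p) + s"
  have "Re (poly (pCons a p) z * cnj (poly q z)) = Re (poly r z)" if z: "z \<in> sphere 0 1" for z
  proof -
    have zz: "z * cnj z = 1" using z by (simp add: complex_norm_square[symmetric])
    have "poly (pCons a p) z * cnj (poly q z) = a * cnj b + cnj (cnj a * (z * poly q' z)) + cnj b * (z * poly p z) + (z * cnj z) * (poly p z * cnj (poly q' z))"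
      unfolding q by (simp add: algebra_simps)
    then have "Re (poly (pCons a p) z * cnj (poly q z)) = Re (a * cnj b) + Re (cnj (cnj a * (z * poly q' z))) + Re (cnj b * (z * poly p z)) + Re (poly p z * cnj (poly q' z))"
      unfolding zz by (simp only: mult_1_left plus_complex.simps)
    also have "Re (cnj (cnj a * (z * poly q' z))) = Re (cnj a * (z * poly q' z))" by (simp only: cnj.simps)
    finally show ?thesis unfolding r_def using bspec[OF s z] by (simp only: poly_add poly_smult poly_pCons poly_0 mult_zero_right add_0_left add_0_right plus_complex.simps)
  qed
  then show ?case by blast
qed

text \<open>Products are handled by 2 (Re p)(Re q) = Re (p q) + Re (p conj q), the second term being
  again the real part of a polynomial on the circle.\<close>

lemma real_polynomial_on_circle:
  fixes u :: "complex \<Rightarrow> real"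
  assumes "real_polynomial_function u"
  shows "\<exists>p. \<forall>z\<in>sphere 0 1. u z = Re (poly p z)"
  using assms
proof (induction rule: real_polynomial_function.induct)
  case (linear f)
  have "f z = Re (poly [:0, Complex (f 1) (- f \<i>):] z)" for z
  proof -
    have z: "Re z *\<^sub>R 1 + Im z *\<^sub>R \<i> = z" by (simp add: complex_eq_iff)
    then have "f z = Re z * f 1 + Im z * f \<i>"
      using linear_add[OF bounded_linear.linear[OF linear], of "Re z *\<^sub>R 1" "Im z *\<^sub>R \<i>"]
        linear_scale[OF bounded_linear.linear[OF linear]] by simp
    then show ?thesis by simp
  qed
  then show ?case by blast
next
  case (const c)
  show ?case by (intro exI[of _ "[:of_real c:]"]) simp
next
  case (add f g)
  then obtain p q where "\<forall>z\<in>sphere 0 1. f z = Re (poly p z)" "\<forall>z\<in>sphere 0 1. g z = Re (poly q z)" by blast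
  then show ?case by (intro exI[of _ "p + q"]) simp
next
  case (mult f g)
  then obtain p q where pq: "\<forall>z\<in>sphere 0 1. f z = Re (poly p z)" "\<forall>z\<in>sphere 0 1. g z = Re (poly q z)" by blast
  obtain s where s: "\<forall>z\<in>sphere 0 1. Re (poly p z * cnj (poly q z)) = Re (poly s z)" using Re_poly_mult_cnj by blast
  obtain r where r: "\<forall>z\<in>sphere 0 1. Re (poly p z * cnj (poly [:1:] z) * 1) = Re (poly r z)" using Re_poly_mult_cnj[of p "[:1:]"] by auto
  have "f z * g z = Re (poly (smult (1/2) (p * q + s)) z)" if z: "z \<in> sphere 0 1" for z
  proof -
    have "Re (poly (smult (1/2) (p * q + s)) z) = (Re (poly p z * poly q z) + Re (poly p z * cnj (poly q z))) / 2"
      using bspec[OF s z] by simp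
    also have "\<dots> = Re (poly p z) * Re (poly q z)" by simp
    finally show ?thesis using pq z by simp
  qed
  then show ?case by blast
qed

text \<open>Stone--Weierstrass stands in for the Dirichlet problem: continuous boundary data obtain
  an approximate harmonic extension together with its holomorphic completion. Making p(0) real
  prepares for \<open>mean_poly_Re\<close>.\<close>

lemma circle_poly_approx:
  fixes u :: "complex \<Rightarrow> real"
  assumes "continuous_on (sphere 0 1) u" "e > 0"
  obtains p where "\<And>z. cmod z = 1 \<Longrightarrow> \<bar>u z - Re (poly p z)\<bar> < e" "Im (poly p 0) = 0"
proof -
  obtain g where g: "real_polynomial_function g" "\<And>x. x \<in> sphere 0 1 \<Longrightarrow> \<bar>u x - g x\<bar> < e"
    using Stone_Weierstrass_real_polynomial_function[OF _ assms] by auto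
  obtain p where p: "\<forall>z\<in>sphere 0 1. g z = Re (poly p z)" using real_polynomial_on_circle[OF g(1)] by blast
  show ?thesis
  proof (rule that[of "p - [:\<i> * of_real (Im (poly p 0)):]"])
    fix z :: complex assume "cmod z = 1"
    then have "z \<in> sphere 0 1" by simp
    then show "\<bar>u z - Re (poly (p - [:\<i> * of_real (Im (poly p 0)):]) z)\<bar> < e" using g(2)[of z] p by simp
  qed simp
qed

lemma mean_poly: "(LINT t|circ. poly p (cis t)) = poly p 0"
proof -
  have "(LINT t|circ. poly p (cis t)) = integral\<^sup>L circ (\<lambda>t. \<Sum>i\<le>degree p. coeff p i * cis (of_int (int i) * t))"
    by (simp add: poly_altdef Complex.DeMoivre)
  also have "\<dots> = (\<Sum>i\<le>degree p. (LINT t|circ. coeff p i * cis (of_int (int i) * t)))"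
    by (rule Bochner_Integration.integral_sum) (intro integrable_circ_continuous continuous_intros)
  also have "\<dots> = (\<Sum>i\<le>degree p. if i = 0 then coeff p 0 else 0)"
  proof (intro sum.cong refl)
    fix i
    show "(LINT t|circ. coeff p i * cis (of_int (int i) * t)) = (if i = 0 then coeff p 0 else 0)"
      using integral_cis_of_int[of "int i"] by (auto simp del: of_int_of_nat_eq)
  qed
  also have "\<dots> = poly p 0" by (simp add: poly_0_coeff_0)
  finally show ?thesis .
qed

lemma mean_Re_poly: "(LINT t|circ. Re (poly p (cis t))) = Re (poly p 0)"
  by (subst integral_Re) (auto intro!: integrable_circ_continuous continuous_intros simp: mean_poly)

text \<open>The maximum principle compares S with an approximating Re p inside the disc, and Re p
  satisfies the mean value property exactly.\<close>

lemma submean: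
  assumes c: "continuous_on (cball 0 1) S" and supp: "\<And>w. cmod w < 1 \<Longrightarrow> hsupp S w"
  shows "S 0 \<le> (LINT t|circ. S (cis t))"
proof (rule field_le_epsilon)
  fix e :: real assume e: "e > 0"
  have "continuous_on (sphere 0 1) S" by (rule continuous_on_subset[OF c]) auto
  then obtain p where p: "\<And>z. cmod z = 1 \<Longrightarrow> \<bar>S z - Re (poly p z)\<bar> < e/2"
    using circle_poly_approx[of S "e/2"] e by (metis half_gt_zero)
  have "S 0 + Re (- poly p 0) \<le> e/2"
  proof (rule max_principle[of "cball 0 1" "\<lambda>w. S w + Re (- poly p w)" "ball 0 1"])
    show "continuous_on (cball 0 1) (\<lambda>w. S w + Re (- poly p w))" by (intro continuous_intros c)
    show "hsupp (\<lambda>w. S w + Re (- poly p w)) w" if "w \<in> ball 0 1" for w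
      by (rule hsupp_add_Re[of _ _ _ 1]) (use that supp in \<open>auto intro!: holomorphic_intros\<close>)
    show "S w + Re (- poly p w) \<le> e/2" if "w \<in> cball 0 1 - ball 0 1" for w
    proof -
      have "cmod w = 1" using that by auto
      from p[OF this] show ?thesis unfolding abs_less_iff by simp
    qed
  qed auto
  then have "S 0 \<le> Re (poly p 0) + e/2" by simp
  also have "Re (poly p 0) = (LINT t|circ. Re (poly p (cis t)))" by (rule mean_Re_poly[symmetric])
  also have "\<dots> \<le> (LINT t|circ. S (cis t) + e/2)"
  proof (rule integral_mono)
    have "continuous_on UNIV (\<lambda>t. S (cis t))"
      by (rule continuous_on_compose2[OF c]) (auto intro!: continuous_intros)
    then show "integrable circ (\<lambda>t. S (cis t) + e/2)" by (intro integrable_circ_continuous continuous_intros)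
    show "Re (poly p (cis t)) \<le> S (cis t) + e/2" for t using p[of "cis t"] unfolding abs_less_iff by simp
  qed (intro integrable_circ_continuous continuous_intros)
  also have "\<dots> = (LINT t|circ. S (cis t)) + e/2"
  proof -
    have "continuous_on UNIV (\<lambda>t. S (cis t))"
      by (rule continuous_on_compose2[OF c]) (auto intro!: continuous_intros)
    then show ?thesis by (subst Bochner_Integration.integral_add) (auto intro: integrable_circ_continuous)
  qed
  finally show "S 0 \<le> (LINT t|circ. S (cis t)) + e" by simp
qed

lemma hsupp_cmod_holomorphic_square:
  \<comment> \<open>Where \<open>f \<noteq> 0\<close> the square root \<open>q\<close> of \<open>f\<close> is holomorphic, and \<open>|q| \<ge> Re (c q)\<close> for unimodular \<open>c\<close>.\<close>
  assumes f: "f holomorphic_on ball w e" "e > 0"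
  shows "hsupp (\<lambda>z. sqrt (cmod (f z))) w"
proof (cases "f w = 0")
  case True
  show ?thesis by (rule hsuppI[of 1 "\<lambda>_. 0"]) (auto simp: True)
next
  case False
  have "continuous_on (ball w e) f" by (rule holomorphic_on_imp_continuous_on[OF f(1)])
  then obtain d where d: "d > 0" "\<And>z. z \<in> ball w d \<Longrightarrow> f z \<noteq> 0" "d \<le> e"
  proof -
    have "isCont f w" using f by (intro holomorphic_on_imp_continuous_on[OF f(1), THEN continuous_on_interior]) auto
    then obtain d where "d > 0" "\<forall>z. dist w z < d \<longrightarrow> f z \<noteq> 0"
      using continuous_at_avoid[of w f 0] False by blast
    then show ?thesis using that[of "min d e"] f by auto
  qed
  obtain q where q: "q holomorphic_on ball w d" "\<And>z. z \<in> ball w d \<Longrightarrow> f z = (q z)\<^sup>2"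
  proof (rule contractible_imp_holomorphic_sqrt[of f "ball w d"])
    show "f holomorphic_on ball w d" by (rule holomorphic_on_subset[OF f(1)]) (use d in auto)
    show "contractible (ball w d)" by (intro convex_imp_contractible convex_ball)
  qed (use d in auto)
  have sq: "sqrt (cmod (f z)) = cmod (q z)" if "z \<in> ball w d" for z
    using q(2)[OF that] by (simp add: norm_power real_sqrt_abs)
  have qw: "q w \<noteq> 0" using q(2)[of w] False d by auto
  define c where "c = cnj (q w) / of_real (cmod (q w))"
  have c1: "cmod c = 1" using qw by (simp add: c_def norm_divide)
  show ?thesis
  proof (rule hsuppI[of d "\<lambda>z. c * q z"])
    show "Re (c * q w) = sqrt (cmod (f w))"
    proof -
      have "c * q w = of_real ((cmod (q w))\<^sup>2 / cmod (q w))"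
        unfolding c_def of_real_divide complex_norm_square by simp
      then show ?thesis using sq[of w] d qw by (simp add: power2_eq_square)
    qed
    show "Re (c * q z) \<le> sqrt (cmod (f z))" if "z \<in> ball w d" for z
      using complex_Re_le_cmod[of "c * q z"] sq[OF that] c1 by (simp add: norm_mult)
  qed (use d q in \<open>auto intro!: holomorphic_intros\<close>)
qed

section \<open>Boundary values in the Hardy space \<open>H\<^sup>1\<close>\<close>

lemma afun_eqI:
  assumes "analytic_disk a" "analytic_disk b" "\<And>z. cmod z < 1 \<Longrightarrow> ev a z = ev b z"
  shows "a = b"
proof
  fix n
  have "fc (\<lambda>t. evc a (1/2) t) (int n) = fc (\<lambda>t. evc b (1/2) t) (int n)"
    by (intro arg_cong2[where f = fc] ext assms) (auto simp: norm_mult)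
  then show "a n = b n"
    using fc_dilation[OF assms(1), of "1/2" "int n"] fc_dilation[OF assms(2), of "1/2" "int n"] by simp
qed

lemma poly_afun:
  fixes p :: "complex poly"
  shows "analytic_disk (coeff p)" "ev (coeff p) z = poly p z"
    "(\<lambda>k. (cmod (coeff p k))\<^sup>2) sums (LINT t|circ. (cmod (poly p (cis t)))\<^sup>2)"
proof -
  have fin: "(\<lambda>k. c k * coeff p k * z ^ k) sums (\<Sum>k\<le>degree p. c k * coeff p k * z ^ k)" for c z
    by (rule sums_finite) (auto simp: coeff_eq_0)
  have "summable (\<lambda>k. coeff p k * z ^ k)" for z using fin[of "\<lambda>_. 1"] by (auto simp: sums_iff)
  then show "analytic_disk (coeff p)" by (intro analytic_diskI)
  show evp: "ev (coeff p) z = poly p z" for z using fin[of "\<lambda>_. 1"] by (simp add: ev_def sums_iff poly_altdef)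
  \<comment> \<open>Parseval is available for radii below 1 only; scaling the coefficients by 2^k
    turns the unit circle for p into the circle of radius 1/2 for q.\<close>
  define q where "q k = 2 ^ k * coeff p k" for k
  have "summable (\<lambda>k. q k * z ^ k)" for z using fin[of "\<lambda>k. 2 ^ k"] by (auto simp: q_def sums_iff)
  then have q: "analytic_disk q" by (intro analytic_diskI)
  have "evc q (1/2) t = poly p (cis t)" for t
  proof -
    have "2 ^ k * coeff p k * (of_real (1/2) * cis t) ^ k = coeff p k * cis t ^ k" for k
      by (simp add: power_mult_distrib power_divide)
    then have "evc q (1/2) t = ev (coeff p) (cis t)" unfolding ev_def q_def by (simp only:)
    then show ?thesis unfolding evp .
  qed
  moreover have "(cmod (q k))\<^sup>2 * (1/2) ^ (2 * k) = (cmod (coeff p k))\<^sup>2" for k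
  proof -
    have "(2::real) ^ (k * 2) = 4 ^ k" using power_mult[of "2::real" 2 k] by (simp add: mult.commute)
    moreover have "(cmod (q k))\<^sup>2 * (1/2) ^ (2 * k) = (cmod (coeff p k))\<^sup>2 * 2 ^ (k * 2) / 4 ^ k"
      by (simp add: q_def norm_mult norm_power power_mult_distrib power_mult power_divide)
    ultimately show ?thesis by simp
  qed
  ultimately show "(\<lambda>k. (cmod (coeff p k))\<^sup>2) sums (LINT t|circ. (cmod (poly p (cis t)))\<^sup>2)"
    using parseval_dilation[OF q, of "1/2"] by simp
qed

text \<open>The mean of Re (p^2) is Re (p(0)^2), which is nonnegative as p(0) is real, and Re (p^2)
  = 2 (Re p)^2 - |p|^2. This is the L^2 bound for harmonic conjugation.\<close>

lemma mean_poly_Re: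
  fixes p :: "complex poly"
  assumes "Im (poly p 0) = 0"
  shows "(LINT t|circ. (cmod (poly p (cis t)))\<^sup>2) \<le> 2 * (LINT t|circ. (Re (poly p (cis t)))\<^sup>2)"
proof -
  have i: "integrable circ (\<lambda>t. (cmod (poly p (cis t)))\<^sup>2)" "integrable circ (\<lambda>t. (Re (poly p (cis t)))\<^sup>2)"
    by (intro integrable_circ_continuous continuous_intros)+
  have "Re (poly (p * p) 0) \<ge> 0" using assms by simp
  then have "0 \<le> (LINT t|circ. Re (poly (p * p) (cis t)))" by (simp only: mean_Re_poly)
  also have "\<dots> = (LINT t|circ. 2 * (Re (poly p (cis t)))\<^sup>2 - (cmod (poly p (cis t)))\<^sup>2)"
    by (intro Bochner_Integration.integral_cong) (simp_all add: cmod_power2, simp add: power2_eq_square)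
  also have "\<dots> = 2 * (LINT t|circ. (Re (poly p (cis t)))\<^sup>2) - (LINT t|circ. (cmod (poly p (cis t)))\<^sup>2)"
    using i by simp
  finally show ?thesis by simp
qed

lemma Hp1_D:
  assumes "f \<in> Hp 1"
  obtains M where "M \<ge> 0" "\<And>r. 0 \<le> r \<Longrightarrow> r < 1 \<Longrightarrow> (LINT t|circ. cmod (evc f r t)) \<le> M"
proof -
  have f: "analytic_disk f" "bdd_above (pmean 1 f ` {0..<1})" using assms by (auto simp: Hp_def)
  then obtain M where M: "\<forall>r\<in>{0..<1}. pmean 1 f r \<le> M" unfolding bdd_above_def by blast
  have 1: "(LINT t|circ. cmod (evc f r t)) \<le> M" if "0 \<le> r" "r < 1" for r
    using M that by (simp add: pmean1[OF f(1)])
  moreover have "M \<ge> 0" using 1[of 0] by (simp) (smt (verit) norm_ge_zero)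
  ultimately show ?thesis using that by blast
qed

lemma Hp2_bounded_mean:
  assumes "v holomorphic_on ball 0 1" "\<And>r. 0 \<le> r \<Longrightarrow> r < 1 \<Longrightarrow> (LINT t|circ. (cmod (v (of_real r * cis t)))\<^sup>2) \<le> K"
  obtains a where "a \<in> Hp 2" "\<And>z. cmod z < 1 \<Longrightarrow> ev a z = v z"
proof -
  obtain a where a: "analytic_disk a" "\<And>z. cmod z < 1 \<Longrightarrow> ev a z = v z" using holomorphic_afun[OF assms(1)] by blast
  have "pmean 2 a r \<le> K" if r: "0 \<le> r" "r < 1" for r
  proof -
    have "evc a r t = v (of_real r * cis t)" for t by (rule a(2)) (use r in \<open>simp add: norm_mult\<close>)
    then show ?thesis using assms(2)[OF r] by (simp add: pmean2[OF a(1) r])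
  qed
  then have "a \<in> Hp 2" using Hp2_D(1)[OF a(1)] Hp2_iff by blast
  then show ?thesis using that a(2) by blast
qed

text \<open>Polynomial majorants of \<open>sqrt |f|\<close> with controlled \<open>L\<^sup>2\<close> norm; their limit
  is an outer-like function dividing \<open>f\<close>, which replaces the Blaschke factorisation.\<close>
lemma sqrt_majorant:
  assumes f: "analytic_disk f" and r: "0 \<le> r" "r < 1" and M: "(LINT t|circ. cmod (evc f r t)) \<le> M"
  obtains p where "\<And>z. cmod z \<le> 1 \<Longrightarrow> sqrt (cmod (ev f (of_real r * z))) + 1 \<le> Re (poly p z)"
    "(LINT t|circ. (cmod (poly p (cis t)))\<^sup>2) \<le> 4 * M + 16"
proof -
  define \<phi> where "\<phi> z = sqrt (cmod (ev f (of_real r * z)))" for z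
  have small: "cmod (of_real r * z) < 1" if "cmod z \<le> 1" for z
  proof -
    have "r * cmod z \<le> r * 1" using that r by (intro mult_left_mono) auto
    then show ?thesis using r by (simp add: norm_mult)
  qed
  have c: "continuous_on (cball 0 1) \<phi>" unfolding \<phi>_def
    by (intro continuous_on_real_sqrt continuous_on_norm continuous_on_compose2[OF holomorphic_on_imp_continuous_on[OF ev_holomorphic[OF f]]] continuous_intros)
       (use small in auto)
  \<comment> \<open>The shift 3/2 with tolerance 1/2 puts Re p between \<open>\<phi>\<close> + 1 and
    \<open>\<phi>\<close> + 2: the lower bound keeps the later divisor away from zero, the upper one
    controls the L^2 norm.\<close>
  have "continuous_on (sphere 0 1) (\<lambda>z. \<phi> z + 3/2)" by (intro continuous_intros continuous_on_subset[OF c]) auto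
  then obtain p where p: "\<And>z. cmod z = 1 \<Longrightarrow> \<bar>\<phi> z + 3/2 - Re (poly p z)\<bar> < 1/2" "Im (poly p 0) = 0"
    using circle_poly_approx[of "\<lambda>z. \<phi> z + 3/2" "1/2"] by auto
  have pb: "\<phi> z + 1 \<le> Re (poly p z)" "Re (poly p z) \<le> \<phi> z + 2" if "cmod z = 1" for z
    using p(1)[OF that] unfolding abs_less_iff by linarith+
  have 1: "\<phi> z + Re (- poly p z) \<le> -1" if z: "cmod z \<le> 1" for z
  proof (rule max_principle[of "cball 0 1" "\<lambda>w. \<phi> w + Re (- poly p w)" "ball 0 1"])
    show "continuous_on (cball 0 1) (\<lambda>w. \<phi> w + Re (- poly p w))" by (intro continuous_intros c)
    show "\<phi> w + Re (- poly p w) \<le> -1" if "w \<in> cball 0 1 - ball 0 1" for w using pb(1)[of w] that by simp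
    show "hsupp (\<lambda>w. \<phi> w + Re (- poly p w)) w" if w: "w \<in> ball 0 1" for w
    proof (rule hsupp_add_Re[of _ _ _ 1])
      have sub: "ball w (1 - cmod w) \<subseteq> ball 0 1"
      proof
        fix z assume "z \<in> ball w (1 - cmod w)"
        then show "z \<in> ball 0 1" using norm_triangle_ineq4[of z "z - w"] norm_triangle_ineq[of w "z - w"] by (simp add: dist_norm norm_minus_commute)
      qed
      have "(\<lambda>z. ev f (of_real r * z)) holomorphic_on ball w (1 - cmod w)"
      proof (rule holomorphic_on_compose_gen[of "\<lambda>z. of_real r * z" _ "ev f", unfolded o_def])
        show "ev f holomorphic_on ball 0 1" by (rule ev_holomorphic[OF f])
        show "(\<lambda>z. of_real r * z) ` ball w (1 - cmod w) \<subseteq> ball 0 1"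
        proof (intro image_subsetI)
          fix z assume "z \<in> ball w (1 - cmod w)"
          then have "cmod z \<le> 1" using sub by force
          then show "of_real r * z \<in> ball 0 1" using small by simp
        qed
      qed (intro holomorphic_intros)
      then show "hsupp \<phi> w" unfolding \<phi>_def using w by (intro hsupp_cmod_holomorphic_square[where e = "1 - cmod w"]) auto
    qed (auto intro!: holomorphic_intros)
  qed (use z in auto)
  have i1: "integrable circ (\<lambda>t. cmod (evc f r t))"
    by (intro integrable_circ_continuous continuous_intros continuous_ev_circle f r)
  have "(LINT t|circ. (cmod (poly p (cis t)))\<^sup>2) \<le> 2 * (LINT t|circ. (Re (poly p (cis t)))\<^sup>2)"
    by (rule mean_poly_Re[OF p(2)])
  also have "(LINT t|circ. (Re (poly p (cis t)))\<^sup>2) \<le> (LINT t|circ. 2 * cmod (evc f r t) + 8)"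
  proof (rule integral_mono)
    show "(Re (poly p (cis t)))\<^sup>2 \<le> 2 * cmod (evc f r t) + 8" for t
    proof -
      have ph: "(\<phi> (cis t))\<^sup>2 = cmod (evc f r t)" "0 \<le> \<phi> (cis t)" by (simp_all add: \<phi>_def)
      have "(Re (poly p (cis t)))\<^sup>2 \<le> (\<phi> (cis t) + 2)\<^sup>2" using pb[of "cis t"] ph(2) by (intro power_mono) auto
      also have "\<dots> \<le> 2 * (\<phi> (cis t))\<^sup>2 + 8"
        using zero_le_power2[of "\<phi> (cis t) - 2"] by (simp add: power2_eq_square algebra_simps)
      finally show ?thesis using ph by simp
    qed
  qed (use i1 in \<open>auto intro!: integrable_circ_continuous continuous_intros\<close>)
  also have "\<dots> = 2 * (LINT t|circ. cmod (evc f r t)) + 8" using i1 by simp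
  finally have "(LINT t|circ. (cmod (poly p (cis t)))\<^sup>2) \<le> 4 * M + 16" using M by simp
  moreover have "\<phi> z + 1 \<le> Re (poly p z)" if "cmod z \<le> 1" for z using 1[OF that] by simp
  ultimately show ?thesis using that unfolding \<phi>_def by blast
qed

text \<open>A locally uniform limit V of the majorants satisfies Re V >= sqrt |f| + 1. Hence V has
  no zeros, even where f vanishes, and |f / V| <= |V|, so the quotient inherits the H^2 bound of
  V.\<close>

lemma H1_factorization:
  assumes "f \<in> Hp 1"
  obtains u v where "u \<in> Hp 2" "v \<in> Hp 2" "f = amult u v"
proof -
  have f: "analytic_disk f" using assms by (simp add: Hp_def)
  obtain M where M: "M \<ge> 0" "\<And>r. 0 \<le> r \<Longrightarrow> r < 1 \<Longrightarrow> (LINT t|circ. cmod (evc f r t)) \<le> M"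
    using Hp1_D[OF assms] by blast
  define K where "K = 4 * M + 16"
  have K: "K \<ge> 0" using M by (simp add: K_def)
  define \<rho> where "\<rho> j = 1 - 1 / real (Suc (Suc j))" for j
  have \<rho>: "0 \<le> \<rho> j" "\<rho> j < 1" for j by (auto simp: \<rho>_def)
  have \<rho>1: "\<rho> \<longlonglongrightarrow> 1"
    unfolding \<rho>_def using LIMSEQ_Suc[OF LIMSEQ_inverse_real_of_nat_add_minus[of 1]] by (simp add: inverse_eq_divide)
  have "\<exists>p. (\<forall>z. cmod z \<le> 1 \<longrightarrow> sqrt (cmod (ev f (of_real (\<rho> j) * z))) + 1 \<le> Re (poly p z)) \<and>
    (LINT t|circ. (cmod (poly p (cis t)))\<^sup>2) \<le> K" for j
    using sqrt_majorant[OF f \<rho> M(2)[OF \<rho>]] unfolding K_def by metis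
  then obtain p where p: "\<And>j z. cmod z \<le> 1 \<Longrightarrow> sqrt (cmod (ev f (of_real (\<rho> j) * z))) + 1 \<le> Re (poly (p j) z)"
    "\<And>j. (LINT t|circ. (cmod (poly (p j) (cis t)))\<^sup>2) \<le> K" by metis
  have sK: "summable (\<lambda>k. (cmod (coeff (p j) k))\<^sup>2)" "(\<Sum>k. (cmod (coeff (p j) k))\<^sup>2) \<le> K" for j
    using poly_afun(3)[of "p j"] p(2)[of j] by (simp_all add: sums_iff)
  have cK: "cmod (coeff (p j) k) \<le> sqrt K" for j k
  proof (rule real_le_rsqrt)
    have "(cmod (coeff (p j) k))\<^sup>2 \<le> (\<Sum>k. (cmod (coeff (p j) k))\<^sup>2)"
      using sum_le_suminf[OF sK(1), of "{k}" j] by simp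
    then show "(cmod (coeff (p j) k))\<^sup>2 \<le> K" using sK(2)[of j] by simp
  qed
  have pbound: "cmod (poly (p j) z) \<le> sqrt K / (1 - cmod z)" if z: "cmod z < 1" for j z
  proof -
    have s: "summable (\<lambda>k. sqrt K * cmod z ^ k)" using z by (intro summable_mult summable_geometric) auto
    have le: "norm (coeff (p j) k * z ^ k) \<le> sqrt K * cmod z ^ k" for k
      using cK by (simp add: norm_mult norm_power mult_right_mono)
    have sn: "summable (\<lambda>k. norm (coeff (p j) k * z ^ k))"
      by (rule summable_comparison_test'[OF s, of 0]) (use le in simp)
    have "cmod (ev (coeff (p j)) z) \<le> (\<Sum>k. sqrt K * cmod z ^ k)"
      unfolding ev_def by (rule order.trans[OF summable_norm[OF sn] suminf_le[OF le sn s]])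
    also have "\<dots> = sqrt K / (1 - cmod z)"
      using z by (subst suminf_mult) (auto simp: suminf_geometric summable_geometric)
    finally show ?thesis by (simp add: poly_afun(2))
  qed
  have mb: "\<exists>B. \<forall>h\<in>range (\<lambda>j. poly (p j)). \<forall>z\<in>C. cmod (h z) \<le> B" if C: "compact C" "C \<subseteq> ball 0 1" for C
  proof (cases "C = {}")
    case False
    then obtain z0 where z0: "z0 \<in> C" "\<And>z. z \<in> C \<Longrightarrow> cmod z \<le> cmod z0"
      using continuous_attains_sup[of C cmod] C(1) continuous_on_norm_id by blast
    have "cmod (poly (p j) z) \<le> sqrt K / (1 - cmod z0)" if "z \<in> C" for j z
    proof -
      have "cmod z < 1" "cmod z0 < 1" using that C z0 by auto
      then have "cmod (poly (p j) z) \<le> sqrt K / (1 - cmod z)" by (intro pbound)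
      also have "\<dots> \<le> sqrt K / (1 - cmod z0)"
        using z0(2)[OF that] \<open>cmod z0 < 1\<close> K by (intro divide_left_mono) auto
      finally show ?thesis .
    qed
    then show ?thesis by blast
  qed auto
  obtain V s where V: "V holomorphic_on ball 0 1" "strict_mono s" "\<And>x. x \<in> ball 0 1 \<Longrightarrow> (\<lambda>n. poly (p (s n)) x) \<longlonglongrightarrow> V x"
  proof (rule Montel[of "ball 0 1" "range (\<lambda>j. poly (p j))" "\<lambda>j. poly (p j)"])
    show "\<And>h. h \<in> range (\<lambda>j. poly (p j)) \<Longrightarrow> h holomorphic_on ball 0 1" by (auto intro!: holomorphic_intros)
    show "\<And>C. compact C \<Longrightarrow> C \<subseteq> ball 0 1 \<Longrightarrow> \<exists>B. \<forall>h\<in>range (\<lambda>j. poly (p j)). \<forall>z\<in>C. cmod (h z) \<le> B" by (rule mb)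
  qed (auto simp: o_def)
  have lim: "(\<lambda>n. poly (p (s n)) z) \<longlonglongrightarrow> V z" if "cmod z < 1" for z using V(3) that by auto
  have VK: "(LINT t|circ. (cmod (V (of_real r * cis t)))\<^sup>2) \<le> K" if r: "0 \<le> r" "r < 1" for r
  proof (rule tendsto_upperbound)
    show "(\<lambda>n. (LINT t|circ. (cmod (poly (p (s n)) (of_real r * cis t)))\<^sup>2)) \<longlonglongrightarrow> (LINT t|circ. (cmod (V (of_real r * cis t)))\<^sup>2)"
    proof (rule integral_dominated_convergence[where w = "\<lambda>t. (sqrt K / (1 - r))\<^sup>2"])
      have "continuous_on UNIV (\<lambda>t. V (of_real r * cis t))"
        by (rule continuous_on_compose2[OF holomorphic_on_imp_continuous_on[OF V(1)]])
          (use r in \<open>auto intro!: continuous_intros simp: norm_mult\<close>)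
      then show "(\<lambda>t. (cmod (V (of_real r * cis t)))\<^sup>2) \<in> borel_measurable circ"
        by (auto intro!: borel_measurable_continuous_onI continuous_intros)
      show "(\<lambda>t. (cmod (poly (p (s n)) (of_real r * cis t)))\<^sup>2) \<in> borel_measurable circ" for n
        by (auto intro!: borel_measurable_continuous_onI continuous_intros)
      show "AE t in circ. (\<lambda>n. (cmod (poly (p (s n)) (of_real r * cis t)))\<^sup>2) \<longlonglongrightarrow> (cmod (V (of_real r * cis t)))\<^sup>2"
        using r by (intro AE_I2 tendsto_intros lim) (simp add: norm_mult)
      show "AE t in circ. norm ((cmod (poly (p (s n)) (of_real r * cis t)))\<^sup>2) \<le> (sqrt K / (1 - r))\<^sup>2" for n
      proof (rule AE_I2)
        fix t
        have "cmod (poly (p (s n)) (of_real r * cis t)) \<le> sqrt K / (1 - r)"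
          using pbound[of "of_real r * cis t" "s n"] r by (simp add: norm_mult)
        then have "(cmod (poly (p (s n)) (of_real r * cis t)))\<^sup>2 \<le> (sqrt K / (1 - r))\<^sup>2" by (intro power_mono) auto
        then show "norm ((cmod (poly (p (s n)) (of_real r * cis t)))\<^sup>2) \<le> (sqrt K / (1 - r))\<^sup>2" by simp
      qed
    qed simp
    show "\<forall>\<^sub>F n in sequentially. (LINT t|circ. (cmod (poly (p (s n)) (of_real r * cis t)))\<^sup>2) \<le> K"
    proof (intro always_eventually allI)
      fix n
      have P: "(\<lambda>k. (cmod (coeff (p (s n)) k))\<^sup>2 * r ^ (2*k)) sums (LINT t|circ. (cmod (poly (p (s n)) (of_real r * cis t)))\<^sup>2)"
        using parseval_dilation[OF poly_afun(1) r] by (simp add: poly_afun(2))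
      have "(LINT t|circ. (cmod (poly (p (s n)) (of_real r * cis t)))\<^sup>2) \<le> (\<Sum>k. (cmod (coeff (p (s n)) k))\<^sup>2)"
        unfolding sums_unique[OF P] using r by (intro suminf_le sK(1) sums_summable[OF P] mult_left_le power_le_one) auto
      then show "(LINT t|circ. (cmod (poly (p (s n)) (of_real r * cis t)))\<^sup>2) \<le> K" using sK(2)[of "s n"] by simp
    qed
  qed simp
  have ReV: "sqrt (cmod (ev f z)) + 1 \<le> Re (V z)" if z: "cmod z < 1" for z
  proof (rule LIMSEQ_le)
    show "(\<lambda>n. Re (poly (p (s n)) z)) \<longlonglongrightarrow> Re (V z)" by (intro tendsto_intros lim z)
    have "(\<lambda>n. \<rho> (s n)) \<longlonglongrightarrow> 1" using LIMSEQ_subseq_LIMSEQ[OF \<rho>1 V(2)] by (simp add: o_def)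
    then have "(\<lambda>n. of_real (\<rho> (s n)) * z) \<longlonglongrightarrow> of_real 1 * z" by (intro tendsto_intros)
    moreover have "isCont (ev f) (of_real 1 * z)"
      using holomorphic_on_imp_continuous_on[OF ev_holomorphic[OF f]] z by (intro continuous_on_interior[of "ball 0 1"]) auto
    ultimately have "(\<lambda>n. ev f (of_real (\<rho> (s n)) * z)) \<longlonglongrightarrow> ev f (of_real 1 * z)" by (rule isCont_tendsto_compose[rotated])
    then show "(\<lambda>n. sqrt (cmod (ev f (of_real (\<rho> (s n)) * z))) + 1) \<longlonglongrightarrow> sqrt (cmod (ev f z)) + 1"
      by (intro tendsto_intros) simp
    show "\<exists>N. \<forall>n\<ge>N. sqrt (cmod (ev f (of_real (\<rho> (s n)) * z))) + 1 \<le> Re (poly (p (s n)) z)" using p(1) z by auto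
  qed
  have V0: "V z \<noteq> 0" if z: "cmod z < 1" for z
  proof
    assume "V z = 0"
    then have "sqrt (cmod (ev f z)) + 1 \<le> 0" using ReV[OF z] by simp
    then show False by (smt (verit) real_sqrt_ge_zero norm_ge_zero)
  qed
  have fV: "cmod (ev f z / V z) \<le> cmod (V z)" if z: "cmod z < 1" for z
  proof -
    have "sqrt (cmod (ev f z)) \<le> cmod (V z)" using ReV[OF z] complex_Re_le_cmod[of "V z"] by linarith
    then have "cmod (ev f z) \<le> (cmod (V z))\<^sup>2" by (simp add: sqrt_le_D)
    then show ?thesis using V0[OF z] by (simp add: norm_divide power2_eq_square divide_le_eq)
  qed
  have hq: "(\<lambda>z. ev f z / V z) holomorphic_on ball 0 1"
    by (intro holomorphic_intros ev_holomorphic f V) (use V0 in auto)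
  have qK: "(LINT t|circ. (cmod (evc f r t / V (of_real r * cis t)))\<^sup>2) \<le> K" if r: "0 \<le> r" "r < 1" for r
  proof (rule order.trans[OF integral_mono VK[OF r]])
    have c: "continuous_on UNIV (\<lambda>t. V (of_real r * cis t))" "continuous_on UNIV (\<lambda>t. evc f r t / V (of_real r * cis t))"
      by (rule continuous_on_compose2[OF holomorphic_on_imp_continuous_on[OF V(1)]] continuous_on_compose2[OF holomorphic_on_imp_continuous_on[OF hq]];
          use r in \<open>auto intro!: continuous_intros simp: norm_mult\<close>)+
    from c(1) show "integrable circ (\<lambda>t. (cmod (V (of_real r * cis t)))\<^sup>2)"
      by (intro integrable_circ_continuous continuous_on_power continuous_on_norm)
    from c(2) show "integrable circ (\<lambda>t. (cmod (evc f r t / V (of_real r * cis t)))\<^sup>2)"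
      by (intro integrable_circ_continuous continuous_on_power continuous_on_norm)
    show "(cmod (evc f r t / V (of_real r * cis t)))\<^sup>2 \<le> (cmod (V (of_real r * cis t)))\<^sup>2" for t
      using r by (intro power_mono fV) (auto simp: norm_mult)
  qed
  obtain v where v: "v \<in> Hp 2" "\<And>z. cmod z < 1 \<Longrightarrow> ev v z = V z" using Hp2_bounded_mean[OF V(1) VK] by blast
  obtain u where u: "u \<in> Hp 2" "\<And>z. cmod z < 1 \<Longrightarrow> ev u z = ev f z / V z" using Hp2_bounded_mean[OF hq qK] by blast
  have uv: "analytic_disk u" "analytic_disk v" using u v by (auto simp: Hp_def)
  have "f = amult u v"
    by (rule afun_eqI[OF f analytic_disk_amult[OF uv]]) (simp add: ev_amult[OF uv] u v V0)
  then show ?thesis using that u v by blast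
qed

lemma Hp2_L2_le:
  assumes "a \<in> Hp 2" "0 \<le> r" "r < 1"
  shows "(LINT t|circ. (cmod (evc a r t))\<^sup>2) \<le> (\<Sum>k. (cmod (a k))\<^sup>2)"
proof -
  have a: "analytic_disk a" using assms(1) by (simp add: Hp_def)
  have s: "summable (\<lambda>k. (cmod (a k))\<^sup>2)" using assms(1) Hp2_iff by simp
  note P = parseval_dilation[OF a assms(2,3)]
  have "(\<Sum>k. (cmod (a k))\<^sup>2 * r ^ (2 * k)) \<le> (\<Sum>k. (cmod (a k))\<^sup>2)"
    using assms by (intro suminf_le s sums_summable[OF P] mult_left_le power_le_one) auto
  then show ?thesis using P by (simp add: sums_iff)
qed

lemma eventually_radius: "\<forall>\<^sub>F r in at_left (1::real). 0 \<le> r \<and> r < 1"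
  using eventually_at_leftI[of 0 1 "\<lambda>r::real. 0 \<le> r \<and> r < 1"] by auto

lemma product_L1_dilation:
  assumes u: "u \<in> Hp 2" and v: "v \<in> Hp 2"
  shows "((\<lambda>r. (LINT t|circ. cmod (bv u t * bv v t - evc u r t * evc v r t))) \<longlongrightarrow> 0) (at_left 1)"
    and "\<And>r. 0 \<le> r \<Longrightarrow> r < 1 \<Longrightarrow> integrable circ (\<lambda>t. bv u t * bv v t - evc u r t * evc v r t)"
proof -
  note U = Hp2_boundary[OF u] and V = Hp2_boundary[OF v]
  note [measurable] = U(3) V(3)
  define A where "A = (LINT t|circ. (cmod (bv u t))\<^sup>2)"
  define B where "B = (\<Sum>k. (cmod (v k))\<^sup>2)"
  have main: "integrable circ (\<lambda>t. bv u t * bv v t - evc u r t * evc v r t) \<and>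
     (LINT t|circ. cmod (bv u t * bv v t - evc u r t * evc v r t))
     \<le> sqrt A * sqrt (defect v r) + sqrt (defect u r) * sqrt B" if r: "0 \<le> r" "r < 1" for r
  proof -
    have [measurable]: "(\<lambda>t. evc u r t) \<in> borel_measurable borel" "(\<lambda>t. evc v r t) \<in> borel_measurable borel"
      by (intro ev_circle_measurable r U V)+
    have iv: "integrable circ (\<lambda>t. (cmod (evc v r t))\<^sup>2)"
      by (intro integrable_circ_continuous continuous_intros continuous_ev_circle V r)
    note c1 = circ_Cauchy_Schwarz[of "bv u" "\<lambda>t. bv v t - evc v r t", OF _ _ U(7) V(9)[OF r]]
    note c2 = circ_Cauchy_Schwarz[of "\<lambda>t. bv u t - evc u r t" "\<lambda>t. evc v r t", OF _ _ U(9)[OF r] iv]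
    have eq: "bv u t * bv v t - evc u r t * evc v r t =
       bv u t * (bv v t - evc v r t) + (bv u t - evc u r t) * evc v r t" for t
      by (simp add: algebra_simps)
    have i: "integrable circ (\<lambda>t. bv u t * (bv v t - evc v r t))"
      "integrable circ (\<lambda>t. (bv u t - evc u r t) * evc v r t)"
      by (rule c1(1) c2(1); measurable)+
    have int: "integrable circ (\<lambda>t. bv u t * bv v t - evc u r t * evc v r t)"
      unfolding eq using i by simp
    have "(LINT t|circ. cmod (bv u t * bv v t - evc u r t * evc v r t)) \<le>
      (LINT t|circ. cmod (bv u t * (bv v t - evc v r t)) + cmod ((bv u t - evc u r t) * evc v r t))"
      unfolding eq by (intro integral_mono) (use i in \<open>auto intro: norm_triangle_ineq\<close>)
    also have "\<dots> = (LINT t|circ. cmod (bv u t * (bv v t - evc v r t))) + (LINT t|circ. cmod ((bv u t - evc u r t) * evc v r t))"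
      using i by (intro Bochner_Integration.integral_add) auto
    also have "\<dots> \<le> sqrt A * sqrt (defect v r) + sqrt (defect u r) * sqrt B"
    proof (intro add_mono)
      have "(LINT t|circ. cmod (bv u t * (bv v t - evc v r t))) \<le>
        sqrt A * sqrt ((LINT t|circ. (cmod (bv v t - evc v r t))\<^sup>2))"
        unfolding A_def by (rule c1(2)) measurable
      also have "\<dots> \<le> sqrt A * sqrt (defect v r)"
        using V(8)[OF r] by (intro mult_left_mono) (auto simp: A_def)
      finally show "(LINT t|circ. cmod (bv u t * (bv v t - evc v r t))) \<le> sqrt A * sqrt (defect v r)" .
      have "(LINT t|circ. cmod ((bv u t - evc u r t) * evc v r t)) \<le>
        sqrt ((LINT t|circ. (cmod (bv u t - evc u r t))\<^sup>2)) * sqrt ((LINT t|circ. (cmod (evc v r t))\<^sup>2))"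
        by (rule c2(2)) measurable
      also have "\<dots> \<le> sqrt (defect u r) * sqrt B"
        using U(8)[OF r] Hp2_L2_le[OF v r]
        by (intro mult_mono) (auto simp: B_def intro: order.trans[OF integral_nonneg_AE U(8)[OF r]])
      finally show "(LINT t|circ. cmod ((bv u t - evc u r t) * evc v r t)) \<le> sqrt (defect u r) * sqrt B" .
    qed
    finally show ?thesis using int by simp
  qed
  show "\<And>r. 0 \<le> r \<Longrightarrow> r < 1 \<Longrightarrow> integrable circ (\<lambda>t. bv u t * bv v t - evc u r t * evc v r t)"
    using main by blast
  have s: "summable (\<lambda>k. (cmod (u k))\<^sup>2)" "summable (\<lambda>k. (cmod (v k))\<^sup>2)" using u v Hp2_iff by auto
  have "((\<lambda>r. sqrt A * sqrt (defect v r) + sqrt (defect u r) * sqrt B) \<longlongrightarrow> sqrt A * sqrt 0 + sqrt 0 * sqrt B) (at_left 1)"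
    by (intro tendsto_intros defect_tendsto s)
  then have lim: "((\<lambda>r. sqrt A * sqrt (defect v r) + sqrt (defect u r) * sqrt B) \<longlongrightarrow> 0) (at_left 1)" by simp
  show "((\<lambda>r. (LINT t|circ. cmod (bv u t * bv v t - evc u r t * evc v r t))) \<longlongrightarrow> 0) (at_left 1)"
  proof (rule tendsto_sandwich[OF _ _ tendsto_const lim])
    show "\<forall>\<^sub>F r in at_left 1. (LINT t|circ. cmod (bv u t * bv v t - evc u r t * evc v r t)) \<le> sqrt A * sqrt (defect v r) + sqrt (defect u r) * sqrt B"
      using eventually_radius by eventually_elim (use main in blast)
  qed simp
qed

lemma radlim_mult: "analytic_disk u \<Longrightarrow> analytic_disk v \<Longrightarrow> radlim u t L \<Longrightarrow> radlim v t M \<Longrightarrow> radlim (amult u v) t (L * M)"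
  unfolding radlim_def
proof (rule Lim_transform_eventually, rule tendsto_mult, assumption, assumption)
  assume "analytic_disk u" "analytic_disk v"
  then show "\<forall>\<^sub>F r in at_left 1. evc u r t * evc v r t = evc (amult u v) r t"
    using eventually_radius by (elim eventually_mono) (simp add: ev_amult norm_mult)
qed

text \<open>Bounded L^1 means by themselves would only yield a boundary measure. Factorising into
  two H^2 functions gives L^1 convergence of the dilations, through Cauchy--Schwarz, and with it the
  Fourier coefficients.\<close>

lemma Hp1_boundary:
  assumes "a \<in> Hp 1"
  shows "analytic_disk a" "AE t in circ. radlim a t (bv a t)" "bv a \<in> borel_measurable borel"
    "integrable circ (bv a)" "\<And>n. fc (bv a) (int n) = a n" "\<And>n. n < 0 \<Longrightarrow> fc (bv a) n = 0"
    "((\<lambda>r. (LINT t|circ. cmod (bv a t - evc a r t))) \<longlongrightarrow> 0) (at_left 1)"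
proof -
  obtain u v where uv: "u \<in> Hp 2" "v \<in> Hp 2" "a = amult u v" using H1_factorization[OF assms] by blast
  note U = Hp2_boundary[OF uv(1)] and V = Hp2_boundary[OF uv(2)]
  show a: "analytic_disk a" using assms by (simp add: Hp_def)
  show bm [measurable]: "bv a \<in> borel_measurable borel" by (rule bv_measurable[OF a])
  note [measurable] = U(3) V(3)
  have "AE t in circ. radlim a t (bv u t * bv v t)"
    using U(2) V(2) unfolding uv(3) by eventually_elim (intro radlim_mult U V)
  note rl = radlim_bv_AE[OF this]
  show "AE t in circ. radlim a t (bv a t)" by (rule rl(2))
  have "integrable circ (\<lambda>t. bv u t * bv v t)" by (rule circ_Cauchy_Schwarz(1)[OF U(3) V(3) U(7) V(7)])
  then show int: "integrable circ (bv a)" using rl(1) by (subst integrable_cong_AE[of _ _ "\<lambda>t. bv u t * bv v t"]) auto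
  have eva: "evc a r t = evc u r t * evc v r t" if "0 \<le> r" "r < 1" for r t
    unfolding uv(3) using that by (intro ev_amult U V) (simp add: norm_mult)
  show lim: "((\<lambda>r. (LINT t|circ. cmod (bv a t - evc a r t))) \<longlongrightarrow> 0) (at_left 1)"
  proof (rule Lim_transform_eventually[OF product_L1_dilation(1)[OF uv(1,2)]])
    show "\<forall>\<^sub>F r in at_left 1. (LINT t|circ. cmod (bv u t * bv v t - evc u r t * evc v r t)) =
        (LINT t|circ. cmod (bv a t - evc a r t))"
      using eventually_radius
    proof eventually_elim
      case (elim r)
      then have [measurable]: "(\<lambda>t. evc u r t) \<in> borel_measurable borel" "(\<lambda>t. evc v r t) \<in> borel_measurable borel" "(\<lambda>t. evc a r t) \<in> borel_measurable borel"
        by (intro ev_circle_measurable U V a; simp)+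
      show ?case
        by (rule integral_cong_AE) (use rl(1) eva elim in \<open>auto elim!: eventually_mono\<close>)
    qed
  qed
  have fcn: "fc (bv a) n = (if n \<ge> 0 then a (nat n) else 0)" for n
  proof (rule tendsto_unique[of "at_left (1::real)"])
    show "((\<lambda>r. fc (\<lambda>t. evc a r t) n) \<longlongrightarrow> fc (bv a) n) (at_left 1)"
    proof (rule LIM_zero_cancel, rule Lim_null_comparison[OF _ lim])
      show "\<forall>\<^sub>F r in at_left 1. norm (fc (\<lambda>t. evc a r t) n - fc (bv a) n) \<le> (LINT t|circ. cmod (bv a t - evc a r t))"
        using eventually_radius
      proof eventually_elim
        case (elim r)
        have "fc (bv a) n - fc (\<lambda>t. evc a r t) n = fc (\<lambda>t. bv a t - evc a r t) n"
          using elim by (intro fc_diff[symmetric] int integrable_circ_continuous continuous_ev_circle a) auto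
        then show ?case using norm_fc_le by (metis norm_minus_commute)
      qed
    qed
    have "((\<lambda>r. if n \<ge> 0 then a (nat n) * of_real r ^ nat n else 0) \<longlongrightarrow> (if n \<ge> 0 then a (nat n) else 0)) (at_left (1::real))"
      by (auto intro!: tendsto_eq_intros)
    then show "((\<lambda>r. fc (\<lambda>t. evc a r t) n) \<longlongrightarrow> (if n \<ge> 0 then a (nat n) else 0)) (at_left (1::real))"
    proof (rule Lim_transform_eventually)
      show "\<forall>\<^sub>F r in at_left 1. (if n \<ge> 0 then a (nat n) * of_real r ^ nat n else 0) = fc (\<lambda>t. evc a r t) n"
        using eventually_radius by eventually_elim (subst fc_dilation[OF a]; simp)
    qed
  qed simp
  then show "\<And>n. fc (bv a) (int n) = a n" "\<And>n. n < 0 \<Longrightarrow> fc (bv a) n = 0" by auto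
qed

section \<open>The H^1 norm as a boundary norm\<close>

interpretation circ2: pair_sigma_finite circ circ ..

text \<open>The nonnegative integral on the left allows Tonelli's theorem before anything is known
  about measurability or integrability of the Poisson integral in t.\<close>

lemma pint_contraction:
  assumes F: "integrable circ F" and r: "0 \<le> r" "r < 1"
  shows "(\<integral>\<^sup>+t. ennreal (cmod (pint F r t)) \<partial>circ) \<le> ennreal ((LINT t|circ. cmod (F t)))"
proof -
  have [measurable]: "F \<in> borel_measurable borel" using borel_measurable_integrable[OF F] by simp
  have "(\<integral>\<^sup>+t. ennreal (cmod (pint F r t)) \<partial>circ) \<le> (\<integral>\<^sup>+t. (\<integral>\<^sup>+s. ennreal (pk r (t - s)) * ennreal (cmod (F s)) \<partial>circ) \<partial>circ)"
  proof (rule nn_integral_mono)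
    fix t
    have i: "integrable circ (\<lambda>s. pk r (t - s) * cmod (F s))" using integrable_pk[of "\<lambda>s. cmod (F s)", OF _ r] F by simp
    have "cmod (pint F r t) \<le> (LINT s|circ. cmod (of_real (pk r (t - s)) * F s))"
      unfolding pint_def by (rule integral_norm_bound)
    also have "\<dots> = (LINT s|circ. pk r (t - s) * cmod (F s))" using pk_nonneg[OF r] by (simp add: norm_mult)
    finally have "ennreal (cmod (pint F r t)) \<le> ennreal ((LINT s|circ. pk r (t - s) * cmod (F s)))" by (rule ennreal_leI)
    also have "\<dots> = (\<integral>\<^sup>+s. ennreal (pk r (t - s) * cmod (F s)) \<partial>circ)"
      by (rule nn_integral_eq_integral[symmetric, OF i]) (use pk_nonneg[OF r] in auto)
    finally show "ennreal (cmod (pint F r t)) \<le> (\<integral>\<^sup>+s. ennreal (pk r (t - s)) * ennreal (cmod (F s)) \<partial>circ)"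
      using pk_nonneg[OF r] by (simp add: ennreal_mult)
  qed
  also have "\<dots> = (\<integral>\<^sup>+s. (\<integral>\<^sup>+t. ennreal (pk r (t - s)) * ennreal (cmod (F s)) \<partial>circ) \<partial>circ)"
    by (rule circ2.Fubini'[of "\<lambda>s t. ennreal (pk r (t - s)) * ennreal (cmod (F s))"]) measurable
  also have "\<dots> = (\<integral>\<^sup>+s. ennreal (cmod (F s)) \<partial>circ)"
  proof (rule nn_integral_cong)
    fix s
    have i: "integrable circ (\<lambda>t. pk r (s - t))" using integrable_pk[of "\<lambda>s. 1::real", OF _ r] by simp
    have "(\<integral>\<^sup>+t. ennreal (pk r (t - s)) * ennreal (cmod (F s)) \<partial>circ) = (\<integral>\<^sup>+t. ennreal (pk r (s - t)) \<partial>circ) * ennreal (cmod (F s))"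
      using pk_periodic(2)[of r "_ - s"] by (subst nn_integral_multc) auto
    also have "(\<integral>\<^sup>+t. ennreal (pk r (s - t)) \<partial>circ) = ennreal ((LINT t|circ. pk r (s - t)))"
      by (rule nn_integral_eq_integral[OF i]) (use pk_nonneg[OF r] in auto)
    finally show "(\<integral>\<^sup>+t. ennreal (pk r (t - s)) * ennreal (cmod (F s)) \<partial>circ) = ennreal (cmod (F s))"
      by (simp add: pint_const[OF r])
  qed
  also have "\<dots> = ennreal ((LINT t|circ. cmod (F t)))"
    by (rule nn_integral_eq_integral) (use F in auto)
  finally show ?thesis .
qed

lemma pmean1_le:
  assumes F: "integrable circ F" and neg: "\<And>n. n < 0 \<Longrightarrow> fc F n = 0" and a: "\<And>n. fc F (int n) = a n"
    and r: "0 \<le> r" "r < 1"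
  shows "pmean 1 a r \<le> (LINT t|circ. cmod (F t))"
proof -
  have L: "analytic_disk a" "\<And>t. evc a r t = pint F r t"
    using L1_analytic_boundary(1,3)[of F a] F neg a r by blast+
  have "ennreal ((LINT t|circ. cmod (evc a r t))) = (\<integral>\<^sup>+t. ennreal (cmod (evc a r t)) \<partial>circ)"
    by (rule nn_integral_eq_integral[symmetric], intro integrable_circ_continuous continuous_intros continuous_ev_circle L(1) r) auto
  also have "\<dots> \<le> ennreal ((LINT t|circ. cmod (F t)))"
    unfolding L(2) by (rule pint_contraction[OF F r])
  finally show ?thesis unfolding pmean1[OF L(1) r] by (subst (asm) ennreal_le_iff) auto
qed

lemma Hp1_I:
  assumes F: "integrable circ F" and neg: "\<And>n. n < 0 \<Longrightarrow> fc F n = 0" and a: "\<And>n. fc F (int n) = a n"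
  shows "a \<in> Hp 1"
  unfolding Hp_def using L1_analytic_boundary(1)[OF F neg a] pmean1_le[OF F neg a]
  by (auto intro!: bdd_aboveI[of _ "(LINT t|circ. cmod (F t))"])

lemma hnorm1:
  assumes "a \<in> Hp 1"
  shows "hnorm 1 a = (LINT t|circ. cmod (bv a t))"
proof -
  note A = Hp1_boundary[OF assms]
  have up: "pmean 1 a r \<le> (LINT t|circ. cmod (bv a t))" if "0 \<le> r" "r < 1" for r
    by (rule pmean1_le[OF A(4) A(6,5) that])
  have bdd: "bdd_above (pmean 1 a ` {0..<1})" using up by (auto intro!: bdd_aboveI)
  have "(LINT t|circ. cmod (bv a t)) \<le> (SUP r\<in>{0..<1}. pmean 1 a r)"
  proof (rule tendsto_lowerbound)
    have "((\<lambda>r. (SUP r\<in>{0..<1}. pmean 1 a r) + (LINT t|circ. cmod (bv a t - evc a r t))) \<longlongrightarrow> (SUP r\<in>{0..<1}. pmean 1 a r) + 0) (at_left 1)"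
      by (intro tendsto_intros A)
    then show "((\<lambda>r. (SUP r\<in>{0..<1}. pmean 1 a r) + (LINT t|circ. cmod (bv a t - evc a r t))) \<longlongrightarrow> (SUP r\<in>{0..<1}. pmean 1 a r)) (at_left 1)" by simp
    show "\<forall>\<^sub>F r in at_left 1. (LINT t|circ. cmod (bv a t)) \<le> (SUP r\<in>{0..<1}. pmean 1 a r) + (LINT t|circ. cmod (bv a t - evc a r t))"
      using eventually_radius
    proof eventually_elim
      case (elim r)
      have i: "integrable circ (\<lambda>t. evc a r t)" using elim by (intro integrable_circ_continuous continuous_ev_circle A) auto
      have "(LINT t|circ. cmod (bv a t)) \<le> (LINT t|circ. cmod (evc a r t) + cmod (bv a t - evc a r t))"
      proof (rule integral_mono)
        show "cmod (bv a t) \<le> cmod (evc a r t) + cmod (bv a t - evc a r t)" for t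
          using norm_triangle_ineq[of "evc a r t" "bv a t - evc a r t"] by simp
      qed (use A(4) i in auto)
      also have "\<dots> = pmean 1 a r + (LINT t|circ. cmod (bv a t - evc a r t))"
        using A(4) i elim by (simp add: pmean1[OF A(1)])
      also have "pmean 1 a r \<le> (SUP r\<in>{0..<1}. pmean 1 a r)" using elim by (intro cSUP_upper bdd) auto
      finally show ?case by simp
    qed
  qed simp
  moreover have "(SUP r\<in>{0..<1}. pmean 1 a r) \<le> (LINT t|circ. cmod (bv a t))"
    using up by (intro cSUP_least) auto
  ultimately have eq: "(SUP r\<in>{0..<1}. pmean 1 a r) = (LINT t|circ. cmod (bv a t))" by (intro antisym)
  show ?thesis unfolding hnorm_def eq by simp
qed

section \<open>Kolmogorov's theorem and the limiting Toeplitz operator\<close>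

lemma powr_subadditive:
  fixes a b :: real
  assumes "0 \<le> a" "0 \<le> b" "0 < p" "p \<le> 1"
  shows "(a + b) powr p \<le> a powr p + b powr p"
proof (cases "a + b = 0")
  case False
  then have s: "a + b > 0" using assms by simp
  have 1: "x / (a + b) \<le> (x / (a + b)) powr p" if "0 \<le> x" "x \<le> a + b" for x
  proof (cases "x = 0")
    case False
    then have "(x / (a + b)) powr 1 \<le> (x / (a + b)) powr p"
      using that s assms by (intro powr_mono') auto
    then show ?thesis using that s by simp
  qed simp
  have "1 = a / (a + b) + b / (a + b)" using s by (simp add: add_divide_distrib[symmetric])
  also have "\<dots> \<le> (a / (a + b)) powr p + (b / (a + b)) powr p" using assms by (intro add_mono 1) auto
  also have "\<dots> = (a powr p + b powr p) / (a + b) powr p"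
    using assms s by (simp add: powr_divide add_divide_distrib)
  finally show ?thesis using s by (simp add: le_divide_eq)
qed (use assms in auto)

lemma integrable_powr_ev:
  assumes "analytic_disk a" "0 \<le> r" "r < 1" "0 < p"
  shows "integrable circ (\<lambda>t. cmod (evc a r t) powr p)"
  by (intro integrable_circ_continuous continuous_on_powr' continuous_intros continuous_ev_circle assms) (use assms in auto)

lemma pmean_diff_le:
  assumes "analytic_disk a" "analytic_disk b" "0 \<le> r" "r < 1" "0 < p" "p \<le> 1"
  shows "pmean p (\<lambda>n. a n - b n) r \<le> pmean p a r + pmean p b r"
proof -
  have "(LINT t|circ. cmod (evc (\<lambda>n. a n - b n) r t) powr p) \<le>
    (LINT t|circ. cmod (evc a r t) powr p + cmod (evc b r t) powr p)"
  proof (rule integral_mono)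
    fix t
    have "cmod (evc (\<lambda>n. a n - b n) r t) \<le> cmod (evc a r t) + cmod (evc b r t)"
      using assms by (subst ev_diff) (auto simp: norm_mult intro: norm_triangle_ineq4)
    then have "cmod (evc (\<lambda>n. a n - b n) r t) powr p \<le> (cmod (evc a r t) + cmod (evc b r t)) powr p"
      using assms by (intro powr_mono2) auto
    also have "\<dots> \<le> cmod (evc a r t) powr p + cmod (evc b r t) powr p"
      using assms by (intro powr_subadditive) auto
    finally show "cmod (evc (\<lambda>n. a n - b n) r t) powr p \<le> cmod (evc a r t) powr p + cmod (evc b r t) powr p" .
  qed (use assms in \<open>auto intro!: integrable_powr_ev analytic_disk_diff\<close>)
  then show ?thesis using assms integrable_powr_ev by (simp add: pmean_eq analytic_disk_diff)
qed

lemma Hp_diff: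
  assumes "a \<in> Hp p" "b \<in> Hp p" "0 < p" "p \<le> 1"
  shows "(\<lambda>n. a n - b n) \<in> Hp p"
proof -
  have ad: "analytic_disk a" "analytic_disk b" using assms by (auto simp: Hp_def)
  obtain A B where "\<forall>r\<in>{0..<1}. pmean p a r \<le> A" "\<forall>r\<in>{0..<1}. pmean p b r \<le> B"
    using assms unfolding Hp_def bdd_above_def by blast
  then have "pmean p (\<lambda>n. a n - b n) r \<le> A + B" if "r \<in> {0..<1}" for r
    by (rule_tac order.trans[OF pmean_diff_le[OF ad] add_mono]) (use that assms in auto)
  then show ?thesis using ad unfolding Hp_def by (auto intro!: analytic_disk_diff bdd_aboveI[of _ "A + B"])
qed

lemma pmean_le_hnorm:
  assumes "a \<in> Hp p" "0 \<le> r" "r < 1" "0 < p"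
  shows "pmean p a r \<le> hnorm p a powr p"
proof -
  have ad: "analytic_disk a" "bdd_above (pmean p a ` {0..<1})" using assms by (auto simp: Hp_def)
  have 0: "0 \<le> pmean p a r" using assms by (simp add: pmean_eq[OF ad(1)])
  have le: "pmean p a r \<le> (SUP r\<in>{0..<1}. pmean p a r)" using assms by (intro cSUP_upper ad) auto
  then have "(SUP r\<in>{0..<1}. pmean p a r) \<ge> 0" using 0 by linarith
  then show ?thesis using le assms unfolding hnorm_def by (simp add: powr_powr)
qed

lemma hnorm_le:
  assumes "analytic_disk a" "\<And>r. 0 \<le> r \<Longrightarrow> r < 1 \<Longrightarrow> pmean p a r \<le> C" "0 < p"
  shows "a \<in> Hp p" "hnorm p a \<le> C powr (1/p)"
proof -
  have b: "bdd_above (pmean p a ` {0..<1})" using assms by (auto intro!: bdd_aboveI[of _ C])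
  then show "a \<in> Hp p" using assms by (simp add: Hp_def)
  have "0 \<le> pmean p a 0" by (simp add: pmean_eq[OF assms(1)])
  also have "\<dots> \<le> (SUP r\<in>{0..<1}. pmean p a r)" by (intro cSUP_upper b) auto
  finally show "hnorm p a \<le> C powr (1/p)"
    unfolding hnorm_def using assms by (intro powr_mono2 cSUP_least) auto
qed

lemma mean_value_holomorphic:
  assumes W: "W holomorphic_on ball 0 1" and r: "0 \<le> r" "r < 1"
  shows "(LINT t|circ. W (of_real r * cis t)) = W 0" "integrable circ (\<lambda>t. W (of_real r * cis t))"
proof -
  obtain w where w: "analytic_disk w" "\<And>z. cmod z < 1 \<Longrightarrow> ev w z = W z" using holomorphic_afun[OF W] by blast
  have e: "W (of_real r * cis t) = evc w r t" for t using r by (subst w(2)) (auto simp: norm_mult)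
  show "(LINT t|circ. W (of_real r * cis t)) = W 0"
    using fc_dilation[OF w(1) r, of 0] w(2)[of 0] by (simp add: fc_def e)
  show "integrable circ (\<lambda>t. W (of_real r * cis t))" unfolding e by (intro integrable_circ_continuous continuous_ev_circle w r)
qed

text \<open>For G >= 0 the analytic part has nonnegative real part, so U takes values in the right
  half plane and U^p has argument at most p pi / 2. Thus cos (p pi / 2) |U|^p <= Re U^p, and the
  mean of the right side is U(0)^p.\<close>

lemma kolmogorov_positive:
  fixes G :: "real \<Rightarrow> real"
  assumes G: "integrable circ G" "\<And>t. 0 \<le> G t" "integral\<^sup>L circ G \<le> \<epsilon>" and e: "\<epsilon> > 0" and p: "0 < p" "p < 1" and r: "0 \<le> r" "r < 1"
  shows "pmean p (\<lambda>n. fc (\<lambda>t. of_real (G t)) (int n)) r \<le> 3 powr p / cos (p * pi / 2) * \<epsilon> powr p"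
proof -
  define a where "a n = fc (\<lambda>t. of_real (G t)) (int n)" for n
  have iG: "integrable circ (\<lambda>t. complex_of_real (G t))" using G by simp
  have a: "analytic_disk a" unfolding a_def by (rule analytic_disk_fc)
  define a0 where "a0 = integral\<^sup>L circ G"
  have a0: "0 \<le> a0" "a0 \<le> \<epsilon>" "a 0 = of_real a0" using G by (auto simp: a0_def a_def fc_def)
  have cn: "cnj (fc (\<lambda>t. of_real (G t)) (- int n)) = a n" for n
    using fc_cnj[of "\<lambda>t. of_real (G t)" "int n"] by (simp add: a_def)
  have Re: "0 \<le> Re (ev a z)" if z: "cmod z < 1" for z
  proof -
    obtain \<rho> t where zt: "z = of_real \<rho> * cis t" "0 \<le> \<rho>" "\<rho> < 1"
      using z rcis_cmod_Arg[of z] unfolding rcis_def by (metis norm_ge_zero)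
    have "pint (\<lambda>t. of_real (G t)) \<rho> t = ev a z + cnj (ev a z) - of_real a0"
      using pint_eq[OF iG zt(2,3), of t] a0 unfolding cn zt(1)[symmetric] by (simp add: a_def[abs_def, symmetric] a_def)
    then have "Re (pint (\<lambda>t. of_real (G t)) \<rho> t) = 2 * Re (ev a z) - a0" by simp
    moreover have "pint (\<lambda>t. of_real (G t)) \<rho> t = of_real ((LINT s|circ. pk \<rho> (t - s) * G s))"
      unfolding pint_def by (simp flip: of_real_mult)
    moreover have "0 \<le> (LINT s|circ. pk \<rho> (t - s) * G s)" using pk_nonneg[OF zt(2,3)] G by simp
    ultimately show ?thesis using a0 by simp
  qed
  \<comment> \<open>The summand \<open>\<epsilon>\<close> keeps U off 0, so that \<open>Ln\<close>
    is holomorphic on its range; U(0) <= 2 \<open>\<epsilon>\<close> + \<open>\<epsilon>\<close>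
    explains the factor 3 powr p.\<close>
  define U where "U z = 2 * ev a z + of_real \<epsilon>" for z
  have ReU: "0 < Re (U z)" if "cmod z < 1" for z using Re[OF that] e by (simp add: U_def)
  have U: "U holomorphic_on ball 0 1" unfolding U_def by (intro holomorphic_intros ev_holomorphic a)
  define W where "W z = exp (of_real p * Ln (U z))" for z
  have W: "W holomorphic_on ball 0 1" unfolding W_def
  proof (intro holomorphic_intros U)
    fix z assume "z \<in> ball (0::complex) 1"
    then have "0 < Re (U z)" using ReU by simp
    then show "U z \<notin> \<real>\<^sub>\<le>\<^sub>0" by (simp add: complex_nonpos_Reals_iff)
  qed
  have cpos: "0 < cos (p * pi / 2)"
  proof (rule cos_gt_zero_pi)
    have "0 < p * pi" "p * pi < 1 * pi" using p by (auto intro!: mult_strict_right_mono)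
    then show "- (pi / 2) < p * pi / 2" "p * pi / 2 < pi / 2" using pi_gt_zero by linarith+
  qed
  have ReW: "cos (p * pi / 2) * cmod (2 * ev a z) powr p \<le> Re (W z)" if z: "cmod z < 1" for z
  proof -
    have U0: "U z \<noteq> 0" using ReU[OF z] by auto
    have "\<bar>Im (Ln (U z))\<bar> < pi / 2" using Re_Ln_pos_lt[OF U0] ReU[OF z] by simp
    then have "\<bar>p * Im (Ln (U z))\<bar> \<le> p * (pi / 2)" using p by (simp add: abs_mult)
    then have c: "cos (p * pi / 2) \<le> cos (p * Im (Ln (U z)))"
    proof -
      have "cos (p * pi / 2) \<le> cos \<bar>p * Im (Ln (U z))\<bar>"
      proof (rule cos_monotone_0_pi_le)
        show "\<bar>p * Im (Ln (U z))\<bar> \<le> p * pi / 2" using \<open>\<bar>p * Im (Ln (U z))\<bar> \<le> p * (pi / 2)\<close> by simp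
        have "p * pi \<le> 1 * pi" using p by (intro mult_right_mono) auto
        then show "p * pi / 2 \<le> pi" using pi_gt_zero by linarith
      qed simp
      then show ?thesis by (simp add: cos_abs_real)
    qed
    have "Re (W z) = exp (p * ln (cmod (U z))) * cos (p * Im (Ln (U z)))"
      unfolding W_def Re_exp using U0 by simp
    also have "exp (p * ln (cmod (U z))) = cmod (U z) powr p" using U0 by (simp add: powr_def)
    finally have RW: "Re (W z) = cmod (U z) powr p * cos (p * Im (Ln (U z)))" .
    have "cmod (2 * ev a z) \<le> cmod (U z)"
    proof -
      have "(cmod (2 * ev a z))\<^sup>2 \<le> (cmod (U z))\<^sup>2"
      proof -
        have "(2 * Re (ev a z))\<^sup>2 \<le> (2 * Re (ev a z) + \<epsilon>)\<^sup>2" using Re[OF z] e by (intro power_mono) auto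
        then show ?thesis unfolding cmod_power2 U_def by (simp add: power_mult_distrib)
      qed
      then show ?thesis by (rule power2_le_imp_le) simp
    qed
    then have "cmod (2 * ev a z) powr p \<le> cmod (U z) powr p" using p by (intro powr_mono2) auto
    then have "cos (p * pi / 2) * cmod (2 * ev a z) powr p \<le> cos (p * Im (Ln (U z))) * cmod (U z) powr p"
      using c cpos by (intro mult_mono) auto
    then show ?thesis unfolding RW by (simp add: mult.commute)
  qed
  note mv = mean_value_holomorphic[OF W r]
  have "cos (p * pi / 2) * (LINT t|circ. cmod (2 * evc a r t) powr p) = (LINT t|circ. cos (p * pi / 2) * cmod (2 * evc a r t) powr p)"
    by simp
  also have "\<dots> \<le> (LINT t|circ. Re (W (of_real r * cis t)))"
  proof (rule integral_mono)
    show "integrable circ (\<lambda>t. cos (p * pi / 2) * cmod (2 * evc a r t) powr p)"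
      using integrable_powr_ev[OF analytic_disk_cmult[OF a, of 2] r p(1)] r a
      by (intro integrable_mult_right) (simp add: ev_cmult norm_mult)
    show "integrable circ (\<lambda>t. Re (W (of_real r * cis t)))" using mv(2) by simp
    show "cos (p * pi / 2) * cmod (2 * evc a r t) powr p \<le> Re (W (of_real r * cis t))" for t
      using r by (intro ReW) (simp add: norm_mult)
  qed
  also have "\<dots> = Re (W 0)" using mv by simp
  also have "\<dots> = (2 * a0 + \<epsilon>) powr p"
  proof -
    have "U 0 = of_real (2 * a0 + \<epsilon>)" using a0 by (simp add: U_def)
    then have "W 0 = exp (of_real (p * ln (2 * a0 + \<epsilon>)))" using a0 e unfolding W_def by (simp add: Ln_of_real flip: of_real_add of_real_mult)
    then have "Re (W 0) = exp (p * ln (2 * a0 + \<epsilon>))" by (simp only: exp_of_real Re_complex_of_real)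
    then show ?thesis using a0 e by (simp add: powr_def)
  qed
  also have "\<dots> \<le> (3 * \<epsilon>) powr p" using a0 e p by (intro powr_mono2) auto
  also have "\<dots> = 3 powr p * \<epsilon> powr p" using e by (simp add: powr_mult)
  finally have 1: "(LINT t|circ. cmod (2 * evc a r t) powr p) \<le> 3 powr p / cos (p * pi / 2) * \<epsilon> powr p"
    using cpos by (simp add: field_simps)
  have "pmean p a r \<le> (LINT t|circ. cmod (2 * evc a r t) powr p)"
    unfolding pmean_eq[OF a r]
  proof (rule integral_mono)
    show "integrable circ (\<lambda>t. cmod (2 * evc a r t) powr p)"
      using integrable_powr_ev[OF analytic_disk_cmult[OF a, of 2] r p(1)] r a by (simp add: ev_cmult norm_mult)
    show "cmod (evc a r t) powr p \<le> cmod (2 * evc a r t) powr p" for t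
      using p by (intro powr_mono2) (auto simp: norm_mult)
  qed (rule integrable_powr_ev[OF a r p(1)])
  with 1 show ?thesis unfolding a_def by linarith
qed

text \<open>Splitting F into the positive and negative parts of its real and imaginary parts gives
  four instances of the positive case, whence the factor 4. A positive upper bound
  \<open>\<epsilon>\<close> replaces the L^1 norm because the positive case takes a logarithm of
  it.\<close>

lemma kolmogorov:
  assumes p: "0 < p" "p < 1"
  obtains C where "C > 0" "\<And>F \<epsilon> r. integrable circ F \<Longrightarrow> (LINT t|circ. cmod (F t)) \<le> \<epsilon> \<Longrightarrow> \<epsilon> > 0 \<Longrightarrow> 0 \<le> r \<Longrightarrow> r < 1 \<Longrightarrow>
     pmean p (\<lambda>n. fc F (int n)) r \<le> C * \<epsilon> powr p"
proof -
  define C where "C = 3 powr p / cos (p * pi / 2)"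
  have cpos: "0 < cos (p * pi / 2)"
  proof (rule cos_gt_zero_pi)
    have "0 < p * pi" "p * pi < 1 * pi" using p by (auto intro!: mult_strict_right_mono)
    then show "- (pi / 2) < p * pi / 2" "p * pi / 2 < pi / 2" using pi_gt_zero by linarith+
  qed
  have "4 * C > 0" using cpos by (simp add: C_def)
  moreover have "pmean p (\<lambda>n. fc F (int n)) r \<le> 4 * C * \<epsilon> powr p"
    if F: "integrable circ F" "(LINT t|circ. cmod (F t)) \<le> \<epsilon>" and e: "\<epsilon> > 0" and r: "0 \<le> r" "r < 1" for F \<epsilon> r
  proof -
    define G :: "nat \<Rightarrow> real \<Rightarrow> real" where "G i t = (if i = 0 then max (Re (F t)) 0 else if i = 1 then max (- Re (F t)) 0 else if i = 2 then max (Im (F t)) 0 else max (- Im (F t)) 0)" for i t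
    define H where "H i t = complex_of_real (G i t)" for i t
    have m [measurable]: "F \<in> borel_measurable borel" using borel_measurable_integrable[OF F(1)] by simp
    have Gm [measurable]: "G i \<in> borel_measurable borel" for i unfolding G_def by measurable
    have G0: "0 \<le> G i t" "G i t \<le> cmod (F t)" for i t
      using abs_Re_le_cmod[of "F t"] abs_Im_le_cmod[of "F t"] unfolding G_def by auto
    have Gi: "integrable circ (G i)" for i
      by (rule Bochner_Integration.integrable_bound[OF integrable_norm[OF F(1)]]) (use G0 in auto)
    have Ge: "integral\<^sup>L circ (G i) \<le> \<epsilon>" for i
      using integral_mono[OF Gi integrable_norm[OF F(1)] G0(2)] F(2) by (rule order.trans)
    define a where "a i n = fc (H i) (int n)" for i and n :: nat
    have pm: "pmean p (a i) r \<le> C * \<epsilon> powr p" for i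
      unfolding a_def[abs_def] C_def H_def[abs_def] by (rule kolmogorov_positive[OF Gi G0(1) Ge e p r])
    have ad: "analytic_disk (a i)" for i unfolding a_def by (rule analytic_disk_fc)
    have Hi: "integrable circ (H i)" for i unfolding H_def using Gi by simp
    \<comment> \<open>Only differences and the unimodular factor -i occur, so that
      \<open>pmean_diff_le\<close> alone combines the four parts.\<close>
    have Feq: "F = (\<lambda>t. (H 0 t - H 1 t) - ((-\<i>) * H 2 t - (-\<i>) * H 3 t))"
      by (auto simp: fun_eq_iff complex_eq_iff H_def G_def)
    have fcF: "fc F n = (fc (H 0) n - fc (H 1) n) - ((-\<i>) * fc (H 2) n - (-\<i>) * fc (H 3) n)" for n
      by (subst Feq) (simp only: fc_diff fc_cmult Hi Bochner_Integration.integrable_diff integrable_mult_right simp_thms)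
    have ci: "pmean p (\<lambda>n. (-\<i>) * a i n) r = pmean p (a i) r" for i
    proof -
      have "ev (\<lambda>n. (-\<i>) * a i n) (of_real r * cis t) = (-\<i>) * evc (a i) r t" for t
        by (rule ev_cmult[OF ad]) (use r in \<open>simp add: norm_mult\<close>)
      then show ?thesis
        unfolding pmean_eq[OF ad r] pmean_eq[OF analytic_disk_cmult[OF ad] r] by (simp only: norm_mult norm_minus_cancel norm_ii mult_1_left)
    qed
    have "pmean p (\<lambda>n. fc F (int n)) r = pmean p (\<lambda>n. (a 0 n - a 1 n) - ((-\<i>) * a 2 n - (-\<i>) * a 3 n)) r"
      unfolding fcF a_def ..
    also have "\<dots> \<le> (pmean p (a 0) r + pmean p (a 1) r) + (pmean p (\<lambda>n. (-\<i>) * a 2 n) r + pmean p (\<lambda>n. (-\<i>) * a 3 n) r)"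
      using p r by (intro order.trans[OF pmean_diff_le] add_mono pmean_diff_le analytic_disk_diff analytic_disk_cmult ad) auto
    also have "\<dots> \<le> 4 * C * \<epsilon> powr p" unfolding ci using pm[of 0] pm[of 1] pm[of 2] pm[of 3] by simp
    finally show ?thesis .
  qed
  ultimately show ?thesis using that by blast
qed

section \<open>Toeplitz coefficients, pairings and the limiting operator\<close>

lemma toep_eq_fc:
  assumes "bv h \<in> borel_measurable borel" "bv f \<in> borel_measurable borel"
  shows "toep h f = (\<lambda>n. fc (\<lambda>t. cnj (bv h t) * bv f t) (int n))"
  unfolding toep_def fc_def using assms
  by (intro ext, subst integral_circ) (auto simp: scaleR_conv_of_real)

lemma pairing_eq:
  assumes "bv h \<in> borel_measurable borel" "bv f \<in> borel_measurable borel"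
  shows "pairing f h = (LINT t|circ. bv f t * cnj (bv h t))"
  unfolding pairing_def using assms
  by (subst integral_circ) (auto simp: scaleR_conv_of_real)

lemma pairing_limit:
  assumes D: "D \<in> borel_measurable borel" "integrable circ (\<lambda>t. (cmod (D t))\<^sup>2)" and w: "w \<in> Hp 2"
  shows "((\<lambda>r. (LINT t|circ. D t * cnj (evc w r t))) \<longlongrightarrow> (LINT t|circ. D t * cnj (bv w t))) (at_left 1)"
proof -
  note W = Hp2_boundary[OF w]
  note [measurable] = D(1) W(3)
  have iD: "integrable circ D" by (rule circ_L1_le_L2(1)[OF D])
  define A where "A = (LINT t|circ. (cmod (D t))\<^sup>2)"
  have b: "cmod ((LINT t|circ. D t * cnj (evc w r t)) - (LINT t|circ. D t * cnj (bv w t))) \<le> sqrt A * sqrt (defect w r)" if r: "0 \<le> r" "r < 1" for r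
  proof -
    have [measurable]: "(\<lambda>t. evc w r t) \<in> borel_measurable borel" by (intro ev_circle_measurable r W)
    have i1: "integrable circ (\<lambda>t. D t * cnj (bv w t))"
      using D W(7) by (intro circ_Cauchy_Schwarz(1)) auto
    have i2: "integrable circ (\<lambda>t. D t * cnj (evc w r t))"
    proof (rule circ_Cauchy_Schwarz(1)[OF D(1) _ D(2)])
      show "integrable circ (\<lambda>t. (cmod (cnj (evc w r t)))\<^sup>2)"
        by (intro integrable_circ_continuous continuous_intros continuous_ev_circle W r)
    qed measurable
    have "(LINT t|circ. D t * cnj (bv w t)) - (LINT t|circ. D t * cnj (evc w r t)) = (LINT t|circ. D t * cnj (bv w t) - D t * cnj (evc w r t))"
      using i1 i2 by simp
    also have "\<dots> = (LINT t|circ. D t * cnj (bv w t - evc w r t))" by (simp add: right_diff_distrib)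
    finally have "cmod ((LINT t|circ. D t * cnj (evc w r t)) - (LINT t|circ. D t * cnj (bv w t))) \<le> (LINT t|circ. cmod (D t * cnj (bv w t - evc w r t)))"
      by (subst norm_minus_commute) (simp only: integral_norm_bound)
    also have "\<dots> \<le> sqrt A * sqrt ((LINT t|circ. (cmod (cnj (bv w t - evc w r t)))\<^sup>2))"
      unfolding A_def using D W(9)[OF r] by (intro circ_Cauchy_Schwarz(2)) (auto simp flip: complex_cnj_diff)
    also have "\<dots> \<le> sqrt A * sqrt (defect w r)"
      using W(8)[OF r] by (intro mult_left_mono) (auto simp: A_def simp flip: complex_cnj_diff)
    finally show ?thesis .
  qed
  have s: "summable (\<lambda>k. (cmod (w k))\<^sup>2)" using w Hp2_iff by simp
  have "((\<lambda>r. sqrt A * sqrt (defect w r)) \<longlongrightarrow> sqrt A * sqrt 0) (at_left 1)" by (intro tendsto_intros defect_tendsto s)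
  then have lim: "((\<lambda>r. sqrt A * sqrt (defect w r)) \<longlongrightarrow> 0) (at_left 1)" by simp
  show ?thesis
  proof (rule LIM_zero_cancel, rule Lim_null_comparison[OF _ lim])
    show "\<forall>\<^sub>F r in at_left 1. norm ((LINT t|circ. D t * cnj (evc w r t)) - (LINT t|circ. D t * cnj (bv w t))) \<le> sqrt A * sqrt (defect w r)"
      using eventually_radius by eventually_elim (use b in blast)
  qed
qed

text \<open>A function with negative frequencies only is orthogonal to every dilation of w by the
  coefficient formula, and then to w by passage to the limit. It lets f be exchanged for any
  square-integrable function with the same nonnegative coefficients.\<close>

lemma annihilator_H2:
  assumes D: "D \<in> borel_measurable borel" "integrable circ (\<lambda>t. (cmod (D t))\<^sup>2)" and 0: "\<And>n. n \<ge> 0 \<Longrightarrow> fc D n = 0" and w: "w \<in> Hp 2"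
  shows "(LINT t|circ. D t * cnj (bv w t)) = 0"
proof (rule tendsto_unique[OF _ pairing_limit[OF D w]])
  have iD: "integrable circ D" by (rule circ_L1_le_L2(1)[OF D])
  have "(LINT t|circ. D t * cnj (evc w r t)) = 0" if r: "0 \<le> r" "r < 1" for r
  proof -
    have "(\<lambda>k. 0) sums (LINT t|circ. D t * cnj (evc w r t))"
      using integral_cnj_ev[OF iD Hp2_boundary(1)[OF w] r] by (simp add: 0)
    then show ?thesis by (simp add: sums_iff)
  qed
  then have "\<forall>\<^sub>F r in at_left 1. 0 = (LINT t|circ. D t * cnj (evc w r t))"
    using eventually_radius by (auto elim!: eventually_mono)
  then show "((\<lambda>r. (LINT t|circ. D t * cnj (evc w r t))) \<longlongrightarrow> 0) (at_left 1)"
    by (rule Lim_transform_eventually[OF tendsto_const])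
qed simp

lemma bv_diff:
  assumes "a \<in> Hp 1" "b \<in> Hp 1"
  shows "AE t in circ. bv (\<lambda>n. a n - b n) t = bv a t - bv b t"
  using Hp1_boundary(2)[OF assms(1)] Hp1_boundary(2)[OF assms(2)]
proof eventually_elim
  case (elim t)
  have "\<forall>\<^sub>F r in at_left 1. evc a r t - evc b r t = evc (\<lambda>n. a n - b n) r t"
    using eventually_radius by eventually_elim (subst ev_diff; simp add: Hp1_boundary(1)[OF assms(1)] Hp1_boundary(1)[OF assms(2)] norm_mult)
  from Lim_transform_eventually[OF tendsto_diff[OF elim[unfolded radlim_def]] this]
  show ?case by (intro radlim_bv) (simp add: radlim_def)
qed

lemma Hp2_imp_Hp1: "a \<in> Hp 2 \<Longrightarrow> a \<in> Hp 1"
  using Hp2_boundary[of a] Hp1_I[of "bv a" a] by blast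

lemma dilation_approx:
  assumes g: "g \<in> Hp 1"
  obtains G where "\<And>n. G n \<in> Hp 2" "(\<lambda>n. hnorm 1 (\<lambda>k. G n k - g k)) \<longlonglongrightarrow> 0"
proof -
  note B = Hp1_boundary[OF g]
  define \<rho> where "\<rho> n = 1 - 1 / real (Suc n)" for n
  have \<rho>: "0 \<le> \<rho> n" "\<rho> n < 1" for n by (auto simp: \<rho>_def)
  define G where "G n k = g k * of_real (\<rho> n) ^ k" for n k
  have G2: "G n \<in> Hp 2" for n
  proof (rule Hp2_I)
    \<comment> \<open>Convergence at the intermediate radius sqrt \<open>\<rho>\<close> bounds |g_k|
      by C \<open>\<rho>\<close>^(-k/2), so the squared coefficients of the dilation are at most C^2
      \<open>\<rho>\<close>^k.\<close>
    have s: "summable (\<lambda>k. norm (g k) * sqrt (\<rho> n) ^ k)" using B(1) \<rho>[of n] unfolding analytic_disk_def by (simp add: real_sqrt_lt_1_iff)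
    then have "(\<lambda>k. norm (g k) * sqrt (\<rho> n) ^ k) \<longlonglongrightarrow> 0" by (rule summable_LIMSEQ_zero)
    then obtain C where C: "\<And>k. norm (norm (g k) * sqrt (\<rho> n) ^ k) \<le> C" using convergent_imp_Bseq[of "\<lambda>k. norm (g k) * sqrt (\<rho> n) ^ k"] unfolding convergent_def Bseq_def by blast
    have "(cmod (G n k))\<^sup>2 \<le> C\<^sup>2 * \<rho> n ^ k" for k
    proof -
      have "sqrt (\<rho> n) * sqrt (\<rho> n) = \<rho> n" using \<rho>[of n] by simp
      then have "\<rho> n ^ k = sqrt (\<rho> n) ^ k * sqrt (\<rho> n) ^ k" by (metis power_mult_distrib)
      then have "cmod (G n k) = (norm (g k) * sqrt (\<rho> n) ^ k) * sqrt (\<rho> n) ^ k" using \<rho>[of n] by (simp add: G_def norm_mult norm_power)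
      also have "\<dots> \<le> C * sqrt (\<rho> n) ^ k" using C[of k] \<rho>[of n] by (intro mult_right_mono) auto
      finally have "(cmod (G n k))\<^sup>2 \<le> (C * sqrt (\<rho> n) ^ k)\<^sup>2" by (intro power_mono) auto
      also have "\<dots> = C\<^sup>2 * \<rho> n ^ k" unfolding \<open>\<rho> n ^ k = sqrt (\<rho> n) ^ k * sqrt (\<rho> n) ^ k\<close> by (simp add: power2_eq_square mult_ac)
      finally show ?thesis .
    qed
    moreover have "summable (\<lambda>k. C\<^sup>2 * \<rho> n ^ k)" using \<rho>[of n] by (intro summable_mult summable_geometric) auto
    ultimately show "summable (\<lambda>k. (cmod (G n k))\<^sup>2)"
      by (rule_tac summable_comparison_test'[of "\<lambda>k. C\<^sup>2 * \<rho> n ^ k" 0]) auto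
  qed
  have evG: "ev (G n) z = ev g (of_real (\<rho> n) * z)" for n z
    unfolding ev_def G_def by (simp add: power_mult_distrib mult.assoc)
  have bvG: "bv (G n) t = evc g (\<rho> n) t" for n t
  proof (rule radlim_bv)
    have n1: "cmod (of_real (\<rho> n) * cis t) < 1" using \<rho>[of n] by (simp add: norm_mult)
    have "isCont (ev g) (of_real (\<rho> n) * cis t)"
      using holomorphic_on_imp_continuous_on[OF ev_holomorphic[OF B(1)]] n1 by (intro continuous_on_interior[of "ball 0 1"]) auto
    moreover have "((\<lambda>r. of_real (\<rho> n) * (of_real r * cis t)) \<longlongrightarrow> of_real (\<rho> n) * (of_real 1 * cis t)) (at_left (1::real))"
      by (intro tendsto_intros)
    ultimately show "radlim (G n) t (evc g (\<rho> n) t)"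
      unfolding radlim_def evG by (intro isCont_tendsto_compose[of _ "ev g"]) auto
  qed
  have "hnorm 1 (\<lambda>k. G n k - g k) = (LINT t|circ. cmod (bv g t - evc g (\<rho> n) t))" for n
  proof -
    have G1: "G n \<in> Hp 1" by (rule Hp2_imp_Hp1[OF G2])
    have d: "(\<lambda>k. G n k - g k) \<in> Hp 1" by (rule Hp_diff[OF G1 g]) auto
    have m: "bv (G n) \<in> borel_measurable borel" by (rule Hp1_boundary(3)[OF G1])
    have m': "(\<lambda>t. evc g (\<rho> n) t) \<in> borel_measurable borel" by (intro ev_circle_measurable B \<rho>)
    have "(LINT t|circ. cmod (bv (\<lambda>k. G n k - g k) t)) = (LINT t|circ. cmod (bv g t - evc g (\<rho> n) t))"
      by (rule integral_cong_AE) (use bv_diff[OF G1 g] B(3) Hp1_boundary(3)[OF d] m' bvG in \<open>auto elim!: eventually_mono simp: norm_minus_commute\<close>)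
    then show ?thesis using hnorm1[OF d] by simp
  qed
  moreover have "(\<lambda>n. (LINT t|circ. cmod (bv g t - evc g (\<rho> n) t))) \<longlonglongrightarrow> 0"
  proof (rule filterlim_compose[OF B(7)])
    show "filterlim \<rho> (at_left 1) sequentially" unfolding \<rho>_def
      by (rule tendsto_imp_filterlim_at_left) (use LIMSEQ_inverse_real_of_nat_add_minus[of 1] in \<open>auto simp: field_simps inverse_eq_divide\<close>)
  qed
  ultimately show ?thesis using that[of G] G2 by simp
qed

text \<open>For square-integrable symbols f may be exchanged for the bounded \<open>\<phi>\<close>
  with the same nonnegative coefficients. The exchanged formula makes sense for every g in H^1,
  depends continuously on g in L^1, and Kolmogorov's theorem turns L^1 convergence into convergence
  in \<open>Hp p\<close>.\<close>

lemma toep_lim_eq: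
  assumes g: "g \<in> Hp 1" and f: "f \<in> Hp 2"
    and \<phi>: "\<phi> \<in> borel_measurable borel" "AE t in circ. cmod (\<phi> t) \<le> B" "\<And>n. fc \<phi> (int n) = f n"
  shows "toep_lim g f = (\<lambda>n. fc (\<lambda>t. cnj (bv g t) * \<phi> t) (int n))"
proof -
  define \<Phi> where "\<Phi> = (\<lambda>n. fc (\<lambda>t. cnj (bv g t) * \<phi> t) (int n))"
  note F = Hp2_boundary[OF f]
  note [measurable] = F(3) \<phi>(1)
  have i\<phi>: "integrable circ \<phi>" by (rule integrable_circ_bounded[OF \<phi>(1,2)])
  have i\<phi>2: "integrable circ (\<lambda>t. (cmod (\<phi> t))\<^sup>2)"
    by (rule integrable_circ_bounded[of _ "B\<^sup>2"]) (use \<phi>(2) in \<open>auto elim!: eventually_mono intro!: power_mono\<close>)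
  have ig: "integrable circ (\<lambda>t. cnj (bv u t) * \<phi> t)" if "u \<in> Hp 1" for u
    using integrable_circ_mult_bounded[OF _ \<phi>(1,2), of "\<lambda>t. cnj (bv u t)"] Hp1_boundary(4)[OF that] by (simp add: mult.commute)
  have toepG: "toep G f = (\<lambda>n. fc (\<lambda>t. cnj (bv G t) * \<phi> t) (int n))" if G: "G \<in> Hp 2" for G
  proof
    fix n
    note GB = Hp2_boundary[OF G]
    note [measurable] = GB(3)
    \<comment> \<open>The frequencies of f - \<open>\<phi>\<close> are negative, and the factor
      e^(-int) lowers them by a further n; the n-th coefficients to be compared therefore differ by
      a pairing that vanishes.\<close>
    define D where "D t = (bv f t - \<phi> t) * cis (- (real n * t))" for t
    have [measurable]: "D \<in> borel_measurable borel" unfolding D_def using cis_measurable[of "- real n"] by simp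
    have D2: "integrable circ (\<lambda>t. (cmod (D t))\<^sup>2)"
    proof (rule Bochner_Integration.integrable_bound)
      show "integrable circ (\<lambda>t. 2 * (cmod (bv f t))\<^sup>2 + 2 * (cmod (\<phi> t))\<^sup>2)" using F(7) i\<phi>2 by simp
      show "AE t in circ. norm ((cmod (D t))\<^sup>2) \<le> norm (2 * (cmod (bv f t))\<^sup>2 + 2 * (cmod (\<phi> t))\<^sup>2)"
      proof (rule AE_I2)
        fix t
        have "cmod (D t) \<le> cmod (bv f t) + cmod (\<phi> t)" by (simp add: D_def norm_mult norm_triangle_ineq4)
        then have "(cmod (D t))\<^sup>2 \<le> (cmod (bv f t) + cmod (\<phi> t))\<^sup>2" by (intro power_mono) auto
        also have "\<dots> \<le> 2 * (cmod (bv f t))\<^sup>2 + 2 * (cmod (\<phi> t))\<^sup>2"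
          using sum_squares_bound[of "cmod (bv f t)" "cmod (\<phi> t)"] by (simp add: power2_sum)
        finally show "norm ((cmod (D t))\<^sup>2) \<le> norm (2 * (cmod (bv f t))\<^sup>2 + 2 * (cmod (\<phi> t))\<^sup>2)" by simp
      qed
    qed simp
    have "fc D k = 0" if "k \<ge> 0" for k
    proof -
      have "fc D k = fc (\<lambda>t. bv f t - \<phi> t) (k + int n)"
        using fc_cis_shift[of "\<lambda>t. bv f t - \<phi> t" "- int n" k] unfolding D_def by simp
      also have "\<dots> = fc (bv f) (k + int n) - fc \<phi> (k + int n)" by (rule fc_diff[OF F(4) i\<phi>])
      also have "\<dots> = 0" using F(5)[of "nat (k + int n)"] \<phi>(3)[of "nat (k + int n)"] that by simp
      finally show ?thesis .
    qed
    from annihilator_H2[OF _ D2 this G] have 0: "(LINT t|circ. D t * cnj (bv G t)) = 0" by simp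
    have i1: "integrable circ (\<lambda>t. cnj (bv G t) * bv f t)" using F(7) GB(7) by (intro circ_Cauchy_Schwarz(1)) auto
    note i2 = ig[OF Hp2_imp_Hp1[OF G]]
    have "fc (\<lambda>t. cnj (bv G t) * bv f t) (int n) - fc (\<lambda>t. cnj (bv G t) * \<phi> t) (int n) = fc (\<lambda>t. cnj (bv G t) * bv f t - cnj (bv G t) * \<phi> t) (int n)"
      by (rule fc_diff[OF i1 i2, symmetric])
    also have "\<dots> = (LINT t|circ. D t * cnj (bv G t))"
      unfolding fc_def D_def by (intro Bochner_Integration.integral_cong) (auto simp: algebra_simps)
    finally show "toep G f n = fc (\<lambda>t. cnj (bv G t) * \<phi> t) (int n)"
      unfolding toep_eq_fc[OF GB(3) F(3)] 0 by simp
  qed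
  have fcdisk: "analytic_disk (\<lambda>n. fc H (int n))" for H by (rule analytic_disk_fc)
  have inHp: "(\<lambda>n. fc H (int n)) \<in> Hp p" if p: "0 < p" "p < 1" and H: "integrable circ H" for p H
  proof -
    obtain C where C: "C > 0" "\<And>F \<epsilon> r. integrable circ F \<Longrightarrow> (LINT t|circ. cmod (F t)) \<le> \<epsilon> \<Longrightarrow> \<epsilon> > 0 \<Longrightarrow> 0 \<le> r \<Longrightarrow> r < 1 \<Longrightarrow>
       pmean p (\<lambda>n. fc F (int n)) r \<le> C * \<epsilon> powr p" using kolmogorov[OF p] by blast
    show ?thesis
    proof (rule hnorm_le(1)[OF fcdisk _ p(1)])
      fix r :: real assume r: "0 \<le> r" "r < 1"
      have "0 \<le> (LINT t|circ. cmod (H t))" by simp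
      then show "pmean p (\<lambda>n. fc H (int n)) r \<le> C * ((LINT t|circ. cmod (H t)) + 1) powr p"
        using r by (intro C(2) H add_nonneg_pos) auto
    qed
  qed
  have conv: "(\<lambda>n. hnorm p (\<lambda>k. toep (G n) f k - \<Phi> k)) \<longlonglongrightarrow> 0"
    if p: "0 < p" "p < 1" and G: "\<And>n. G n \<in> Hp 2" "(\<lambda>n. hnorm 1 (\<lambda>k. G n k - g k)) \<longlonglongrightarrow> 0" for p G
  proof -
    obtain C where C: "C > 0" "\<And>F \<epsilon> r. integrable circ F \<Longrightarrow> (LINT t|circ. cmod (F t)) \<le> \<epsilon> \<Longrightarrow> \<epsilon> > 0 \<Longrightarrow> 0 \<le> r \<Longrightarrow> r < 1 \<Longrightarrow>
       pmean p (\<lambda>n. fc F (int n)) r \<le> C * \<epsilon> powr p" using kolmogorov[OF p] by blast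
    \<comment> \<open>The null sequence 1/(n+1) is added because Kolmogorov's bound asks for a
      strictly positive \<open>\<epsilon>\<close>.\<close>
    define \<epsilon> where "\<epsilon> n = \<bar>B\<bar> * hnorm 1 (\<lambda>k. G n k - g k) + 1 / real (Suc n)" for n
    have G1: "G n \<in> Hp 1" for n by (rule Hp2_imp_Hp1[OF G(1)])
    define H where "H n t = cnj (bv (G n) t) * \<phi> t - cnj (bv g t) * \<phi> t" for n t
    have iH: "integrable circ (H n)" for n unfolding H_def by (intro Bochner_Integration.integrable_diff ig G1 g)
    have d: "(\<lambda>k. G n k - g k) \<in> Hp 1" for n by (rule Hp_diff[OF G1 g]) auto
    have hn: "0 \<le> hnorm 1 (\<lambda>k. G n k - g k)" for n unfolding hnorm1[OF d] by simp
    have \<epsilon>: "\<epsilon> n > 0" for n unfolding \<epsilon>_def by (intro add_nonneg_pos mult_nonneg_nonneg hn) auto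
    have Hle: "(LINT t|circ. cmod (H n t)) \<le> \<epsilon> n" for n
    proof -
      have "(LINT t|circ. cmod (H n t)) \<le> (LINT t|circ. \<bar>B\<bar> * cmod (bv (\<lambda>k. G n k - g k) t))"
      proof (rule integral_mono_AE)
        show "integrable circ (\<lambda>t. cmod (H n t))" using iH by simp
        show "integrable circ (\<lambda>t. \<bar>B\<bar> * cmod (bv (\<lambda>k. G n k - g k) t))" using Hp1_boundary(4)[OF d] by simp
        show "AE t in circ. cmod (H n t) \<le> \<bar>B\<bar> * cmod (bv (\<lambda>k. G n k - g k) t)"
          using bv_diff[OF G1[of n] g] \<phi>(2)
        proof eventually_elim
          case (elim t)
          have "H n t = cnj (bv (\<lambda>k. G n k - g k) t) * \<phi> t" unfolding H_def elim(1) by (simp add: left_diff_distrib)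
          then have "cmod (H n t) = cmod (\<phi> t) * cmod (bv (\<lambda>k. G n k - g k) t)" by (simp add: norm_mult)
          also have "\<dots> \<le> \<bar>B\<bar> * cmod (bv (\<lambda>k. G n k - g k) t)" using elim(2) by (intro mult_right_mono) auto
          finally show ?case .
        qed
      qed
      also have "\<dots> = \<bar>B\<bar> * hnorm 1 (\<lambda>k. G n k - g k)" by (simp add: hnorm1[OF d])
      finally show ?thesis unfolding \<epsilon>_def by (rule order.trans) simp
    qed
    have eq: "(\<lambda>k. toep (G n) f k - \<Phi> k) = (\<lambda>k. fc (H n) (int k))" for n
      unfolding toepG[OF G(1)] \<Phi>_def H_def by (intro ext fc_diff[symmetric] ig G1 g)
    have le: "hnorm p (\<lambda>k. toep (G n) f k - \<Phi> k) \<le> C powr (1/p) * \<epsilon> n" for n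
    proof -
      have "hnorm p (\<lambda>k. fc (H n) (int k)) \<le> (C * \<epsilon> n powr p) powr (1/p)"
        by (rule hnorm_le(2)[OF fcdisk C(2)[OF iH Hle \<epsilon>] p(1)])
      also have "\<dots> = C powr (1/p) * \<epsilon> n" using C(1) \<epsilon>[of n] p by (simp add: powr_mult powr_powr)
      finally show ?thesis unfolding eq .
    qed
    have "(\<lambda>n. C powr (1/p) * (\<bar>B\<bar> * hnorm 1 (\<lambda>k. G n k - g k) + inverse (real (Suc n)))) \<longlonglongrightarrow> C powr (1/p) * (\<bar>B\<bar> * 0 + 0)"
      by (intro tendsto_intros G LIMSEQ_inverse_real_of_nat)
    then have lim: "(\<lambda>n. C powr (1/p) * \<epsilon> n) \<longlonglongrightarrow> 0" by (simp add: \<epsilon>_def inverse_eq_divide)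
    show ?thesis
    proof (rule tendsto_sandwich[OF _ _ tendsto_const lim])
      show "\<forall>\<^sub>F n in sequentially. 0 \<le> hnorm p (\<lambda>k. toep (G n) f k - \<Phi> k)" by (simp add: hnorm_def)
    qed (use le in simp)
  qed
  have P1: "\<Phi> \<in> Hp p" if "0 < p" "p < 1" for p unfolding \<Phi>_def by (rule inHp[OF that ig[OF g]])
  have uniq: "\<Psi> = \<Phi>"
    if \<Psi>: "\<forall>p. 0 < p \<and> p < 1 \<longrightarrow> \<Psi> \<in> Hp p" "\<forall>G. (\<forall>n. G n \<in> Hp 2) \<and> (\<lambda>n. hnorm 1 (\<lambda>k. G n k - g k)) \<longlonglongrightarrow> 0 \<longrightarrow>
         (\<forall>p. 0 < p \<and> p < 1 \<longrightarrow> (\<lambda>n. hnorm p (\<lambda>k. toep (G n) f k - \<Psi> k)) \<longlonglongrightarrow> 0)" for \<Psi>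
  proof -
    obtain G where G: "\<And>n. G n \<in> Hp 2" "(\<lambda>n. hnorm 1 (\<lambda>k. G n k - g k)) \<longlonglongrightarrow> 0" using dilation_approx[OF g] by blast
    \<comment> \<open>One exponent and one radius suffice: a difference with vanishing mean on a
      single circle of positive radius has zero Taylor coefficients.\<close>
    define p :: real where "p = 1/2"
    have p: "0 < p" "p < 1" by (auto simp: p_def)
    have l1: "(\<lambda>n. hnorm p (\<lambda>k. toep (G n) f k - \<Psi> k)) \<longlonglongrightarrow> 0" using \<Psi>(2) G p by blast
    have l2: "(\<lambda>n. hnorm p (\<lambda>k. toep (G n) f k - \<Phi> k)) \<longlonglongrightarrow> 0" by (rule conv[OF p G])
    have T: "toep (G n) f \<in> Hp p" for n unfolding toepG[OF G(1)] by (rule inHp[OF p ig[OF Hp2_imp_Hp1[OF G(1)]]])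
    have ps: "\<Psi> \<in> Hp p" "\<Phi> \<in> Hp p" using \<Psi>(1) P1 p by auto
    have ad: "analytic_disk \<Psi>" "analytic_disk \<Phi>" using ps by (auto simp: Hp_def)
    define r :: real where "r = 1/2"
    have r: "0 \<le> r" "r < 1" by (auto simp: r_def)
    have up: "pmean p (\<lambda>k. \<Psi> k - \<Phi> k) r \<le> hnorm p (\<lambda>k. toep (G n) f k - \<Phi> k) powr p + hnorm p (\<lambda>k. toep (G n) f k - \<Psi> k) powr p" for n
    proof -
      have d1: "(\<lambda>k. toep (G n) f k - \<Phi> k) \<in> Hp p" "(\<lambda>k. toep (G n) f k - \<Psi> k) \<in> Hp p" using p by (auto intro!: Hp_diff T ps)
      have "pmean p (\<lambda>k. (toep (G n) f k - \<Phi> k) - (toep (G n) f k - \<Psi> k)) r \<le> pmean p (\<lambda>k. toep (G n) f k - \<Phi> k) r + pmean p (\<lambda>k. toep (G n) f k - \<Psi> k) r"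
        using d1 p r by (intro pmean_diff_le) (auto simp: Hp_def)
      then show ?thesis using pmean_le_hnorm[OF d1(1) r p(1)] pmean_le_hnorm[OF d1(2) r p(1)] by simp
    qed
    have "(\<lambda>n. hnorm p (\<lambda>k. toep (G n) f k - \<Phi> k) powr p + hnorm p (\<lambda>k. toep (G n) f k - \<Psi> k) powr p) \<longlonglongrightarrow> 0"
    proof -
      have "(\<lambda>n. hnorm p (\<lambda>k. toep (G n) f k - \<Phi> k) powr p + hnorm p (\<lambda>k. toep (G n) f k - \<Psi> k) powr p) \<longlonglongrightarrow> 0 powr p + 0 powr p"
        using p by (intro tendsto_add tendsto_powr2 l1 l2 tendsto_const) (auto simp: hnorm_def)
      then show ?thesis using p by simp
    qed
    then have pm0: "pmean p (\<lambda>k. \<Psi> k - \<Phi> k) r \<le> 0" by (rule LIMSEQ_le_const) (use up in blast)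
    define d where "d = (\<lambda>k. \<Psi> k - \<Phi> k)"
    have le0: "(LINT t|circ. cmod (evc d r t) powr p) \<le> 0"
      using pm0 by (simp add: d_def pmean_eq[OF analytic_disk_diff[OF ad] r])
    have dd: "analytic_disk d" unfolding d_def by (rule analytic_disk_diff[OF ad])
    have "AE t in circ. cmod (evc d r t) powr p = 0"
    proof (subst integral_nonneg_eq_0_iff_AE[symmetric])
      show "integrable circ (\<lambda>t. cmod (evc d r t) powr p)" by (rule integrable_powr_ev[OF dd r p(1)])
      show "(LINT t|circ. cmod (evc d r t) powr p) = 0" using le0 by (intro antisym) auto
    qed auto
    then have "AE t in circ. evc d r t = 0" by eventually_elim simp
    then have "fc (\<lambda>t. evc d r t) n = fc (\<lambda>t. 0) n" for n
      by (intro fc_cong_AE ev_circle_measurable dd r) auto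
    moreover have "fc (\<lambda>t. 0) n = 0" for n by (simp add: fc_def)
    ultimately have "fc (\<lambda>t. evc d r t) (int n) = 0" for n by (simp only:)
    then have "d n = 0" for n using fc_dilation[OF dd r, of "int n"] by (simp add: r_def)
    then show ?thesis by (auto simp: d_def fun_eq_iff)
  qed
  show ?thesis unfolding toep_lim_def \<Phi>_def[symmetric]
  proof (rule the_equality)
    show "(\<forall>p. 0 < p \<and> p < 1 \<longrightarrow> \<Phi> \<in> Hp p) \<and> (\<forall>G. (\<forall>n. G n \<in> Hp 2) \<and> (\<lambda>n. hnorm 1 (\<lambda>k. G n k - g k)) \<longlonglongrightarrow> 0 \<longrightarrow>
         (\<forall>p. 0 < p \<and> p < 1 \<longrightarrow> (\<lambda>n. hnorm p (\<lambda>k. toep (G n) f k - \<Phi> k)) \<longlonglongrightarrow> 0))"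
      using P1 conv by blast
  qed (use uniq in blast)
qed

section \<open>Fefferman's inequality\<close>

text \<open>With F = exp g and x = Re g the function is K e^x - e^(2x), whose second derivative e^x
  (K - 4 e^x) is nonnegative exactly where |F| <= K/4. Tangents in the variable Re g are then
  supporting real parts of holomorphic functions; at a zero of F the constant 0 supports.\<close>

lemma hsupp_convex_in_log:
  assumes F: "F holomorphic_on ball w e" "e > 0" and K: "cmod (F w) < K / 4"
  shows "hsupp (\<lambda>z. K * cmod (F z) - (cmod (F z))\<^sup>2) w"
proof -
  have cF: "continuous_on (ball w e) F" by (rule holomorphic_on_imp_continuous_on[OF F(1)])
  have "0 \<le> cmod (F w)" by simp
  with K have K0: "K > 0" by linarith
  have "open (ball w e \<inter> (\<lambda>z. cmod (F z)) -` {..<K/4})"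
    by (intro continuous_open_preimage continuous_intros cF) auto
  moreover have "w \<in> ball w e \<inter> (\<lambda>z. cmod (F z)) -` {..<K/4}" using F K by auto
  ultimately obtain d where d: "d > 0" "ball w d \<subseteq> ball w e \<inter> (\<lambda>z. cmod (F z)) -` {..<K/4}" by (meson openE)
  have small: "cmod (F z) < K / 4" if "z \<in> ball w d" for z using d that by auto
  show ?thesis
  proof (cases "F w = 0")
    case True
    show ?thesis
    proof (rule hsuppI[of d "\<lambda>_. 0"])
      fix z assume "z \<in> ball w d"
      then have "cmod (F z) \<le> K" using small[of z] K0 by simp
      then have "cmod (F z) * cmod (F z) \<le> K * cmod (F z)" by (intro mult_right_mono) auto
      then show "Re 0 \<le> K * cmod (F z) - (cmod (F z))\<^sup>2" by (simp add: power2_eq_square)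
    qed (use d True in auto)
  next
    case False
    have "isCont F w" by (rule continuous_on_interior[OF cF]) (use F in auto)
    then obtain d1 where d1: "d1 > 0" "\<forall>z. dist w z < d1 \<longrightarrow> F z \<noteq> 0"
      using continuous_at_avoid[of w F 0] False by blast
    define \<delta> where "\<delta> = min d d1"
    have sub: "ball w \<delta> \<subseteq> ball w e" using d(2) by (auto simp: \<delta>_def)
    obtain g where g: "g holomorphic_on ball w \<delta>" "\<And>z. z \<in> ball w \<delta> \<Longrightarrow> F z = exp (g z)"
    proof (rule contractible_imp_holomorphic_log[of F "ball w \<delta>"])
      show "F holomorphic_on ball w \<delta>" by (rule holomorphic_on_subset[OF F(1) sub])
      show "contractible (ball w \<delta>)" by (intro convex_imp_contractible convex_ball)
    qed (use d1 in \<open>auto simp: \<delta>_def\<close>)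
    have \<delta>0: "\<delta> > 0" using d d1 by (simp add: \<delta>_def)
    define \<psi> where "\<psi> x = K * exp x - exp (2 * x)" for x :: real
    define \<psi>' where "\<psi>' x = K * exp x - 2 * exp (2 * x)" for x :: real
    have e2: "exp (2 * x) = exp x * exp x" for x :: real unfolding mult_2 by (rule exp_add)
    define C where "C = {..ln (K/4)}"
    have conv: "convex_on C \<psi>"
    proof (rule f''_ge0_imp_convex[where f' = \<psi>' and f'' = "\<lambda>x. K * exp x - 4 * exp (2 * x)"])
      show "convex C" by (simp add: C_def)
      fix x assume "x \<in> C"
      then have "exp x \<le> K / 4" using K0 by (simp add: C_def ln_ge_iff)
      then have "4 * (exp x * exp x) \<le> K * exp x" by (simp flip: mult.assoc)
      then show "0 \<le> K * exp x - 4 * exp (2 * x)" unfolding e2 by linarith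
      show "DERIV \<psi> x :> \<psi>' x" "DERIV \<psi>' x :> K * exp x - 4 * exp (2 * x)"
        unfolding \<psi>_def[abs_def] \<psi>'_def[abs_def] by (auto intro!: derivative_eq_intros)
    qed
    have inC: "Re (g z) < ln (K / 4)" if "z \<in> ball w \<delta>" for z
    proof -
      have "exp (Re (g z)) < K / 4" using small[of z] g(2)[OF that] that by (simp add: \<delta>_def)
      then show ?thesis using K0 by (metis exp_gt_zero ln_exp ln_less_cancel_iff less_trans)
    qed
    have wb: "w \<in> ball w \<delta>" using \<delta>0 by simp
    define x0 where "x0 = Re (g w)"
    have val: "K * cmod (F z) - (cmod (F z))\<^sup>2 = \<psi> (Re (g z))" if "z \<in> ball w \<delta>" for z
      unfolding \<psi>_def g(2)[OF that] e2 norm_exp_eq_Re power2_eq_square ..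
    have tangent: "\<psi> x0 + \<psi>' x0 * (Re (g z) - x0) \<le> \<psi> (Re (g z))" if "z \<in> ball w \<delta>" for z
    proof -
      have "\<psi> (Re (g z)) - \<psi> x0 \<ge> \<psi>' x0 * (Re (g z) - x0)"
      proof (rule convex_on_imp_above_tangent[OF conv])
        show "connected C" by (simp add: C_def)
        show "x0 \<in> interior C" using inC[OF wb] by (simp add: C_def x0_def interior_Iic)
        show "Re (g z) \<in> C" using inC[OF that] by (simp add: C_def)
        show "(\<psi> has_field_derivative \<psi>' x0) (at x0 within C)"
          unfolding \<psi>_def[abs_def] \<psi>'_def by (auto intro!: derivative_eq_intros)
      qed
      then show ?thesis by linarith
    qed
    show ?thesis
    proof (rule hsuppI[OF \<delta>0, of "\<lambda>z. of_real (\<psi> x0) + of_real (\<psi>' x0) * (g z - of_real x0)"])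
      show "(\<lambda>z. of_real (\<psi> x0) + of_real (\<psi>' x0) * (g z - of_real x0)) holomorphic_on ball w \<delta>"
        by (intro holomorphic_intros g)
      show "Re (of_real (\<psi> x0) + of_real (\<psi>' x0) * (g w - of_real x0)) = K * cmod (F w) - (cmod (F w))\<^sup>2"
        unfolding val[OF wb] by (simp add: x0_def)
      fix z assume z: "z \<in> ball w \<delta>"
      show "Re (of_real (\<psi> x0) + of_real (\<psi>' x0) * (g z - of_real x0)) \<le> K * cmod (F z) - (cmod (F z))\<^sup>2"
        unfolding val[OF z] using tangent[OF z] by simp
    qed
  qed
qed

lemma cmod_diff_square: "(cmod (x - a))\<^sup>2 = (cmod x)\<^sup>2 - 2 * Re (cnj a * x) + (cmod a)\<^sup>2"
  by (simp only: cmod_power2) (simp add: power2_eq_square algebra_simps)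

text \<open>John--Nirenberg from the \<open>L\<^sup>1\<close> to the \<open>L\<^sup>2\<close> Garsia bound: on \<open>{|\<phi> - a| \<le> K/4}\<close> the function
  \<open>Re E - |\<phi>|\<^sup>2 + K |\<phi> - a|\<close> is subharmonic, and the maximum principle compares it with a multiple of \<open>Re h\<close>.\<close>
lemma garsia_L1_imp_L2:
  assumes R: "R > 1" and \<phi>: "\<phi> holomorphic_on ball 0 R" and M: "M > 0"
    and h: "\<And>a. \<exists>h. h holomorphic_on ball 0 R \<and> (\<forall>z\<in>ball 0 R. cmod (\<phi> z - a) \<le> Re (h z)) \<and> (\<forall>z\<in>ball 0 R. \<phi> z = a \<longrightarrow> Re (h z) \<le> M)"
    and E: "\<And>z. cmod z = 1 \<Longrightarrow> Re (poly E z) \<le> (cmod (\<phi> z))\<^sup>2 + \<epsilon>" and \<epsilon>: "\<epsilon> \<ge> 0" and z: "cmod z \<le> 1"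
  shows "Re (poly E z) - (cmod (\<phi> z))\<^sup>2 \<le> 16 * M\<^sup>2 + 2 * \<epsilon>"
proof -
  define G where "G w = Re (poly E w) - (cmod (\<phi> w))\<^sup>2" for w
  have sub: "cball 0 1 \<subseteq> ball (0::complex) R" using R by auto
  have c\<phi>: "continuous_on (cball 0 1) \<phi>" by (rule continuous_on_subset[OF holomorphic_on_imp_continuous_on[OF \<phi>] sub])
  have cG: "continuous_on (cball 0 1) G" unfolding G_def by (intro continuous_intros c\<phi>)
  obtain zm where zm: "cmod zm \<le> 1" "\<And>w. cmod w \<le> 1 \<Longrightarrow> G w \<le> G zm"
    using continuous_attains_sup[OF _ _ cG] by auto
  \<comment> \<open>Compactness makes A finite beforehand, so an estimate of A by a constant plus
    A/2 can be solved for A.\<close>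
  define A where "A = max (G zm) 0"
  have GA: "G w \<le> A" if "cmod w \<le> 1" for w using zm(2)[OF that] by (simp add: A_def)
  have A0: "A \<ge> 0" by (simp add: A_def)
  \<comment> \<open>With K = 8 M the two parts of \<open>k\<close> times M are 8 M^2 and A/2; the
    latter is what can be absorbed.\<close>
  define K where "K = 8 * M"
  have K0: "K > 0" using M by (simp add: K_def)
  have main: "G z \<le> \<epsilon> + 8 * M\<^sup>2 + A / 2" if z: "cmod z < 1" for z
  proof -
    define a where "a = \<phi> z"
    obtain h where h: "h holomorphic_on ball 0 R" "\<And>w. w \<in> ball 0 R \<Longrightarrow> cmod (\<phi> w - a) \<le> Re (h w)" "\<And>w. w \<in> ball 0 R \<Longrightarrow> \<phi> w = a \<Longrightarrow> Re (h w) \<le> M"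
      using assms(4)[of a] by blast
    \<comment> \<open>The summand K makes k Re h dominate K |\<open>\<phi>\<close> - a| everywhere;
      the summand 4A/K pays for G <= A on the inner boundary, where Re h >= |\<open>\<phi>\<close> -
      a| = K/4.\<close>
    define k where "k = K + 4 * A / K"
    have k0: "k \<ge> 0" using K0 A0 by (simp add: k_def)
    \<comment> \<open>Expanding |\<open>\<phi>\<close>|^2 around a leaves K |\<open>\<phi>\<close> -
      a| - |\<open>\<phi>\<close> - a|^2 plus the real part of a holomorphic function, the shape
      covered by \<open>hsupp_convex_in_log\<close>.\<close>
    define U where "U w = (K * cmod (\<phi> w - a) - (cmod (\<phi> w - a))\<^sup>2) + Re (poly E w - 2 * cnj a * \<phi> w + of_real ((cmod a)\<^sup>2) - of_real k * h w)" for w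
    have Ueq: "U w = G w + K * cmod (\<phi> w - a) - k * Re (h w)" for w
      unfolding U_def G_def using cmod_diff_square[of "\<phi> w" a] by simp
    define S where "S = {w \<in> cball 0 1. cmod (\<phi> w - a) \<le> K / 4}"
    define \<Omega> where "\<Omega> = {w \<in> ball 0 1. cmod (\<phi> w - a) < K / 4}"
    have "closed S"
    proof -
      have "S = cball 0 1 \<inter> (\<lambda>w. cmod (\<phi> w - a)) -` {..K/4}" by (auto simp: S_def)
      moreover have "continuous_on (cball 0 1) (\<lambda>w. cmod (\<phi> w - a))" by (intro continuous_intros c\<phi>)
      ultimately show ?thesis using continuous_closed_preimage[of "cball 0 1" "\<lambda>w. cmod (\<phi> w - a)" "{..K/4}"] by simp
    qed
    moreover have "S = cball 0 1 \<inter> S" by (auto simp: S_def)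
    ultimately have cS: "compact S" using compact_Int_closed[of "cball (0::complex) 1" S] by simp
    have "open \<Omega>"
    proof -
      have "\<Omega> = ball 0 1 \<inter> (\<lambda>w. cmod (\<phi> w - a)) -` {..<K/4}" by (auto simp: \<Omega>_def)
      moreover have "continuous_on (ball 0 1) (\<lambda>w. cmod (\<phi> w - a))"
        by (intro continuous_intros continuous_on_subset[OF c\<phi>]) auto
      ultimately show ?thesis using continuous_open_preimage[of "ball 0 1" "\<lambda>w. cmod (\<phi> w - a)" "{..<K/4}"] by simp
    qed
    have ch: "continuous_on (cball 0 1) h" by (rule continuous_on_subset[OF holomorphic_on_imp_continuous_on[OF h(1)] sub])
    have "U z \<le> \<epsilon>"
    proof (rule max_principle[OF cS _ \<open>open \<Omega>\<close>])
      show "continuous_on S U" unfolding U_def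
        by (rule continuous_on_subset[of "cball 0 1"]) (auto simp: S_def intro!: continuous_intros c\<phi> ch)
      show "\<Omega> \<subseteq> S" by (auto simp: \<Omega>_def S_def)
      show "hsupp U w" if w: "w \<in> \<Omega>" for w
      proof -
        have wR: "ball w (R - 1) \<subseteq> ball 0 R"
        proof
          fix v assume "v \<in> ball w (R - 1)"
          moreover have "cmod w < 1" using w by (simp add: \<Omega>_def)
          ultimately show "v \<in> ball 0 R" using norm_triangle_ineq[of w "v - w"] by (simp add: dist_norm norm_minus_commute)
        qed
        have \<phi>w: "\<phi> holomorphic_on ball w (R - 1)" "h holomorphic_on ball w (R - 1)"
          using holomorphic_on_subset[OF \<phi> wR] holomorphic_on_subset[OF h(1) wR] by auto
        show ?thesis unfolding U_def
        proof (rule hsupp_add_Re[of _ _ _ "R - 1"])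
          show "hsupp (\<lambda>w. K * cmod (\<phi> w - a) - (cmod (\<phi> w - a))\<^sup>2) w"
            by (rule hsupp_convex_in_log[of _ _ "R - 1"]) (use \<phi>w R w in \<open>auto simp: \<Omega>_def intro!: holomorphic_intros\<close>)
          show "(\<lambda>w. poly E w - 2 * cnj a * \<phi> w + of_real ((cmod a)\<^sup>2) - of_real k * h w) holomorphic_on ball w (R - 1)"
            by (intro holomorphic_intros \<phi>w)
        qed (use R in simp)
      qed
      show "U w \<le> \<epsilon>" if w: "w \<in> S - \<Omega>" for w
      proof -
        have w1: "cmod w \<le> 1" "cmod (\<phi> w - a) \<le> K / 4" using w by (auto simp: S_def)
        have hw: "cmod (\<phi> w - a) \<le> Re (h w)" using w1 R by (intro h(2)) auto
        have hw0: "0 \<le> Re (h w)" using hw norm_ge_zero[of "\<phi> w - a"] by linarith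
        have Kh: "K * cmod (\<phi> w - a) \<le> K * Re (h w)" using hw K0 by (intro mult_left_mono) auto
        have kh: "k * Re (h w) = K * Re (h w) + 4 * A / K * Re (h w)" by (simp add: k_def distrib_right)
        show ?thesis
        proof (cases "cmod w = 1")
          case True
          have "G w \<le> \<epsilon>" using E[OF True] by (simp add: G_def)
          moreover have "0 \<le> 4 * A / K * Re (h w)" using A0 K0 hw0 by simp
          ultimately show ?thesis unfolding Ueq kh using Kh by linarith
        next
          case False
          then have "cmod (\<phi> w - a) = K / 4" using w w1 by (auto simp: S_def \<Omega>_def)
          then have "K / 4 \<le> Re (h w)" using hw by simp
          then have "4 * A / K * (K / 4) \<le> 4 * A / K * Re (h w)" using A0 K0 by (intro mult_left_mono) auto
          then have "A \<le> 4 * A / K * Re (h w)" using K0 by simp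
          then show ?thesis unfolding Ueq kh using Kh GA[OF w1(1)] \<epsilon> by linarith
        qed
      qed
      show "z \<in> S" using z K0 by (simp add: S_def a_def)
    qed
    then have "G z \<le> \<epsilon> + k * Re (h z)" unfolding Ueq by (simp add: a_def)
    also have "k * Re (h z) \<le> k * M" using k0 z R by (intro mult_left_mono h(3)) (auto simp: a_def)
    also have "k * M = 8 * M\<^sup>2 + A / 2" using M by (simp add: k_def K_def field_simps power2_eq_square)
    finally show ?thesis by simp
  qed
  have "G zm \<le> \<epsilon> + 8 * M\<^sup>2 + A / 2"
  proof (cases "cmod zm < 1")
    case True
    then show ?thesis by (rule main)
  next
    case False
    then have "G zm \<le> \<epsilon>" using E[of zm] zm(1) by (simp add: G_def)
    then show ?thesis using A0 by (simp add: add_increasing2)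
  qed
  then have "A \<le> \<epsilon> + 8 * M\<^sup>2 + A / 2" using \<epsilon> A0 unfolding A_def by (auto simp: max_def)
  then have "A \<le> 16 * M\<^sup>2 + 2 * \<epsilon>" by simp
  then show ?thesis using GA[OF z] by (simp add: G_def)
qed

text \<open>This is (2 sqrt A x - y)^2 >= 0, scaled. The weight 3 sqrt A matches the constant in
  front of |h| in the subharmonic function below, which is what decides that constant.\<close>

lemma amgm_weighted:
  fixes x y :: real
  assumes "A > 0" "x \<ge> 0" "y \<ge> 0"
  shows "3 * (x * y) \<le> 3 * sqrt A * x\<^sup>2 + 3 * sqrt A / (4 * A) * y\<^sup>2"
proof -
  define s where "s = sqrt A"
  have s: "s > 0" "A = s\<^sup>2" using assms by (auto simp: s_def)
  have "0 \<le> (2 * s * x - y)\<^sup>2" by simp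
  then have "4 * s * x * y \<le> 4 * s\<^sup>2 * x\<^sup>2 + y\<^sup>2" by (simp add: power2_eq_square algebra_simps)
  then have "3 / (4 * s) * (4 * s * x * y) \<le> 3 / (4 * s) * (4 * s\<^sup>2 * x\<^sup>2 + y\<^sup>2)" using s by (intro mult_left_mono) auto
  then show ?thesis unfolding s_def[symmetric] s(2) using s(1) by (simp add: field_simps power2_eq_square)
qed

text \<open>Uchiyama's trick: \<open>e\<^bsup>-G/A\<^esup> |h|\<close> has enough positive Laplacian to absorb \<open>Re (\<phi>\<^sup>* h)\<close>. Writing \<open>h = q\<^sup>2\<close> locally
  removes the need to factorise \<open>h\<close>.\<close>
lemma hsupp_fefferman:
  assumes \<phi>: "\<phi> holomorphic_on ball w e" and h: "h holomorphic_on ball w e" and e: "e > 0"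
    and A: "A > 0" and G: "Re (poly E w) - (cmod (\<phi> w))\<^sup>2 \<le> A"
  shows "hsupp (\<lambda>z. 3 * sqrt A * ((1 + exp (- (Re (poly E z) - (cmod (\<phi> z))\<^sup>2) / A)) * cmod (h z)) - Re (cnj (\<phi> z) * h z)) w"
proof -
  define c where "c = 3 * sqrt A"
  have c0: "c > 0" using A by (simp add: c_def)
  define \<phi>0 where "\<phi>0 = \<phi> w"
  define X where "X z = exp (- (Re (poly E z) - (cmod (\<phi> z))\<^sup>2) / A)" for z
  have cont: "isCont \<phi> w" by (rule continuous_on_interior[OF holomorphic_on_imp_continuous_on[OF \<phi>]]) (use e in auto)
  show ?thesis
  proof (cases "h w = 0")
    case True
    \<comment> \<open>At a zero of h no square root is used: the deviation of \<open>\<phi>\<close>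
      from its value at w is less than c = 3 sqrt A nearby, so the first part of c (1 + X) |h|
      already absorbs it.\<close>
    obtain d where d: "d > 0" "\<And>z. dist z w < d \<Longrightarrow> cmod (\<phi> z - \<phi>0) < c"
      using cont c0 unfolding continuous_at_eps_delta dist_norm \<phi>0_def by (metis dist_norm)
    show ?thesis
    proof (rule hsuppI[of "min d e" "\<lambda>z. - (cnj \<phi>0 * h z)"])
      show "(\<lambda>z. - (cnj \<phi>0 * h z)) holomorphic_on ball w (min d e)"
        by (intro holomorphic_intros holomorphic_on_subset[OF h]) auto
      fix z assume z: "z \<in> ball w (min d e)"
      have "Re (cnj (\<phi> z) * h z) = Re (cnj (\<phi> z - \<phi>0) * h z) + Re (cnj \<phi>0 * h z)" by (simp add: algebra_simps)
      moreover have "Re (cnj (\<phi> z - \<phi>0) * h z) \<le> c * cmod (h z)"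
      proof (rule order.trans[OF complex_Re_le_cmod])
        show "cmod (cnj (\<phi> z - \<phi>0) * h z) \<le> c * cmod (h z)"
          unfolding norm_mult complex_mod_cnj using d(2)[of z] z by (intro mult_right_mono) (auto simp: dist_commute)
      qed
      moreover have "c * cmod (h z) \<le> c * ((1 + X z) * cmod (h z))"
        using c0 by (intro mult_left_mono) (auto simp: X_def distrib_right)
      ultimately show "Re (- (cnj \<phi>0 * h z)) \<le> 3 * sqrt A * ((1 + exp (- (Re (poly E z) - (cmod (\<phi> z))\<^sup>2) / A)) * cmod (h z)) - Re (cnj (\<phi> z) * h z)"
        unfolding X_def[symmetric] c_def[symmetric] uminus_complex.simps by linarith
    qed (use d e True in auto)
  next
    case False
    have "isCont h w" by (rule continuous_on_interior[OF holomorphic_on_imp_continuous_on[OF h]]) (use e in auto)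
    then obtain d1 where d1: "d1 > 0" "\<forall>z. dist w z < d1 \<longrightarrow> h z \<noteq> 0"
      using continuous_at_avoid[of w h 0] False by blast
    define \<delta> where "\<delta> = min e d1"
    have \<delta>0: "\<delta> > 0" using e d1 by (simp add: \<delta>_def)
    obtain q where q: "q holomorphic_on ball w \<delta>" "\<And>z. z \<in> ball w \<delta> \<Longrightarrow> h z = (q z)\<^sup>2"
    proof (rule contractible_imp_holomorphic_sqrt[of h "ball w \<delta>"])
      show "h holomorphic_on ball w \<delta>" by (rule holomorphic_on_subset[OF h]) (auto simp: \<delta>_def)
      show "contractible (ball w \<delta>)" by (intro convex_imp_contractible convex_ball)
    qed (use d1 in \<open>auto simp: \<delta>_def\<close>)
    define q0 where "q0 = q w"
    have q00: "q0 \<noteq> 0" using q(2)[of w] False \<delta>0 by (auto simp: q0_def)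
    \<comment> \<open>Expanding |\<open>\<phi>\<close>|^2 around \<open>\<phi>0\<close> leaves a
      holomorphic \<open>E1\<close> and the square |\<open>\<phi>\<close> -
      \<open>\<phi>0\<close>|^2. Then e^(-G/A) is |k|^2 times an exponential of that square, which
      is the gain used below.\<close>
    define E1 where "E1 z = poly E z - 2 * cnj \<phi>0 * \<phi> z + of_real ((cmod \<phi>0)\<^sup>2)" for z
    define k where "k z = exp (- E1 z / of_real (2 * A))" for z
    have ReE1: "Re (poly E z) - (cmod (\<phi> z))\<^sup>2 = Re (E1 z) - (cmod (\<phi> z - \<phi>0))\<^sup>2" for z
      unfolding E1_def cmod_diff_square by simp
    have k2: "(cmod (k z))\<^sup>2 = exp (- Re (E1 z) / A)" for z
    proof -
      have "cmod (k z) = exp (- Re (E1 z) / (2 * A))" unfolding k_def norm_exp_eq_Re by simp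
      then have "(cmod (k z))\<^sup>2 = exp (- Re (E1 z) / (2 * A) + - Re (E1 z) / (2 * A))" unfolding exp_add by (simp add: power2_eq_square)
      also have "- Re (E1 z) / (2 * A) + - Re (E1 z) / (2 * A) = - Re (E1 z) / A" using A by (simp add: field_simps)
      finally show ?thesis .
    qed
    have Xk: "X z = exp ((cmod (\<phi> z - \<phi>0))\<^sup>2 / A) * (cmod (k z))\<^sup>2" for z
      unfolding X_def ReE1 k2 exp_add[symmetric] by (simp add: diff_divide_distrib)
    have X0: "X w = (cmod (k w))\<^sup>2" unfolding Xk by (simp add: \<phi>0_def)
    have Xge: "(1 + (cmod (\<phi> z - \<phi>0))\<^sup>2 / A) * (cmod (k z))\<^sup>2 \<le> X z" for z
      unfolding Xk using exp_ge_add_one_self[of "(cmod (\<phi> z - \<phi>0))\<^sup>2 / A"] by (intro mult_right_mono) auto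
    have \<phi>\<delta>: "\<phi> holomorphic_on ball w \<delta>" by (rule holomorphic_on_subset[OF \<phi>]) (auto simp: \<delta>_def)
    have kh: "k holomorphic_on ball w \<delta>" unfolding k_def E1_def by (intro holomorphic_intros \<phi>\<delta>) (use A in auto)
    \<comment> \<open>G <= A at w gives X >= 1/e there; since e < 4, |k|^2 exceeds 1/4 at w and
      hence nearby.\<close>
    have "1/4 < exp (-1 :: real)" using exp_le by (simp add: exp_minus field_simps)
    also have "\<dots> \<le> X w" using G A unfolding X_def by (simp add: divide_le_eq field_simps)
    finally have kw: "1/4 < (cmod (k w))\<^sup>2" unfolding X0 .
    have "continuous_on (ball w \<delta>) (\<lambda>z. (cmod (k z))\<^sup>2)" "continuous_on (ball w \<delta>) (\<lambda>z. 2 * cmod (q z) - cmod q0)"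
      by (intro continuous_intros holomorphic_on_imp_continuous_on[OF kh] holomorphic_on_imp_continuous_on[OF q(1)])+
    then have op: "open (ball w \<delta> \<inter> (\<lambda>z. (cmod (k z))\<^sup>2) -` {1/4<..})" "open (ball w \<delta> \<inter> (\<lambda>z. 2 * cmod (q z) - cmod q0) -` {0<..})"
      by (auto intro!: continuous_open_preimage)
    have "w \<in> (ball w \<delta> \<inter> (\<lambda>z. (cmod (k z))\<^sup>2) -` {1/4<..}) \<inter> (ball w \<delta> \<inter> (\<lambda>z. 2 * cmod (q z) - cmod q0) -` {0<..})"
      using kw \<delta>0 q00 by (auto simp: q0_def)
    then obtain d where d: "d > 0" "ball w d \<subseteq> (ball w \<delta> \<inter> (\<lambda>z. (cmod (k z))\<^sup>2) -` {1/4<..}) \<inter> (ball w \<delta> \<inter> (\<lambda>z. 2 * cmod (q z) - cmod q0) -` {0<..})"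
      using openE[OF open_Int[OF op]] by blast
    have dsub: "ball w d \<subseteq> ball w \<delta>" using d(2) by auto
    \<comment> \<open>Each modulus square is replaced by its tangent |b|^2 + 2 Re (conj b (x - b))
      at b = q0 or b = q0 k(w), and in the cross term the conjugation is moved onto the constant
      q0^2 so that P is holomorphic. The loss |q - q0|^2 from the first tangent is then spent on the
      cross term.\<close>
    define P where "P z = of_real c * (2 * cnj q0 * q z - of_real ((cmod q0)\<^sup>2)) + of_real c * (2 * cnj (q0 * k w) * (q z * k z) - of_real ((cmod (q0 * k w))\<^sup>2))
       - cnj \<phi>0 * (q z)\<^sup>2 - (\<phi> z - \<phi>0) * cnj (q0\<^sup>2)" for z
    have lin: "Re (2 * cnj b * x - of_real ((cmod b)\<^sup>2)) = (cmod x)\<^sup>2 - (cmod (x - b))\<^sup>2" for b x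
      unfolding cmod_diff_square by simp
    have RP: "Re (P z) = c * ((cmod (q z))\<^sup>2 - (cmod (q z - q0))\<^sup>2) + c * ((cmod (q z * k z))\<^sup>2 - (cmod (q z * k z - q0 * k w))\<^sup>2)
       - Re (cnj \<phi>0 * (q z)\<^sup>2) - Re (cnj (\<phi> z - \<phi>0) * q0\<^sup>2)" for z
    proof -
      have "Re ((\<phi> z - \<phi>0) * cnj (q0\<^sup>2)) = Re (cnj (\<phi> z - \<phi>0) * q0\<^sup>2)"
        by (metis cnj.simps(1) complex_cnj_cnj complex_cnj_mult)
      moreover have "Re (of_real c * u1 + of_real c * u2 - u3 - u4) = c * Re u1 + c * Re u2 - Re u3 - Re u4" for u1 u2 u3 u4
        by simp
      ultimately show ?thesis unfolding P_def by (simp only: lin)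
    qed
    show ?thesis
    proof (rule hsuppI[OF d(1), of P])
      show "P holomorphic_on ball w d"
        unfolding P_def by (intro holomorphic_intros holomorphic_on_subset[OF q(1) dsub] holomorphic_on_subset[OF kh dsub] holomorphic_on_subset[OF \<phi>\<delta> dsub])
      have hw: "h w = q0\<^sup>2" using q(2)[of w] \<delta>0 by (simp add: q0_def)
      have "Re (P w) = c * (cmod q0)\<^sup>2 + c * (cmod (q0 * k w))\<^sup>2 - Re (cnj \<phi>0 * q0\<^sup>2)"
        unfolding RP by (simp add: q0_def \<phi>0_def)
      also have "\<dots> = c * ((1 + X w) * cmod (h w)) - Re (cnj (\<phi> w) * h w)"
        unfolding hw X0 \<phi>0_def[symmetric] by (simp add: norm_mult norm_power power_mult_distrib algebra_simps)
      finally show "Re (P w) = 3 * sqrt A * ((1 + exp (- (Re (poly E w) - (cmod (\<phi> w))\<^sup>2) / A)) * cmod (h w)) - Re (cnj (\<phi> w) * h w)"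
        unfolding X_def c_def .
      fix z assume z: "z \<in> ball w d"
      have zk: "1/4 < (cmod (k z))\<^sup>2" and zq: "cmod q0 \<le> 2 * cmod (q z)" and zd: "z \<in> ball w \<delta>" using d(2) z by auto
      define x y where "x = cmod (q z - q0)" and "y = cmod (\<phi> z - \<phi>0) * cmod (q z)"
      have hz: "h z = (q z)\<^sup>2" by (rule q(2)[OF zd])
      \<comment> \<open>The factor 3 arises from |q + q0| <= 3 |q|, valid where |q0| <= 2
        |q|.\<close>
      have cross: "Re (cnj (\<phi> z - \<phi>0) * ((q z)\<^sup>2 - q0\<^sup>2)) \<le> 3 * (x * y)"
      proof -
        have "(q z)\<^sup>2 - q0\<^sup>2 = (q z - q0) * (q z + q0)" by (simp add: power2_eq_square algebra_simps)
        then have "cmod (cnj (\<phi> z - \<phi>0) * ((q z)\<^sup>2 - q0\<^sup>2)) = cmod (\<phi> z - \<phi>0) * (x * cmod (q z + q0))"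
          by (simp only: norm_mult complex_mod_cnj x_def)
        also have "\<dots> \<le> cmod (\<phi> z - \<phi>0) * (x * (3 * cmod (q z)))"
          using norm_triangle_ineq[of "q z" q0] zq by (intro mult_left_mono) (auto simp: x_def)
        also have "\<dots> = 3 * (x * y)" by (simp add: y_def mult_ac)
        finally show ?thesis using complex_Re_le_cmod order.trans by blast
      qed
      have "c / (4 * A) * y\<^sup>2 \<le> c * ((cmod (\<phi> z - \<phi>0))\<^sup>2 / A * (cmod (k z))\<^sup>2 * (cmod (q z))\<^sup>2)"
      proof -
        have "(cmod (\<phi> z - \<phi>0))\<^sup>2 / A * (1/4) * (cmod (q z))\<^sup>2 \<le> (cmod (\<phi> z - \<phi>0))\<^sup>2 / A * (cmod (k z))\<^sup>2 * (cmod (q z))\<^sup>2"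
          using zk A by (intro mult_right_mono mult_left_mono) auto
        then have "c * ((cmod (\<phi> z - \<phi>0))\<^sup>2 / A * (1/4) * (cmod (q z))\<^sup>2) \<le> c * ((cmod (\<phi> z - \<phi>0))\<^sup>2 / A * (cmod (k z))\<^sup>2 * (cmod (q z))\<^sup>2)"
          using c0 by (intro mult_left_mono) auto
        then show ?thesis by (simp add: y_def power_mult_distrib)
      qed
      moreover have "c * ((1 + (cmod (\<phi> z - \<phi>0))\<^sup>2 / A) * (cmod (k z))\<^sup>2 * (cmod (q z))\<^sup>2) \<le> c * (X z * cmod (h z))"
        unfolding hz norm_power using c0 Xge[of z] by (intro mult_left_mono mult_right_mono) auto
      moreover have "c * ((1 + (cmod (\<phi> z - \<phi>0))\<^sup>2 / A) * (cmod (k z))\<^sup>2 * (cmod (q z))\<^sup>2) = c * (cmod (q z * k z))\<^sup>2 + c * ((cmod (\<phi> z - \<phi>0))\<^sup>2 / A * (cmod (k z))\<^sup>2 * (cmod (q z))\<^sup>2)"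
        by (simp only: norm_mult power_mult_distrib) (simp add: algebra_simps)
      moreover have "3 * (x * y) \<le> c * x\<^sup>2 + c / (4 * A) * y\<^sup>2"
        unfolding c_def by (rule amgm_weighted[OF A]) (auto simp: x_def y_def)
      ultimately have k1: "c * (cmod (q z * k z))\<^sup>2 + Re (cnj (\<phi> z - \<phi>0) * ((q z)\<^sup>2 - q0\<^sup>2)) \<le> c * (X z * cmod (h z)) + c * x\<^sup>2"
        using cross by linarith
      have "Re (P z) \<le> c * ((cmod (q z))\<^sup>2 - x\<^sup>2) + c * (cmod (q z * k z))\<^sup>2 - Re (cnj \<phi>0 * (q z)\<^sup>2) - Re (cnj (\<phi> z - \<phi>0) * q0\<^sup>2)"
        unfolding RP x_def using c0 by (simp add: mult_left_mono)
      moreover have "Re (cnj (\<phi> z) * h z) = Re (cnj \<phi>0 * (q z)\<^sup>2) + Re (cnj (\<phi> z - \<phi>0) * q0\<^sup>2) + Re (cnj (\<phi> z - \<phi>0) * ((q z)\<^sup>2 - q0\<^sup>2))"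
      proof -
        have "cnj (\<phi> z) * h z = cnj \<phi>0 * (q z)\<^sup>2 + cnj (\<phi> z - \<phi>0) * q0\<^sup>2 + cnj (\<phi> z - \<phi>0) * ((q z)\<^sup>2 - q0\<^sup>2)"
          unfolding hz complex_cnj_diff by (simp add: algebra_simps)
        then show ?thesis by (simp only: plus_complex.simps)
      qed
      moreover have "c * ((1 + X z) * cmod (h z)) = c * (cmod (q z))\<^sup>2 + c * (X z * cmod (h z))"
        by (simp add: hz norm_power algebra_simps)
      moreover have "c * ((cmod (q z))\<^sup>2 - x\<^sup>2) = c * (cmod (q z))\<^sup>2 - c * x\<^sup>2" by (simp add: right_diff_distrib)
      ultimately have "Re (P z) \<le> c * ((1 + X z) * cmod (h z)) - Re (cnj (\<phi> z) * h z)"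
        using k1 by linarith
      then show "Re (P z) \<le> 3 * sqrt A * ((1 + exp (- (Re (poly E z) - (cmod (\<phi> z))\<^sup>2) / A)) * cmod (h z)) - Re (cnj (\<phi> z) * h z)"
        unfolding X_def c_def .
    qed
  qed
qed

section \<open>From mean oscillation to Garsia majorants\<close>

definition bmo_bound :: "(real \<Rightarrow> complex) \<Rightarrow> real \<Rightarrow> bool" where
  "bmo_bound F B \<longleftrightarrow> (\<forall>a l. 0 < l \<and> l \<le> 2*pi \<longrightarrow>
     (1 / l) * (LINT t:{a..a+l}|lborel. cmod (F t - (1 / of_real l) * (LINT s:{a..a+l}|lborel. F s))) \<le> B)"

lemma dyadic_weights: "(\<Sum>k\<le>n. (1/2)^(n-k) * (1 + 2 * real (n-k))) \<le> 6"
proof -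
  have "(\<Sum>k\<le>n. (1/2)^(n-k) * (1 + 2 * real (n-k))) = (\<Sum>k\<le>n. (1/2)^k * (1 + 2 * real k))"
    by (rule sum.reindex_bij_witness[of _ "\<lambda>k. n - k" "\<lambda>k. n - k"]) auto
  also have "\<dots> = 6 - (2 * real n + 5) * (1/2)^n"
    by (induction n) (simp_all add: field_simps)
  also have "\<dots> \<le> 6" by simp
  finally show ?thesis .
qed

lemma set_integrable_cmod_minus:
  fixes F :: "real \<Rightarrow> complex"
  assumes "set_integrable lborel {a..b} F"
  shows "set_integrable lborel {a..b} (\<lambda>s. cmod (F s - c))"
proof -
  have "set_integrable lborel {a..b} (\<lambda>s. F s - c)"
  proof (rule set_integral_diff(1)[OF assms])
    show "set_integrable lborel {a..b} (\<lambda>s. c)" unfolding set_integrable_def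
      by (intro integrable_scaleR_left integrable_real_indicator) (auto simp: emeasure_lborel_Icc_eq)
  qed
  then show ?thesis by (rule set_integrable_norm)
qed

text \<open>Halving an interval moves the mean by at most 2B, the 2 being the ratio of lengths. The
  mean over the smallest interval therefore serves at every larger scale, with a loss linear in the
  number of halvings, which the geometric weights of the Poisson kernel can bear.\<close>

lemma bmo_davg:
  fixes F :: "real \<Rightarrow> complex"
  assumes per: "\<And>s. F (s + 2*pi) = F s" and F: "integrable circ F" and B: "bmo_bound F B"
  obtains c where "\<And>k. k \<le> n \<Longrightarrow> davg (\<lambda>s. cmod (F s - c)) t k \<le> B * (1 + 2 * real (n - k))"
proof -
  define I where "I k = {t - pi*(1/2)^k..t + pi*(1/2)^k}" for k :: nat
  define l where "l k = 2 * pi * (1/2)^k" for k :: nat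
  have l0: "l k > 0" for k by (simp add: l_def)
  have l2: "l k \<le> 2 * pi" for k unfolding l_def by (simp add: power_le_one)
  have lS: "l k = 2 * l (Suc k)" for k by (simp add: l_def)
  have Il: "I k = {t - pi*(1/2)^k..t - pi*(1/2)^k + l k}" for k by (simp add: I_def l_def)
  define c where "c k = (1 / of_real (l k)) * (LINT s:I k|lborel. F s)" for k
  have siF: "set_integrable lborel (I k) F" for k unfolding I_def by (rule integrable_on_periodic[OF per F])
  have siW: "set_integrable lborel (I k) (\<lambda>s. cmod (F s - d))" for k d
    using siF[of k] unfolding I_def by (rule set_integrable_cmod_minus)
  have da: "davg W t k = (1 / l k) * (LINT s:I k|lborel. W s)" for W k by (simp add: davg_def I_def l_def)
  have osc: "davg (\<lambda>s. cmod (F s - c k)) t k \<le> B" for k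
    using B[unfolded bmo_bound_def, rule_format, of "l k" "t - pi*(1/2)^k"] l0 l2 unfolding da c_def Il by blast
  have measI: "measure lborel (I k) = l k" for k by (simp add: I_def l_def)
  have step: "cmod (c (Suc k) - c k) \<le> 2 * B" for k
  proof -
    have sub: "I (Suc k) \<subseteq> I k" unfolding I_def by auto
    have const: "(LINT s:I (Suc k)|lborel. c k) = of_real (l (Suc k)) * c k"
      using measI[of "Suc k"] less_imp_le[OF l0[of "Suc k"]] by (simp add: set_lebesgue_integral_def scaleR_conv_of_real I_def)
    have ic: "set_integrable lborel (I (Suc k)) (\<lambda>_. c k)" by (simp add: set_integrable_def I_def)
    have "(LINT s:I (Suc k)|lborel. F s - c k) = (LINT s:I (Suc k)|lborel. F s) - of_real (l (Suc k)) * c k"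
      using siF[of "Suc k"] ic by (simp add: set_integral_diff const)
    then have "c (Suc k) - c k = (1 / of_real (l (Suc k))) * (LINT s:I (Suc k)|lborel. F s - c k)"
      using l0[of "Suc k"] by (simp add: c_def right_diff_distrib)
    then have "cmod (c (Suc k) - c k) = (1 / l (Suc k)) * cmod (LINT s:I (Suc k)|lborel. F s - c k)"
      using l0[of "Suc k"] by (simp add: norm_mult norm_divide)
    also have "\<dots> \<le> (1 / l (Suc k)) * (LINT s:I (Suc k)|lborel. cmod (F s - c k))"
      using l0[of "Suc k"] siF[of "Suc k"] ic by (intro mult_left_mono set_integral_norm_bound set_integral_diff) auto
    also have "\<dots> \<le> (1 / l (Suc k)) * (LINT s:I k|lborel. cmod (F s - c k))"
    proof (intro mult_left_mono)
      show "(LINT s:I (Suc k)|lborel. cmod (F s - c k)) \<le> (LINT s:I k|lborel. cmod (F s - c k))"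
        unfolding set_lebesgue_integral_def
        using siW[of "Suc k" "c k"] siW[of k "c k"] sub unfolding set_integrable_def by (intro integral_mono) (auto simp: indicator_def)
    qed (use l0[of "Suc k"] in simp)
    also have "\<dots> = 2 * davg (\<lambda>s. cmod (F s - c k)) t k" using l0[of "Suc k"] by (simp add: da lS[of k])
    also have "\<dots> \<le> 2 * B" using osc by simp
    finally show ?thesis .
  qed
  have far: "cmod (c k - c (k + j)) \<le> 2 * B * real j" for k j
  proof (induction j)
    case (Suc j)
    have "cmod (c k - c (k + Suc j)) \<le> cmod (c k - c (k + j)) + cmod (c (Suc (k + j)) - c (k + j))"
      using norm_triangle_ineq4[of "c k - c (k + j)" "c (Suc (k + j)) - c (k + j)"] by simp
    also have "\<dots> \<le> 2 * B * real j + 2 * B" by (intro add_mono Suc step)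
    finally show ?case by (simp add: algebra_simps)
  qed simp
  show ?thesis
  proof (rule that[of "c n"])
    fix k assume k: "k \<le> n"
    have siP: "set_integrable lborel {t - pi..t + pi} (\<lambda>s. cmod (F s - d))" for d
      by (rule set_integrable_cmod_minus[OF integrable_on_periodic[OF per F]])
    have "davg (\<lambda>s. cmod (F s - c n)) t k \<le> davg (\<lambda>s. cmod (F s - c k) + cmod (c k - c n)) t k"
    proof (rule davg_mono)
      show "set_integrable lborel {t - pi..t + pi} (\<lambda>s. cmod (F s - c k) + cmod (c k - c n))"
        using siP[of "c k"] by (intro set_integral_add) (auto simp: set_integrable_def)
      show "cmod (F s - c n) \<le> cmod (F s - c k) + cmod (c k - c n)" for s
        using norm_triangle_ineq[of "F s - c k" "c k - c n"] by simp
    qed (rule siP)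
    also have "\<dots> = davg (\<lambda>s. cmod (F s - c k)) t k + cmod (c k - c n)" by (rule davg_add_const[OF siP])
    also have "\<dots> \<le> B + 2 * B * real (n - k)" using osc[of k] far[of k "n - k"] k by (intro add_mono) auto
    finally show "davg (\<lambda>s. cmod (F s - c n)) t k \<le> B * (1 + 2 * real (n - k))" by (simp add: algebra_simps)
  qed
qed

text \<open>The dyadic bound starts at radius 1/2; smaller radii are compared with 1/2. There the
  kernel is at most 4, while the kernel of radius 1/2 is at least 1/3.\<close>

lemma pk_small_radius:
  assumes "0 \<le> r" "r \<le> 1/2"
  shows "pk r y \<le> 12 * pk (1/2) y"
proof -
  have "pk r y \<le> 2 / (1 - r)" using assms by (intro pk_le) auto
  also have "\<dots> \<le> 2 / (1/2)" using assms by (intro divide_left_mono) auto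
  finally have 1: "pk r y \<le> 4" by simp
  have d: "0 < 5/4 - cos y" using cos_le_one[of y] by linarith
  have "5/4 - cos y \<le> 9/4" using cos_ge_minus_one[of y] by linarith
  then have "3/4 / (9/4) \<le> (3/4) / (5/4 - cos y)"
    using d by (intro divide_left_mono) auto
  then have "1/3 \<le> pk (1/2) y" by (simp add: pk_def power2_eq_square)
  then show ?thesis using 1 by simp
qed

text \<open>For r >= 1/2 the kernel constant 12 times the bound 6 of the weighted sum gives 72;
  comparison with radius 1/2 costs another factor 12, hence 864.\<close>

lemma garsia_L1_const:
  fixes F :: "real \<Rightarrow> complex"
  assumes per: "\<And>s. F (s + 2*pi) = F s" and F: "integrable circ F" and B: "bmo_bound F B" and r: "0 \<le> r" "r < 1"
  obtains c where "(LINT s|circ. pk r (t - s) * cmod (F s - c)) \<le> 864 * \<bar>B\<bar>"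
proof -
  have big: "\<exists>c. (LINT s|circ. pk r (t - s) * cmod (F s - c)) \<le> 72 * \<bar>B\<bar>" if r: "1/2 \<le> r" "r < 1" for r
  proof -
    obtain n where n: "1 - r \<le> (1/2)^n" "(1/2)^Suc n \<le> 1 - r" using ex_dyadic[of "1-r"] r by auto
    obtain c where c: "\<And>k. k \<le> n \<Longrightarrow> davg (\<lambda>s. cmod (F s - c)) t k \<le> B * (1 + 2 * real (n - k))"
      using bmo_davg[OF per F B] by blast
    have "(LINT s|circ. pk r (t - s) * cmod (F s - c)) \<le> 12 * (\<Sum>k\<le>n. (1/2)^(n-k) * davg (\<lambda>s. cmod (F s - c)) t k)"
      using F by (intro pint_dyadic_bound r n) (auto simp: per)
    also have "\<dots> \<le> 12 * (\<Sum>k\<le>n. (1/2)^(n-k) * (\<bar>B\<bar> * (1 + 2 * real (n - k))))"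
    proof (intro mult_left_mono sum_mono)
      fix k assume "k \<in> {..n}"
      then have "davg (\<lambda>s. cmod (F s - c)) t k \<le> B * (1 + 2 * real (n - k))" using c by simp
      also have "\<dots> \<le> \<bar>B\<bar> * (1 + 2 * real (n - k))" by (intro mult_right_mono) auto
      finally show "davg (\<lambda>s. cmod (F s - c)) t k \<le> \<bar>B\<bar> * (1 + 2 * real (n - k))" .
    qed auto
    also have "\<dots> = 12 * \<bar>B\<bar> * (\<Sum>k\<le>n. (1/2)^(n-k) * (1 + 2 * real (n-k)))" by (simp add: sum_distrib_left mult_ac)
    also have "\<dots> \<le> 12 * \<bar>B\<bar> * 6" using dyadic_weights by (intro mult_left_mono) auto
    finally show ?thesis by auto
  qed
  show ?thesis
  proof (cases "1/2 \<le> r")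
    case True
    obtain c where "(LINT s|circ. pk r (t - s) * cmod (F s - c)) \<le> 72 * \<bar>B\<bar>" using big[OF True r(2)] by blast
    then show ?thesis using that[of c] by simp
  next
    case False
    obtain c where c: "(LINT s|circ. pk (1/2) (t - s) * cmod (F s - c)) \<le> 72 * \<bar>B\<bar>" using big[of "1/2"] by auto
    have i: "integrable circ (\<lambda>s. cmod (F s - c))" using F by simp
    have "(LINT s|circ. pk r (t - s) * cmod (F s - c)) \<le> (LINT s|circ. 12 * (pk (1/2) (t - s) * cmod (F s - c)))"
    proof (rule integral_mono)
      show "integrable circ (\<lambda>s. pk r (t - s) * cmod (F s - c))" using integrable_pk[OF i r] by simp
      show "integrable circ (\<lambda>s. 12 * (pk (1/2) (t - s) * cmod (F s - c)))" using integrable_pk[OF i, of "1/2"] by simp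
      show "pk r (t - s) * cmod (F s - c) \<le> 12 * (pk (1/2) (t - s) * cmod (F s - c))" for s
        using mult_right_mono[OF pk_small_radius[of r "t - s"], of "cmod (F s - c)"] r False by simp
    qed
    also have "\<dots> = 12 * (LINT s|circ. pk (1/2) (t - s) * cmod (F s - c))" by simp
    also have "\<dots> \<le> 864 * \<bar>B\<bar>" using c by simp
    finally show ?thesis by (rule that)
  qed
qed

lemma complex_polar:
  fixes z :: complex
  obtains t where "z = of_real (cmod z) * cis t"
  using rcis_cmod_Arg[of z] unfolding rcis_def by metis

text \<open>The majorant h is the holomorphic completion of the Poisson integral of |f - a|. At a
  point where f = a, replacing the good constant c by a costs |c - a|, itself at most 864 |B|; this
  doubles the bound to 1728 |B|. The final 1 makes M strictly positive even for B = 0.\<close>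

lemma garsia_majorant:
  assumes f: "f \<in> Hp 2" and B: "bmo_bound (bv f) B"
  obtains M where "M > 0" "\<And>a. \<exists>h. h holomorphic_on ball 0 1 \<and> (\<forall>z\<in>ball 0 1. cmod (ev f z - a) \<le> Re (h z)) \<and> (\<forall>z\<in>ball 0 1. ev f z = a \<longrightarrow> Re (h z) \<le> M)"
proof (rule that[of "1728 * \<bar>B\<bar> + 1"])
  note F = Hp2_boundary[OF f]
  have ev: "evc f r t = pint (bv f) r t" if "0 \<le> r" "r < 1" for r t
    using pint_analytic[OF F(4) that F(5,6)] by simp
  have dev: "cmod (evc f r t - a) \<le> (LINT s|circ. pk r (t - s) * cmod (bv f s - a))" if r: "0 \<le> r" "r < 1" for r t a
  proof -
    have i1: "integrable circ (\<lambda>s. of_real (pk r (t - s)) * bv f s)" "integrable circ (\<lambda>s. of_real (pk r (t - s)) * a)"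
      using integrable_pk[OF F(4) r] integrable_pk[of "\<lambda>_. a", OF _ r] by (simp_all add: scaleR_conv_of_real)
    have "a = (LINT s|circ. of_real (pk r (t - s)) * a)"
      using pint_const[OF r, of t] by (simp add: integral_complex_of_real)
    then have "evc f r t - a = (LINT s|circ. of_real (pk r (t - s)) * (bv f s - a))"
      unfolding ev[OF r] pint_def using i1 by (simp add: right_diff_distrib)
    then have "cmod (evc f r t - a) \<le> (LINT s|circ. cmod (of_real (pk r (t - s)) * (bv f s - a)))"
      by (simp only: integral_norm_bound)
    also have "\<dots> = (LINT s|circ. pk r (t - s) * cmod (bv f s - a))" using pk_nonneg[OF r] by (simp add: norm_mult)
    finally show ?thesis .
  qed
  fix a
  define W where "W s = cmod (bv f s - a)" for s
  have W: "integrable circ W" unfolding W_def using F(4) by simp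
  then have W': "integrable circ (\<lambda>s. complex_of_real (W s))" by simp
  define w where "w n = fc (\<lambda>s. of_real (W s)) (int n)" for n
  have w: "analytic_disk w" unfolding w_def by (rule analytic_disk_fc)
  define h where "h z = 2 * ev w z - fc (\<lambda>s. of_real (W s)) 0" for z
  have Reh: "Re (h (of_real r * cis t)) = (LINT s|circ. pk r (t - s) * W s)" if r: "0 \<le> r" "r < 1" for r t
  proof -
    have cn: "cnj (fc (\<lambda>t. of_real (W t)) (- int n)) = w n" for n
      using fc_cnj[of "\<lambda>t. of_real (W t)" "int n"] by (simp add: w_def)
    have "pint (\<lambda>s. of_real (W s)) r t = evc w r t + cnj (evc w r t) - fc (\<lambda>s. of_real (W s)) 0"
      using pint_eq[OF W' r, of t] unfolding cn w_def[abs_def, symmetric] by (simp add: w_def[abs_def])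
    then have "Re (pint (\<lambda>s. of_real (W s)) r t) = Re (h (of_real r * cis t))" by (simp add: h_def)
    moreover have "pint (\<lambda>s. of_real (W s)) r t = of_real ((LINT s|circ. pk r (t - s) * W s))"
      unfolding pint_def by (simp flip: of_real_mult)
    ultimately show ?thesis by simp
  qed
  show "\<exists>h. h holomorphic_on ball 0 1 \<and> (\<forall>z\<in>ball 0 1. cmod (ev f z - a) \<le> Re (h z)) \<and> (\<forall>z\<in>ball 0 1. ev f z = a \<longrightarrow> Re (h z) \<le> 1728 * \<bar>B\<bar> + 1)"
  proof (intro exI[of _ h] conjI ballI impI)
    show "h holomorphic_on ball 0 1" unfolding h_def by (intro holomorphic_intros ev_holomorphic w)
    fix z :: complex assume z: "z \<in> ball 0 1"
    obtain t where zt: "z = of_real (cmod z) * cis t" by (rule complex_polar)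
    define r where "r = cmod z"
    have zt: "z = of_real r * cis t" and r: "0 \<le> r" "r < 1" using zt z by (auto simp: r_def)
    show "cmod (ev f z - a) \<le> Re (h z)" unfolding zt Reh[OF r] W_def by (rule dev[OF r])
    assume fa: "ev f z = a"
    obtain c where c: "(LINT s|circ. pk r (t - s) * cmod (bv f s - c)) \<le> 864 * \<bar>B\<bar>"
      using garsia_L1_const[OF bv_periodic F(4) B r] by blast
    have ca: "cmod (c - a) \<le> 864 * \<bar>B\<bar>"
      using order.trans[OF dev[OF r, of t c] c] fa unfolding zt by (simp add: norm_minus_commute)
    have i: "integrable circ (\<lambda>s. pk r (t - s) * cmod (bv f s - c))" using integrable_pk[of "\<lambda>s. cmod (bv f s - c)", OF _ r] F(4) by simp
    have i2: "integrable circ (\<lambda>s. pk r (t - s) * cmod (c - a))" using integrable_pk[of "\<lambda>s. cmod (c - a)", OF _ r] by simp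
    have i3: "integrable circ (\<lambda>s. pk r (t - s) * W s)" using integrable_pk[OF W r] by simp
    have "(LINT s|circ. pk r (t - s) * W s) \<le> (LINT s|circ. pk r (t - s) * cmod (bv f s - c) + pk r (t - s) * cmod (c - a))"
    proof (rule integral_mono[OF i3])
      show "integrable circ (\<lambda>s. pk r (t - s) * cmod (bv f s - c) + pk r (t - s) * cmod (c - a))" using i i2 by simp
      fix s
      have "W s \<le> cmod (bv f s - c) + cmod (c - a)" unfolding W_def using norm_triangle_ineq[of "bv f s - c" "c - a"] by simp
      then show "pk r (t - s) * W s \<le> pk r (t - s) * cmod (bv f s - c) + pk r (t - s) * cmod (c - a)"
        unfolding distrib_left[symmetric] using pk_nonneg[OF r] by (intro mult_left_mono)
    qed
    also have "\<dots> = (LINT s|circ. pk r (t - s) * cmod (bv f s - c)) + cmod (c - a)"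
      using i i2 pint_const[OF r, of t] by simp
    also have "\<dots> \<le> 1728 * \<bar>B\<bar> + 1" using c ca by simp
    finally show "Re (h z) \<le> 1728 * \<bar>B\<bar> + 1" unfolding zt Reh[OF r] .
  qed
qed simp

section \<open>Fefferman's inequality, first across the boundary and then in general\<close>

text \<open>The submean inequality at the origin is applied to c (1 + e^(-G/A)) |h| - Re (conj
  \<open>\<phi>\<close> h). Its value at 0 is at least minus |\<open>\<phi>\<close>(0) h(0)|, and on
  the circle the exponential is at most 1 because G >= 0 there.\<close>

lemma fefferman_smooth:
  assumes R: "R > 1" and \<phi>: "\<phi> holomorphic_on ball 0 R" and h: "h holomorphic_on ball 0 R" and M: "M > 0"
    and maj: "\<And>a. \<exists>h. h holomorphic_on ball 0 R \<and> (\<forall>z\<in>ball 0 R. cmod (\<phi> z - a) \<le> Re (h z)) \<and> (\<forall>z\<in>ball 0 R. \<phi> z = a \<longrightarrow> Re (h z) \<le> M)"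
  shows "(LINT t|circ. Re (cnj (\<phi> (cis t)) * h (cis t))) \<le> 30 * M * (LINT t|circ. cmod (h (cis t))) + cmod (\<phi> 0 * h 0)"
proof -
  have sub: "cball 0 1 \<subseteq> ball (0::complex) R" using R by auto
  have c\<phi>: "continuous_on (cball 0 1) \<phi>" by (rule continuous_on_subset[OF holomorphic_on_imp_continuous_on[OF \<phi>] sub])
  have ch: "continuous_on (cball 0 1) h" by (rule continuous_on_subset[OF holomorphic_on_imp_continuous_on[OF h] sub])
  \<comment> \<open>Approximating |\<open>\<phi>\<close>|^2 + \<open>\<epsilon>\<close>/2 within
    \<open>\<epsilon>\<close>/2 keeps G in [0, \<open>\<epsilon>\<close>] on the circle. This choice
    makes the Garsia bound 16 M^2 + 2 \<open>\<epsilon>\<close> = 18 M^2, the A below; then 6 sqrt A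
    <= 30 M.\<close>
  define \<epsilon> where "\<epsilon> = M\<^sup>2"
  have \<epsilon>: "\<epsilon> > 0" using M by (simp add: \<epsilon>_def)
  have "continuous_on (sphere 0 1) (\<lambda>z. (cmod (\<phi> z))\<^sup>2 + \<epsilon> / 2)" by (intro continuous_intros continuous_on_subset[OF c\<phi>]) auto
  then obtain E where E: "\<And>z. cmod z = 1 \<Longrightarrow> \<bar>(cmod (\<phi> z))\<^sup>2 + \<epsilon> / 2 - Re (poly E z)\<bar> < \<epsilon> / 2"
    using circle_poly_approx[of "\<lambda>z. (cmod (\<phi> z))\<^sup>2 + \<epsilon> / 2" "\<epsilon> / 2"] \<epsilon> by (metis half_gt_zero)
  have E1: "Re (poly E z) \<le> (cmod (\<phi> z))\<^sup>2 + \<epsilon>" "(cmod (\<phi> z))\<^sup>2 \<le> Re (poly E z)" if "cmod z = 1" for z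
    using E[OF that] unfolding abs_less_iff by linarith+
  define A where "A = 18 * M\<^sup>2"
  have A: "A > 0" using M by (simp add: A_def)
  have G: "Re (poly E z) - (cmod (\<phi> z))\<^sup>2 \<le> A" if "cmod z \<le> 1" for z
    using garsia_L1_imp_L2[OF R \<phi> M maj E1(1) less_imp_le[OF \<epsilon>] that] by (simp add: A_def \<epsilon>_def)
  define S where "S z = 3 * sqrt A * ((1 + exp (- (Re (poly E z) - (cmod (\<phi> z))\<^sup>2) / A)) * cmod (h z)) - Re (cnj (\<phi> z) * h z)" for z
  have S0: "S 0 \<le> (LINT t|circ. S (cis t))"
  proof (rule submean)
    show "continuous_on (cball 0 1) S" unfolding S_def by (intro continuous_intros c\<phi> ch) (use A in auto)
    fix w :: complex assume w: "cmod w < 1"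
    have wR: "ball w (R - 1) \<subseteq> ball 0 R"
    proof
      fix v assume "v \<in> ball w (R - 1)"
      then show "v \<in> ball 0 R" using norm_triangle_ineq[of w "v - w"] w by (simp add: dist_norm norm_minus_commute)
    qed
    show "hsupp S w" unfolding S_def
      by (rule hsupp_fefferman[OF holomorphic_on_subset[OF \<phi> wR] holomorphic_on_subset[OF h wR]]) (use R A G w in auto)
  qed
  have "- cmod (\<phi> 0 * h 0) \<le> - Re (cnj (\<phi> 0) * h 0)"
    using complex_Re_le_cmod[of "cnj (\<phi> 0) * h 0"] by (simp only: norm_mult complex_mod_cnj neg_le_iff_le)
  also have "\<dots> \<le> S 0" unfolding S_def using A by (simp add: add_nonneg_nonneg)
  also note S0
  also have "(LINT t|circ. S (cis t)) \<le> (LINT t|circ. 30 * M * cmod (h (cis t)) - Re (cnj (\<phi> (cis t)) * h (cis t)))"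
  proof (rule integral_mono)
    have cc: "continuous_on UNIV (\<lambda>t. \<phi> (cis t))" "continuous_on UNIV (\<lambda>t. h (cis t))"
      by (auto intro!: continuous_on_compose2[OF c\<phi>] continuous_on_compose2[OF ch] continuous_intros)
    show "integrable circ (\<lambda>t. S (cis t))" unfolding S_def
      by (intro integrable_circ_continuous continuous_intros cc) (use A in auto)
    show "integrable circ (\<lambda>t. 30 * M * cmod (h (cis t)) - Re (cnj (\<phi> (cis t)) * h (cis t)))"
      by (intro integrable_circ_continuous continuous_intros cc)
    fix t
    have "exp (- (Re (poly E (cis t)) - (cmod (\<phi> (cis t)))\<^sup>2) / A) \<le> 1"
      using E1(2)[of "cis t"] A by (simp add: divide_le_0_iff)
    then have "(1 + exp (- (Re (poly E (cis t)) - (cmod (\<phi> (cis t)))\<^sup>2) / A)) * cmod (h (cis t)) \<le> 2 * cmod (h (cis t))"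
      by (intro mult_right_mono) auto
    then have "3 * sqrt A * ((1 + exp (- (Re (poly E (cis t)) - (cmod (\<phi> (cis t)))\<^sup>2) / A)) * cmod (h (cis t))) \<le> 3 * sqrt A * (2 * cmod (h (cis t)))"
      using A by (intro mult_left_mono) auto
    also have "\<dots> \<le> 30 * M * cmod (h (cis t))"
    proof -
      have "sqrt A \<le> 5 * M" using M by (intro real_le_lsqrt) (auto simp: A_def power2_eq_square)
      then have "(6 * sqrt A) * cmod (h (cis t)) \<le> (30 * M) * cmod (h (cis t))" by (intro mult_right_mono) auto
      then show ?thesis by simp
    qed
    finally show "S (cis t) \<le> 30 * M * cmod (h (cis t)) - Re (cnj (\<phi> (cis t)) * h (cis t))" unfolding S_def by simp
  qed
  also have "\<dots> = 30 * M * (LINT t|circ. cmod (h (cis t))) - (LINT t|circ. Re (cnj (\<phi> (cis t)) * h (cis t)))"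
  proof -
    have cc: "continuous_on UNIV (\<lambda>t. \<phi> (cis t))" "continuous_on UNIV (\<lambda>t. h (cis t))"
      by (auto intro!: continuous_on_compose2[OF c\<phi>] continuous_on_compose2[OF ch] continuous_intros)
    have "integrable circ (\<lambda>t. 30 * M * cmod (h (cis t)))" "integrable circ (\<lambda>t. Re (cnj (\<phi> (cis t)) * h (cis t)))"
      by (intro integrable_circ_continuous continuous_intros cc)+
    then show ?thesis by (subst Bochner_Integration.integral_diff) auto
  qed
  finally show ?thesis by simp
qed

text \<open>The constant also contains |f(0)|, since mean oscillation does not see constants. It may
  depend on f: only the finiteness of the dual norm is drawn from it.\<close>

theorem fefferman:
  assumes f: "f \<in> Hp 2" and B: "bmo_bound (bv f) B"
  obtains C where "\<And>h. h \<in> Hp 2 \<Longrightarrow> cmod (pairing f h) \<le> C * hnorm 1 h"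
proof -
  note F = Hp2_boundary[OF f]
  obtain M where M: "M > 0" "\<And>a. \<exists>h. h holomorphic_on ball 0 1 \<and> (\<forall>z\<in>ball 0 1. cmod (ev f z - a) \<le> Re (h z)) \<and> (\<forall>z\<in>ball 0 1. ev f z = a \<longrightarrow> Re (h z) \<le> M)"
    using garsia_majorant[OF f B] by blast
  define C where "C = 30 * M + cmod (f 0)"
  have C0: "C \<ge> 0" using M by (simp add: C_def)
  show ?thesis
  proof (rule that[of C])
    fix h assume h: "h \<in> Hp 2"
    note H = Hp2_boundary[OF h]
    have h1: "h \<in> Hp 1" by (rule Hp2_imp_Hp1[OF h])
    \<comment> \<open>Pairing f with the dilation of h by \<open>\<rho>\<close>^2 equals pairing the
      dilations of both by \<open>\<rho>\<close>, and these are holomorphic on the larger disc of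
      radius 1/\<open>\<rho>\<close>.\<close>
    have smooth: "cmod ((LINT t|circ. bv f t * cnj (evc h (\<rho>\<^sup>2) t))) \<le> C * hnorm 1 h" if \<rho>: "0 < \<rho>" "\<rho> < 1" for \<rho>
    proof -
      have \<rho>0: "0 \<le> \<rho>" "\<rho>\<^sup>2 < 1" "0 \<le> \<rho>\<^sup>2" using \<rho> by (auto simp: power_less_one_iff abs_square_less_1)
      define I where "I = (LINT t|circ. bv f t * cnj (evc h (\<rho>\<^sup>2) t))"
      have i: "integrable circ (\<lambda>t. evc f \<rho> t)" by (intro integrable_circ_continuous continuous_ev_circle F \<rho>0 \<rho>)
      have "(\<lambda>k. f k * cnj (h k) * of_real (\<rho>\<^sup>2) ^ k) sums I"
        using integral_cnj_ev[OF F(4) H(1) \<rho>0(3,2)] by (simp add: F(5) I_def)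
      moreover have "(\<lambda>k. f k * cnj (h k) * of_real (\<rho>\<^sup>2) ^ k) sums (LINT t|circ. evc f \<rho> t * cnj (evc h \<rho> t))"
        using integral_cnj_ev[OF i H(1) \<rho>0(1) \<rho>(2)] unfolding fc_dilation[OF F(1) \<rho>0(1) \<rho>(2)] by (simp add: power2_eq_square power_mult_distrib mult_ac)
      ultimately have I: "I = (LINT t|circ. evc f \<rho> t * cnj (evc h \<rho> t))" by (rule sums_unique2)
      define R where "R = 1 / \<rho>"
      have R: "R > 1" using \<rho> by (simp add: R_def)
      have inb: "of_real \<rho> * z \<in> ball 0 1" if "z \<in> ball 0 R" for z :: complex
        using that \<rho> by (simp add: R_def norm_mult field_simps)
      have hol: "(\<lambda>z. g (of_real \<rho> * z)) holomorphic_on ball 0 R" if "g holomorphic_on ball 0 1" for g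
        by (rule holomorphic_on_compose_gen[of "\<lambda>z. of_real \<rho> * z" _ g, unfolded o_def, OF _ that]) (use inb in \<open>auto intro!: holomorphic_intros\<close>)
      \<comment> \<open>The unimodular u rotates h so that the real part bounded in
        \<open>fefferman_smooth\<close> is the modulus of the pairing.\<close>
      define u where "u = (if I = 0 then 1 else I / of_real (cmod I))"
      have u1: "cmod u = 1" by (simp add: u_def norm_divide)
      have uI: "Re (u * cnj I) = cmod I"
      proof (cases "I = 0")
        case False
        have "u * cnj I = (I * cnj I) / of_real (cmod I)" using False by (simp add: u_def)
        also have "\<dots> = of_real ((cmod I)\<^sup>2 / cmod I)" unfolding of_real_divide complex_norm_square ..
        finally show ?thesis using False by (simp add: power2_eq_square)
      qed simp
      have maj: "\<exists>h. h holomorphic_on ball 0 R \<and> (\<forall>z\<in>ball 0 R. cmod (ev f (of_real \<rho> * z) - a) \<le> Re (h z)) \<and> (\<forall>z\<in>ball 0 R. ev f (of_real \<rho> * z) = a \<longrightarrow> Re (h z) \<le> M)" for a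
      proof -
        obtain h where h: "h holomorphic_on ball 0 1" "\<forall>z\<in>ball 0 1. cmod (ev f z - a) \<le> Re (h z)" "\<forall>z\<in>ball 0 1. ev f z = a \<longrightarrow> Re (h z) \<le> M" using M(2) by blast
        show ?thesis by (rule exI[of _ "\<lambda>z. h (of_real \<rho> * z)"]) (use hol[OF h(1)] h(2,3) inb in blast)
      qed
      have "(LINT t|circ. Re (cnj (evc f \<rho> t) * (u * evc h \<rho> t)))
         \<le> 30 * M * (LINT t|circ. cmod (u * evc h \<rho> t)) + cmod (ev f (of_real \<rho> * 0) * (u * ev h (of_real \<rho> * 0)))"
        by (rule fefferman_smooth[OF R hol[OF ev_holomorphic[OF F(1)]] _ M(1) maj]) (intro holomorphic_intros hol ev_holomorphic H)
      also have "(LINT t|circ. Re (cnj (evc f \<rho> t) * (u * evc h \<rho> t))) = cmod I"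
      proof -
        have ii: "integrable circ (\<lambda>t. u * cnj (evc f \<rho> t * cnj (evc h \<rho> t)))"
          by (intro integrable_circ_continuous continuous_intros continuous_ev_circle F H \<rho> \<rho>0)
        have "(LINT t|circ. Re (u * cnj (evc f \<rho> t * cnj (evc h \<rho> t)))) = Re (u * cnj I)"
          unfolding integral_Re[OF ii] by (simp only: integral_mult_right_zero Bochner_Integration.integral_cnj I)
        then show ?thesis unfolding uI by (simp add: mult_ac)
      qed
      also have "(LINT t|circ. cmod (u * evc h \<rho> t)) = pmean 1 h \<rho>"
        using u1 by (simp add: norm_mult pmean1[OF H(1) \<rho>0(1) \<rho>(2)])
      also have "cmod (ev f (of_real \<rho> * 0) * (u * ev h (of_real \<rho> * 0))) = cmod (f 0) * cmod (h 0)" using u1 by (simp add: norm_mult)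
      also have "30 * M * pmean 1 h \<rho> + cmod (f 0) * cmod (h 0) \<le> 30 * M * hnorm 1 h + cmod (f 0) * hnorm 1 h"
      proof (intro add_mono mult_left_mono)
        have hh: "0 \<le> hnorm 1 h" unfolding hnorm1[OF h1] by simp
        show "pmean 1 h \<rho> \<le> hnorm 1 h" using pmean_le_hnorm[OF h1 \<rho>0(1) \<rho>(2)] hh by simp
        have "cmod (h 0) \<le> (LINT t|circ. cmod (bv h t))" using norm_fc_le[of "bv h" 0] H(5)[of 0] by simp
        then show "cmod (h 0) \<le> hnorm 1 h" by (simp add: hnorm1[OF h1])
      qed (use M in auto)
      finally show ?thesis unfolding I_def C_def by (simp add: distrib_right)
    qed
    have "((\<lambda>\<rho>. \<rho>\<^sup>2) \<longlongrightarrow> 1\<^sup>2) (at_left (1::real))" by (intro tendsto_intros)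
    then have "filterlim (\<lambda>\<rho>. \<rho>\<^sup>2) (at_left 1) (at_left (1::real))"
    proof (intro tendsto_imp_filterlim_at_left)
      show "\<forall>\<^sub>F \<rho> in at_left 1. \<rho>\<^sup>2 < (1::real)"
        using eventually_radius by eventually_elim (simp add: abs_square_less_1)
    qed simp
    from filterlim_compose[OF pairing_limit[OF F(3) F(7) h] this]
    have lim: "((\<lambda>\<rho>. (LINT t|circ. bv f t * cnj (evc h (\<rho>\<^sup>2) t))) \<longlongrightarrow> (LINT t|circ. bv f t * cnj (bv h t))) (at_left 1)" .
    have "cmod ((LINT t|circ. bv f t * cnj (bv h t))) \<le> C * hnorm 1 h"
    proof (rule tendsto_upperbound[OF tendsto_norm[OF lim]])
      have "\<forall>\<^sub>F \<rho> in at_left (1::real). \<rho> \<in> {0<..<1}" by (rule eventually_at_leftI[of 0]) auto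
      then show "\<forall>\<^sub>F \<rho> in at_left 1. cmod ((LINT t|circ. bv f t * cnj (evc h (\<rho>\<^sup>2) t))) \<le> C * hnorm 1 h"
        by eventually_elim (use smooth in auto)
    qed simp
    then show "cmod (pairing f h) \<le> C * hnorm 1 h" by (simp add: pairing_eq[OF H(3) F(3)])
  qed
qed

section \<open>Bounded functions with prescribed Fourier coefficients\<close>

text \<open>Restricting to finitely many coefficients makes the residual of the extremal problem a
  trigonometric polynomial, against which the duality hypothesis can be tested.\<close>

definition fdist :: "afun \<Rightarrow> nat \<Rightarrow> (real \<Rightarrow> complex) \<Rightarrow> real" where
  "fdist f n \<phi> = (\<Sum>k<n. (cmod (fc \<phi> (int k) - f k))\<^sup>2)"

text \<open>The ball of bounded functions with the bound at every point, which keeps null sets out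
  of the convexity arguments.\<close>

definition mball :: "real \<Rightarrow> (real \<Rightarrow> complex) set" where
  "mball B = {\<phi>. \<phi> \<in> borel_measurable borel \<and> (\<forall>t. cmod (\<phi> t) \<le> B)}"

lemma mball_integrable: "\<phi> \<in> mball B \<Longrightarrow> integrable circ \<phi>"
  unfolding mball_def by (intro integrable_circ_bounded[of _ B]) auto

lemma mball_integrable2:
  assumes "\<phi> \<in> mball B" shows "integrable circ (\<lambda>t. (cmod (\<phi> t))\<^sup>2)"
  by (rule integrable_circ_bounded[of _ "B\<^sup>2"]) (use assms in \<open>auto simp: mball_def intro!: power_mono\<close>)

lemma mball_convex:
  assumes "\<phi> \<in> mball B" "\<psi> \<in> mball B" "0 \<le> s" "s \<le> 1"
  shows "(\<lambda>t. \<phi> t + of_real s * (\<psi> t - \<phi> t)) \<in> mball B"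
proof -
  have "cmod (\<phi> t + of_real s * (\<psi> t - \<phi> t)) \<le> B" for t
  proof -
    have "\<phi> t + of_real s * (\<psi> t - \<phi> t) = of_real (1 - s) * \<phi> t + of_real s * \<psi> t" by (simp add: algebra_simps)
    then have "cmod (\<phi> t + of_real s * (\<psi> t - \<phi> t)) \<le> cmod (of_real (1 - s) * \<phi> t) + cmod (of_real s * \<psi> t)"
      by (simp only: norm_triangle_ineq)
    also have "\<dots> = (1 - s) * cmod (\<phi> t) + s * cmod (\<psi> t)"
      using assms by (simp only: norm_mult norm_of_real abs_of_nonneg diff_ge_0_iff_ge)
    also have "\<dots> \<le> (1 - s) * B + s * B" using assms by (intro add_mono mult_left_mono) (auto simp: mball_def)
    finally show ?thesis by (simp add: algebra_simps)
  qed
  then show ?thesis using assms unfolding mball_def by auto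
qed

lemma cmod_add_square: "(cmod (a + of_real s * b))\<^sup>2 = (cmod a)\<^sup>2 + 2 * s * Re (cnj a * b) + s\<^sup>2 * (cmod b)\<^sup>2"
  by (simp only: cmod_power2) (simp add: power2_eq_square algebra_simps)

text \<open>If the distance from the bounded functions to the coefficient data were positive, moving towards
  the extremal function \<open>B sgn H\<close> of the residual \<open>H\<close> would decrease it.\<close>
lemma fdist_small:
  fixes f :: "nat \<Rightarrow> complex"
  assumes B: "B \<ge> 0" and dual: "\<And>h. cmod (\<Sum>k<n. f k * cnj (h k)) \<le> B * (LINT t|circ. cmod (\<Sum>k<n. h k * cis (real k * t)))"
    and \<eta>: "\<eta> > 0"
  shows "\<exists>\<phi>\<in>mball B. fdist f n \<phi> \<le> \<eta>"
proof -
  define d where "d = Inf (fdist f n ` mball B)"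
  have ne: "(\<lambda>_. 0) \<in> mball B" using B by (simp add: mball_def)
  have fd0: "0 \<le> fdist f n \<phi>" for \<phi> by (simp add: fdist_def sum_nonneg)
  have bdd: "bdd_below (fdist f n ` mball B)" using fd0 by (auto intro!: bdd_belowI)
  have dle: "d \<le> fdist f n \<phi>" if "\<phi> \<in> mball B" for \<phi> unfolding d_def using that by (intro cInf_lower bdd) auto
  \<comment> \<open>A move by s changes the squared distance to second order by at most s^2 n
    (2B)^2, and the starting point is within s^2 of the infimum; L collects both, and s is chosen so
    that s L <= \<open>\<eta>\<close>.\<close>
  define L where "L = 1 + real n * (2 * B)\<^sup>2"
  have L: "L \<ge> 1" by (simp add: L_def)
  define s where "s = min 1 (\<eta> / L)"
  have s: "0 < s" "s \<le> 1" using \<eta> L by (auto simp: s_def)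
  have "d < d + s\<^sup>2" using s by simp
  then obtain \<phi> where \<phi>: "\<phi> \<in> mball B" "fdist f n \<phi> < d + s\<^sup>2"
    using cInf_lessD[of "fdist f n ` mball B" "d + s\<^sup>2"] ne unfolding d_def by auto
  define h where "h k = f k - fc \<phi> (int k)" for k
  define H where "H t = (\<Sum>k<n. h k * cis (real k * t))" for t
  define \<psi> where "\<psi> t = of_real B * (if H t = 0 then 0 else H t / of_real (cmod (H t)))" for t
  have Hc: "continuous_on UNIV H" unfolding H_def by (intro continuous_intros)
  have Hm [measurable]: "H \<in> borel_measurable borel" by (rule borel_measurable_continuous_onI[OF Hc])
  have [measurable]: "\<psi> \<in> borel_measurable borel" unfolding \<psi>_def by measurable
  have \<psi>: "\<psi> \<in> mball B" unfolding mball_def using B by (auto simp: \<psi>_def norm_mult norm_divide)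
  have i\<phi>: "integrable circ \<phi>" and i\<psi>: "integrable circ \<psi>" using mball_integrable \<phi>(1) \<psi> by auto
  define e where "e k = fc \<psi> (int k) - fc \<phi> (int k)" for k
  have eB: "(cmod (e k))\<^sup>2 \<le> (2 * B)\<^sup>2" for k
  proof -
    have bd: "cmod (fc \<phi> (int k)) \<le> B" if "\<phi> \<in> mball B" for \<phi>
    proof -
      have "cmod (fc \<phi> (int k)) \<le> (LINT t|circ. cmod (\<phi> t))" by (rule norm_fc_le)
      also have "\<dots> \<le> (LINT t|circ. B)"
        using that mball_integrable[OF that] by (intro integral_mono) (auto simp: mball_def)
      finally show ?thesis by simp
    qed
    have "cmod (e k) \<le> B + B" unfolding e_def using bd[OF \<psi>] bd[OF \<phi>(1)] norm_triangle_ineq4 by (rule_tac order.trans[OF norm_triangle_ineq4 add_mono])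
    then show ?thesis by (intro power_mono) auto
  qed
  define \<xi> where "\<xi> t = \<phi> t + of_real s * (\<psi> t - \<phi> t)" for t
  have \<xi>: "\<xi> \<in> mball B" unfolding \<xi>_def using s by (intro mball_convex \<phi> \<psi>) auto
  have fc\<xi>: "fc \<xi> (int k) - f k = - h k + of_real s * e k" for k
    unfolding \<xi>_def h_def e_def using i\<phi> i\<psi> by (simp add: fc_add fc_diff fc_cmult)
  have "fdist f n \<xi> = (\<Sum>k<n. (cmod (- h k))\<^sup>2 + 2 * s * Re (cnj (- h k) * e k) + s\<^sup>2 * (cmod (e k))\<^sup>2)"
    unfolding fdist_def fc\<xi> cmod_add_square ..
  also have "\<dots> = fdist f n \<phi> - 2 * s * (\<Sum>k<n. Re (cnj (h k) * e k)) + s\<^sup>2 * (\<Sum>k<n. (cmod (e k))\<^sup>2)"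
  proof -
    have neg: "Re (cnj (- h k) * e k) = - Re (cnj (h k) * e k)" for k by simp
    have fd: "fdist f n \<phi> = (\<Sum>k<n. (cmod (h k))\<^sup>2)" by (simp add: fdist_def h_def norm_minus_commute)
    show ?thesis unfolding fd neg
      by (simp only: norm_minus_cancel mult_minus_right sum.distrib sum_negf sum_distrib_left diff_conv_add_uminus)
  qed
  also have "\<dots> \<le> fdist f n \<phi> - 2 * s * (\<Sum>k<n. Re (cnj (h k) * e k)) + s\<^sup>2 * (real n * (2 * B)\<^sup>2)"
    using sum_bounded_above[of "{..<n}" "\<lambda>k. (cmod (e k))\<^sup>2" "(2 * B)\<^sup>2"] eB by (intro add_left_mono mult_left_mono) auto
  finally have "d \<le> fdist f n \<phi> - 2 * s * (\<Sum>k<n. Re (cnj (h k) * e k)) + s\<^sup>2 * (real n * (2 * B)\<^sup>2)"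
    using dle[OF \<xi>] by linarith
  then have "2 * s * (\<Sum>k<n. Re (cnj (h k) * e k)) \<le> s\<^sup>2 * L" using \<phi>(2) by (simp add: L_def algebra_simps)
  then have "s * (2 * (\<Sum>k<n. Re (cnj (h k) * e k))) \<le> s * (s * L)" by (simp add: power2_eq_square mult_ac)
  then have 1: "2 * (\<Sum>k<n. Re (cnj (h k) * e k)) \<le> s * L" using s by (simp only: mult_le_cancel_left_pos)
  have "(\<Sum>k<n. cnj (h k) * fc \<psi> (int k)) = (LINT t|circ. \<psi> t * cnj (H t))"
  proof -
    have "\<psi> t * cnj (H t) = (\<Sum>k<n. cnj (h k) * (\<psi> t * cis (- (of_int (int k) * t))))" for t
      unfolding H_def by (simp add: sum_distrib_left cis_cnj mult_ac)
    then have "(LINT t|circ. \<psi> t * cnj (H t)) = (\<Sum>k<n. (LINT t|circ. cnj (h k) * (\<psi> t * cis (- (of_int (int k) * t)))))"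
      using integrable_fc'[OF i\<psi>] by (simp only:) (rule Bochner_Integration.integral_sum, intro integrable_mult_right, auto)
    then show ?thesis by (simp add: fc_def)
  qed
  also have "\<dots> = (LINT t|circ. complex_of_real (B * cmod (H t)))"
  proof (rule Bochner_Integration.integral_cong)
    fix t
    show "\<psi> t * cnj (H t) = complex_of_real (B * cmod (H t))"
    proof (cases "H t = 0")
      case False
      have "\<psi> t * cnj (H t) = of_real B * ((H t * cnj (H t)) / of_real (cmod (H t)))" using False by (simp add: \<psi>_def)
      also have "\<dots> = of_real B * of_real ((cmod (H t))\<^sup>2 / cmod (H t))" unfolding complex_norm_square[symmetric] of_real_divide ..
      finally show ?thesis using False by (simp add: power2_eq_square)
    qed (simp add: \<psi>_def)
  qed simp
  also have "\<dots> = of_real (B * (LINT t|circ. cmod (H t)))" unfolding integral_complex_of_real by simp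
  finally have psi: "(\<Sum>k<n. Re (cnj (h k) * fc \<psi> (int k))) = B * (LINT t|circ. cmod (H t))"
    by (metis Re_complex_of_real Re_sum)
  have "(\<Sum>k<n. Re (cnj (h k) * f k)) = Re (\<Sum>k<n. f k * cnj (h k))" by (simp add: Re_sum mult.commute)
  also have "\<dots> \<le> B * (LINT t|circ. cmod (H t))" unfolding H_def by (rule order.trans[OF complex_Re_le_cmod dual])
  finally have 2: "(\<Sum>k<n. Re (cnj (h k) * f k)) \<le> (\<Sum>k<n. Re (cnj (h k) * fc \<psi> (int k)))" unfolding psi .
  have "fdist f n \<phi> = (\<Sum>k<n. Re (cnj (h k) * f k)) - (\<Sum>k<n. Re (cnj (h k) * fc \<phi> (int k)))"
  proof -
    have "(cmod (fc \<phi> (int k) - f k))\<^sup>2 = Re (cnj (h k) * f k) - Re (cnj (h k) * fc \<phi> (int k))" for k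
    proof -
      have "(cmod (fc \<phi> (int k) - f k))\<^sup>2 = Re (of_real ((cmod (h k))\<^sup>2))" by (simp add: h_def norm_minus_commute)
      also have "\<dots> = Re (cnj (h k) * (f k - fc \<phi> (int k)))" unfolding complex_norm_square by (simp add: h_def mult.commute)
      finally show ?thesis by (simp add: right_diff_distrib)
    qed
    then show ?thesis by (simp add: fdist_def sum_subtractf)
  qed
  also have "\<dots> \<le> (\<Sum>k<n. Re (cnj (h k) * e k))"
    using 2 by (simp add: e_def right_diff_distrib sum_subtractf)
  also have "\<dots> \<le> s * L / 2" using 1 by simp
  also have "\<dots> \<le> \<eta>"
  proof -
    have "s * L \<le> \<eta> / L * L" using L by (intro mult_right_mono) (auto simp: s_def)
    then show ?thesis using L \<eta> by simp
  qed
  finally show ?thesis using \<phi>(1) by blast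
qed

lemma parallelogram_cmod: "(cmod (x - y))\<^sup>2 = 2 * (cmod x)\<^sup>2 + 2 * (cmod y)\<^sup>2 - 4 * (cmod (x + of_real (1/2) * (y - x)))\<^sup>2"
  by (simp only: cmod_power2) (simp add: power2_eq_square field_simps)

text \<open>Nested closed convex sets in \<open>L\<^sup>2\<close>: near-minimal-norm elements form a Cauchy sequence.\<close>
lemma bounded_representative:
  fixes f :: "nat \<Rightarrow> complex"
  assumes B: "B \<ge> 0" and dual: "\<And>n h. cmod (\<Sum>k<n. f k * cnj (h k)) \<le> B * (LINT t|circ. cmod (\<Sum>k<n. h k * cis (real k * t)))"
  obtains \<phi> where "\<phi> \<in> borel_measurable borel" "\<And>t. cmod (\<phi> t) \<le> B" "\<And>n. fc \<phi> (int n) = f n"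
proof -
  \<comment> \<open>A tolerance 1/(n+1) on the first n coefficients makes these convex sets decrease
    and forces the exact coefficients in the limit.\<close>
  define D where "D n = {\<phi> \<in> mball B. fdist f n \<phi> \<le> 1 / real (Suc n)}" for n
  define q where "q \<phi> = (LINT t|circ. (cmod (\<phi> t))\<^sup>2)" for \<phi> :: "real \<Rightarrow> complex"
  have q0: "0 \<le> q \<phi>" for \<phi> unfolding q_def by simp
  have Dne: "D n \<noteq> {}" for n using fdist_small[OF B dual, of "1 / real (Suc n)" n] by (auto simp: D_def)
  have Dm: "D n \<subseteq> mball B" for n by (auto simp: D_def)
  have Ddec: "D m \<subseteq> D n" if "n \<le> m" for n m
  proof
    fix \<phi> assume \<phi>: "\<phi> \<in> D m"
    have "fdist f n \<phi> \<le> fdist f m \<phi>" unfolding fdist_def using that by (intro sum_mono2) auto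
    also have "\<dots> \<le> 1 / real (Suc m)" using \<phi> by (simp add: D_def)
    also have "\<dots> \<le> 1 / real (Suc n)" using that by (simp add: frac_le)
    finally show "\<phi> \<in> D n" using \<phi> by (simp add: D_def)
  qed
  have Dmid: "(\<lambda>t. \<phi> t + of_real (1/2) * (\<psi> t - \<phi> t)) \<in> D n" if "\<phi> \<in> D n" "\<psi> \<in> D n" for \<phi> \<psi> n
  proof -
    have m: "\<phi> \<in> mball B" "\<psi> \<in> mball B" using that by (auto simp: D_def)
    have "fdist f n (\<lambda>t. \<phi> t + of_real (1/2) * (\<psi> t - \<phi> t)) \<le> (\<Sum>k<n. ((cmod (fc \<phi> (int k) - f k))\<^sup>2 + (cmod (fc \<psi> (int k) - f k))\<^sup>2) / 2)"
      unfolding fdist_def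
    proof (rule sum_mono)
      fix k
      define x y where "x = fc \<phi> (int k) - f k" and "y = fc \<psi> (int k) - f k"
      have "fc (\<lambda>t. \<phi> t + of_real (1/2) * (\<psi> t - \<phi> t)) (int k) = fc \<phi> (int k) + of_real (1/2) * (fc \<psi> (int k) - fc \<phi> (int k))"
        using mball_integrable[OF m(1)] mball_integrable[OF m(2)] by (simp only: fc_add fc_diff fc_cmult Bochner_Integration.integrable_diff integrable_mult_right)
      then have "fc (\<lambda>t. \<phi> t + of_real (1/2) * (\<psi> t - \<phi> t)) (int k) - f k = x + of_real (1/2) * (y - x)" by (simp add: x_def y_def)
      moreover have "(cmod (x + of_real (1/2) * (y - x)))\<^sup>2 \<le> ((cmod x)\<^sup>2 + (cmod y)\<^sup>2) / 2"
      proof -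
        define m where "m = (cmod (x + of_real (1/2) * (y - x)))\<^sup>2"
        have "(cmod (x - y))\<^sup>2 = 2 * (cmod x)\<^sup>2 + 2 * (cmod y)\<^sup>2 - 4 * m" unfolding m_def by (rule parallelogram_cmod)
        moreover have "m' \<le> (b + c) / 2" if "a = 2 * b + 2 * c - 4 * m'" "0 \<le> a" for a b c m' :: real
          using that by simp
        ultimately show ?thesis unfolding m_def[symmetric] using zero_le_power2 by blast
      qed
      ultimately show "(cmod (fc (\<lambda>t. \<phi> t + of_real (1/2) * (\<psi> t - \<phi> t)) (int k) - f k))\<^sup>2 \<le> ((cmod (fc \<phi> (int k) - f k))\<^sup>2 + (cmod (fc \<psi> (int k) - f k))\<^sup>2) / 2"
        by (simp only: x_def y_def)
    qed
    also have "\<dots> = (fdist f n \<phi> + fdist f n \<psi>) / 2" by (simp only: fdist_def sum.distrib sum_divide_distrib[symmetric])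
    also have "\<dots> \<le> 1 / real (Suc n)" using that by (simp add: D_def)
    finally show ?thesis using mball_convex[OF m, of "1/2"] by (simp add: D_def)
  qed
  define d where "d n = Inf (q ` D n)" for n
  have bdd: "bdd_below (q ` D n)" for n using q0 by (auto intro!: bdd_belowI)
  have dle: "d n \<le> q \<phi>" if "\<phi> \<in> D n" for n \<phi> unfolding d_def using that by (intro cInf_lower bdd) auto
  have dmono: "d n \<le> d m" if "n \<le> m" for n m
    unfolding d_def using Ddec[OF that] Dne by (intro cInf_superset_mono bdd) auto
  have dB: "d n \<le> B\<^sup>2" for n
  proof -
    obtain \<phi> where \<phi>: "\<phi> \<in> D n" using Dne by blast
    then have m: "\<phi> \<in> mball B" using Dm by blast
    have "q \<phi> \<le> (LINT t|circ. B\<^sup>2)" unfolding q_def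
      using mball_integrable2[OF m] m by (intro integral_mono) (auto simp: mball_def intro!: power_mono)
    then show ?thesis using dle[OF \<phi>] by simp
  qed
  have "\<exists>\<phi>\<in>D n. q \<phi> \<le> d n + 1 / real (Suc n)" for n
  proof -
    have "Inf (q ` D n) < d n + 1 / real (Suc n)" by (simp add: d_def)
    then show ?thesis using cInf_lessD[of "q ` D n" "d n + 1 / real (Suc n)"] Dne[of n] by (auto intro: less_imp_le)
  qed
  then obtain x where x: "\<And>n. x n \<in> D n" "\<And>n. q (x n) \<le> d n + 1 / real (Suc n)" by metis
  have xm: "x n \<in> mball B" for n using x(1) Dm by blast
  \<comment> \<open>For n <= m the midpoint lies in \<open>D n\<close> and so has squared norm at
    least \<open>d n\<close>; the parallelogram identity converts near-minimality into
    closeness.\<close>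
  have dist: "q (\<lambda>t. x n t - x m t) \<le> 2 * (d m - d n) + 4 / real (Suc n)" if nm: "n \<le> m" for n m
  proof -
    have mid: "(\<lambda>t. x n t + of_real (1/2) * (x m t - x n t)) \<in> D n" by (rule Dmid) (use x Ddec[OF nm] in auto)
    have midm: "(\<lambda>t. x n t + of_real (1/2) * (x m t - x n t)) \<in> mball B" using mid Dm by blast
    have "q (\<lambda>t. x n t - x m t) = 2 * q (x n) + 2 * q (x m) - 4 * q (\<lambda>t. x n t + of_real (1/2) * (x m t - x n t))"
      unfolding q_def parallelogram_cmod using mball_integrable2[OF xm[of n]] mball_integrable2[OF xm[of m]] mball_integrable2[OF midm]
      by (simp only: Bochner_Integration.integral_diff Bochner_Integration.integral_add integrable_mult_right Bochner_Integration.integrable_add integral_mult_right_zero)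
    also have "\<dots> \<le> 2 * (d n + 1 / real (Suc n)) + 2 * (d m + 1 / real (Suc m)) - 4 * d n"
      using x(2)[of n] x(2)[of m] dle[OF mid] by simp
    also have "\<dots> \<le> 2 * (d m - d n) + 4 / real (Suc n)"
    proof -
      have "1 / real (Suc m) \<le> 1 / real (Suc n)" using nm by (simp add: frac_le)
      then show ?thesis by simp
    qed
    finally show ?thesis .
  qed
  have "incseq d" using dmono by (auto simp: incseq_def)
  then obtain l where l: "d \<longlonglongrightarrow> l" "\<And>n. d n \<le> l"
    using incseq_convergent[of d "B\<^sup>2"] dB by blast
  have "\<exists>n0. \<forall>n\<ge>n0. 2 * (l - d n) + 4 / real (Suc n) < e" if "e > 0" for e
  proof -
    have "(\<lambda>n. 2 * (l - d n) + 4 * inverse (real (Suc n))) \<longlonglongrightarrow> 2 * (l - l) + 4 * 0"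
      by (intro tendsto_intros l LIMSEQ_inverse_real_of_nat)
    then have "\<forall>\<^sub>F n in sequentially. 2 * (l - d n) + 4 * inverse (real (Suc n)) < e"
      using that by (intro order_tendstoD(2)) auto
    then show ?thesis by (auto simp: eventually_sequentially divide_inverse)
  qed
  then have "\<exists>n0. \<forall>n\<ge>n0. 2 * (l - d n) + 4 / real (Suc n) < (1/4)^j" for j by simp
  then obtain N where N: "\<And>j n. n \<ge> N j \<Longrightarrow> 2 * (l - d n) + 4 / real (Suc n) < (1/4)^j" by metis
  \<comment> \<open>The thresholds \<open>N j\<close> need not increase; partial sums give a
    monotone choice above each of them, and the summand j makes it unbounded.\<close>
  define s where "s j = j + (\<Sum>i\<le>j. N i)" for j
  have sN: "s j \<ge> N j" for j unfolding s_def using member_le_sum[of j "{..j}" N] by simp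
  have sinc: "s j \<le> s (Suc j)" "j \<le> s j" for j by (auto simp: s_def)
  have L1: "(LINT t|circ. cmod (x (s (Suc j)) t - x (s j) t)) \<le> (1/2)^j" for j
  proof -
    have [measurable]: "x n \<in> borel_measurable borel" for n using xm[of n] by (simp add: mball_def)
    have m: "(\<lambda>t. x (s j) t - x (s (Suc j)) t) \<in> borel_measurable borel" by measurable
    have "q (\<lambda>t. x (s j) t - x (s (Suc j)) t) \<le> 2 * (d (s (Suc j)) - d (s j)) + 4 / real (Suc (s j))" by (rule dist[OF sinc(1)])
    also have "\<dots> \<le> 2 * (l - d (s j)) + 4 / real (Suc (s j))" using l(2)[of "s (Suc j)"] by simp
    also have "\<dots> \<le> (1/4)^j" using N[OF sN[of j]] by simp
    finally have q: "q (\<lambda>t. x (s j) t - x (s (Suc j)) t) \<le> (1/4)^j" .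
    have i: "integrable circ (\<lambda>t. (cmod (x (s j) t - x (s (Suc j)) t))\<^sup>2)"
    proof (rule integrable_circ_bounded[of _ "(B + B)\<^sup>2"])
      have bnd: "cmod (x (s j) t - x (s (Suc j)) t) \<le> B + B" for t
        by (rule order.trans[OF norm_triangle_ineq4 add_mono]) (use xm in \<open>auto simp: mball_def\<close>)
      then show "AE t in circ. norm ((cmod (x (s j) t - x (s (Suc j)) t))\<^sup>2) \<le> (B + B)\<^sup>2"
        by (intro AE_I2) (simp only: real_norm_def abs_power2 power_mono[OF bnd norm_ge_zero])
    qed (use m in simp)
    have "(LINT t|circ. cmod (x (s (Suc j)) t - x (s j) t)) = (LINT t|circ. cmod (x (s j) t - x (s (Suc j)) t))"
      by (simp add: norm_minus_commute)
    also have "\<dots> \<le> sqrt (q (\<lambda>t. x (s j) t - x (s (Suc j)) t))"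
      unfolding q_def by (rule circ_L1_le_L2(2)[OF m i])
    also have "\<dots> \<le> sqrt ((1/4)^j)" using q by simp
    also have "\<dots> = (1/2)^j" by (simp add: real_sqrt_power real_sqrt_divide)
    finally show ?thesis .
  qed
  obtain F where F: "integrable circ F" "AE t in circ. (\<lambda>j. x (s j) t) \<longlonglongrightarrow> F t"
    "(\<lambda>j. (LINT t|circ. cmod (x (s j) t - F t))) \<longlonglongrightarrow> 0"
    using L1_fast_cauchy[of "\<lambda>j. x (s j)", OF mball_integrable[OF xm] L1] by blast
  have Fm [measurable]: "F \<in> borel_measurable borel" using borel_measurable_integrable[OF F(1)] by simp
  \<comment> \<open>Truncation alters the limit on a null set only and secures the bound at every
    point.\<close>
  define \<phi> where "\<phi> t = (if cmod (F t) \<le> B then F t else 0)" for t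
  have \<phi>m: "\<phi> \<in> borel_measurable borel" unfolding \<phi>_def by measurable
  have \<phi>F: "AE t in circ. \<phi> t = F t" using F(2)
  proof eventually_elim
    case (elim t)
    have "cmod (F t) \<le> B"
      by (rule tendsto_upperbound[OF tendsto_norm[OF elim]]) (use xm in \<open>auto simp: mball_def\<close>)
    then show ?case by (simp add: \<phi>_def)
  qed
  have fcF: "fc F (int k) = f k" for k
  proof -
    have "(\<lambda>j. fc (x (s j)) (int k)) \<longlonglongrightarrow> fc F (int k)"
    proof (rule LIM_zero_cancel, rule Lim_null_comparison[OF _ F(3)], intro always_eventually allI)
      fix j
      have "fc (x (s j)) (int k) - fc F (int k) = fc (\<lambda>t. x (s j) t - F t) (int k)"
        by (rule fc_diff[symmetric]) (use mball_integrable[OF xm] F in auto)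
      then show "norm (fc (x (s j)) (int k) - fc F (int k)) \<le> (LINT t|circ. cmod (x (s j) t - F t))" using norm_fc_le by metis
    qed
    moreover have "(\<lambda>j. fc (x (s j)) (int k)) \<longlonglongrightarrow> f k"
    proof (rule LIM_zero_cancel, rule Lim_null_comparison)
      have "(\<lambda>j. sqrt (inverse (real (Suc j)))) \<longlonglongrightarrow> sqrt 0" by (intro tendsto_intros LIMSEQ_inverse_real_of_nat)
      then show "(\<lambda>j. sqrt (inverse (real (Suc j)))) \<longlonglongrightarrow> 0" by simp
      show "\<forall>\<^sub>F j in sequentially. norm (fc (x (s j)) (int k) - f k) \<le> sqrt (inverse (real (Suc j)))"
        using eventually_gt_at_top[of k]
      proof eventually_elim
        case (elim j)
        have "(cmod (fc (x (s j)) (int k) - f k))\<^sup>2 \<le> fdist f (s j) (x (s j))"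
          unfolding fdist_def using elim sinc(2)[of j] by (intro member_le_sum) auto
        also have "\<dots> \<le> 1 / real (Suc (s j))" using x(1)[of "s j"] by (simp add: D_def)
        also have "\<dots> \<le> inverse (real (Suc j))" using sinc(2)[of j] by (simp add: inverse_eq_divide frac_le)
        finally show ?case by (intro real_le_rsqrt)
      qed
    qed
    ultimately show ?thesis by (rule LIMSEQ_unique)
  qed
  show ?thesis
  proof (rule that[OF \<phi>m])
    show "cmod (\<phi> t) \<le> B" for t using B by (simp add: \<phi>_def)
    show "fc \<phi> (int n) = f n" for n using fc_cong_AE[OF \<phi>m Fm \<phi>F] fcF by simp
  qed
qed

section \<open>Toeplitz operators on model spaces\<close>

lemma ev_sup: "f \<in> Hinf \<Longrightarrow> cmod z < 1 \<Longrightarrow> cmod (ev f z) \<le> hinf_norm f"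
proof -
  assume f: "f \<in> Hinf" and z: "cmod z < 1"
  obtain B where "\<forall>x\<in>ev f ` ball 0 1. cmod x \<le> B" using f unfolding Hinf_def bounded_iff by blast
  then have "bdd_above ((\<lambda>z. cmod (ev f z)) ` ball 0 1)" by (intro bdd_aboveI[of _ B]) auto
  then show ?thesis unfolding hinf_norm_def using z by (intro cSUP_upper) auto
qed

lemma hinf_norm_le:
  assumes "\<And>z. cmod z < 1 \<Longrightarrow> cmod (ev f z) \<le> B"
  shows "hinf_norm f \<le> B"
  unfolding hinf_norm_def using assms by (intro cSUP_least) auto

lemma hinf_norm_nonneg: "f \<in> Hinf \<Longrightarrow> 0 \<le> hinf_norm f"
  using ev_sup[of f 0] norm_ge_zero[of "ev f 0"] by (simp del: norm_ge_zero)

lemma HinfI: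
  assumes "analytic_disk f" "\<And>z. cmod z < 1 \<Longrightarrow> cmod (ev f z) \<le> B"
  shows "f \<in> Hinf"
proof -
  have "\<forall>x\<in>ev f ` ball 0 1. cmod x \<le> B" using assms(2) by auto
  then show ?thesis using assms(1) unfolding Hinf_def bounded_iff by blast
qed

lemma Hinf_imp_Hp2:
  assumes f: "f \<in> Hinf"
  shows "f \<in> Hp 2"
proof -
  have a: "analytic_disk f" using f by (simp add: Hinf_def)
  have "pmean 2 f r \<le> (hinf_norm f)\<^sup>2" if r: "0 \<le> r" "r < 1" for r
  proof -
    have "(LINT t|circ. (cmod (evc f r t))\<^sup>2) \<le> (LINT t|circ. (hinf_norm f)\<^sup>2)"
      using r by (intro integral_mono integrable_circ_continuous continuous_intros continuous_ev_circle a power_mono ev_sup f) (auto simp: norm_mult)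
    then show ?thesis by (simp add: pmean2[OF a r])
  qed
  then show ?thesis using Hp2_D(1)[OF a] Hp2_iff by blast
qed

lemma Hinf_bv_le:
  assumes f: "f \<in> Hinf"
  shows "AE t in circ. cmod (bv f t) \<le> hinf_norm f"
  using Hp2_boundary(2)[OF Hinf_imp_Hp2[OF f]]
proof eventually_elim
  case (elim t)
  show ?case
  proof (rule tendsto_upperbound[OF tendsto_norm[OF elim[unfolded radlim_def]]])
    show "\<forall>\<^sub>F r in at_left 1. cmod (evc f r t) \<le> hinf_norm f"
      using eventually_radius by eventually_elim (intro ev_sup f, simp add: norm_mult)
  qed simp
qed

lemma bounded_boundary_Hinf:
  assumes F: "F \<in> borel_measurable borel" "AE t in circ. cmod (F t) \<le> B" and neg: "\<And>n. n < 0 \<Longrightarrow> fc F n = 0"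
    and a: "\<And>n. fc F (int n) = a n"
  shows "a \<in> Hinf" "hinf_norm a \<le> B" "AE t in circ. bv a t = F t"
proof -
  have i: "integrable circ F" by (rule integrable_circ_bounded[OF F])
  have L: "analytic_disk a" "AE t in circ. radlim a t (F t)" "\<And>r t. 0 \<le> r \<Longrightarrow> r < 1 \<Longrightarrow> evc a r t = pint F r t"
    using L1_analytic_boundary[of F a] i neg a by blast+
  have le: "cmod (ev a z) \<le> B" if z: "cmod z < 1" for z
  proof -
    obtain t where "z = of_real (cmod z) * cis t" by (rule complex_polar)
    then have e: "ev a z = pint F (cmod z) t" using L(3)[of "cmod z" t] z by simp
    note r = norm_ge_zero[of z] z
    have "cmod (pint F (cmod z) t) \<le> (LINT s|circ. cmod (of_real (pk (cmod z) (t - s)) * F s))"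
      unfolding pint_def by (rule integral_norm_bound)
    also have "\<dots> \<le> (LINT s|circ. pk (cmod z) (t - s) * B)"
    proof (rule integral_mono_AE)
      show "integrable circ (\<lambda>s. cmod (of_real (pk (cmod z) (t - s)) * F s))"
        using integrable_pk[OF i r] by (intro integrable_norm) (simp add: scaleR_conv_of_real)
      show "integrable circ (\<lambda>s. pk (cmod z) (t - s) * B)" using integrable_pk[of "\<lambda>_. B", OF _ r] by simp
      show "AE s in circ. cmod (of_real (pk (cmod z) (t - s)) * F s) \<le> pk (cmod z) (t - s) * B"
        using F(2) by eventually_elim (use pk_nonneg[OF r] in \<open>simp add: norm_mult mult_left_mono\<close>)
    qed
    also have "\<dots> = B" using pint_const[OF r, of t] by simp
    finally show ?thesis unfolding e .
  qed
  show "a \<in> Hinf" by (rule HinfI[OF L(1) le])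
  show "hinf_norm a \<le> B" by (rule hinf_norm_le[OF le])
  show "AE t in circ. bv a t = F t" by (rule radlim_bv_AE(1)[OF L(2)])
qed

lemma amult_Hinf_Hp2:
  assumes u: "u \<in> Hinf" and v: "v \<in> Hp 2"
  shows "amult u v \<in> Hp 2" "AE t in circ. bv (amult u v) t = bv u t * bv v t"
proof -
  have a: "analytic_disk u" "analytic_disk v" using u v by (auto simp: Hinf_def Hp_def)
  have am: "analytic_disk (amult u v)" by (rule analytic_disk_amult[OF a])
  have "pmean 2 (amult u v) r \<le> (hinf_norm u)\<^sup>2 * (\<Sum>k. (cmod (v k))\<^sup>2)" if r: "0 \<le> r" "r < 1" for r
  proof -
    have n: "cmod (of_real r * cis t) < 1" for t using r by (simp add: norm_mult)
    have "(LINT t|circ. (cmod (evc (amult u v) r t))\<^sup>2) \<le> (LINT t|circ. (hinf_norm u)\<^sup>2 * (cmod (evc v r t))\<^sup>2)"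
    proof (rule integral_mono)
      show "(cmod (evc (amult u v) r t))\<^sup>2 \<le> (hinf_norm u)\<^sup>2 * (cmod (evc v r t))\<^sup>2" for t
        unfolding ev_amult[OF a n] norm_mult power_mult_distrib by (intro mult_right_mono power_mono ev_sup u n) auto
    qed (intro integrable_circ_continuous continuous_intros continuous_ev_circle am a r)+
    also have "\<dots> \<le> (hinf_norm u)\<^sup>2 * (\<Sum>k. (cmod (v k))\<^sup>2)" using Hp2_L2_le[OF v r] by (simp add: mult_left_mono)
    finally show ?thesis by (simp add: pmean2[OF am r])
  qed
  then show "amult u v \<in> Hp 2" using Hp2_D(1)[OF am] Hp2_iff by blast
  show "AE t in circ. bv (amult u v) t = bv u t * bv v t"
    using Hp2_boundary(2)[OF Hinf_imp_Hp2[OF u]] Hp2_boundary(2)[OF v]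
    by eventually_elim (intro radlim_bv radlim_mult a)
qed

lemma finite_support:
  fixes h :: "nat \<Rightarrow> complex" and n :: nat
  assumes a_def: "a = (\<lambda>k. if k < n then h k else 0)"
  shows "a \<in> Hp 2" "bv a t = (\<Sum>k<n. h k * cis (real k * t))"
proof -
  show "a \<in> Hp 2" by (rule Hp2_I, rule summable_finite[of "{..<n}"]) (auto simp: a_def)
  have ev: "ev a z = (\<Sum>k<n. h k * z ^ k)" for z
  proof -
    have "(\<lambda>k. a k * z ^ k) sums (\<Sum>k<n. a k * z ^ k)" by (rule sums_finite) (auto simp: a_def)
    then show ?thesis by (simp add: ev_def sums_iff a_def)
  qed
  show "bv a t = (\<Sum>k<n. h k * cis (real k * t))"
  proof (rule radlim_bv)
    have "((\<lambda>r::real. \<Sum>k<n. h k * (of_real r * cis t) ^ k) \<longlongrightarrow> (\<Sum>k<n. h k * (of_real 1 * cis t) ^ k)) (at_left 1)"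
      by (intro tendsto_intros)
    then show "radlim a t (\<Sum>k<n. h k * cis (real k * t))" by (simp add: radlim_def ev Complex.DeMoivre)
  qed
qed

lemma inner_circ:
  assumes "inner_fn \<theta>"
  shows "\<theta> \<in> Hinf" "AE t in circ. cmod (bv \<theta> t) = 1"
proof -
  show "\<theta> \<in> Hinf" using assms by (simp add: inner_fn_def)
  have "AE t in circ. \<exists>L. radlim \<theta> t L \<and> cmod L = 1"
    using assms unfolding inner_fn_def AE_circ radlim_def by blast
  then show "AE t in circ. cmod (bv \<theta> t) = 1" by eventually_elim (use radlim_bv in blast)
qed

lemma BMO_T_bound:
  assumes "BMO_T F"
  obtains B where "bmo_bound F B"
proof -
  obtain B where "\<forall>x\<in>{(1 / l) * (LINT t:{a..a+l}|lborel.
      cmod (F t - (1 / l) * (LINT s:{a..a+l}|lborel. F s))) | a l. 0 < l \<and> l \<le> 2*pi}. x \<le> B"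
    using assms unfolding BMO_T_def bdd_above_def by blast
  then have "bmo_bound F B" unfolding bmo_bound_def by auto
  then show ?thesis by (rule that)
qed

section \<open>The dual norm and bounded representatives\<close>

lemma hnorm1_cmult:
  assumes h: "h \<in> Hp 2"
  shows "(\<lambda>n. c * h n) \<in> Hp 2" "hnorm 1 (\<lambda>n. c * h n) = cmod c * hnorm 1 h" "AE t in circ. bv (\<lambda>n. c * h n) t = c * bv h t"
proof -
  note H = Hp2_boundary[OF h]
  show c: "(\<lambda>n. c * h n) \<in> Hp 2"
    using h unfolding Hp2_iff by (simp add: norm_mult power_mult_distrib summable_mult)
  show ae: "AE t in circ. bv (\<lambda>n. c * h n) t = c * bv h t" using H(2)
  proof eventually_elim
    case (elim t)
    have "\<forall>\<^sub>F r in at_left 1. c * evc h r t = evc (\<lambda>n. c * h n) r t"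
      using eventually_radius by eventually_elim (subst ev_cmult; simp add: H(1) norm_mult)
    from Lim_transform_eventually[OF tendsto_mult[OF tendsto_const elim[unfolded radlim_def]] this]
    show ?case by (intro radlim_bv) (simp add: radlim_def)
  qed
  have "hnorm 1 (\<lambda>n. c * h n) = (LINT t|circ. cmod (c * bv h t))"
    unfolding hnorm1[OF Hp2_imp_Hp1[OF c]]
    by (rule integral_cong_AE) (use ae H(3) Hp2_boundary(3)[OF c] in auto)
  then show "hnorm 1 (\<lambda>n. c * h n) = cmod c * hnorm 1 h"
    by (simp add: norm_mult hnorm1[OF Hp2_imp_Hp1[OF h]])
qed

lemma hnorm1_nonneg: "h \<in> Hp 2 \<Longrightarrow> 0 \<le> hnorm 1 h"
  by (simp add: hnorm1[OF Hp2_imp_Hp1])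

lemma pairing_cmult:
  assumes f: "f \<in> Hp 2" and h: "h \<in> Hp 2"
  shows "pairing f (\<lambda>n. c * h n) = cnj c * pairing f h"
proof -
  note H = Hp2_boundary[OF h] and F = Hp2_boundary[OF f]
  note C = hnorm1_cmult[OF h, of c]
  note CB = Hp2_boundary(3)[OF C(1)]
  have "pairing f (\<lambda>n. c * h n) = (LINT t|circ. cnj c * (bv f t * cnj (bv h t)))"
    unfolding pairing_eq[OF CB F(3)]
    by (rule integral_cong_AE) (use C(3) H(3) F(3) CB in \<open>auto elim!: eventually_mono\<close>)
  then show ?thesis by (simp add: pairing_eq[OF H(3) F(3)])
qed

text \<open>Fefferman's inequality makes the defining set of \<open>bmo_norm\<close> bounded above,
  so that the supremum really bounds the pairings. Its constant settles the case of norm zero, where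
  h cannot be normalised, and then disappears.\<close>

lemma pairing_bmo_norm:
  assumes f: "f \<in> Hp 2" and B: "bmo_bound (bv f) B"
  shows "0 \<le> bmo_norm f" "\<And>h. h \<in> Hp 2 \<Longrightarrow> cmod (pairing f h) \<le> bmo_norm f * hnorm 1 h"
proof -
  obtain C where C: "\<And>h. h \<in> Hp 2 \<Longrightarrow> cmod (pairing f h) \<le> C * hnorm 1 h" using fefferman[OF f B] by blast
  define S where "S = {cmod (pairing f h) | h. h \<in> Hp 2 \<and> hnorm 1 h \<le> 1}"
  have bdd: "bdd_above S"
  proof (rule bdd_aboveI[of _ "\<bar>C\<bar>"])
    fix x assume "x \<in> S"
    then obtain h where h: "x = cmod (pairing f h)" "h \<in> Hp 2" "hnorm 1 h \<le> 1" by (auto simp: S_def)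
    have "x \<le> C * hnorm 1 h" using C h by simp
    also have "\<dots> \<le> \<bar>C\<bar> * 1" using h(3) hnorm1_nonneg[OF h(2)] by (intro mult_mono) auto
    finally show "x \<le> \<bar>C\<bar>" by simp
  qed
  have up: "cmod (pairing f h) \<le> bmo_norm f" if "h \<in> Hp 2" "hnorm 1 h \<le> 1" for h
    unfolding bmo_norm_def S_def[symmetric] using that by (intro cSup_upper bdd) (auto simp: S_def)
  have z: "(\<lambda>n. 0) \<in> Hp 2" by (rule Hp2_I) simp
  have "hnorm 1 (\<lambda>n. 0) = 0" using hnorm1_cmult(2)[OF z, of 0] by simp
  then have "cmod (pairing f (\<lambda>n. 0)) \<le> bmo_norm f" by (intro up z) simp
  then show b0: "0 \<le> bmo_norm f" using norm_ge_zero[of "pairing f (\<lambda>n. 0)"] by linarith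
  fix h assume h: "h \<in> Hp 2"
  show "cmod (pairing f h) \<le> bmo_norm f * hnorm 1 h"
  proof (cases "hnorm 1 h = 0")
    case True
    then show ?thesis using C[OF h] by simp
  next
    case False
    then have p: "hnorm 1 h > 0" using hnorm1_nonneg[OF h] by simp
    define c where "c = complex_of_real (1 / hnorm 1 h)"
    have "cmod c = 1 / hnorm 1 h" unfolding c_def norm_of_real using p by simp
    then have "hnorm 1 (\<lambda>n. c * h n) \<le> 1" using p by (simp add: hnorm1_cmult(2)[OF h])
    from up[OF hnorm1_cmult(1)[OF h] this] have "cmod c * cmod (pairing f h) \<le> bmo_norm f"
      unfolding pairing_cmult[OF f h] by (simp add: norm_mult)
    then show ?thesis using p \<open>cmod c = 1 / hnorm 1 h\<close> by (simp add: field_simps)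
  qed
qed

text \<open>Tested on analytic trigonometric polynomials, the dual norm inequality is the hypothesis
  of \<open>bounded_representative\<close>, so the representative is bounded by the dual norm with
  no loss of constant.\<close>

lemma BMOA_representative:
  assumes f: "f \<in> Hp 2" and B: "bmo_bound (bv f) B"
  obtains \<phi> where "\<phi> \<in> borel_measurable borel" "\<And>t. cmod (\<phi> t) \<le> bmo_norm f" "\<And>n. fc \<phi> (int n) = f n"
proof (rule bounded_representative[OF pairing_bmo_norm(1)[OF f B]])
  fix n and h :: "nat \<Rightarrow> complex"
  note F = Hp2_boundary[OF f]
  define a where "a k = (if k < n then h k else 0)" for k
  have a: "a \<in> Hp 2" and bva: "bv a t = (\<Sum>k<n. h k * cis (real k * t))" for t
    using finite_support[of a n h] by (simp_all add: a_def[abs_def])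
  have "pairing f a = integral\<^sup>L circ (\<lambda>t. \<Sum>k<n. cnj (h k) * (bv f t * cis (- (of_int (int k) * t))))"
    unfolding pairing_eq[OF Hp2_boundary(3)[OF a] F(3)] bva by (simp add: sum_distrib_left cis_cnj mult_ac)
  also have "\<dots> = (\<Sum>k<n. (LINT t|circ. cnj (h k) * (bv f t * cis (- (of_int (int k) * t)))))"
    using integrable_fc'[OF F(4)] by (intro Bochner_Integration.integral_sum integrable_mult_right)
  also have "\<dots> = (\<Sum>k<n. f k * cnj (h k))"
  proof (rule sum.cong[OF refl])
    fix k
    have "(LINT t|circ. cnj (h k) * (bv f t * cis (- (of_int (int k) * t)))) = cnj (h k) * fc (bv f) (int k)"
      unfolding fc_def by (rule integral_mult_right_zero)
    then show "(LINT t|circ. cnj (h k) * (bv f t * cis (- (of_int (int k) * t)))) = f k * cnj (h k)" by (simp only: F(5) mult.commute)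
  qed
  finally have "cmod (\<Sum>k<n. f k * cnj (h k)) \<le> bmo_norm f * hnorm 1 a" using pairing_bmo_norm(2)[OF f B a] by simp
  then show "cmod (\<Sum>k<n. f k * cnj (h k)) \<le> bmo_norm f * (LINT t|circ. cmod (\<Sum>k<n. h k * cis (real k * t)))"
    unfolding hnorm1[OF Hp2_imp_Hp1[OF a]] bva .
qed (use that in blast)

text \<open>On the circle conj z times theta has the nonnegative coefficients of k, the only other
  frequency being -1 with coefficient theta(0). Being unimodular, it is an admissible bounded
  representative. The scalar c allows k to be normalised later.\<close>

lemma toep_lim_kfun:
  assumes \<theta>: "inner_fn \<theta>" and g: "g \<in> Hp 1"
  shows "toep_lim g (\<lambda>n. c * kfun \<theta> n) = (\<lambda>n. c * fc (\<lambda>t. cnj (bv g t) * (cis (- t) * bv \<theta> t)) (int n))"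
proof -
  note I = inner_circ[OF \<theta>]
  note T = Hp2_boundary[OF Hinf_imp_Hp2[OF I(1)]]
  note [measurable] = T(3)
  have m: "(\<lambda>t. cis (- t)) \<in> borel_measurable borel" using cis_measurable[of "-1"] by simp
  define W where "W t = c * (cis (- t) * bv \<theta> t)" for t
  have Wm: "W \<in> borel_measurable borel" unfolding W_def using m by simp
  have WB: "AE t in circ. cmod (W t) \<le> cmod c" using I(2) by eventually_elim (simp add: W_def norm_mult)
  have fcW: "fc W (int n) = c * kfun \<theta> n" for n
  proof -
    have "fc W (int n) = c * fc (\<lambda>t. bv \<theta> t * cis (of_int (-1) * t)) (int n)"
      unfolding W_def fc_cmult by (simp add: mult.commute)
    also have "fc (\<lambda>t. bv \<theta> t * cis (of_int (-1) * t)) (int n) = fc (bv \<theta>) (int (Suc n))" unfolding fc_cis_shift by (simp add: add.commute)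
    finally show ?thesis unfolding T(5) by (simp add: kfun_def)
  qed
  have "summable (\<lambda>k. (cmod (\<theta> (Suc k)))\<^sup>2)"
    using Hp2_iff[of \<theta>] Hinf_imp_Hp2[OF I(1)] by (subst summable_Suc_iff) simp
  then have k2: "(\<lambda>n. c * kfun \<theta> n) \<in> Hp 2"
    unfolding Hp2_iff kfun_def norm_mult power_mult_distrib by (rule summable_mult)
  have "toep_lim g (\<lambda>n. c * kfun \<theta> n) = (\<lambda>n. fc (\<lambda>t. cnj (bv g t) * W t) (int n))"
    by (rule toep_lim_eq[OF g k2 Wm WB fcW])
  also have "(\<lambda>t. cnj (bv g t) * W t) = (\<lambda>t. c * (cnj (bv g t) * (cis (- t) * bv \<theta> t)))" by (auto simp: W_def mult_ac)
  finally show ?thesis unfolding fc_cmult .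
qed

text \<open>The antianalytic part of \<open>W\<close> is killed by dominated convergence along dilations of \<open>\<psi>\<close>.\<close>
lemma toep_absorb:
  assumes \<psi>: "\<psi> \<in> Hinf" and W: "integrable circ W" and \<Phi>: "\<Phi> \<in> Hp 1" "\<And>n. fc W (int n) = \<Phi> n"
  shows "toep \<psi> \<Phi> = (\<lambda>n. fc (\<lambda>t. cnj (bv \<psi> t) * W t) (int n))"
proof
  fix n
  note P = Hp2_boundary[OF Hinf_imp_Hp2[OF \<psi>]] and Q = Hp1_boundary[OF \<Phi>(1)]
  note [measurable] = P(3) Q(3)
  have [measurable]: "W \<in> borel_measurable borel" using borel_measurable_integrable[OF W] by simp
  define D where "D t = (W t - bv \<Phi> t) * cis (of_int (- int n) * t)" for t
  have iD: "integrable circ D" unfolding D_def by (intro integrable_fc Bochner_Integration.integrable_diff W Q)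
  have [measurable]: "D \<in> borel_measurable borel" using borel_measurable_integrable[OF iD] by simp
  have fcD: "fc D (int k) = 0" for k
  proof -
    have "fc D (int k) = fc (\<lambda>t. W t - bv \<Phi> t) (int (k + n))" unfolding D_def fc_cis_shift by simp
    also have "\<dots> = fc W (int (k + n)) - fc (bv \<Phi>) (int (k + n))" by (rule fc_diff[OF W Q(4)])
    also have "\<dots> = 0" unfolding \<Phi>(2) Q(5) by simp
    finally show ?thesis .
  qed
  define \<rho> where "\<rho> j = 1 - 1 / real (Suc j)" for j
  have \<rho>: "0 \<le> \<rho> j" "\<rho> j < 1" for j by (auto simp: \<rho>_def)
  have z: "(LINT t|circ. D t * cnj (evc \<psi> (\<rho> j) t)) = 0" for j
    using integral_cnj_ev[OF iD P(1) \<rho>[of j]] by (simp add: fcD sums_iff)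
  have "(\<lambda>j. (LINT t|circ. D t * cnj (evc \<psi> (\<rho> j) t))) \<longlonglongrightarrow> (LINT t|circ. D t * cnj (bv \<psi> t))"
  proof (rule integral_dominated_convergence[where w = "\<lambda>t. hinf_norm \<psi> * cmod (D t)"])
    show "integrable circ (\<lambda>t. hinf_norm \<psi> * cmod (D t))" using iD by simp
    show "AE t in circ. (\<lambda>j. D t * cnj (evc \<psi> (\<rho> j) t)) \<longlonglongrightarrow> D t * cnj (bv \<psi> t)"
      using P(2)
    proof eventually_elim
      case (elim t)
      show ?case using radlim_seq[OF elim] unfolding \<rho>_def by (intro tendsto_intros)
    qed
    show "AE t in circ. norm (D t * cnj (evc \<psi> (\<rho> j) t)) \<le> hinf_norm \<psi> * cmod (D t)" for j
    proof (rule AE_I2)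
      fix t
      have "cmod (evc \<psi> (\<rho> j) t) \<le> hinf_norm \<psi>" using \<rho>[of j] by (intro ev_sup \<psi>) (simp add: norm_mult)
      then show "norm (D t * cnj (evc \<psi> (\<rho> j) t)) \<le> hinf_norm \<psi> * cmod (D t)"
        unfolding norm_mult complex_mod_cnj by (subst mult.commute) (intro mult_right_mono norm_ge_zero)
    qed
    show "(\<lambda>t. D t * cnj (evc \<psi> (\<rho> j) t)) \<in> borel_measurable circ" for j
      using ev_circle_measurable[OF P(1) \<rho>[of j]] by simp
  qed simp
  then have D0: "(LINT t|circ. D t * cnj (bv \<psi> t)) = 0" unfolding z by (simp add: LIMSEQ_const_iff)
  have bd: "AE t in circ. cmod (cnj (bv \<psi> t)) \<le> hinf_norm \<psi>" using Hinf_bv_le[OF \<psi>] by simp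
  have i1: "integrable circ (\<lambda>t. cnj (bv \<psi> t) * W t)" by (rule integrable_circ_mult_bounded[OF W _ bd]) measurable
  have i2: "integrable circ (\<lambda>t. cnj (bv \<psi> t) * bv \<Phi> t)" by (rule integrable_circ_mult_bounded[OF Q(4) _ bd]) measurable
  have "fc (\<lambda>t. cnj (bv \<psi> t) * W t) (int n) - fc (\<lambda>t. cnj (bv \<psi> t) * bv \<Phi> t) (int n) = fc (\<lambda>t. cnj (bv \<psi> t) * W t - cnj (bv \<psi> t) * bv \<Phi> t) (int n)"
    by (rule fc_diff[OF i1 i2, symmetric])
  also have "\<dots> = (LINT t|circ. D t * cnj (bv \<psi> t))"
    unfolding fc_def D_def by (rule Bochner_Integration.integral_cong) (auto simp: algebra_simps)
  finally show "toep \<psi> \<Phi> n = fc (\<lambda>t. cnj (bv \<psi> t) * W t) (int n)"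
    unfolding toep_eq_fc[OF P(3) Q(3)] D0 by simp
qed

lemma KBMO_factor:
  assumes \<theta>: "inner_fn \<theta>" and f: "f \<in> KBMO \<theta>" and g: "g \<in> Hp 1" and \<Phi>: "toep_lim g (kfun \<theta>) \<in> Hp 1"
  obtains \<psi> where "\<psi> \<in> Hinf" "hinf_norm \<psi> \<le> bmo_norm f" "toep_lim g f = toep \<psi> (toep_lim g (kfun \<theta>))"
proof -
  have f2: "f \<in> Hp 2" and orth: "\<And>h. h \<in> Hp 2 \<Longrightarrow> pairing f (amult \<theta> h) = 0" and "BMO_T (bv f)"
    using f by (auto simp: KBMO_def Ktheta_def BMOA_def)
  then obtain B where B: "bmo_bound (bv f) B" using BMO_T_bound by blast
  obtain \<phi> where \<phi>: "\<phi> \<in> borel_measurable borel" "\<And>t. cmod (\<phi> t) \<le> bmo_norm f" "\<And>n. fc \<phi> (int n) = f n"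
    using BMOA_representative[OF f2 B] by blast
  note I = inner_circ[OF \<theta>]
  have \<theta>2: "\<theta> \<in> Hp 2" by (rule Hinf_imp_Hp2[OF I(1)])
  note T = Hp2_boundary[OF \<theta>2] and F = Hp2_boundary[OF f2] and G = Hp1_boundary[OF g]
  note [measurable] = T(3) F(3) G(3) \<phi>(1)
  have mc [measurable]: "(\<lambda>t. cis (- t)) \<in> borel_measurable borel" using cis_measurable[of "-1"] by simp
  have i\<phi>: "integrable circ \<phi>" by (rule integrable_circ_bounded[OF \<phi>(1)]) (use \<phi>(2) in auto)
  have i\<phi>2: "integrable circ (\<lambda>t. (cmod (\<phi> t))\<^sup>2)"
    by (rule integrable_circ_bounded[of _ "(bmo_norm f)\<^sup>2"]) (use \<phi>(2) in \<open>auto intro!: power_mono\<close>)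
  define \<Psi> where "\<Psi> t = bv \<theta> t * (cis (- t) * cnj (\<phi> t))" for t
  have [measurable]: "\<Psi> \<in> borel_measurable borel" unfolding \<Psi>_def by measurable
  have \<Psi>B: "AE t in circ. cmod (\<Psi> t) \<le> bmo_norm f"
    using I(2) by eventually_elim (use \<phi>(2) in \<open>simp add: \<Psi>_def norm_mult\<close>)
  have neg: "fc \<Psi> n = 0" if n: "n < 0" for n
  proof -
    \<comment> \<open>The coefficient of \<open>\<Psi>\<close> at n = -j - 1 is the conjugate of the
      pairing of \<open>\<phi>\<close> with theta z^j; the conj z in \<open>\<Psi>\<close> accounts
      for the shift by one, so that j = 0 handles n = -1.\<close>
    define j where "j = nat (- n - 1)"
    have nj: "n = - int j - 1" using n by (simp add: j_def)
    define e where "e k = (if k < Suc j then (if k = j then 1 else 0) else 0 :: complex)" for k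
    note S = finite_support[of e "Suc j" "\<lambda>k. if k = j then 1 else 0", OF ext[OF e_def]]
    have e: "e \<in> Hp 2" by (rule S(1))
    have bve: "bv e t = cis (real j * t)" for t
    proof -
      have "(\<Sum>k<Suc j. (if k = j then 1 else 0) * cis (real k * t)) = (\<Sum>k<Suc j. if k = j then cis (real j * t) else 0)"
        by (intro sum.cong) auto
      then show ?thesis unfolding S(2) by (simp del: sum.lessThan_Suc add: sum.delta)
    qed
    note w = amult_Hinf_Hp2[OF I(1) e]
    note Wb = Hp2_boundary(3)[OF w(1)]
    \<comment> \<open>Orthogonality is known for f and wanted for \<open>\<phi>\<close>; the
      difference has negative frequencies only and is annihilated by theta z^j.\<close>
    define D where "D t = \<phi> t - bv f t" for t
    have D2: "integrable circ (\<lambda>t. (cmod (D t))\<^sup>2)"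
    proof (rule Bochner_Integration.integrable_bound)
      show "integrable circ (\<lambda>t. 2 * (cmod (\<phi> t))\<^sup>2 + 2 * (cmod (bv f t))\<^sup>2)" using F(7) i\<phi>2 by simp
      show "AE t in circ. norm ((cmod (D t))\<^sup>2) \<le> norm (2 * (cmod (\<phi> t))\<^sup>2 + 2 * (cmod (bv f t))\<^sup>2)"
      proof (rule AE_I2)
        fix t
        have "(cmod (D t))\<^sup>2 \<le> (cmod (\<phi> t) + cmod (bv f t))\<^sup>2" unfolding D_def by (intro power_mono norm_triangle_ineq4) auto
        also have "\<dots> \<le> 2 * (cmod (\<phi> t))\<^sup>2 + 2 * (cmod (bv f t))\<^sup>2"
          using sum_squares_bound[of "cmod (\<phi> t)" "cmod (bv f t)"] by (simp add: power2_sum)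
        finally show "norm ((cmod (D t))\<^sup>2) \<le> norm (2 * (cmod (\<phi> t))\<^sup>2 + 2 * (cmod (bv f t))\<^sup>2)" by simp
      qed
    qed (simp add: D_def)
    have "fc D k = 0" if "k \<ge> 0" for k
      using fc_diff[OF i\<phi> F(4), of k] \<phi>(3)[of "nat k"] F(5)[of "nat k"] that unfolding D_def by simp
    moreover have "D \<in> borel_measurable borel" unfolding D_def by measurable
    ultimately have D0: "(LINT t|circ. D t * cnj (bv (amult \<theta> e) t)) = 0"
      by (intro annihilator_H2 D2 w)
    have W2: "integrable circ (\<lambda>t. (cmod (cnj (bv (amult \<theta> e) t)))\<^sup>2)" using Hp2_boundary(7)[OF w(1)] by simp
    have i1: "integrable circ (\<lambda>t. \<phi> t * cnj (bv (amult \<theta> e) t))" by (rule circ_Cauchy_Schwarz(1)[OF _ _ i\<phi>2 W2]) (use Wb in measurable)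
    have i2: "integrable circ (\<lambda>t. bv f t * cnj (bv (amult \<theta> e) t))" by (rule circ_Cauchy_Schwarz(1)[OF _ _ F(7) W2]) (use Wb in measurable)
    have "(LINT t|circ. \<phi> t * cnj (bv (amult \<theta> e) t)) = (LINT t|circ. bv f t * cnj (bv (amult \<theta> e) t))"
      using D0 i1 i2 by (simp add: D_def left_diff_distrib)
    also have "\<dots> = 0" using orth[OF e] by (simp add: pairing_eq[OF Wb F(3)])
    finally have 0: "(LINT t|circ. \<phi> t * cnj (bv (amult \<theta> e) t)) = 0" .
    have "fc \<Psi> n = (LINT t|circ. cnj (\<phi> t * cnj (bv (amult \<theta> e) t)))"
      unfolding fc_def
    proof (rule integral_cong_AE)
      show "AE t in circ. \<Psi> t * cis (- (of_int n * t)) = cnj (\<phi> t * cnj (bv (amult \<theta> e) t))"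
        using w(2)
      proof eventually_elim
        case (elim t)
        have "cis (- t) * cis (- (of_int n * t)) = cis (real j * t)" unfolding nj by (simp add: cis_mult algebra_simps)
        then show ?case unfolding elim bve \<Psi>_def by (simp add: mult_ac)
      qed
      show "(\<lambda>t. \<Psi> t * cis (- (of_int n * t))) \<in> borel_measurable circ" using cis_measurable[of "- of_int n"] by simp
    qed (use Wb in simp)
    then show ?thesis unfolding Bochner_Integration.integral_cnj 0 by simp
  qed
  define \<psi> where "\<psi> n = fc \<Psi> (int n)" for n
  have \<psi>: "\<psi> \<in> Hinf" "hinf_norm \<psi> \<le> bmo_norm f" "AE t in circ. bv \<psi> t = \<Psi> t"
    using bounded_boundary_Hinf[of \<Psi> "bmo_norm f" \<psi>] \<Psi>B neg \<psi>_def by auto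
  note P = Hp2_boundary(3)[OF Hinf_imp_Hp2[OF \<psi>(1)]]
  define W where "W t = cnj (bv g t) * (cis (- t) * bv \<theta> t)" for t
  have k: "toep_lim g (kfun \<theta>) = (\<lambda>n. fc W (int n))"
    using toep_lim_kfun[OF \<theta> g, of 1] by (simp add: W_def[abs_def])
  have iW: "integrable circ W"
  proof -
    have "AE t in circ. cmod (cis (- t) * bv \<theta> t) \<le> 1" using I(2) by eventually_elim (simp add: norm_mult)
    from integrable_circ_mult_bounded[OF _ _ this, of "\<lambda>t. cnj (bv g t)"] show ?thesis using G(4) by (simp add: W_def[abs_def] mult_ac)
  qed
  have Wm [measurable]: "W \<in> borel_measurable borel" unfolding W_def by measurable
  have "toep \<psi> (toep_lim g (kfun \<theta>)) = (\<lambda>n. fc (\<lambda>t. cnj (bv \<psi> t) * W t) (int n))"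
    by (rule toep_absorb[OF \<psi>(1) iW \<Phi>]) (simp add: k)
  also have "\<dots> = (\<lambda>n. fc (\<lambda>t. cnj (bv g t) * \<phi> t) (int n))"
  proof (intro ext fc_cong_AE)
    show "AE t in circ. cnj (bv \<psi> t) * W t = cnj (bv g t) * \<phi> t"
      using \<psi>(3) I(2)
    proof eventually_elim
      case (elim t)
      have "cnj (bv \<theta> t) * bv \<theta> t = of_real ((cmod (bv \<theta> t))\<^sup>2)" unfolding complex_norm_square by (rule mult.commute)
      then have 1: "cnj (bv \<theta> t) * bv \<theta> t = 1" using elim(2) by simp
      have 2: "cnj (cis (- t)) * cis (- t) = 1" by (simp add: cis_cnj cis_mult)
      have "cnj (bv \<psi> t) * W t = (cnj (bv \<theta> t) * bv \<theta> t) * (cnj (cis (- t)) * cis (- t)) * (cnj (bv g t) * \<phi> t)"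
        unfolding elim(1) \<Psi>_def W_def by (simp only: complex_cnj_mult complex_cnj_cnj mult_ac)
      then show ?case unfolding 1 2 by simp
    qed
  qed (use P in measurable)
  also have "\<dots> = toep_lim g f"
    by (rule toep_lim_eq[OF g f2 \<phi>(1) _ \<phi>(3), symmetric]) (use \<phi>(2) in auto)
  finally show ?thesis using that \<psi> by metis
qed

section \<open>Bounded functions in the model space, and k among them\<close>

lemma bv_AE_lborel_le:
  assumes f: "f \<in> Hinf"
  shows "AE t in lborel. cmod (bv f t) \<le> hinf_norm f"
  by (rule AE_circ_shift[OF _ Hinf_bv_le[OF f]]) (simp add: bv_periodic)

lemma set_integral_bound:
  fixes F :: "real \<Rightarrow> complex" and l :: real
  assumes F: "set_integrable lborel {a..a+l} F" and b: "AE t in lborel. cmod (F t) \<le> B" and l: "l > 0"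
  shows "(1 / l) * (LINT t:{a..a+l}|lborel. cmod (F t)) \<le> B"
proof -
  have "(LINT t:{a..a+l}|lborel. cmod (F t)) \<le> (LINT t:{a..a+l}|lborel. B)"
    unfolding set_lebesgue_integral_def
  proof (rule integral_mono_AE)
    show "integrable lborel (\<lambda>t. indicator {a..a+l} t *\<^sub>R cmod (F t))"
      using set_integrable_norm[OF F] unfolding set_integrable_def .
    show "integrable lborel (\<lambda>t. indicator {a..a+l} t *\<^sub>R B)"
      by (intro integrable_scaleR_left integrable_real_indicator) (auto simp: emeasure_lborel_Icc_eq)
    show "AE t in lborel. indicator {a..a+l} t *\<^sub>R cmod (F t) \<le> indicator {a..a+l} t *\<^sub>R B"
      using b by eventually_elim (auto simp: indicator_def)
  qed
  also have "\<dots> = l * B" using l by (simp add: set_lebesgue_integral_def)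
  finally show ?thesis using l by (simp add: field_simps)
qed

lemma Hinf_BMO:
  assumes f: "f \<in> Hinf"
  shows "BMO_T (bv f)"
proof -
  note F = Hp2_boundary[OF Hinf_imp_Hp2[OF f]]
  define B where "B = hinf_norm f"
  have B0: "0 \<le> B" using hinf_norm_nonneg[OF f] by (simp add: B_def)
  have si: "set_integrable lborel {a..b} (bv f)" for a b by (rule integrable_on_periodic[OF bv_periodic F(4)])
  have osc: "(1 / l) * (LINT t:{a..a+l}|lborel. cmod (bv f t - (1 / complex_of_real l) * (LINT s:{a..a+l}|lborel. bv f s))) \<le> B + B"
    if l: "0 < l" for a l :: real
  proof (rule set_integral_bound[OF _ _ l])
    define c where "c = complex_of_real (1 / l) * (LINT s:{a..a+l}|lborel. bv f s)"
    have "cmod c = (1 / l) * cmod (LINT s:{a..a+l}|lborel. bv f s)" using l by (simp add: c_def norm_mult norm_divide)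
    also have "\<dots> \<le> (1 / l) * (LINT s:{a..a+l}|lborel. cmod (bv f s))"
      using l si by (intro mult_left_mono set_integral_norm_bound) auto
    also have "\<dots> \<le> B" unfolding B_def by (rule set_integral_bound[OF si bv_AE_lborel_le[OF f] l])
    finally have c: "cmod c \<le> B" .
    have ceq: "1 / complex_of_real l * (LINT s:{a..a+l}|lborel. bv f s) = c" by (simp add: c_def)
    show "AE t in lborel. cmod (bv f t - 1 / complex_of_real l * (LINT s:{a..a+l}|lborel. bv f s)) \<le> B + B"
      unfolding ceq using bv_AE_lborel_le[OF f]
    proof eventually_elim
      case (elim t)
      then show ?case using c unfolding B_def by (rule_tac order.trans[OF norm_triangle_ineq4 add_mono])
    qed
    show "set_integrable lborel {a..a+l} (\<lambda>t. bv f t - 1 / complex_of_real l * (LINT s:{a..a+l}|lborel. bv f s))"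
      unfolding ceq
    proof (rule set_integral_diff(1)[OF si])
      show "set_integrable lborel {a..a+l} (\<lambda>t. c)" unfolding set_integrable_def
        by (intro integrable_scaleR_left integrable_real_indicator) (auto simp: emeasure_lborel_Icc_eq)
    qed
  qed
  show ?thesis unfolding BMO_T_def
  proof (intro conjI si bdd_aboveI[of _ "B + B"])
    fix x assume "x \<in> {(1 / l) * (LINT t:{a..a+l}|lborel. cmod (bv f t - (1 / l) * (LINT s:{a..a+l}|lborel. bv f s))) | a l. 0 < l \<and> l \<le> 2*pi}"
    then show "x \<le> B + B" using osc by auto
  qed
qed

text \<open>If f = theta conj h with h(0) = 0, then pairing f with theta u leaves the conjugate of
  the mean of h u, which is conj (h(0) u(0)) = 0. The norm inequality is the L^infinity--L^1
  estimate of the pairing.\<close>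

lemma Kinf_subset_KBMO:
  assumes \<theta>: "inner_fn \<theta>" and f: "f \<in> Kinf \<theta>"
  shows "f \<in> KBMO \<theta>" "bmo_norm f \<le> hinf_norm f" "f \<in> Hinf"
proof -
  obtain h where fh: "f \<in> Hinf" "h \<in> Hinf" "h 0 = 0" "AE t in circ. bv f t = bv \<theta> t * cnj (bv h t)"
    using f unfolding Kinf_def AE_circ by blast
  show "f \<in> Hinf" by (rule fh(1))
  note I = inner_circ[OF \<theta>]
  have f2: "f \<in> Hp 2" by (rule Hinf_imp_Hp2[OF fh(1)])
  note F = Hp2_boundary[OF f2]
  have orth: "pairing f (amult \<theta> u) = 0" if u: "u \<in> Hp 2" for u
  proof -
    note w = amult_Hinf_Hp2[OF I(1) u] and v = amult_Hinf_Hp2[OF fh(2) u]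
    note Wb = Hp2_boundary[OF w(1)] and Vb = Hp2_boundary[OF v(1)]
    have "pairing f (amult \<theta> u) = (LINT t|circ. cnj (bv (amult h u) t))"
      unfolding pairing_eq[OF Wb(3) F(3)]
    proof (rule integral_cong_AE)
      show "AE t in circ. bv f t * cnj (bv (amult \<theta> u) t) = cnj (bv (amult h u) t)"
        using fh(4) w(2) v(2) I(2)
      proof eventually_elim
        case (elim t)
        have "bv \<theta> t * cnj (bv \<theta> t) = 1" unfolding complex_norm_square[symmetric] elim(4) by simp
        moreover have "bv f t * cnj (bv (amult \<theta> u) t) = (bv \<theta> t * cnj (bv \<theta> t)) * cnj (bv (amult h u) t)"
          unfolding elim(1,2,3) by (simp add: mult_ac)
        ultimately show ?case by simp
      qed
    qed (use F(3) Wb(3) Vb(3) in simp_all)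
    also have "\<dots> = cnj (fc (bv (amult h u)) 0)" by (simp add: fc_def)
    also have "\<dots> = 0" using Vb(5)[of 0] fh(3) by (simp add: amult_def)
    finally show ?thesis .
  qed
  show "f \<in> KBMO \<theta>" unfolding KBMO_def Ktheta_def BMOA_def
    using f2 orth Hp2_imp_Hp1[OF f2] Hinf_BMO[OF fh(1)] by blast
  show "bmo_norm f \<le> hinf_norm f" unfolding bmo_norm_def
  proof (rule cSup_least)
    have z: "(\<lambda>n. 0) \<in> Hp 2" by (rule Hp2_I) simp
    have "hnorm 1 (\<lambda>n. 0) = 0" using hnorm1_cmult(2)[OF z, of 0] by simp
    then have "hnorm 1 (\<lambda>n. 0) \<le> 1" by simp
    with z show "{cmod (pairing f h) |h. h \<in> Hp 2 \<and> hnorm 1 h \<le> 1} \<noteq> {}" by blast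
    fix x assume "x \<in> {cmod (pairing f h) |h. h \<in> Hp 2 \<and> hnorm 1 h \<le> 1}"
    then obtain h where h: "x = cmod (pairing f h)" "h \<in> Hp 2" "hnorm 1 h \<le> 1" by blast
    note H = Hp2_boundary[OF h(2)]
    have i: "integrable circ (\<lambda>t. bv f t * cnj (bv h t))"
      by (rule integrable_circ_mult_bounded[OF _ F(3) Hinf_bv_le[OF fh(1)]]) (use H(4) in simp)
    have "x \<le> (LINT t|circ. cmod (bv f t * cnj (bv h t)))"
      unfolding h(1) pairing_eq[OF H(3) F(3)] by (rule integral_norm_bound)
    also have "\<dots> \<le> (LINT t|circ. hinf_norm f * cmod (bv h t))"
    proof (rule integral_mono_AE)
      show "AE t in circ. cmod (bv f t * cnj (bv h t)) \<le> hinf_norm f * cmod (bv h t)"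
        using Hinf_bv_le[OF fh(1)] by eventually_elim (simp add: norm_mult mult_right_mono)
    qed (use i H(4) in simp_all)
    also have "\<dots> = hinf_norm f * hnorm 1 h" by (simp add: hnorm1[OF Hp2_imp_Hp1[OF h(2)]])
    also have "\<dots> \<le> hinf_norm f * 1" using h(3) hinf_norm_nonneg[OF fh(1)] by (intro mult_left_mono) auto
    finally show "x \<le> hinf_norm f" by simp
  qed
qed

lemma Kinf_cmult:
  assumes f: "f \<in> Kinf \<theta>"
  shows "(\<lambda>n. c * f n) \<in> Kinf \<theta>" "hinf_norm (\<lambda>n. c * f n) \<le> cmod c * hinf_norm f"
proof -
  obtain h where fh: "f \<in> Hinf" "h \<in> Hinf" "h 0 = 0" "AE t in circ. bv f t = bv \<theta> t * cnj (bv h t)"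
    using f unfolding Kinf_def AE_circ by blast
  have in_Hinf: "(\<lambda>n. c * u n) \<in> Hinf" and norm_le: "hinf_norm (\<lambda>n. c * u n) \<le> cmod c * hinf_norm u" if u: "u \<in> Hinf" for c u
  proof -
    have a: "analytic_disk u" using u by (simp add: Hinf_def)
    have le: "cmod (ev (\<lambda>n. c * u n) z) \<le> cmod c * hinf_norm u" if z: "cmod z < 1" for z
      unfolding ev_cmult[OF a z] norm_mult by (intro mult_left_mono ev_sup u z) auto
    show "(\<lambda>n. c * u n) \<in> Hinf" by (rule HinfI[OF analytic_disk_cmult[OF a] le])
    show "hinf_norm (\<lambda>n. c * u n) \<le> cmod c * hinf_norm u" by (rule hinf_norm_le[OF le])
  qed
  show "hinf_norm (\<lambda>n. c * f n) \<le> cmod c * hinf_norm f" by (rule norm_le[OF fh(1)])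
  have "AE t in circ. bv (\<lambda>n. c * f n) t = bv \<theta> t * cnj (bv (\<lambda>n. cnj c * h n) t)"
    using fh(4) hnorm1_cmult(3)[OF Hinf_imp_Hp2[OF fh(1)], of c] hnorm1_cmult(3)[OF Hinf_imp_Hp2[OF fh(2)], of "cnj c"]
    by eventually_elim (simp add: mult_ac)
  then show "(\<lambda>n. c * f n) \<in> Kinf \<theta>" unfolding Kinf_def AE_circ[symmetric]
    using in_Hinf[OF fh(1)] in_Hinf[OF fh(2), of "cnj c"] fh(3) by (auto intro!: exI[of _ "\<lambda>n. cnj c * h n"] simp: Bex_def)
qed

text \<open>On the circle k = conj z (theta - theta(0)) = theta conj h with h = z (1 - conj theta(0)
  theta), because |theta| = 1. Both functions are bounded by 1 + |theta(0)| <= 2.\<close>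

lemma kfun_Kinf:
  assumes \<theta>: "inner_fn \<theta>"
  shows "kfun \<theta> \<in> Kinf \<theta>" "hinf_norm (kfun \<theta>) \<le> 2"
proof -
  note I = inner_circ[OF \<theta>]
  note T = Hp2_boundary[OF Hinf_imp_Hp2[OF I(1)]]
  note [measurable] = T(3)
  have \<theta>0: "cmod (\<theta> 0) \<le> 1"
  proof -
    have "cmod (\<theta> 0) \<le> (LINT t|circ. cmod (bv \<theta> t))" using norm_fc_le[of "bv \<theta>" 0] T(5)[of 0] by simp
    also have "\<dots> = (LINT t|circ. 1::real)" by (rule integral_cong_AE) (use I(2) in auto)
    finally show ?thesis by simp
  qed
  have fc1: "fc (\<lambda>_. c) n = (if n = 0 then c else 0)" for n c
    using integral_cis_of_int[of "-n"] by (simp add: fc_def)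
  define F where "F t = (bv \<theta> t - \<theta> 0) * cis (of_int (-1) * t)" for t
  define H where "H t = (1 - cnj (\<theta> 0) * bv \<theta> t) * cis (of_int 1 * t)" for t
  have m: "F \<in> borel_measurable borel" "H \<in> borel_measurable borel"
    unfolding F_def H_def using cis_measurable[of "of_int (-1)"] cis_measurable[of "of_int 1"] by simp_all
  have FB: "AE t in circ. cmod (F t) \<le> 2" using I(2)
  proof eventually_elim
    case (elim t)
    have "cmod (F t) = cmod (bv \<theta> t - \<theta> 0)" by (simp add: F_def norm_mult)
    also have "\<dots> \<le> 1 + 1" using elim \<theta>0 by (rule_tac order.trans[OF norm_triangle_ineq4 add_mono]) auto
    finally show ?case by simp
  qed
  have HB: "AE t in circ. cmod (H t) \<le> 2" using I(2)
  proof eventually_elim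
    case (elim t)
    have "cmod (H t) = cmod (1 - cnj (\<theta> 0) * bv \<theta> t)" by (simp add: H_def norm_mult)
    also have "\<dots> \<le> 1 + 1" using elim \<theta>0 by (rule_tac order.trans[OF norm_triangle_ineq4 add_mono]) (auto simp: norm_mult)
    finally show ?case by simp
  qed
  have ic: "integrable circ (\<lambda>_. c :: complex)" for c by simp
  have fcF: "fc F n = fc (bv \<theta>) (n + 1) - (if n + 1 = 0 then \<theta> 0 else 0)" for n
    unfolding F_def fc_cis_shift using fc_diff[OF T(4) ic, of "\<theta> 0" "n + 1"] by (simp add: fc1)
  have fcH: "fc H n = (if n - 1 = 0 then 1 else 0) - cnj (\<theta> 0) * fc (bv \<theta>) (n - 1)" for n
    unfolding H_def fc_cis_shift using fc_diff[OF ic integrable_mult_right[of "cnj (\<theta> 0)", OF T(4)], of 1 "n - 1"] by (simp add: fc1 fc_cmult)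
  have negF: "fc F n = 0" if "n < 0" for n using that T(6)[of "n + 1"] T(5)[of 0] by (cases "n = -1") (auto simp: fcF)
  have posF: "fc F (int n) = kfun \<theta> n" for n using T(5)[of "Suc n"] by (simp add: fcF kfun_def add.commute)
  have K: "kfun \<theta> \<in> Hinf" "hinf_norm (kfun \<theta>) \<le> 2" "AE t in circ. bv (kfun \<theta>) t = F t"
    using bounded_boundary_Hinf[of F 2 "kfun \<theta>"] m(1) FB negF posF by blast+
  define h where "h n = fc H (int n)" for n
  have negH: "fc H n = 0" if "n < 1" for n using that T(6)[of "n - 1"] by (auto simp: fcH)
  have h: "h \<in> Hinf" "AE t in circ. bv h t = H t"
    using bounded_boundary_Hinf[OF m(2) HB, of h] negH h_def by auto
  have h0: "h 0 = 0" using negH[of 0] by (simp add: h_def)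
  have "AE t in circ. bv (kfun \<theta>) t = bv \<theta> t * cnj (bv h t)"
    using K(3) h(2) I(2)
  proof eventually_elim
    case (elim t)
    have 1: "bv \<theta> t * cnj (bv \<theta> t) = 1" unfolding complex_norm_square[symmetric] elim(3) by simp
    have "bv \<theta> t * cnj (bv h t) = (bv \<theta> t - \<theta> 0 * (bv \<theta> t * cnj (bv \<theta> t))) * cis (- t)"
      unfolding elim(2) H_def by (simp add: cis_cnj algebra_simps)
    then show ?case unfolding 1 elim(1) F_def by simp
  qed
  then show "kfun \<theta> \<in> Kinf \<theta>" unfolding Kinf_def AE_circ[symmetric] using K(1) h(1) h0 by blast
  show "hinf_norm (kfun \<theta>) \<le> 2" by (rule K(2))
qed

lemma toep_lim_kfun_cmult:
  assumes \<theta>: "inner_fn \<theta>" and g: "g \<in> Hp 1"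
  shows "toep_lim g (\<lambda>n. c * kfun \<theta> n) = (\<lambda>n. c * toep_lim g (kfun \<theta>) n)"
  using toep_lim_kfun[OF assms, of c] toep_lim_kfun[OF assms, of 1] by simp

section \<open>Equivalence and comparison of operator norms\<close>

text \<open>The constant is chosen before theta and g, hence depends only on the normed space. The
  norms are compared under condition (iii), which makes the sets behind the two suprema
  bounded.\<close>

theorem theorem4p3:
  fixes X :: "afun set" and N :: "afun \<Rightarrow> real"
  assumes "K_space X N"
  shows "(\<forall>\<theta> g. inner_fn \<theta> \<longrightarrow> g \<in> Hp 1 \<longrightarrow>
            (bdd_BMO X N \<theta> g \<longleftrightarrow> bdd_Inf X N \<theta> g) \<and>
            (bdd_Inf X N \<theta> g \<longleftrightarrow> toep_lim g (kfun \<theta>) \<in> X)) \<and>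
         (\<exists>C>0. \<forall>\<theta> g. inner_fn \<theta> \<longrightarrow> g \<in> Hp 1 \<longrightarrow> toep_lim g (kfun \<theta>) \<in> X \<longrightarrow>
            opnorm_BMO N \<theta> g \<le> C * opnorm_Inf N \<theta> g \<and>
            opnorm_Inf N \<theta> g \<le> C * opnorm_BMO N \<theta> g \<and>
            opnorm_BMO N \<theta> g \<le> C * N (toep_lim g (kfun \<theta>)) \<and>
            N (toep_lim g (kfun \<theta>)) \<le> C * opnorm_BMO N \<theta> g \<and>
            opnorm_Inf N \<theta> g \<le> C * N (toep_lim g (kfun \<theta>)) \<and>
            N (toep_lim g (kfun \<theta>)) \<le> C * opnorm_Inf N \<theta> g)"
proof -
  note Kdef = assms[unfolded K_space_def]
  have "\<exists>C. \<forall>\<psi>\<in>Hinf. \<forall>f\<in>X. toep \<psi> f \<in> X \<and> N (toep \<psi> f) \<le> C * hinf_norm \<psi> * N f"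
    using Kdef by (elim conjE)
  then obtain C0 where C0: "\<And>\<psi> f. \<psi> \<in> Hinf \<Longrightarrow> f \<in> X \<Longrightarrow> toep \<psi> f \<in> X \<and> N (toep \<psi> f) \<le> C0 * hinf_norm \<psi> * N f"
    by blast
  have X1: "X \<subseteq> Hp 1" using Kdef by (elim conjE)
  have "\<forall>f\<in>X. 0 \<le> N f \<and> (N f = 0 \<longleftrightarrow> f = (\<lambda>n. 0))" using Kdef by (elim conjE)
  then have N0: "\<And>f. f \<in> X \<Longrightarrow> 0 \<le> N f" by blast
  have "\<forall>c. \<forall>f\<in>X. N (\<lambda>n. c * f n) = cmod c * N f" using Kdef by (elim conjE)
  then have Nc: "\<And>c f. f \<in> X \<Longrightarrow> N (\<lambda>n. c * f n) = cmod c * N f" by blast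
  \<comment> \<open>The constant of a K-space comes without a sign; the maximum with 1 permits
    monotone estimates and serves as a factor in the comparisons.\<close>
  define C1 where "C1 = max C0 1"
  have C1: "C1 \<ge> 1" "C0 \<le> C1" by (simp_all add: C1_def)
  have main: "toep_lim g f \<in> X \<and> N (toep_lim g f) \<le> C1 * bmo_norm f * N (toep_lim g (kfun \<theta>))"
    if \<theta>: "inner_fn \<theta>" and g: "g \<in> Hp 1" and k: "toep_lim g (kfun \<theta>) \<in> X" and f: "f \<in> KBMO \<theta>" for \<theta> g f
  proof -
    obtain \<psi> where \<psi>: "\<psi> \<in> Hinf" "hinf_norm \<psi> \<le> bmo_norm f" "toep_lim g f = toep \<psi> (toep_lim g (kfun \<theta>))"
      using KBMO_factor[OF \<theta> f g] k X1 by blast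
    have h0: "0 \<le> hinf_norm \<psi>" by (rule hinf_norm_nonneg[OF \<psi>(1)])
    have "N (toep_lim g f) \<le> C0 * hinf_norm \<psi> * N (toep_lim g (kfun \<theta>))" using C0[OF \<psi>(1) k] \<psi>(3) by simp
    also have "\<dots> \<le> C1 * bmo_norm f * N (toep_lim g (kfun \<theta>))"
      using C1 h0 \<psi>(2) N0[OF k] by (intro mult_right_mono mult_mono) auto
    finally show ?thesis using C0[OF \<psi>(1) k] \<psi>(3) by simp
  qed
  have imp1: "bdd_BMO X N \<theta> g" if \<theta>: "inner_fn \<theta>" and g: "g \<in> Hp 1" and k: "toep_lim g (kfun \<theta>) \<in> X" for \<theta> g
    unfolding bdd_BMO_def
  proof (intro exI ballI)
    fix f assume "f \<in> KBMO \<theta>"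
    from main[OF \<theta> g k this]
    show "toep_lim g f \<in> X \<and> N (toep_lim g f) \<le> (C1 * N (toep_lim g (kfun \<theta>))) * bmo_norm f" by (simp add: mult_ac)
  qed
  have bmo0: "0 \<le> bmo_norm f" if "f \<in> KBMO \<theta>" for f \<theta>
  proof -
    have f: "f \<in> Hp 2" "BMO_T (bv f)" using that by (auto simp: KBMO_def Ktheta_def BMOA_def)
    obtain B where "bmo_bound (bv f) B" using BMO_T_bound[OF f(2)] by blast
    then show ?thesis by (rule pairing_bmo_norm(1)[OF f(1)])
  qed
  have imp2: "bdd_Inf X N \<theta> g" if \<theta>: "inner_fn \<theta>" and b: "bdd_BMO X N \<theta> g" for \<theta> g
  proof -
    obtain C where C: "\<And>f. f \<in> KBMO \<theta> \<Longrightarrow> toep_lim g f \<in> X \<and> N (toep_lim g f) \<le> C * bmo_norm f"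
      using b unfolding bdd_BMO_def by blast
    show ?thesis unfolding bdd_Inf_def
    proof (intro exI[of _ "\<bar>C\<bar>"] ballI)
      fix f assume f: "f \<in> Kinf \<theta>"
      note K = Kinf_subset_KBMO[OF \<theta> f]
      have "N (toep_lim g f) \<le> C * bmo_norm f" using C[OF K(1)] by simp
      also have "\<dots> \<le> \<bar>C\<bar> * hinf_norm f" using K(2) bmo0[OF K(1)] by (intro mult_mono) auto
      finally show "toep_lim g f \<in> X \<and> N (toep_lim g f) \<le> \<bar>C\<bar> * hinf_norm f" using C[OF K(1)] by simp
    qed
  qed
  have imp3: "toep_lim g (kfun \<theta>) \<in> X" if \<theta>: "inner_fn \<theta>" and b: "bdd_Inf X N \<theta> g" for \<theta> g
    using b kfun_Kinf(1)[OF \<theta>] unfolding bdd_Inf_def by blast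
  have norms: "opnorm_BMO N \<theta> g \<le> C1 * N (toep_lim g (kfun \<theta>))" "opnorm_Inf N \<theta> g \<le> opnorm_BMO N \<theta> g"
      "N (toep_lim g (kfun \<theta>)) \<le> 2 * opnorm_Inf N \<theta> g"
    if \<theta>: "inner_fn \<theta>" and g: "g \<in> Hp 1" and k: "toep_lim g (kfun \<theta>) \<in> X" for \<theta> g
  proof -
    define SB SI where "SB = {N (toep_lim g f) | f. f \<in> KBMO \<theta> \<and> bmo_norm f \<le> 1}"
      and "SI = {N (toep_lim g f) | f. f \<in> Kinf \<theta> \<and> hinf_norm f \<le> 1}"
    have sub: "SI \<subseteq> SB"
    proof
      fix x assume "x \<in> SI"
      then obtain f where f: "x = N (toep_lim g f)" "f \<in> Kinf \<theta>" "hinf_norm f \<le> 1" by (auto simp: SI_def)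
      then show "x \<in> SB" using Kinf_subset_KBMO(1,2)[OF \<theta> f(2)] unfolding SB_def by (auto intro: order.trans)
    qed
    have le: "x \<le> C1 * N (toep_lim g (kfun \<theta>))" if x: "x \<in> SB" for x
    proof -
      obtain f where f: "x = N (toep_lim g f)" "f \<in> KBMO \<theta>" "bmo_norm f \<le> 1" using x by (auto simp: SB_def)
      have "x \<le> C1 * bmo_norm f * N (toep_lim g (kfun \<theta>))" using main[OF \<theta> g k f(2)] f(1) by simp
      also have "\<dots> \<le> C1 * 1 * N (toep_lim g (kfun \<theta>))" using f(3) C1 N0[OF k] by (intro mult_right_mono mult_left_mono) auto
      finally show ?thesis by simp
    qed
    have bddB: "bdd_above SB" using le by (rule bdd_aboveI)
    \<comment> \<open>As the sup norm of k is at most 2, k/2 is a test function in the unit ball. It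
      shows both sets nonempty and bounds the operator norms from below.\<close>
    have half: "N (toep_lim g (kfun \<theta>)) / 2 \<in> SI"
    proof -
      have "hinf_norm (\<lambda>n. (1/2) * kfun \<theta> n) \<le> 1"
        using Kinf_cmult(2)[OF kfun_Kinf(1)[OF \<theta>], of "1/2"] kfun_Kinf(2)[OF \<theta>] by simp
      moreover have "N (toep_lim g (\<lambda>n. (1/2) * kfun \<theta> n)) = N (toep_lim g (kfun \<theta>)) / 2"
        unfolding toep_lim_kfun_cmult[OF \<theta> g] Nc[OF k] by simp
      ultimately show ?thesis unfolding SI_def using Kinf_cmult(1)[OF kfun_Kinf(1)[OF \<theta>], of "1/2"] by (intro CollectI exI[of _ "\<lambda>n. (1/2) * kfun \<theta> n"]) auto
    qed
    show "opnorm_BMO N \<theta> g \<le> C1 * N (toep_lim g (kfun \<theta>))"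
      unfolding opnorm_BMO_def SB_def[symmetric] using half sub by (intro cSup_least le) auto
    show "opnorm_Inf N \<theta> g \<le> opnorm_BMO N \<theta> g"
      unfolding opnorm_BMO_def opnorm_Inf_def SB_def[symmetric] SI_def[symmetric] using half by (intro cSup_subset_mono bddB sub) auto
    have "N (toep_lim g (kfun \<theta>)) / 2 \<le> opnorm_Inf N \<theta> g"
      unfolding opnorm_Inf_def SI_def[symmetric] by (intro cSup_upper half bdd_above_mono[OF bddB sub])
    then show "N (toep_lim g (kfun \<theta>)) \<le> 2 * opnorm_Inf N \<theta> g" by simp
  qed
  show ?thesis
  \<comment> \<open>The bounds form a cycle with factors C1, 1 and 2; their product 2 * C1 covers
    every comparison since C1 >= 1 and all quantities are nonnegative.\<close>
  proof (intro conjI allI impI exI[of _ "2 * C1"])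
    fix \<theta> g assume \<theta>: "inner_fn \<theta>" and g: "g \<in> Hp 1"
    show "bdd_BMO X N \<theta> g \<longleftrightarrow> bdd_Inf X N \<theta> g" using imp1[OF \<theta> g] imp2[OF \<theta>] imp3[OF \<theta>] by blast
    show "bdd_Inf X N \<theta> g \<longleftrightarrow> toep_lim g (kfun \<theta>) \<in> X" using imp1[OF \<theta> g] imp2[OF \<theta>] imp3[OF \<theta>] by blast
  next
    show "0 < 2 * C1" using C1 by simp
  next
    fix \<theta> g assume \<theta>: "inner_fn \<theta>" and g: "g \<in> Hp 1" and k: "toep_lim g (kfun \<theta>) \<in> X"
    note n = norms[OF \<theta> g k]
    have "0 \<le> N (toep_lim g (kfun \<theta>))" by (rule N0[OF k])
    then have nn: "0 \<le> opnorm_Inf N \<theta> g" "0 \<le> opnorm_BMO N \<theta> g" "0 \<le> N (toep_lim g (kfun \<theta>))" using n by linarith+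
    have C: "x \<le> 2 * C1 * x" "2 * x \<le> 2 * C1 * x" "C1 * x \<le> 2 * C1 * x" if "0 \<le> x" for x
    proof -
      have "1 * x \<le> C1 * x" using C1 that by (intro mult_right_mono) auto
      then show "x \<le> 2 * C1 * x" "2 * x \<le> 2 * C1 * x" "C1 * x \<le> 2 * C1 * x" using that by simp_all
    qed
    have "C1 * N (toep_lim g (kfun \<theta>)) \<le> C1 * (2 * opnorm_Inf N \<theta> g)" using n(3) C1 by (intro mult_left_mono) auto
    then show "opnorm_BMO N \<theta> g \<le> 2 * C1 * opnorm_Inf N \<theta> g" using n(1) by simp
    show "opnorm_Inf N \<theta> g \<le> 2 * C1 * opnorm_BMO N \<theta> g" using n(2) C(1)[OF nn(2)] by linarith
    show "opnorm_BMO N \<theta> g \<le> 2 * C1 * N (toep_lim g (kfun \<theta>))" using n(1) C(3)[OF nn(3)] by linarith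
    show "N (toep_lim g (kfun \<theta>)) \<le> 2 * C1 * opnorm_BMO N \<theta> g" using n(2,3) C(2)[OF nn(2)] by linarith
    show "opnorm_Inf N \<theta> g \<le> 2 * C1 * N (toep_lim g (kfun \<theta>))" using n(1,2) C(3)[OF nn(3)] by linarith
    show "N (toep_lim g (kfun \<theta>)) \<le> 2 * C1 * opnorm_Inf N \<theta> g" using n(3) C(2)[OF nn(1)] by linarith
  qed
qed

end
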